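(* Let $T>0$, $X$ a real Banach space, $Y,Z$ real normed spaces, $\Omega\subset X$ and $U\subset Y$ non-empty open subsets, $\xi_0\in\Omega$, $m,q\ge1$ integers, and let $f^0:[0,T]\times\Omega\times U\times Z\to\mathbb R$, $f:[0,T]\times\Omega\times U\times Z\to X$, $g^i:\Omega\times Z\to\mathbb R$ ($0\le i\le m$), $h^j:\Omega\times Z\to\mathbb R$ ($1\le j\le q$) be mappings. For $\pi\in Z$ let $(\mathcal B,\pi)$ be the Bolza problem and $V[\pi]$ its value, as in the context. Fix $\pi_0\in Z$ and assume: (SO) There is an open neighborhood $P$ of $\pi_0$ in $Z$ such that for every $\pi\in P$ there is a solution $(x[\pi],u[\pi])\in PC^1([0,T],\Omega)\times NPC^0_R([0,T],U)$ of $(\mathcal B,\pi)$. (SO-bis) For all $\delta\pi\in Z$, $D_G^+x[\pi_0;\delta\pi]$ and $D_G^+u[\pi_0;\delta\pi]$ exist. (IC1) $f^0\in C^0([0,T]\times\Omega\times U\times P,\mathbb R)$; $D_{G,2}f^0(t,\xi,\zeta,\pi)$ exists for all $(t,\xi,\zeta,\pi)\in[0,T]\times\Omega\times U\times P$; and for all $\pi\in P$ and all non-empty compact $K\subset\Omega\times U$, $\sup_{(t,\xi,\zeta)\in[0,T]\times K}\|D_{G,2}f^0(t,\xi,\zeta,\pi)\|<+\infty$. (IC2) For all $t\in[0,T]$, $D_{H,(2,3,4)}f^0(t,x[\pi_0](t),u[\pi_0](t),\pi_0)$ exists; for all $\pi\in P$, $D_{H,3}f^0(T,x[\pi](T),u[\pi](T),\pi)$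 exists, and $[\pi\mapsto D_{H,3}f^0(T,x[\pi](T),u[\pi](T),\pi)]\in C^0(P,Y^* )$. (IC3) There are $\kappa\in\mathcal L^1(([0,T],\mathcal B([0,T])),\mathfrak m_1;\mathbb R_+)$ and $\rho>0$ such that for all $t\in[0,T]$ and all $(\xi_1,\zeta_1,\pi_1),(\xi_2,\zeta_2,\pi_2)\in B_{\|\cdot\|_1}((x[\pi_0](t),u[\pi_0](t),\pi_0),\rho)$, $|f^0(t,\xi_1,\zeta_1,\pi_1)-f^0(t,\xi_2,\zeta_2,\pi_2)|\le\kappa(t)\|(\xi_1,\zeta_1,\pi_1)-(\xi_2,\zeta_2,\pi_2)\|$. (IC4) For all $(t,\zeta,\pi)\in[0,T]\times U\times P$, $D_{F,2}f^0(t,x[\pi](t),\zeta,\pi)$ exists, and for all $\pi\in P$, $[(t,\zeta)\mapsto D_{F,2}f^0(t,x[\pi](t),\zeta,\pi)]\in C^0([0,T]\times U,X^* )$. (V1) For all $\pi\in P$, $[(t,\xi,\zeta)\mapsto f(t,\xi,\zeta,\pi)]\in C^0([0,T]\times\Omega\times U,X)$; $D_{G,2}f(t,\xi,\zeta,\pi)$ exists for all $(t,\xi,\zeta,\pi)\in[0,T]\times\Omega\times U\times P$; and for all $\pi\in P$ and all non-empty compact $K\subset\Omega\times U$, $\sup_{(t,\xi,\zeta)\in[0,T]\times K}\|D_{G,2}f(t,\xi,\zeta,\pi)\|<+\infty$. (V2) For all $t\in[0,T]$, $D_{H,(2,3,4)}f(t,x[\pi_0](t),u[\pi_0](t),\pi_0)$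 exists; for all $\pi\in P$, $D_{H,3}f(T,x[\pi](T),u[\pi](T),\pi)$ exists. (V3) For all $(t,\zeta,\pi)\in[0,T]\times U\times P$, $D_{F,2}f(t,x[\pi](t),\zeta,\pi)$ exists, and for all $\pi\in P$, $[(t,\zeta)\mapsto D_{F,2}f(t,x[\pi](t),\zeta,\pi)]\in C^0([0,T]\times U,\mathcal L(X,X))$. (V4) There is $\underline c\in\mathcal L^1(([0,T],\mathcal B([0,T])),\mathfrak m_1;\mathbb R_+)$ such that for all $t\in[0,T]$, $\|D_{H,4}f(t,x[\pi_0](t),u[\pi_0](t),\pi_0)\|\le\underline c(t)$. (CT1) For all $\phi\in\{g^i:0\le i\le m\}\cup\{h^j:1\le j\le q\}$, $D_H\phi(x[\pi_0](T),\pi_0)$ exists and, for all $\pi\in P$, $D_{H,1}\phi(x[\pi](T),\pi)$ exists. (CT2) For all $\pi\in P$ and $j\in\{1,\dots,q\}$, $h^j(\cdot,\pi)$ is continuous on a neighborhood of $x[\pi](T)$. (CVT1) The family consisting of $D_{H,1}g^i(x[\pi_0](T),\pi_0)\circ D_{H,3}f(T,x[\pi_0](T),u[\pi_0](T),\pi_0)$ ($1\le i\le m$) and $D_{H,1}h^j(x[\pi_0](T),\pi_0)\circ D_{H,3}f(T,x[\pi_0](T),u[\pi_0](T),\pi_0)$ ($1\le j\le q$) is linearly independent. (CVT2) For all $\phi\in\{g^i:0\le i\le m\}\cup\{h^j:1\le j\le q\}$, $[\pi\mapsto D_{H,1}\phi(x[\pi](T),\pi)\circ D_{H,3}f(T,x[\pi](T),u[\pi](T),\pi)]\in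 C^0(P,Y^* )$. (ESP) There is an inner product $(\cdot|\cdot)$ on $Y^*$ which is continuous on $(Y^*,\|\cdot\|_{Y^*})^2$. Then $V$ is Gâteaux differentiable at $\pi_0$ and, for all $\delta\pi\in Z$, $$\begin{aligned}D_GV[\pi_0]\cdot\delta\pi={}&D_{H,2}g^0(x[\pi_0](T),\pi_0)\cdot\delta\pi+\sum_{i=1}^m\lambda_i[\pi_0]D_{H,2}g^i(x[\pi_0](T),\pi_0)\cdot\delta\pi\\&+\sum_{j=1}^q\mu_j[\pi_0]D_{H,2}h^j(x[\pi_0](T),\pi_0)\cdot\delta\pi\\&+\int_{[0,T]}D_{H,4}f^0(t,x[\pi_0](t),u[\pi_0](t),\pi_0)\cdot\delta\pi\,d\mathfrak m_1(t)\\&+\int_{[0,T]}p[\pi_0](t)\cdot D_{H,4}f(t,x[\pi_0](t),u[\pi_0](t),\pi_0)\cdot\delta\pi\,d\mathfrak m_1(t),\end{aligned}$$ where $((\lambda_i[\pi_0])_{0\le i\le m},(\mu_j[\pi_0])_{1\le j\le q},p[\pi_0])$ is the unique Pontryagin triple, with $\lambda_0[\pi_0]=1$, of the solution $(x[\pi_0],u[\pi_0])$ of $(\mathcal B,\pi_0)$.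
   Context: Function spaces. For a Hausdorff topological space $W$, $PC^0([0,T],W)$ is the set of $x:[0,T]\to W$ which are continuous, or for which there is a subdivision $0=\tau_0<\dots<\tau_{k+1}=T$ such that $x$ is continuous at every $t\notin\{\tau_i\}$, the right limit $x(\tau_i+)$ exists in $W$ for $0\le i\le k$ and the left limit $x(\tau_i-)$ exists in $W$ for $1\le i\le k+1$. $NPC^0_R([0,T],W)$ is the set of $x\in PC^0([0,T],W)$ right-continuous on $[0,T[$ and left-continuous at $T$. For $W$ a subset of a real normed space, $PC^1([0,T],W)$ is the set of continuous $x:[0,T]\to W$ which are continuously differentiable, or for which there is a subdivision $0=\tau_0<\dots<\tau_{k+1}=T$ such that $x$ is continuously differentiable at every $t\notin\{\tau_i\}$, $x'_R(\tau_i)=x'(\tau_i+)$ exists for $0\le i\le k$ and $x'_L(\tau_i)=x'(\tau_i-)$ exists for $1\le i\le k+1$. The extended derivative is $\underline d x(t):=x'(t)$ if $t\notin\{\tau_i\}$, $\underline d x(\tau_i):=x'_R(\tau_i)$ for $0\le i\le k$, $\underline d x(T):=x'_L(T)$. For a normed space $W$, $NPC^0_R([0,T],W)$ has the sup norm $\|\cdot\|_\infty$, and $PC^1([0,T],W)$ has the norm $\|x\|_\infty+\|\underline dx\|_\infty$; the variations $D_G^+x[\pi;\delta\pi]$, $D_G^+u[\pi;\delta\pi]$ of $\pi\mapsto x[\pi]$, $\pi\mapsto u[\pi]$ are taken in $PC^1([0,T],X)$ and $NPC^0_R([0,T],Y)$. Differentials. $D_G^+\mathfrak f(x;v)=\lim_{\theta\to0+}(\mathfrak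 f(x+\theta v)-\mathfrak f(x))/\theta$ is the right Gâteaux variation. $D_G,D_H,D_F$ are the Gâteaux, Hadamard, Fréchet differentials (continuous linear maps): $D_G\mathfrak f(x)\cdot v=D^+_G\mathfrak f(x;v)$ for all $v$; $\mathfrak f$ is Hadamard differentiable at $x$ when moreover $\lim_{\theta\to0+,\,w\to v}(\mathfrak f(x+\theta w)-\mathfrak f(x))/\theta=D_H\mathfrak f(x)\cdot v$ for all $v$. Subscripts $i$ denote partial differentials in the $i$-th variable; $D_{H,(2,3,4)}$ is the Hadamard differential jointly in the 2nd, 3rd, 4th variables. $\mathfrak m_1$ is Lebesgue measure on the Borel $\sigma$-algebra $\mathcal B([0,T])$, $\mathcal L^1$ the integrable functions. On $X\times Y\times Z$, $\|(\xi,\zeta,\pi)\|_1=\|\xi\|+\|\zeta\|+\|\pi\|$; balls in (IC3) are understood to be in $\Omega\times U\times P$. Problem $(\mathcal B,\pi)$: maximize $\int_0^Tf^0(t,x(t),u(t),\pi)\,dt+g^0(x(T),\pi)$ over the pairs $(x,u)\in PC^1([0,T],\Omega)\times NPC^0_R([0,T],U)$ with $\underline dx(t)=f(t,x(t),u(t),\pi)$ for all $t\in[0,T]$, $x(0)=\xi_0$, $g^i(x(T),\pi)\ge0$ ($1\le i\le m$), $h^j(x(T),\pi)=0$ ($1\le j\le q$). A solution attains the maximum; $V[\pi]$ is the value (supremum). Pontryagin triple: let $H_\pi(t,\xi,\zeta,p,\lambda):=p\cdot f(t,\xi,\zeta,\pi)+\lambda f^0(t,\xi,\zeta,\pi)$.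 A Pontryagin triple of a solution $(x[\pi],u[\pi])$ of $(\mathcal B,\pi)$ is $((\lambda_i)_{0\le i\le m},(\mu_j)_{1\le j\le q},p)\in\mathbb R^{1+m}\times\mathbb R^q\times PC^1([0,T],X^* )$ with: $((\lambda_i),(\mu_j))\ne0$; $\lambda_i\ge0$ for all $i$; $\lambda_ig^i(x[\pi](T),\pi)=0$ for $1\le i\le m$; $\sum_{i=0}^m\lambda_iD_{H,1}g^i(x[\pi](T),\pi)+\sum_{j=1}^q\mu_jD_{H,1}h^j(x[\pi](T),\pi)=p(T)$; $\underline dp(t)=-D_{F,2}H_\pi(t,x[\pi](t),u[\pi](t),p(t),\lambda_0)$ for all $t$; $H_\pi(t,x[\pi](t),u[\pi](t),p(t),\lambda_0)\ge H_\pi(t,x[\pi](t),\zeta,p(t),\lambda_0)$ for all $t\in[0,T]$, $\zeta\in U$; and $t\mapsto H_\pi(t,x[\pi](t),u[\pi](t),p(t),\lambda_0)$ continuous on $[0,T]$. Under the assumptions of the claim, the triple with $\lambda_0=1$ exists and is unique for $\pi=\pi_0$. *)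

theory Defs
  imports "HOL-Analysis.Analysis"
begin

section \<open>Differentials\<close>

text \<open>
  A mapping defined only on an open subset of a normed space is represented by a total function.
  All differentials below are taken at points of that open set and depend only on the values
  of the function near the point.
\<close>

definition has_right_gateaux_variation ::
    "('a::real_normed_vector \<Rightarrow> 'b::real_normed_vector) \<Rightarrow> 'b \<Rightarrow> 'a \<Rightarrow> 'a \<Rightarrow> bool" where
  "has_right_gateaux_variation F d x v \<longleftrightarrow>
     ((\<lambda>\<theta>. (F (x + \<theta> *\<^sub>R v) - F x) /\<^sub>R \<theta>) \<longlongrightarrow> d) (at_right 0)"

definition has_gateaux_deriv ::
    "('a::real_normed_vector \<Rightarrow> 'b::real_normed_vector) \<Rightarrow> ('a \<Rightarrow>\<^sub>L 'b) \<Rightarrow> 'a \<Rightarrow> bool" where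
  "has_gateaux_deriv F L x \<longleftrightarrow> (\<forall>v. has_right_gateaux_variation F (L v) x v)"

definition has_hadamard_deriv ::
    "('a::real_normed_vector \<Rightarrow> 'b::real_normed_vector) \<Rightarrow> ('a \<Rightarrow>\<^sub>L 'b) \<Rightarrow> 'a \<Rightarrow> bool" where
  "has_hadamard_deriv F L x \<longleftrightarrow>
     has_gateaux_deriv F L x \<and>
     (\<forall>v. ((\<lambda>(\<theta>, w). (F (x + \<theta> *\<^sub>R w) - F x) /\<^sub>R \<theta>) \<longlongrightarrow> L v) (at_right 0 \<times>\<^sub>F nhds v))"

definition gateaux_differentiable ::
    "('a::real_normed_vector \<Rightarrow> 'b::real_normed_vector) \<Rightarrow> 'a \<Rightarrow> bool" where
  "gateaux_differentiable F x \<longleftrightarrow> (\<exists>L. has_gateaux_deriv F L x)"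

definition hadamard_differentiable ::
    "('a::real_normed_vector \<Rightarrow> 'b::real_normed_vector) \<Rightarrow> 'a \<Rightarrow> bool" where
  "hadamard_differentiable F x \<longleftrightarrow> (\<exists>L. has_hadamard_deriv F L x)"

definition gateaux_deriv ::
    "('a::real_normed_vector \<Rightarrow> 'b::real_normed_vector) \<Rightarrow> 'a \<Rightarrow> ('a \<Rightarrow>\<^sub>L 'b)" where
  "gateaux_deriv F x = (THE L. has_gateaux_deriv F L x)"

definition hadamard_deriv ::
    "('a::real_normed_vector \<Rightarrow> 'b::real_normed_vector) \<Rightarrow> 'a \<Rightarrow> ('a \<Rightarrow>\<^sub>L 'b)" where
  "hadamard_deriv F x = (THE L. has_hadamard_deriv F L x)"

text \<open>The library's \<open>frechet_derivative\<close>, as an element of the normed space of bounded linear maps.\<close>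

definition frechet_deriv ::
    "('a::real_normed_vector \<Rightarrow> 'b::real_normed_vector) \<Rightarrow> 'a \<Rightarrow> ('a \<Rightarrow>\<^sub>L 'b)" where
  "frechet_deriv F x = Blinfun (frechet_derivative F (at x))"

lemma has_gateaux_deriv_unique:
  assumes "has_gateaux_deriv F L x" "has_gateaux_deriv F L' x"
  shows "L = L'"
proof (rule blinfun_eqI)
  fix v
  show "L v = L' v"
    using assms tendsto_unique[OF trivial_limit_at_right_real]
    unfolding has_gateaux_deriv_def has_right_gateaux_variation_def by blast
qed

lemma gateaux_deriv_eq: "has_gateaux_deriv F L x \<Longrightarrow> gateaux_deriv F x = L"
  unfolding gateaux_deriv_def by (blast intro: has_gateaux_deriv_unique)

lemma hadamard_deriv_eq: "has_hadamard_deriv F L x \<Longrightarrow> hadamard_deriv F x = L"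
  unfolding hadamard_deriv_def has_hadamard_deriv_def by (blast intro: has_gateaux_deriv_unique)

lemma frechet_deriv_eq:
  "(F has_derivative blinfun_apply L) (at x) \<Longrightarrow> frechet_deriv F x = L"
  unfolding frechet_deriv_def by (metis blinfun_apply_inverse frechet_derivative_at)


section \<open>Piecewise continuous and piecewise continuously differentiable functions\<close>

text \<open>
  Functions on \<open>[0,T]\<close> are represented by total functions on the reals; their values outside
  \<open>[0,T]\<close> are never used.
\<close>

definition subdivision :: "real \<Rightarrow> nat \<Rightarrow> (nat \<Rightarrow> real) \<Rightarrow> bool" where
  "subdivision T k \<tau> \<longleftrightarrow> \<tau> 0 = 0 \<and> \<tau> (k + 1) = T \<and> (\<forall>i\<le>k. \<tau> i < \<tau> (i + 1))"

definition PC0 :: "real \<Rightarrow> 'a::t2_space set \<Rightarrow> (real \<Rightarrow> 'a) set" where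
  "PC0 T W = {x. (\<forall>t\<in>{0..T}. x t \<in> W) \<and>
     (continuous_on {0..T} x \<or>
      (\<exists>k \<tau>. subdivision T k \<tau> \<and>
         (\<forall>t\<in>{0..T} - \<tau> ` {0..k+1}. isCont x t) \<and>
         (\<forall>i\<in>{0..k}. \<exists>l\<in>W. (x \<longlongrightarrow> l) (at_right (\<tau> i))) \<and>
         (\<forall>i\<in>{1..k+1}. \<exists>l\<in>W. (x \<longlongrightarrow> l) (at_left (\<tau> i)))))}"

definition NPC0_R :: "real \<Rightarrow> 'a::t2_space set \<Rightarrow> (real \<Rightarrow> 'a) set" where
  "NPC0_R T W = {x \<in> PC0 T W. (\<forall>t\<in>{0..<T}. (x \<longlongrightarrow> x t) (at_right t)) \<and> (x \<longlongrightarrow> x T) (at_left T)}"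

text \<open>
  In the second alternative, \<open>x'\<close> is only constrained off the subdivision points.
\<close>

definition PC1 :: "real \<Rightarrow> 'a::real_normed_vector set \<Rightarrow> (real \<Rightarrow> 'a) set" where
  "PC1 T W = {x. (\<forall>t\<in>{0..T}. x t \<in> W) \<and> continuous_on {0..T} x \<and>
     ((\<exists>x'. continuous_on {0..T} x' \<and>
         (\<forall>t\<in>{0..T}. (x has_vector_derivative x' t) (at t within {0..T}))) \<or>
      (\<exists>k \<tau> x'. subdivision T k \<tau> \<and>
         (\<forall>t\<in>{0..T} - \<tau> ` {0..k+1}. (x has_vector_derivative x' t) (at t) \<and> isCont x' t) \<and>
         (\<forall>i\<in>{0..k}. \<exists>l. (x has_vector_derivative l) (at_right (\<tau> i)) \<and>
                          (x' \<longlongrightarrow> l) (at_right (\<tau> i))) \<and>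
         (\<forall>i\<in>{1..k+1}. \<exists>l. (x has_vector_derivative l) (at_left (\<tau> i)) \<and>
                            (x' \<longlongrightarrow> l) (at_left (\<tau> i)))))}"

text \<open>
  The extended derivative of \<open>x\<close> is \<open>x'(t)\<close> off the subdivision, the right derivative at the
  subdivision points other than \<open>T\<close>, and the left derivative at \<open>T\<close>.  Since \<open>x'(t)\<close> is also the
  one-sided derivative wherever \<open>x\<close> is differentiable (lemma \<open>ext_deriv_eq\<close>), this can be
  written without reference to a subdivision.
\<close>

definition ext_deriv :: "real \<Rightarrow> (real \<Rightarrow> 'a::real_normed_vector) \<Rightarrow> real \<Rightarrow> 'a" where
  "ext_deriv T x t =
     (if t < T then vector_derivative x (at_right t) else vector_derivative x (at_left t))"

lemma ext_deriv_right:
  "t < T \<Longrightarrow> (x has_vector_derivative d) (at_right t) \<Longrightarrow> ext_deriv T x t = d"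
  unfolding ext_deriv_def
  by (simp add: vector_derivative_within trivial_limit_at_right_real)

lemma ext_deriv_left:
  "(x has_vector_derivative d) (at_left T) \<Longrightarrow> ext_deriv T x T = d"
  unfolding ext_deriv_def
  by (simp add: vector_derivative_within trivial_limit_at_left_real)

lemma ext_deriv_eq:
  assumes "0 < T" "t \<in> {0..T}" "(x has_vector_derivative d) (at t within {0..T})"
  shows "ext_deriv T x t = d"
proof (cases "t < T")
  case True
  have "(x has_vector_derivative d) (at t within {t<..<T})"
    using has_vector_derivative_within_subset[OF assms(3)] assms(2) by (auto simp: subset_iff)
  moreover have "at t within {t<..<T} = at_right t"
    using True by (intro at_within_nhd[of _ "{..<T}"]) auto
  ultimately show ?thesis using True ext_deriv_right by metis
next
  case False
  then have t: "t = T" using assms(2) by simp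
  have "(x has_vector_derivative d) (at t within {0<..<T})"
    using has_vector_derivative_within_subset[OF assms(3)] by (auto simp: subset_iff)
  moreover have "at t within {0<..<T} = at_left t"
    using t assms(1) by (intro at_within_nhd[of _ "{0<..}"]) auto
  ultimately show ?thesis using t ext_deriv_left by metis
qed

definition sup_norm :: "real \<Rightarrow> (real \<Rightarrow> 'a::real_normed_vector) \<Rightarrow> real" where
  "sup_norm T x = (SUP t\<in>{0..T}. norm (x t))"

definition PC1_norm :: "real \<Rightarrow> (real \<Rightarrow> 'a::real_normed_vector) \<Rightarrow> real" where
  "PC1_norm T x = sup_norm T x + sup_norm T (ext_deriv T x)"

text \<open>Right Gateaux variations of curves of functions \<open>\<pi> \<mapsto> x[\<pi>]\<close>, \<open>\<pi> \<mapsto> u[\<pi>]\<close> in the two spaces.\<close>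

definition has_PC1_variation ::
    "real \<Rightarrow> ('z::real_normed_vector \<Rightarrow> real \<Rightarrow> 'a::real_normed_vector) \<Rightarrow> (real \<Rightarrow> 'a) \<Rightarrow> 'z \<Rightarrow> 'z \<Rightarrow> bool"
where
  "has_PC1_variation T x d \<pi> v \<longleftrightarrow> d \<in> PC1 T UNIV \<and>
     ((\<lambda>\<theta>. PC1_norm T (\<lambda>t. (x (\<pi> + \<theta> *\<^sub>R v) t - x \<pi> t) /\<^sub>R \<theta> - d t)) \<longlongrightarrow> 0) (at_right 0)"

definition has_NPC0_R_variation ::
    "real \<Rightarrow> ('z::real_normed_vector \<Rightarrow> real \<Rightarrow> 'a::real_normed_vector) \<Rightarrow> (real \<Rightarrow> 'a) \<Rightarrow> 'z \<Rightarrow> 'z \<Rightarrow> bool"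
where
  "has_NPC0_R_variation T u d \<pi> v \<longleftrightarrow> d \<in> NPC0_R T UNIV \<and>
     ((\<lambda>\<theta>. sup_norm T (\<lambda>t. (u (\<pi> + \<theta> *\<^sub>R v) t - u \<pi> t) /\<^sub>R \<theta> - d t)) \<longlongrightarrow> 0) (at_right 0)"


section \<open>The Bolza problem\<close>

definition bolza_admissible ::
    "real \<Rightarrow> 'x::real_normed_vector set \<Rightarrow> 'y::real_normed_vector set \<Rightarrow> 'x \<Rightarrow> nat \<Rightarrow> nat \<Rightarrow>
     (real \<Rightarrow> 'x \<Rightarrow> 'y \<Rightarrow> 'z \<Rightarrow> 'x) \<Rightarrow> (nat \<Rightarrow> 'x \<Rightarrow> 'z \<Rightarrow> real) \<Rightarrow> (nat \<Rightarrow> 'x \<Rightarrow> 'z \<Rightarrow> real) \<Rightarrow>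
     'z \<Rightarrow> ((real \<Rightarrow> 'x) \<times> (real \<Rightarrow> 'y)) set" where
  "bolza_admissible T \<Omega> U \<xi>\<^sub>0 m q f g h \<pi> = {(x, u).
     x \<in> PC1 T \<Omega> \<and> u \<in> NPC0_R T U \<and>
     (\<forall>t\<in>{0..T}. ext_deriv T x t = f t (x t) (u t) \<pi>) \<and>
     x 0 = \<xi>\<^sub>0 \<and>
     (\<forall>i\<in>{1..m}. g i (x T) \<pi> \<ge> 0) \<and>
     (\<forall>j\<in>{1..q}. h j (x T) \<pi> = 0)}"

definition bolza_objective ::
    "real \<Rightarrow> (real \<Rightarrow> 'x \<Rightarrow> 'y \<Rightarrow> 'z \<Rightarrow> real) \<Rightarrow> (nat \<Rightarrow> 'x \<Rightarrow> 'z \<Rightarrow> real) \<Rightarrow>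
     'z \<Rightarrow> (real \<Rightarrow> 'x) \<times> (real \<Rightarrow> 'y) \<Rightarrow> real" where
  "bolza_objective T f0 g \<pi> = (\<lambda>(x, u). (LINT t:{0..T}|lborel. f0 t (x t) (u t) \<pi>) + g 0 (x T) \<pi>)"

definition bolza_solution ::
    "real \<Rightarrow> 'x::real_normed_vector set \<Rightarrow> 'y::real_normed_vector set \<Rightarrow> 'x \<Rightarrow> nat \<Rightarrow> nat \<Rightarrow>
     (real \<Rightarrow> 'x \<Rightarrow> 'y \<Rightarrow> 'z \<Rightarrow> real) \<Rightarrow> (real \<Rightarrow> 'x \<Rightarrow> 'y \<Rightarrow> 'z \<Rightarrow> 'x) \<Rightarrow>
     (nat \<Rightarrow> 'x \<Rightarrow> 'z \<Rightarrow> real) \<Rightarrow> (nat \<Rightarrow> 'x \<Rightarrow> 'z \<Rightarrow> real) \<Rightarrow>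
     'z \<Rightarrow> (real \<Rightarrow> 'x) \<times> (real \<Rightarrow> 'y) \<Rightarrow> bool" where
  "bolza_solution T \<Omega> U \<xi>\<^sub>0 m q f0 f g h \<pi> xu \<longleftrightarrow>
     xu \<in> bolza_admissible T \<Omega> U \<xi>\<^sub>0 m q f g h \<pi> \<and>
     (\<forall>yv \<in> bolza_admissible T \<Omega> U \<xi>\<^sub>0 m q f g h \<pi>.
        bolza_objective T f0 g \<pi> yv \<le> bolza_objective T f0 g \<pi> xu)"

text \<open>
  A real supremum: it is the value of the problem whenever there are admissible pairs and the
  objective is bounded above on them, in particular whenever there is a solution.
\<close>

definition bolza_value ::
    "real \<Rightarrow> 'x::real_normed_vector set \<Rightarrow> 'y::real_normed_vector set \<Rightarrow> 'x \<Rightarrow> nat \<Rightarrow> nat \<Rightarrow>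
     (real \<Rightarrow> 'x \<Rightarrow> 'y \<Rightarrow> 'z \<Rightarrow> real) \<Rightarrow> (real \<Rightarrow> 'x \<Rightarrow> 'y \<Rightarrow> 'z \<Rightarrow> 'x) \<Rightarrow>
     (nat \<Rightarrow> 'x \<Rightarrow> 'z \<Rightarrow> real) \<Rightarrow> (nat \<Rightarrow> 'x \<Rightarrow> 'z \<Rightarrow> real) \<Rightarrow> 'z \<Rightarrow> real" where
  "bolza_value T \<Omega> U \<xi>\<^sub>0 m q f0 f g h \<pi> =
     (SUP xu \<in> bolza_admissible T \<Omega> U \<xi>\<^sub>0 m q f g h \<pi>. bolza_objective T f0 g \<pi> xu)"

lemma bolza_value_eq:
  assumes "bolza_solution T \<Omega> U \<xi>\<^sub>0 m q f0 f g h \<pi> xu"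
  shows "bolza_value T \<Omega> U \<xi>\<^sub>0 m q f0 f g h \<pi> = bolza_objective T f0 g \<pi> xu"
  using assms unfolding bolza_solution_def bolza_value_def
  by (intro cSup_eq_maximum) auto


section \<open>Pontryagin triples\<close>

definition pontryagin_H ::
    "(real \<Rightarrow> 'x::real_normed_vector \<Rightarrow> 'y \<Rightarrow> 'z \<Rightarrow> real) \<Rightarrow> (real \<Rightarrow> 'x \<Rightarrow> 'y \<Rightarrow> 'z \<Rightarrow> 'x) \<Rightarrow> 'z \<Rightarrow>
     real \<Rightarrow> 'x \<Rightarrow> 'y \<Rightarrow> ('x \<Rightarrow>\<^sub>L real) \<Rightarrow> real \<Rightarrow> real" where
  "pontryagin_H f0 f \<pi> t \<xi> \<zeta> p l = p (f t \<xi> \<zeta> \<pi>) + l * f0 t \<xi> \<zeta> \<pi>"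

text \<open>
  Multipliers are functions of the index; only \<open>lam i\<close> for \<open>i \<le> m\<close> and \<open>mu j\<close> for
  \<open>1 \<le> j \<le> q\<close> matter, and only the values of \<open>p\<close> on \<open>[0,T]\<close>.
\<close>

definition pontryagin_triple ::
    "real \<Rightarrow> 'y::real_normed_vector set \<Rightarrow> nat \<Rightarrow> nat \<Rightarrow>
     (real \<Rightarrow> 'x::real_normed_vector \<Rightarrow> 'y \<Rightarrow> 'z \<Rightarrow> real) \<Rightarrow> (real \<Rightarrow> 'x \<Rightarrow> 'y \<Rightarrow> 'z \<Rightarrow> 'x) \<Rightarrow>
     (nat \<Rightarrow> 'x \<Rightarrow> 'z \<Rightarrow> real) \<Rightarrow> (nat \<Rightarrow> 'x \<Rightarrow> 'z \<Rightarrow> real) \<Rightarrow>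
     'z \<Rightarrow> (real \<Rightarrow> 'x) \<times> (real \<Rightarrow> 'y) \<Rightarrow>
     (nat \<Rightarrow> real) \<Rightarrow> (nat \<Rightarrow> real) \<Rightarrow> (real \<Rightarrow> 'x \<Rightarrow>\<^sub>L real) \<Rightarrow> bool" where
  "pontryagin_triple T U m q f0 f g h \<pi> = (\<lambda>(x, u) lam mu p.
     p \<in> PC1 T UNIV \<and>
     ((\<exists>i\<in>{0..m}. lam i \<noteq> 0) \<or> (\<exists>j\<in>{1..q}. mu j \<noteq> 0)) \<and>
     (\<forall>i\<in>{0..m}. lam i \<ge> 0) \<and>
     (\<forall>i\<in>{1..m}. lam i * g i (x T) \<pi> = 0) \<and>
     (\<Sum>i=0..m. lam i *\<^sub>R hadamard_deriv (\<lambda>\<xi>. g i \<xi> \<pi>) (x T)) +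
       (\<Sum>j=1..q. mu j *\<^sub>R hadamard_deriv (\<lambda>\<xi>. h j \<xi> \<pi>) (x T)) = p T \<and>
     (\<forall>t\<in>{0..T}. ext_deriv T p t =
        - frechet_deriv (\<lambda>\<xi>. pontryagin_H f0 f \<pi> t \<xi> (u t) (p t) (lam 0)) (x t)) \<and>
     (\<forall>t\<in>{0..T}. \<forall>\<zeta>\<in>U. pontryagin_H f0 f \<pi> t (x t) (u t) (p t) (lam 0) \<ge>
                       pontryagin_H f0 f \<pi> t (x t) \<zeta> (p t) (lam 0)) \<and>
     continuous_on {0..T} (\<lambda>t. pontryagin_H f0 f \<pi> t (x t) (u t) (p t) (lam 0)))"


section \<open>Inner products\<close>

text \<open>An inner product on a space that already carries another norm.\<close>

definition is_inner_product :: "('a::real_vector \<Rightarrow> 'a \<Rightarrow> real) \<Rightarrow> bool" where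
  "is_inner_product ip \<longleftrightarrow>
     bilinear ip \<and> (\<forall>a b. ip a b = ip b a) \<and> (\<forall>a. a \<noteq> 0 \<longrightarrow> 0 < ip a a)"

end

(*
  At every parameter of P the solution obeys the Pontryagin principle, proved with needle
  variations and a Fritz John rule.  At time T the maximum condition makes the derivative of the
  Hamiltonian in the control vanish; since the family in (CVT1) is independent, the multipliers
  at pi_0 are normal and unique.  If lam i is not 0 at pi_0, compactness of the normalised
  multipliers at nearby parameters shows that g i stays active along the solutions, so that
  lam i g i vanishes identically near pi_0.

  V is the objective along x[pi], u[pi].  Its variation is that of g 0 plus, by dominated
  convergence, the integral of the derivative of f0 along the variations dx, du.  As dx solves the
  linearised equation, the adjoint equation turns this integral into the parameter terms
  minus p(T) dx(T), and the transversality condition together with the activity of the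
  constraints evaluates p(T) dx(T).
*)
theory Submission imports Defs begin

section \<open>Piecewise continuous functions\<close>

text \<open>The state space is infinite-dimensional and the terminal constraints are only Hadamard
  differentiable, so no inverse function theorem or degree argument in the state space is at hand.
  All nonlinear work is therefore moved to finitely many real numbers, the widths of finitely many
  needles: the terminal state depends on them in a Lipschitz way and has a first-order expansion,
  and the equality constraints are restored by finding a zero on a cube. Each finite family of
  needles has its own multipliers; a compactness argument yields one choice that serves all needles,
  and only then is the costate defined, by carrying the terminal functional back along the
  linearised flow. Near \<open>\<pi>\<^sub>0\<close> the multipliers may be abnormal, hence they are
  scaled by the sum of their absolute values and not by \<open>lam 0\<close>. Activity of a
  constraint is essential because feasibility alone gives only a sign for its derivative along the
  variation. Parameter derivatives are known at each time separately; the integrated terms are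
  real-valued and measurable as limits of difference quotients.\<close>

lemma continuous_on_Icc_left_right:
  fixes w :: "real \<Rightarrow> 'a::t2_space"
  assumes "continuous_on {a..b} w"
  shows "t \<in> {a<..<b} \<Longrightarrow> isCont w t"
    and "t \<in> {a..<b} \<Longrightarrow> (w \<longlongrightarrow> w t) (at_right t)"
    and "t \<in> {a<..b} \<Longrightarrow> (w \<longlongrightarrow> w t) (at_left t)"
proof -
  show "isCont w t" if "t \<in> {a<..<b}"
    using assms that by (metis continuous_on_interior interior_atLeastAtMost_real)
  show "(w \<longlongrightarrow> w t) (at_right t)" if "t \<in> {a..<b}"
    using continuous_on_Icc_at_rightD[of t b w] continuous_on_subset[OF assms, of "{t..b}"] that by auto
  show "(w \<longlongrightarrow> w t) (at_left t)" if "t \<in> {a<..b}"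
    using continuous_on_Icc_at_leftD[of a t w] continuous_on_subset[OF assms, of "{a..t}"] that by auto
qed

text \<open>Trades the indexed subdivision for a bare finite exceptional set. Such sets can be
  united when several functions are combined, with no renumbering of points; a continuous function
  has the empty one.\<close>

lemma PC0_D:
  fixes w :: "real \<Rightarrow> 'a::t2_space"
  assumes "w \<in> PC0 T W"
  obtains S where "finite S" "\<And>t. t \<in> {0<..<T} - S \<Longrightarrow> isCont w t"
    "\<And>t. t \<in> {0..<T} \<Longrightarrow> \<exists>l\<in>W. (w \<longlongrightarrow> l) (at_right t)"
    "\<And>t. t \<in> {0<..T} \<Longrightarrow> \<exists>l\<in>W. (w \<longlongrightarrow> l) (at_left t)"
proof (cases "continuous_on {0..T} w")
  case True
  have W: "\<forall>t\<in>{0..T}. w t \<in> W" using assms by (simp add: PC0_def)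
  show thesis
    by (rule that[of "{}"]) (use W continuous_on_Icc_left_right[OF True] in \<open>force+\<close>)
next
  case False
  then obtain k \<tau> where W: "\<forall>t\<in>{0..T}. w t \<in> W" and sub: "subdivision T k \<tau>"
    and c: "\<And>t. t \<in> {0..T} - \<tau> ` {0..k+1} \<Longrightarrow> isCont w t"
    and r: "\<And>i. i \<in> {0..k} \<Longrightarrow> \<exists>l\<in>W. (w \<longlongrightarrow> l) (at_right (\<tau> i))"
    and l: "\<And>i. i \<in> {1..k+1} \<Longrightarrow> \<exists>l\<in>W. (w \<longlongrightarrow> l) (at_left (\<tau> i))"
    using assms unfolding PC0_def by blast
  have c': "(w \<longlongrightarrow> w t) (at_right t)" "(w \<longlongrightarrow> w t) (at_left t)" "w t \<in> W"
    if "t \<in> {0..T} - \<tau> ` {0..k+1}" for t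
    using c[OF that] W that by (auto simp: isCont_def filterlim_at_split)
  show thesis
  proof (rule that[of "\<tau> ` {0..k+1}"])
    show "\<exists>l\<in>W. (w \<longlongrightarrow> l) (at_right t)" if t: "t \<in> {0..<T}" for t
    proof (cases "t \<in> \<tau> ` {0..k+1}")
      case True
      then obtain i where "t = \<tau> i" "i \<le> k + 1" by auto
      moreover have "i \<noteq> k + 1" using t sub calculation by (auto simp: subdivision_def)
      ultimately show ?thesis using r[of i] by auto
    qed (use c'[of t] t in auto)
    show "\<exists>l\<in>W. (w \<longlongrightarrow> l) (at_left t)" if t: "t \<in> {0<..T}" for t
    proof (cases "t \<in> \<tau> ` {0..k+1}")
      case True
      then obtain i where "t = \<tau> i" "i \<le> k + 1" by auto
      moreover have "i \<noteq> 0" using t sub calculation by (metis greaterThanAtMost_iff less_irrefl subdivision_def)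
      ultimately show ?thesis using l[of i] by auto
    qed (use c'[of t] t in auto)
  qed (use c in auto)
qed

text \<open>The way back from a finite exceptional set to the indexed form that the definitions ask
  for: add both end points and sort.\<close>

lemma finite_set_subdivision:
  assumes "finite S" "0 < T"
  obtains k \<tau> where "subdivision T k \<tau>" "\<tau> ` {0..k+1} = insert 0 (insert T (S \<inter> {0<..<T}))"
    "\<And>i. i \<in> {0..k} \<Longrightarrow> \<tau> i \<in> {0..<T}" "\<And>i. i \<in> {1..k+1} \<Longrightarrow> \<tau> i \<in> {0<..T}"
proof -
  define S' where "S' = insert 0 (insert T (S \<inter> {0<..<T}))"
  define ts where "ts = sorted_list_of_set S'"
  have fin: "finite S'" using assms by (simp add: S'_def)
  have sort: "sorted_wrt (<) ts" and set: "set ts = S'" and len: "length ts = card S'"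
    using fin by (simp_all add: ts_def)
  \<comment> \<open>The end points differ because \<open>0 < T\<close>, so the sorted list has at
    least two entries and its last index can be written \<open>k + 1\<close>.\<close>
  have "card {0, T} \<le> card S'" using fin by (intro card_mono) (auto simp: S'_def)
  then obtain k where k: "length ts = k + 2"
    using assms(2) len by (metis add.commute card_2_iff le_Suc_ex less_irrefl)
  have mono: "ts ! i < ts ! j" if "i < j" "j \<le> k + 1" for i j
    using sorted_wrt_nth_less[OF sort that(1)] that k by simp
  have in_S: "ts ! i \<in> S'" if "i \<le> k + 1" for i
    using that k set by (metis add_2_eq_Suc' le_imp_less_Suc nth_mem Suc_eq_plus1)
  have bd: "t \<in> {0..T}" if "t \<in> S'" for t using that assms(2) by (auto simp: S'_def)
  obtain i0 where i0: "i0 \<le> k + 1" "ts ! i0 = 0"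
    using set k by (metis S'_def add_2_eq_Suc' in_set_conv_nth insertI1 less_Suc_eq_le Suc_eq_plus1)
  obtain i1 where i1: "i1 \<le> k + 1" "ts ! i1 = T"
    using set k by (metis S'_def add_2_eq_Suc' in_set_conv_nth insertI1 insertI2 less_Suc_eq_le Suc_eq_plus1)
  have t0: "ts ! 0 = 0" using mono[of 0 i0] i0 bd[OF in_S[of 0]] by (cases "i0 = 0") auto
  have t1: "ts ! (k+1) = T" using mono[of i1 "k+1"] i1 bd[OF in_S[of "k+1"]] by (cases "i1 = k+1") auto
  show thesis
  proof (rule that[of k "\<lambda>i. ts ! i"])
    show "subdivision T k ((!) ts)" using t0 t1 mono by (simp add: subdivision_def)
    have "(!) ts ` {0..<length ts} = set ts" by (metis list.set_map map_nth set_upt)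
    then show "(!) ts ` {0..k+1} = insert 0 (insert T (S \<inter> {0<..<T}))"
      using set S'_def k by (metis add_2_eq_Suc' atLeastLessThanSuc_atLeastAtMost Suc_eq_plus1)
    show "ts ! i \<in> {0..<T}" if "i \<in> {0..k}" for i
      using mono[of i "k+1"] t1 bd[OF in_S[of i]] that by auto
    show "ts ! i \<in> {0<..T}" if "i \<in> {1..k+1}" for i
      using mono[of 0 "i"] t0 bd[OF in_S[of i]] that by auto
  qed
qed

lemma NPC0_R_I:
  fixes w :: "real \<Rightarrow> 'a::t2_space"
  assumes "0 < T" "finite S" and W: "\<And>t. t \<in> {0..T} \<Longrightarrow> w t \<in> W"
    and c: "\<And>t. t \<in> {0<..<T} - S \<Longrightarrow> isCont w t"
    and r: "\<And>t. t \<in> {0..<T} \<Longrightarrow> (w \<longlongrightarrow> w t) (at_right t)"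
    and l: "\<And>t. t \<in> {0<..<T} \<Longrightarrow> \<exists>l\<in>W. (w \<longlongrightarrow> l) (at_left t)"
    and lT: "(w \<longlongrightarrow> w T) (at_left T)"
  shows "w \<in> NPC0_R T W"
proof -
  obtain k \<tau> where \<tau>: "subdivision T k \<tau>" "\<tau> ` {0..k+1} = insert 0 (insert T (S \<inter> {0<..<T}))"
    "\<And>i. i \<in> {0..k} \<Longrightarrow> \<tau> i \<in> {0..<T}" "\<And>i. i \<in> {1..k+1} \<Longrightarrow> \<tau> i \<in> {0<..T}"
    using finite_set_subdivision[OF assms(2,1)] by blast
  have l': "\<exists>l\<in>W. (w \<longlongrightarrow> l) (at_left t)" if "t \<in> {0<..T}" for t
    using l[of t] lT that W by (cases "t = T") auto
  have "w \<in> PC0 T W"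
    unfolding PC0_def mem_Collect_eq
  proof (intro conjI ballI disjI2 exI)
    show "subdivision T k \<tau>" by fact
    show "isCont w t" if "t \<in> {0..T} - \<tau> ` {0..k+1}" for t
      using that \<tau>(2) by (intro c) auto
    show "\<exists>l\<in>W. (w \<longlongrightarrow> l) (at_right (\<tau> i))" if "i \<in> {0..k}" for i
    proof -
      have "\<tau> i \<in> {0..T}" using \<tau>(3)[OF that] by simp
      then show ?thesis using r[OF \<tau>(3)[OF that]] W by blast
    qed
    show "\<exists>l\<in>W. (w \<longlongrightarrow> l) (at_left (\<tau> i))" if "i \<in> {1..k+1}" for i
      using \<tau>(4)[OF that] l' by blast
  qed (use W in auto)
  then show ?thesis using r lT by (simp add: NPC0_R_def)
qed

lemma NPC0_R_D:
  fixes w :: "real \<Rightarrow> 'a::t2_space"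
  assumes "w \<in> NPC0_R T W"
  obtains S where "finite S" "\<And>t. t \<in> {0<..<T} - S \<Longrightarrow> isCont w t"
    "\<And>t. t \<in> {0..T} \<Longrightarrow> w t \<in> W"
    "\<And>t. t \<in> {0..<T} \<Longrightarrow> (w \<longlongrightarrow> w t) (at_right t)"
    "\<And>t. t \<in> {0<..T} \<Longrightarrow> \<exists>l\<in>W. (w \<longlongrightarrow> l) (at_left t)"
    "(w \<longlongrightarrow> w T) (at_left T)"
proof -
  have "w \<in> PC0 T W" using assms by (simp add: NPC0_R_def)
  from PC0_D[OF this] show thesis
    using that assms by (smt (verit) NPC0_R_def PC0_def mem_Collect_eq)
qed

section \<open>Closure properties of normalised piecewise continuous functions\<close>

lemma NPC0_R_mem: "w \<in> NPC0_R T W \<Longrightarrow> t \<in> {0..T} \<Longrightarrow> w t \<in> W"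
  by (simp add: NPC0_R_def PC0_def)

lemma NPC0_R_mono: "w \<in> NPC0_R T W \<Longrightarrow> W \<subseteq> W' \<Longrightarrow> w \<in> NPC0_R T W'"
  unfolding NPC0_R_def PC0_def mem_Collect_eq
  by (elim conjE disjE exE; intro conjI) (blast | (rule disjI2; blast))+

lemma NPC0_R_continuous:
  fixes w :: "real \<Rightarrow> 'a::t2_space"
  assumes "0 < T" "continuous_on {0..T} w" "\<And>t. t \<in> {0..T} \<Longrightarrow> w t \<in> W"
  shows "w \<in> NPC0_R T W"
proof (rule NPC0_R_I[of T "{}"])
  show "\<exists>l\<in>W. (w \<longlongrightarrow> l) (at_left t)" if "t \<in> {0<..<T}" for t
    using continuous_on_Icc_left_right(3)[OF assms(2), of t] assms(3)[of t] that
    by (intro bexI[of _ "w t"]) auto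
qed (use continuous_on_Icc_left_right[OF assms(2)] assms in auto)

text \<open>\<open>G\<close> is continuous only relative to \<open>W\<close>, so a one-sided limit
  of \<open>w\<close> can be pushed through \<open>G\<close> only because \<open>PC0\<close>
  requires that limit to lie in \<open>W\<close>.\<close>

lemma NPC0_R_compose:
  fixes w :: "real \<Rightarrow> 'a::t2_space" and G :: "'a \<Rightarrow> 'b::t2_space"
  assumes "0 < T" "w \<in> NPC0_R T W" "continuous_on W G" "\<And>\<xi>. \<xi> \<in> W \<Longrightarrow> G \<xi> \<in> W'"
  shows "(\<lambda>t. G (w t)) \<in> NPC0_R T W'"
proof -
  obtain S where S: "finite S" "\<And>t. t \<in> {0<..<T} - S \<Longrightarrow> isCont w t"
    "\<And>t. t \<in> {0..T} \<Longrightarrow> w t \<in> W"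
    "\<And>t. t \<in> {0..<T} \<Longrightarrow> (w \<longlongrightarrow> w t) (at_right t)"
    "\<And>t. t \<in> {0<..T} \<Longrightarrow> \<exists>l\<in>W. (w \<longlongrightarrow> l) (at_left t)"
    "(w \<longlongrightarrow> w T) (at_left T)"
    using NPC0_R_D[OF assms(2)] by metis
  \<comment> \<open>Outside [0,T] the function \<open>w\<close> is arbitrary. Each filter in use
    (right, left, two-sided) must first be confined to [0,T] before its values are known to be in
    \<open>W\<close>.\<close>
  have ev: "eventually (\<lambda>s. w s \<in> W) (at t within A)"
    if "t \<in> {0..T}" "A \<subseteq> {0..T} \<or> (A = {t<..} \<and> t < T) \<or> (A = {..<t} \<and> 0 < t) \<or> (A = UNIV \<and> 0 < t \<and> t < T)" for t A
  proof -
    have "\<exists>B. open B \<and> t \<in> B \<and> B \<inter> A - {t} \<subseteq> {0..T}"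
      using that assms(1)
      by (elim disjE)
        ((rule exI[of _ "UNIV"]; force), (rule exI[of _ "{..<T}"]; force), (rule exI[of _ "{0<..}"]; force),
         (rule exI[of _ "{0<..<T}"]; force))
    then obtain B where B: "open B" "t \<in> B" "B \<inter> A - {t} \<subseteq> {0..T}" by blast
    then have "eventually (\<lambda>s. s \<in> {0..T}) (at t within A)"
      unfolding eventually_at_topological by (intro exI[of _ B]) auto
    then show ?thesis by eventually_elim (rule S(3))
  qed
  note comp = continuous_on_tendsto_compose[OF assms(3)]
  show ?thesis
  proof (rule NPC0_R_I[OF assms(1) S(1)])
    show "isCont (\<lambda>t. G (w t)) t" if "t \<in> {0<..<T} - S" for t
      unfolding isCont_def using S(2)[OF that] that
      by (intro comp S ev) (auto simp: isCont_def)
    show "((\<lambda>t. G (w t)) \<longlongrightarrow> G (w t)) (at_right t)" if "t \<in> {0..<T}" for t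
      using S(4)[OF that] that by (intro comp S ev) auto
    show "\<exists>l\<in>W'. ((\<lambda>t. G (w t)) \<longlongrightarrow> l) (at_left t)" if t: "t \<in> {0<..<T}" for t
    proof -
      have t': "t \<in> {0<..T}" using t by auto
      obtain l where l: "l \<in> W" "(w \<longlongrightarrow> l) (at_left t)" using S(5)[OF t'] by blast
      then show ?thesis using t assms(4) by (intro bexI[of _ "G l"] comp ev) auto
    qed
    show "((\<lambda>t. G (w t)) \<longlongrightarrow> G (w T)) (at_left T)"
      using S(6) assms(1) by (intro comp S ev) auto
  qed (use S assms in auto)
qed

lemma NPC0_R_Pair:
  fixes w :: "real \<Rightarrow> 'a::t2_space" and w' :: "real \<Rightarrow> 'b::t2_space"
  assumes "0 < T" "w \<in> NPC0_R T W" "w' \<in> NPC0_R T W'"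
  shows "(\<lambda>t. (w t, w' t)) \<in> NPC0_R T (W \<times> W')"
proof -
  obtain S where S: "finite S" "\<And>t. t \<in> {0<..<T} - S \<Longrightarrow> isCont w t"
    "\<And>t. t \<in> {0..T} \<Longrightarrow> w t \<in> W"
    "\<And>t. t \<in> {0..<T} \<Longrightarrow> (w \<longlongrightarrow> w t) (at_right t)"
    "\<And>t. t \<in> {0<..T} \<Longrightarrow> \<exists>l\<in>W. (w \<longlongrightarrow> l) (at_left t)"
    "(w \<longlongrightarrow> w T) (at_left T)"
    using NPC0_R_D[OF assms(2)] by metis
  obtain S' where S': "finite S'" "\<And>t. t \<in> {0<..<T} - S' \<Longrightarrow> isCont w' t"
    "\<And>t. t \<in> {0..T} \<Longrightarrow> w' t \<in> W'"
    "\<And>t. t \<in> {0..<T} \<Longrightarrow> (w' \<longlongrightarrow> w' t) (at_right t)"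
    "\<And>t. t \<in> {0<..T} \<Longrightarrow> \<exists>l\<in>W'. (w' \<longlongrightarrow> l) (at_left t)"
    "(w' \<longlongrightarrow> w' T) (at_left T)"
    using NPC0_R_D[OF assms(3)] by metis
  show ?thesis
  proof (rule NPC0_R_I[of T "S \<union> S'"])
    show "\<exists>l\<in>W \<times> W'. ((\<lambda>t. (w t, w' t)) \<longlongrightarrow> l) (at_left t)" if t: "t \<in> {0<..<T}" for t
    proof -
      have t': "t \<in> {0<..T}" using t by simp
      obtain l l' where "l \<in> W" "(w \<longlongrightarrow> l) (at_left t)" "l' \<in> W'" "(w' \<longlongrightarrow> l') (at_left t)"
        using S(5)[OF t'] S'(5)[OF t'] by blast
      then show ?thesis by (intro bexI[of _ "(l, l')"] tendsto_Pair) auto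
    qed
    show "isCont (\<lambda>t. (w t, w' t)) t" if "t \<in> {0<..<T} - (S \<union> S')" for t
      using S(2)[of t] S'(2)[of t] that by (intro isCont_Pair) auto
    show "((\<lambda>t. (w t, w' t)) \<longlongrightarrow> (w t, w' t)) (at_right t)" if "t \<in> {0..<T}" for t
      using S(4)[OF that] S'(4)[OF that] by (rule tendsto_Pair)
    show "((\<lambda>t. (w t, w' t)) \<longlongrightarrow> (w T, w' T)) (at_left T)"
      using S(6) S'(6) by (rule tendsto_Pair)
  qed (use S(1,3) S'(1,3) assms in auto)
qed

lemma NPC0_R_compose2:
  fixes w :: "real \<Rightarrow> 'a::t2_space" and w' :: "real \<Rightarrow> 'b::t2_space" and G :: "'a \<Rightarrow> 'b \<Rightarrow> 'c::t2_space"
  assumes "0 < T" "w \<in> NPC0_R T W" "w' \<in> NPC0_R T W'"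
    "continuous_on (W \<times> W') (\<lambda>(\<xi>, \<zeta>). G \<xi> \<zeta>)" "\<And>\<xi> \<zeta>. \<xi> \<in> W \<Longrightarrow> \<zeta> \<in> W' \<Longrightarrow> G \<xi> \<zeta> \<in> V"
  shows "(\<lambda>t. G (w t) (w' t)) \<in> NPC0_R T V"
  using NPC0_R_compose[OF assms(1) NPC0_R_Pair[OF assms(1-3)] assms(4), of V] assms(5) by auto

text \<open>The half-open shape \<open>{c..<d}\<close> preserves right continuity, and
  \<open>d < T\<close> leaves \<open>w\<close> untouched near \<open>T\<close>, where left
  continuity is required. A needle with \<open>d \<le> c\<close> is empty and is covered as
  well.\<close>

lemma NPC0_R_needle:
  fixes w :: "real \<Rightarrow> 'a::t2_space"
  assumes "0 < T" "w \<in> NPC0_R T W" "v \<in> W" "d < T"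
  shows "(\<lambda>t. if t \<in> {c..<d} then v else w t) \<in> NPC0_R T W"
proof -
  obtain S where S: "finite S" "\<And>t. t \<in> {0<..<T} - S \<Longrightarrow> isCont w t"
    "\<And>t. t \<in> {0..T} \<Longrightarrow> w t \<in> W"
    "\<And>t. t \<in> {0..<T} \<Longrightarrow> (w \<longlongrightarrow> w t) (at_right t)"
    "\<And>t. t \<in> {0<..T} \<Longrightarrow> \<exists>l\<in>W. (w \<longlongrightarrow> l) (at_left t)"
    "(w \<longlongrightarrow> w T) (at_left T)"
    using NPC0_R_D[OF assms(2)] by metis
  let ?w = "\<lambda>t. if t \<in> {c..<d} then v else w t"
  have lim: "(?w \<longlongrightarrow> l) (at t within A)"
    if "(g \<longlongrightarrow> l) (at t within A)" "open B" "t \<in> B" "\<And>s. s \<in> B \<Longrightarrow> s \<noteq> t \<Longrightarrow> s \<in> A \<Longrightarrow> ?w s = g s" for g l t A B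
  proof -
    have "eventually (\<lambda>s. g s = ?w s) (at t within A)"
      unfolding eventually_at_topological using that(2-4) by (intro exI[of _ B]) auto
    with that(1) show ?thesis using filterlim_cong[of _ _ _ _ g ?w] by auto
  qed
  show ?thesis
  proof (rule NPC0_R_I[of T "S \<union> {c, d}"])
    show "isCont ?w t" if "t \<in> {0<..<T} - (S \<union> {c, d})" for t
    proof -
      have "t \<noteq> c" "t \<noteq> d" using that by auto
      then consider "t \<in> {c<..<d}" | "t \<in> -{c..d}" by fastforce
      then show ?thesis
      proof cases
        case 1
        then have "(?w \<longlongrightarrow> v) (at t)" by (intro lim[of "\<lambda>_. v" _ _ _ "{c<..<d}"]) auto
        then show ?thesis using 1 by (simp add: isCont_def)
      next
        case 2
        then have "(?w \<longlongrightarrow> w t) (at t)"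
          using that S(2)[of t] by (intro lim[of w _ _ _ "- {c..d}"]) (auto simp: isCont_def)
        then show ?thesis using 2 by (auto simp: isCont_def)
      qed
    qed
    show "(?w \<longlongrightarrow> ?w t) (at_right t)" if "t \<in> {0..<T}" for t
    proof -
      consider "t \<in> {c..<d}" | "t < c" | "d \<le> t" by force
      then show ?thesis
      proof cases
        case 1
        then have "(?w \<longlongrightarrow> v) (at_right t)" by (intro lim[of "\<lambda>_. v" _ _ _ "{..<d}"]) auto
        then show ?thesis using 1 by simp
      next
        case 2
        then have "(?w \<longlongrightarrow> w t) (at_right t)" using S(4) that by (intro lim[of w _ _ _ "{..<c}"]) auto
        then show ?thesis using 2 by simp
      next
        case 3
        then have "(?w \<longlongrightarrow> w t) (at_right t)" using S(4) that by (intro lim[of w _ _ _ UNIV]) auto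
        then show ?thesis using 3 by simp
      qed
    qed
    show "\<exists>l\<in>W. (?w \<longlongrightarrow> l) (at_left t)" if t: "t \<in> {0<..<T}" for t
    proof -
      obtain l where l: "l \<in> W" "(w \<longlongrightarrow> l) (at_left t)" using S(5)[of t] t by auto
      consider "t \<in> {c<..d}" | "t \<le> c" | "d < t" by force
      then show ?thesis
      proof cases
        case 1
        then have "(?w \<longlongrightarrow> v) (at_left t)" by (intro lim[of "\<lambda>_. v" _ _ _ "{c<..}"]) auto
        then show ?thesis using assms by blast
      next
        case 2
        then have "(?w \<longlongrightarrow> l) (at_left t)" using l by (intro lim[of w _ _ _ UNIV]) auto
        then show ?thesis using l by blast
      next
        case 3
        then have "(?w \<longlongrightarrow> l) (at_left t)" using l by (intro lim[of w _ _ _ "{d<..}"]) auto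
        then show ?thesis using l by blast
      qed
    qed
    have "(?w \<longlongrightarrow> w T) (at_left T)" using S(6) assms by (intro lim[of w _ _ _ "{d<..}"]) auto
    then show "(?w \<longlongrightarrow> ?w T) (at_left T)" using assms by simp
  qed (use assms S in auto)
qed

section \<open>Compact range and integrability of piecewise continuous functions\<close>

lemma regulated_continuous_extension:
  fixes w :: "real \<Rightarrow> 'a::t2_space"
  assumes "a < b" "\<And>t. t \<in> {a<..<b} \<Longrightarrow> isCont w t" "(w \<longlongrightarrow> r) (at_right a)" "(w \<longlongrightarrow> l) (at_left b)"
  obtains w' where "continuous_on {a..b} w'" "\<And>t. t \<in> {a<..<b} \<Longrightarrow> w' t = w t" "w' a = r" "w' b = l"
proof
  let ?w = "\<lambda>t. if t = a then r else if t = b then l else w t"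
  have lim: "(?w \<longlongrightarrow> l') (at t within A)"
    if "(w \<longlongrightarrow> l') (at t within A)" "open B" "t \<in> B" "B \<inter> A - {t} \<subseteq> {a<..<b}" for l' t A B
  proof -
    have "eventually (\<lambda>s. w s = ?w s) (at t within A)"
      unfolding eventually_at_topological using that(2-4) by (intro exI[of _ B]) auto
    with that(1) show ?thesis using filterlim_cong[of _ _ _ _ w ?w] by auto
  qed
  show "continuous_on {a..b} ?w"
  proof (rule continuous_on_IccI)
    have "(?w \<longlongrightarrow> r) (at_right a)" using assms by (intro lim[of _ _ _ "{..<b}"]) auto
    then show "(?w \<longlongrightarrow> ?w a) (at_right a)" by simp
    have "(?w \<longlongrightarrow> l) (at_left b)" using assms by (intro lim[of _ _ _ "{a<..}"]) auto
    then show "(?w \<longlongrightarrow> ?w b) (at_left b)" using assms by simp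
    show "?w \<midarrow>t\<rightarrow> ?w t" if "a < t" "t < b" for t
    proof -
      have "(?w \<longlongrightarrow> w t) (at t)" using assms that by (intro lim[of _ _ _ "{a<..<b}"]) (auto simp: isCont_def)
      then show ?thesis using that by simp
    qed
  qed fact
qed (use assms in auto)

text \<open>Induction on the exceptional points: a point inside the interval splits it, a point
  outside is dropped. On an interval without such points, changing the two end values gives a
  continuous function on a compact set. The true end values may differ from the one-sided limits and
  are added as two extra points.\<close>

lemma regulated_compact_range:
  fixes w :: "real \<Rightarrow> 'a::t2_space"
  assumes "finite S"
  shows "a \<le> b \<Longrightarrow> \<forall>t\<in>{a<..<b} - S. isCont w t \<Longrightarrow> \<forall>t\<in>{a..<b}. \<exists>l\<in>W. (w \<longlongrightarrow> l) (at_right t)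
    \<Longrightarrow> \<forall>t\<in>{a<..b}. \<exists>l\<in>W. (w \<longlongrightarrow> l) (at_left t) \<Longrightarrow> \<forall>t\<in>{a..b}. w t \<in> W
    \<Longrightarrow> \<exists>K. compact K \<and> K \<subseteq> W \<and> w ` {a..b} \<subseteq> K"
  using assms
proof (induction S arbitrary: a b)
  case empty
  show ?case
  proof (cases "a < b")
    case True
    obtain r l where rl: "r \<in> W" "l \<in> W" "(w \<longlongrightarrow> r) (at_right a)" "(w \<longlongrightarrow> l) (at_left b)"
      using empty.prems True by (metis atLeastLessThan_iff greaterThanAtMost_iff order_refl)
    obtain w' where w': "continuous_on {a..b} w'" "\<And>t. t \<in> {a<..<b} \<Longrightarrow> w' t = w t" "w' a = r" "w' b = l"
      using regulated_continuous_extension[OF True, of w r l] rl empty.prems by auto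
    have img: "w' t \<in> W" if "t \<in> {a..b}" for t
      using that w' rl empty.prems(5) by (cases "t = a"; cases "t = b") auto
    have "compact (w' ` {a..b} \<union> {w a, w b})" using w' by (intro compact_Un compact_continuous_image) auto
    moreover have "w ` {a..b} \<subseteq> w' ` {a..b} \<union> {w a, w b}"
    proof
      fix y assume "y \<in> w ` {a..b}"
      then obtain t where "t \<in> {a..b}" "y = w t" by auto
      then show "y \<in> w' ` {a..b} \<union> {w a, w b}"
        using w'(2)[of t] image_eqI[of "w t" w' t "{a..b}"] by (cases "t = a"; cases "t = b") auto
    qed
    moreover have "w' ` {a..b} \<union> {w a, w b} \<subseteq> W"
    proof -
      have "w a \<in> W" "w b \<in> W" using empty.prems by auto
      then show ?thesis using img by blast
    qed
    ultimately show ?thesis by blast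
  next
    case False
    then have "b = a" using empty.prems by auto
    moreover have "w a \<in> W" using empty.prems by auto
    ultimately show ?thesis by (intro exI[of _ "{w a}"]) simp
  qed
next
  case (insert s S)
  show ?case
  proof (cases "s \<in> {a<..<b}")
    case True
    have "\<exists>K. compact K \<and> K \<subseteq> W \<and> w ` {a..s} \<subseteq> K"
      using True insert.prems by (intro insert.IH) auto
    then obtain K where K: "compact K" "K \<subseteq> W" "w ` {a..s} \<subseteq> K" by (elim exE conjE)
    have "\<exists>K. compact K \<and> K \<subseteq> W \<and> w ` {s..b} \<subseteq> K"
      using True insert.prems by (intro insert.IH) auto
    then obtain K' where K': "compact K'" "K' \<subseteq> W" "w ` {s..b} \<subseteq> K'" by (elim exE conjE)
    have "w ` {a..b} \<subseteq> K \<union> K'"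
    proof (rule image_subsetI)
      fix t assume "t \<in> {a..b}"
      then show "w t \<in> K \<union> K'"
        using subsetD[OF K(3) imageI[of t]] subsetD[OF K'(3) imageI[of t]] by (cases "t \<le> s") auto
    qed
    then have "compact (K \<union> K') \<and> K \<union> K' \<subseteq> W \<and> w ` {a..b} \<subseteq> K \<union> K'"
      using compact_Un[OF K(1) K'(1)] K(2) K'(2) by simp
    then show ?thesis by (rule exI)
  next
    case False
    then show ?thesis using insert.prems by (intro insert.IH) auto
  qed
qed

lemma NPC0_R_compact_range:
  fixes w :: "real \<Rightarrow> 'a::t2_space"
  assumes "0 < T" "w \<in> NPC0_R T W"
  obtains K where "compact K" "K \<subseteq> W" "\<And>t. t \<in> {0..T} \<Longrightarrow> w t \<in> K"
proof -
  obtain S where S: "finite S" "\<And>t. t \<in> {0<..<T} - S \<Longrightarrow> isCont w t"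
    "\<And>t. t \<in> {0..T} \<Longrightarrow> w t \<in> W"
    "\<And>t. t \<in> {0..<T} \<Longrightarrow> (w \<longlongrightarrow> w t) (at_right t)"
    "\<And>t. t \<in> {0<..T} \<Longrightarrow> \<exists>l\<in>W. (w \<longlongrightarrow> l) (at_left t)"
    "(w \<longlongrightarrow> w T) (at_left T)"
    using NPC0_R_D[OF assms(2)] by metis
  have "\<exists>K. compact K \<and> K \<subseteq> W \<and> w ` {0..T} \<subseteq> K"
  proof (rule regulated_compact_range[OF S(1)])
    show "\<forall>t\<in>{0..<T}. \<exists>l\<in>W. (w \<longlongrightarrow> l) (at_right t)"
      using S(3,4) by (metis atLeastAtMost_iff atLeastLessThan_iff less_imp_le)
  qed (use S assms in auto)
  then show thesis using that by blast
qed

text \<open>Same splitting as for the compact range; on a gap the function differs from its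
  continuous extension in at most two points, which no integral sees.\<close>

lemma regulated_integrable:
  fixes w :: "real \<Rightarrow> 'a::banach"
  assumes "finite S"
  shows "a \<le> b \<Longrightarrow> \<forall>t\<in>{a<..<b} - S. isCont w t \<Longrightarrow> \<forall>t\<in>{a..<b}. \<exists>l. (w \<longlongrightarrow> l) (at_right t)
    \<Longrightarrow> \<forall>t\<in>{a<..b}. \<exists>l. (w \<longlongrightarrow> l) (at_left t) \<Longrightarrow> w integrable_on {a..b}"
  using assms
proof (induction S arbitrary: a b)
  case empty
  show ?case
  proof (cases "a < b")
    case True
    obtain r l where rl: "(w \<longlongrightarrow> r) (at_right a)" "(w \<longlongrightarrow> l) (at_left b)"
      using empty.prems True by (metis atLeastLessThan_iff greaterThanAtMost_iff order_refl)
    obtain w' where w': "continuous_on {a..b} w'" "\<And>t. t \<in> {a<..<b} \<Longrightarrow> w' t = w t" "w' a = r" "w' b = l"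
      using regulated_continuous_extension[OF True, of w r l] rl empty.prems by auto
    show ?thesis
      by (rule integrable_spike_finite[of "{a, b}" _ w w'])
        (use w' in \<open>auto intro: integrable_continuous_interval\<close>)
  next
    case False
    then have "b = a" using empty.prems by auto
    then show ?thesis using has_integral_refl(2)[of w a] by (auto simp: integrable_on_def)
  qed
next
  case (insert s S)
  show ?case
  proof (cases "s \<in> {a<..<b}")
    case True
    have 1: "w integrable_on {a..s}" using True insert.prems by (intro insert.IH) auto
    have 2: "w integrable_on {s..b}" using True insert.prems by (intro insert.IH) auto
    show ?thesis
      by (rule Henstock_Kurzweil_Integration.integrable_combine[OF _ _ 1 2]) (use True in auto)
  next
    case False
    then show ?thesis using insert.prems by (intro insert.IH) auto
  qed
qed

lemma NPC0_R_integrable: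
  fixes w :: "real \<Rightarrow> 'a::banach"
  assumes "0 < T" "w \<in> NPC0_R T W"
  shows "w integrable_on {0..T}"
proof -
  obtain S where S: "finite S" "\<And>t. t \<in> {0<..<T} - S \<Longrightarrow> isCont w t"
    "\<And>t. t \<in> {0..T} \<Longrightarrow> w t \<in> W"
    "\<And>t. t \<in> {0..<T} \<Longrightarrow> (w \<longlongrightarrow> w t) (at_right t)"
    "\<And>t. t \<in> {0<..T} \<Longrightarrow> \<exists>l\<in>W. (w \<longlongrightarrow> l) (at_left t)"
    "(w \<longlongrightarrow> w T) (at_left T)"
    using NPC0_R_D[OF assms(2)] by metis
  show ?thesis
  proof (rule regulated_integrable[OF S(1)])
    show "\<forall>t\<in>{0..<T}. \<exists>l. (w \<longlongrightarrow> l) (at_right t)" using S(4) by blast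
    show "\<forall>t\<in>{0<..T}. \<exists>l. (w \<longlongrightarrow> l) (at_left t)" using S(5) by blast
  qed (use S assms in auto)
qed

lemma NPC0_R_bounded:
  fixes w :: "real \<Rightarrow> 'a::real_normed_vector"
  assumes "0 < T" "w \<in> NPC0_R T W"
  obtains B where "0 < B" "\<And>t. t \<in> {0..T} \<Longrightarrow> norm (w t) \<le> B"
proof -
  obtain K where "compact K" "\<And>t. t \<in> {0..T} \<Longrightarrow> w t \<in> K"
    using NPC0_R_compact_range[OF assms] by metis
  then show thesis using that compact_imp_bounded[of K] by (auto simp: bounded_pos)
qed

text \<open>Gauge integrability does not yield Lebesgue integrability, so measurability is shown
  directly: \<open>w\<close> is a continuous function on an open set with finitely many points
  removed, plus a finite sum of point values. Boundedness then dominates it.\<close>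

lemma NPC0_R_set_integrable:
  fixes w :: "real \<Rightarrow> real"
  assumes "0 < T" "w \<in> NPC0_R T W"
  shows "set_integrable lborel {0..T} w"
proof -
  obtain S where S: "finite S" "\<And>t. t \<in> {0<..<T} - S \<Longrightarrow> isCont w t"
    using NPC0_R_D[OF assms(2)] by metis
  obtain B where B: "0 < B" "\<And>t. t \<in> {0..T} \<Longrightarrow> norm (w t) \<le> B"
    using NPC0_R_bounded[OF assms] by blast
  define S' where "S' = insert 0 (insert T S)"
  have fin: "finite S'" using S by (simp add: S'_def)
  have m: "(\<lambda>t. indicator ({0<..<T} - S') t *\<^sub>R w t) \<in> borel_measurable borel"
  proof (rule borel_measurable_continuous_on_indicator)
    show "continuous_on ({0<..<T} - S') w"
      using S by (intro continuous_at_imp_continuous_on) (auto simp: S'_def)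
    show "{0<..<T} - S' \<in> sets borel"
      using fin by (intro borel_open open_Diff) (auto intro: finite_imp_closed)
  qed
  have m2: "(\<lambda>t. \<Sum>s\<in>S' \<inter> {0..T}. indicator {s} t *\<^sub>R w s) \<in> borel_measurable borel"
    by (intro borel_measurable_sum borel_measurable_scaleR borel_measurable_indicator) auto
  have eq: "indicator {0..T} t *\<^sub>R w t = indicator ({0<..<T} - S') t *\<^sub>R w t + (\<Sum>s\<in>S' \<inter> {0..T}. indicator {s} t *\<^sub>R w s)" for t
  proof -
    have "(\<Sum>s\<in>S' \<inter> {0..T}. indicator {s} t *\<^sub>R w s) = (\<Sum>s\<in>S' \<inter> {0..T}. if s = t then w s else 0)"
      by (intro sum.cong) (auto simp: indicator_def)
    also have "\<dots> = (if t \<in> S' \<inter> {0..T} then w t else 0)" using fin by (simp add: sum.delta)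
    finally show ?thesis by (auto simp: indicator_def S'_def)
  qed
  have m3: "(\<lambda>t. indicator {0..T} t *\<^sub>R w t) \<in> borel_measurable lborel"
    unfolding eq using m m2 by simp
  have "integrable lborel (\<lambda>t. indicator {0..T} t *\<^sub>R B)"
    by (intro integrable_scaleR_left integrable_real_indicator) (simp_all add: emeasure_lborel_Icc_eq)
  then show ?thesis unfolding set_integrable_def
    by (rule Bochner_Integration.integrable_bound[OF _ m3]) (use B in \<open>auto simp: indicator_def intro!: AE_I2\<close>)
qed

section \<open>Piecewise continuously differentiable functions\<close>

lemma finite_gap_right:
  fixes t T :: real
  assumes "finite S" "t < T"
  obtains b where "t < b" "b < T" "\<And>s. t < s \<Longrightarrow> s \<le> b \<Longrightarrow> s \<notin> S"
proof -
  \<comment> \<open>Midpoints between \<open>t\<close> and each later exceptional time, and between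
    \<open>t\<close> and \<open>T\<close>: the smallest of them stays strictly below all of
    these.\<close>
  define b where "b = Min (insert ((t + T) / 2) ((\<lambda>s. (t + s) / 2) ` {s \<in> S. t < s}))"
  have fin: "finite (insert ((t + T) / 2) ((\<lambda>s. (t + s) / 2) ` {s \<in> S. t < s}))" using assms by simp
  have "t < b" using fin assms unfolding b_def by (subst Min_gr_iff) auto
  moreover have "b \<le> (t + T) / 2" using fin unfolding b_def by (intro Min_le) auto
  moreover have "s \<notin> {t<..b}" if "s \<in> S" for s
  proof
    assume s: "s \<in> {t<..b}"
    then have "b \<le> (t + s) / 2" using fin that unfolding b_def by (intro Min_le) auto
    then show False using s by auto
  qed
  ultimately show thesis using assms by (intro that[of b]) auto
qed

lemma finite_gap_left:
  fixes t T :: real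
  assumes "finite S" "a < t"
  obtains b where "a < b" "b < t" "\<And>s. b \<le> s \<Longrightarrow> s < t \<Longrightarrow> s \<notin> S"
proof -
  obtain b where b: "-t < b" "b < -a" "\<And>s. - t < s \<Longrightarrow> s \<le> b \<Longrightarrow> s \<notin> uminus ` S"
    using finite_gap_right[of "uminus ` S" "-t" "-a"] assms by auto
  show thesis
  proof (rule that[of "-b"])
    show "s \<notin> S" if "- b \<le> s" "s < t" for s
      using b(3)[of "-s"] that by auto
  qed (use b in auto)
qed

text \<open>Extend the derivative continuously to the closed interval and integrate it: the integral
  is differentiable up to both ends and coincides with \<open>x\<close> up to a constant. So the
  limits of the derivative are one-sided derivatives of \<open>x\<close>.\<close>

lemma FTC_one_sided:
  fixes x :: "real \<Rightarrow> 'a::banach"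
  assumes ab: "a < b" and cont: "continuous_on {a..b} x"
    and d: "\<And>t. t \<in> {a<..<b} \<Longrightarrow> isCont w t" "\<And>t. t \<in> {a<..<b} \<Longrightarrow> (x has_vector_derivative w t) (at t)"
    and lims: "(w \<longlongrightarrow> r) (at_right a)" "(w \<longlongrightarrow> l) (at_left b)"
  shows "(x has_vector_derivative r) (at_right a)" "(x has_vector_derivative l) (at_left b)"
proof -
  obtain w' where w': "continuous_on {a..b} w'" "\<And>t. t \<in> {a<..<b} \<Longrightarrow> w' t = w t" "w' a = r" "w' b = l"
    using regulated_continuous_extension[OF ab d(1) lims] by metis
  have eq: "x c = x a + integral {a..c} w'" if "c \<in> {a..b}" for c
  proof -
    have "(w' has_integral (x c - x a)) {a..c}"
      using that d w'(2) by (intro fundamental_theorem_of_calculus_interior continuous_on_subset[OF cont]) auto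
    then show ?thesis by (simp add: integral_unique)
  qed
  have "((\<lambda>c. x a + integral {a..c} w') has_vector_derivative w' c) (at c within {a..b})" if "c \<in> {a..b}" for c
    using integral_has_vector_derivative[OF w'(1) that] by (auto intro!: derivative_eq_intros)
  then have D: "(x has_vector_derivative w' c) (at c within {a..b})" if "c \<in> {a..b}" for c
    using has_vector_derivative_transform[of c "{a..b}" x "\<lambda>c. x a + integral {a..c} w'"] eq that by metis
  have "at a within {a<..<b} = at_right a" using ab by (intro at_within_nhd[of _ "{..<b}"]) auto
  then show "(x has_vector_derivative r) (at_right a)"
    using has_vector_derivative_within_subset[OF D[of a], of "{a<..<b}"] ab w'(3) by (auto simp: subset_iff)
  have "at b within {a<..<b} = at_left b" using ab by (intro at_within_nhd[of _ "{a<..}"]) auto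
  then show "(x has_vector_derivative l) (at_left b)"
    using has_vector_derivative_within_subset[OF D[of b], of "{a<..<b}"] ab w'(4) by (auto simp: subset_iff)
qed

text \<open>Solutions of differential equations enter \<open>PC1\<close> through this rule: their
  derivative is known off a finite set only, and the corner derivatives come from
  \<open>FTC_one_sided\<close> on a gap free of exceptional times.\<close>

lemma PC1_I:
  fixes x :: "real \<Rightarrow> 'a::banach"
  assumes "0 < T" and cont: "continuous_on {0..T} x" and W: "\<And>t. t \<in> {0..T} \<Longrightarrow> x t \<in> W"
    and w: "w \<in> NPC0_R T V" and "finite S"
    and d: "\<And>t. t \<in> {0<..<T} - S \<Longrightarrow> (x has_vector_derivative w t) (at t)"
  shows "x \<in> PC1 T W" "t \<in> {0..T} \<Longrightarrow> ext_deriv T x t = w t"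
proof -
  obtain S' where S: "finite S'" "\<And>t. t \<in> {0<..<T} - S' \<Longrightarrow> isCont w t"
    "\<And>t. t \<in> {0..T} \<Longrightarrow> w t \<in> V"
    "\<And>t. t \<in> {0..<T} \<Longrightarrow> (w \<longlongrightarrow> w t) (at_right t)"
    "\<And>t. t \<in> {0<..T} \<Longrightarrow> \<exists>l\<in>V. (w \<longlongrightarrow> l) (at_left t)"
    "(w \<longlongrightarrow> w T) (at_left T)"
    using NPC0_R_D[OF w] by metis
  have fin: "finite (S \<union> S')" using S assms by simp
  have R: "(x has_vector_derivative w t) (at_right t)" if t: "t \<in> {0..<T}" for t
  proof -
    obtain b where b: "t < b" "b < T" "\<And>s. t < s \<Longrightarrow> s \<le> b \<Longrightarrow> s \<notin> S \<union> S'"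
      using finite_gap_right[OF fin, of t T] t by (metis atLeastLessThan_iff)
    then have "(w \<longlongrightarrow> w b) (at_left b)"
      using S(2)[of b] t by (auto simp: isCont_def filterlim_at_split)
    then show ?thesis
      using b t S d by (intro FTC_one_sided(1)[of t b x w] continuous_on_subset[OF cont]) auto
  qed
  have L: "(x has_vector_derivative l) (at_left t)" if t: "t \<in> {0<..T}" "(w \<longlongrightarrow> l) (at_left t)" for t l
  proof -
    obtain b where b: "0 < b" "b < t" "\<And>s. b \<le> s \<Longrightarrow> s < t \<Longrightarrow> s \<notin> S \<union> S'"
      using finite_gap_left[OF fin, of 0 t] t by (metis greaterThanAtMost_iff)
    then have wb: "(w \<longlongrightarrow> w b) (at_right b)"
      using S(2)[of b] t by (auto simp: isCont_def filterlim_at_split)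
    show ?thesis
      using b t S d by (intro FTC_one_sided(2)[OF _ _ _ _ wb] continuous_on_subset[OF cont]) auto
  qed
  obtain k \<tau> where \<tau>: "subdivision T k \<tau>" "\<tau> ` {0..k+1} = insert 0 (insert T ((S \<union> S') \<inter> {0<..<T}))"
    "\<And>i. i \<in> {0..k} \<Longrightarrow> \<tau> i \<in> {0..<T}" "\<And>i. i \<in> {1..k+1} \<Longrightarrow> \<tau> i \<in> {0<..T}"
    using finite_set_subdivision[OF fin assms(1)] by metis
  show "x \<in> PC1 T W"
    unfolding PC1_def mem_Collect_eq
  proof (intro conjI ballI disjI2 exI[of _ k] exI[of _ \<tau>] exI[of _ w])
    show "subdivision T k \<tau>" by fact
    show "(x has_vector_derivative w t) (at t)" "isCont w t" if "t \<in> {0..T} - \<tau> ` {0..k+1}" for t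
      using that S(2) d unfolding \<tau>(2) by auto
    show "\<exists>l. (x has_vector_derivative l) (at_right (\<tau> i)) \<and> (w \<longlongrightarrow> l) (at_right (\<tau> i))" if "i \<in> {0..k}" for i
      using R S(4) \<tau>(3)[OF that] by blast
    show "\<exists>l. (x has_vector_derivative l) (at_left (\<tau> i)) \<and> (w \<longlongrightarrow> l) (at_left (\<tau> i))" if "i \<in> {1..k+1}" for i
      using L S(5) \<tau>(4)[OF that] by blast
  qed (use W cont in auto)
  show "ext_deriv T x t = w t" if "t \<in> {0..T}"
  proof (cases "t < T")
    case True
    then show ?thesis using R[of t] that by (intro ext_deriv_right) auto
  next
    case False
    then show ?thesis using L[of T] S(6) that assms(1) ext_deriv_left[of x "w T" T] by auto
  qed
qed

text \<open>Recovers from \<open>PC1\<close> the data that \<open>PC1_I\<close> consumes, with the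
  canonical \<open>ext_deriv\<close> in place of a representative that may take any value at the
  subdivision points.\<close>

lemma PC1_ext_deriv:
  fixes x :: "real \<Rightarrow> 'a::real_normed_vector"
  assumes "0 < T" and x: "x \<in> PC1 T W"
  shows "ext_deriv T x \<in> NPC0_R T UNIV"
    and "\<exists>S. finite S \<and> (\<forall>t\<in>{0<..<T} - S. (x has_vector_derivative ext_deriv T x t) (at t))"
    and "t \<in> {0..<T} \<Longrightarrow> (x has_vector_derivative ext_deriv T x t) (at_right t)"
    and "(x has_vector_derivative ext_deriv T x T) (at_left T)"
proof -
  have at_I: "at t within {0..T} = at t" if "t \<in> {0<..<T}" for t
    using that by (simp add: at_within_Icc_at)
  have at_R: "(x has_vector_derivative l) (at_right t)" if "(x has_vector_derivative l) (at t)" for t l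
    using that has_vector_derivative_at_within by blast
  have "ext_deriv T x \<in> NPC0_R T UNIV \<and>
    (\<exists>S. finite S \<and> (\<forall>t\<in>{0<..<T} - S. (x has_vector_derivative ext_deriv T x t) (at t))) \<and>
    (\<forall>t\<in>{0..<T}. (x has_vector_derivative ext_deriv T x t) (at_right t)) \<and>
    (x has_vector_derivative ext_deriv T x T) (at_left T)"
  proof (cases "\<exists>x'. continuous_on {0..T} x' \<and> (\<forall>t\<in>{0..T}. (x has_vector_derivative x' t) (at t within {0..T}))")
    case True
    then obtain x' where x': "continuous_on {0..T} x'" "\<And>t. t \<in> {0..T} \<Longrightarrow> (x has_vector_derivative x' t) (at t within {0..T})"
      by blast
    have eq: "ext_deriv T x t = x' t" if "t \<in> {0..T}" for t
      using ext_deriv_eq[OF assms(1) that x'(2)[OF that]] .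
    have "continuous_on {0..T} (ext_deriv T x)" using x'(1) eq continuous_on_cong[of "{0..T}" "{0..T}" "ext_deriv T x" x'] by simp
    then have "ext_deriv T x \<in> NPC0_R T UNIV" using assms(1) by (intro NPC0_R_continuous) auto
    moreover have "(x has_vector_derivative ext_deriv T x t) (at t)" if "t \<in> {0<..<T}" for t
      using x'(2)[of t] eq[of t] at_I[OF that] that by auto
    moreover have "(x has_vector_derivative ext_deriv T x t) (at_right t)" if t: "t \<in> {0..<T}" for t
    proof -
      have "at t within {t<..<T} = at_right t" using t by (intro at_within_nhd[of _ "{..<T}"]) auto
      then show ?thesis
        using has_vector_derivative_within_subset[OF x'(2)[of t], of "{t<..<T}"] t eq[of t] by (auto simp: subset_iff)
    qed
    moreover have "(x has_vector_derivative ext_deriv T x T) (at_left T)"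
    proof -
      have "at T within {0<..<T} = at_left T" using assms by (intro at_within_nhd[of _ "{0<..}"]) auto
      then show ?thesis
        using has_vector_derivative_within_subset[OF x'(2)[of T], of "{0<..<T}"] assms(1) eq[of T] by (auto simp: subset_iff)
    qed
    ultimately show ?thesis by blast
  next
    case False
    then obtain k \<tau> x' where sub: "subdivision T k \<tau>"
      and d: "\<And>t. t \<in> {0..T} - \<tau> ` {0..k+1} \<Longrightarrow> (x has_vector_derivative x' t) (at t) \<and> isCont x' t"
      and r: "\<And>i. i \<in> {0..k} \<Longrightarrow> \<exists>l. (x has_vector_derivative l) (at_right (\<tau> i)) \<and> (x' \<longlongrightarrow> l) (at_right (\<tau> i))"
      and l: "\<And>i. i \<in> {1..k+1} \<Longrightarrow> \<exists>l. (x has_vector_derivative l) (at_left (\<tau> i)) \<and> (x' \<longlongrightarrow> l) (at_left (\<tau> i))"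
      using x unfolding PC1_def by blast
    define S where "S = \<tau> ` {0..k+1}"
    have S: "finite S" "0 \<in> S" "T \<in> S"
      using sub by (force simp: S_def subdivision_def image_iff)+
    have eq: "ext_deriv T x t = x' t" if "t \<in> {0<..<T} - S" for t
      using d[of t] that at_R by (intro ext_deriv_right) (auto simp: S_def)
    \<comment> \<open>A punctured neighbourhood of \<open>t\<close> avoids the finite set, so there
      \<open>ext_deriv\<close> agrees with \<open>x'\<close> and inherits its limits, although
      \<open>x'\<close> is unconstrained on \<open>S\<close>.\<close>
    have evS: "eventually (\<lambda>s. s \<in> {0<..<T} - S) (at t within A)"
      if tA: "t \<in> {0..T}" "A = {t<..} \<and> t < T \<or> A = {..<t} \<and> 0 < t \<or> A = UNIV \<and> t \<in> {0<..<T}" for t A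
    proof -
      have op: "open (- (S - {t}))" using S(1) by (intro open_Compl finite_imp_closed) auto
      obtain B where "open B" "t \<in> B" "B \<inter> A - {t} \<subseteq> {0<..<T}"
      proof -
        consider "A = {t<..} \<and> t < T" | "A = {..<t} \<and> 0 < t" | "A = UNIV \<and> t \<in> {0<..<T}" using tA by blast
        then show thesis
        proof cases
          case 1
          then show thesis using \<open>t \<in> {0..T}\<close> by (intro that[of "{..<T}"]) auto
        next
          case 2
          then show thesis using \<open>t \<in> {0..T}\<close> by (intro that[of "{0<..}"]) auto
        next
          case 3
          then show thesis by (intro that[of "{0<..<T}"]) auto
        qed
      qed
      then show ?thesis
        unfolding eventually_at_topological using open_Int[OF \<open>open B\<close> op]
        by (intro exI[of _ "B \<inter> - (S - {t})"] conjI) auto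
    qed
    have lim: "(ext_deriv T x \<longlongrightarrow> l) (at t within A)"
      if "(x' \<longlongrightarrow> l) (at t within A)" "t \<in> {0..T}"
        "A = {t<..} \<and> t < T \<or> A = {..<t} \<and> 0 < t \<or> A = UNIV \<and> t \<in> {0<..<T}" for l t A
    proof -
      have "eventually (\<lambda>s. ext_deriv T x s = x' s) (at t within A)"
        using evS[OF that(2,3)] by eventually_elim (rule eq)
      then show ?thesis using that(1) by (simp cong: filterlim_cong add: tendsto_cong)
    qed
    have R: "(x has_vector_derivative ext_deriv T x t) (at_right t) \<and> (ext_deriv T x \<longlongrightarrow> ext_deriv T x t) (at_right t)"
      if t: "t \<in> {0..<T}" for t
    proof -
      have "\<exists>l. (x has_vector_derivative l) (at_right t) \<and> (x' \<longlongrightarrow> l) (at_right t)"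
      proof (cases "t \<in> S")
        case True
        then obtain i where "t = \<tau> i" "i \<le> k + 1" by (auto simp: S_def)
        moreover have "i \<noteq> k + 1" using t sub calculation by (auto simp: subdivision_def)
        ultimately show ?thesis using r[of i] by auto
      next
        case False
        then have "(x has_vector_derivative x' t) (at t)" "isCont x' t" using d[of t] t by (auto simp: S_def)
        then show ?thesis using at_R by (auto simp: isCont_def filterlim_at_split)
      qed
      then obtain l where l: "(x has_vector_derivative l) (at_right t)" "(x' \<longlongrightarrow> l) (at_right t)" by blast
      then have "ext_deriv T x t = l" using t by (intro ext_deriv_right) auto
      then show ?thesis using l lim[of l t "{t<..}"] t by auto
    qed
    have L: "\<exists>l. (x has_vector_derivative l) (at_left t) \<and> (x' \<longlongrightarrow> l) (at_left t)" if t: "t \<in> {0<..T}" for t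
    proof (cases "t \<in> S")
      case True
      then obtain i where "t = \<tau> i" "i \<le> k + 1" by (auto simp: S_def)
      moreover have "i \<noteq> 0" using t sub calculation by (metis greaterThanAtMost_iff less_irrefl subdivision_def)
      ultimately show ?thesis using l[of i] by auto
    next
      case False
      then have "(x has_vector_derivative x' t) (at t)" "isCont x' t" using d[of t] t by (auto simp: S_def)
      then show ?thesis using has_vector_derivative_at_within[of x "x' t" t "{..<t}"] by (auto simp: isCont_def filterlim_at_split)
    qed
    obtain lT where lT: "(x has_vector_derivative lT) (at_left T)" "(x' \<longlongrightarrow> lT) (at_left T)"
      using L[of T] assms(1) by auto
    have eT: "ext_deriv T x T = lT" by (rule ext_deriv_left[OF lT(1)])
    have "ext_deriv T x \<in> NPC0_R T UNIV"
    proof (rule NPC0_R_I[OF assms(1) S(1)])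
      show "isCont (ext_deriv T x) t" if "t \<in> {0<..<T} - S" for t
        using lim[of "x' t" t UNIV] d[of t] eq[OF that] that by (auto simp: isCont_def S_def)
      show "\<exists>l\<in>UNIV. (ext_deriv T x \<longlongrightarrow> l) (at_left t)" if "t \<in> {0<..<T}" for t
        using L[of t] lim[of _ t "{..<t}"] that by auto
      show "(ext_deriv T x \<longlongrightarrow> ext_deriv T x T) (at_left T)"
        unfolding eT using lT(2) assms(1) by (intro lim) auto
    qed (use R in auto)
    moreover have "\<forall>t\<in>{0<..<T} - S. (x has_vector_derivative ext_deriv T x t) (at t)"
      using d eq by (auto simp: S_def)
    ultimately show ?thesis using R S(1) lT eT by blast
  qed
  then show "ext_deriv T x \<in> NPC0_R T UNIV"
    and "\<exists>S. finite S \<and> (\<forall>t\<in>{0<..<T} - S. (x has_vector_derivative ext_deriv T x t) (at t))"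
    and "t \<in> {0..<T} \<Longrightarrow> (x has_vector_derivative ext_deriv T x t) (at_right t)"
    and "(x has_vector_derivative ext_deriv T x T) (at_left T)"
    by blast+
qed

section \<open>The fundamental theorem off a finite set and the Gronwall estimate\<close>

lemma PC1_continuous: "x \<in> PC1 T W \<Longrightarrow> continuous_on {0..T} x"
  by (simp add: PC1_def)

lemma PC1_mem: "x \<in> PC1 T W \<Longrightarrow> t \<in> {0..T} \<Longrightarrow> x t \<in> W"
  by (simp add: PC1_def)

lemma has_integral_FTC_finite:
  fixes e :: "real \<Rightarrow> 'a::banach"
  assumes "0 \<le> t" "t \<le> T" "continuous_on {0..T} e" "finite S"
    and "\<And>s. s \<in> {0<..<T} - S \<Longrightarrow> (e has_vector_derivative e' s) (at s)"
  shows "(e' has_integral (e t - e 0)) {0..t}"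
  using assms by (intro fundamental_theorem_of_calculus_interior_strong[OF assms(4)] continuous_on_subset[OF assms(3)]) auto

text \<open>The forcing \<open>r\<close> enters only through its integral. A bounded perturbation
  acting on a short needle therefore costs its length, which is the scale of all needle
  estimates.\<close>

lemma gronwall:
  fixes e :: "real \<Rightarrow> 'a::banach"
  assumes T: "0 \<le> T" and L: "0 \<le> L" and cont: "continuous_on {0..T} e" and S: "finite S"
    and d: "\<And>s. s \<in> {0<..<T} - S \<Longrightarrow> (e has_vector_derivative e' s) (at s)"
    and b: "\<And>s. s \<in> {0<..<T} - S \<Longrightarrow> norm (e' s) \<le> L * norm (e s) + r s"
    and r: "r integrable_on {0..T}" "\<And>s. s \<in> {0..T} \<Longrightarrow> 0 \<le> r s"
    and t: "t \<in> {0..T}"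
  shows "norm (e t) \<le> (norm (e 0) + integral {0..T} r) * exp (L * T)"
proof -
  define k where "k = norm (e 0) + integral {0..T} r"
  define \<phi> where "\<phi> = (\<lambda>s. integral {0..s} (\<lambda>s. norm (e s)))"
  have k0: "0 \<le> k" using integral_nonneg[OF r] by (simp add: k_def)
  have cn: "continuous_on {0..T} (\<lambda>s. norm (e s))" using cont by (intro continuous_intros)
  have main: "norm (e s) \<le> k + L * \<phi> s" if s: "s \<in> {0..T}" for s
  proof -
    have 1: "(e' has_integral (e s - e 0)) {0..s}"
      using has_integral_FTC_finite[of s T e S e'] s cont S d by auto
    define N where "N = S \<union> {0, s}"
    have N: "finite N" "negligible N" using S by (auto simp: N_def)
    have 2: "((\<lambda>s. if s \<in> N then 0 else e' s) has_integral (e s - e 0)) {0..s}"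
      by (rule has_integral_spike[OF N(2) _ 1]) auto
    have ir: "r integrable_on {0..s}" using r(1) s by (intro integrable_subinterval_real[OF r(1)]) auto
    have ie: "(\<lambda>s. norm (e s)) integrable_on {0..s}"
      using cn s by (intro integrable_continuous_real continuous_on_subset[OF cn]) auto
    have 3: "((\<lambda>s. L * norm (e s) + r s) has_integral (L * \<phi> s + integral {0..s} r)) {0..s}"
      unfolding \<phi>_def using ir ie
      by (intro has_integral_add has_integral_mult_right integrable_integral)
    have "norm (e s - e 0) \<le> L * \<phi> s + integral {0..s} r"
      unfolding integral_unique[OF 2, symmetric] integral_unique[OF 3, symmetric]
    proof (rule integral_norm_bound_integral)
      fix y assume y: "y \<in> {0..s}"
      show "norm (if y \<in> N then 0 else e' y) \<le> L * norm (e y) + r y"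
        using y s L r(2)[of y] b[of y] by (auto simp: N_def)
    qed (use 2 3 in \<open>auto simp: integrable_on_def\<close>)
    moreover have "integral {0..s} r \<le> integral {0..T} r"
      using s r ir by (intro integral_subset_le) auto
    moreover have "norm (e s) \<le> norm (e 0) + norm (e s - e 0)"
      by (metis norm_triangle_sub)
    ultimately show ?thesis by (simp add: k_def)
  qed
  \<comment> \<open>Integrating factor: by \<open>main\<close> its derivative is nonpositive, which
    bounds the integral majorant and not only \<open>e\<close>.\<close>
  define \<psi> where "\<psi> = (\<lambda>s. exp (- L * s) * (k + L * \<phi> s))"
  have "\<psi> t \<le> \<psi> 0"
  proof (cases "t = 0")
    case False
    then have t0: "0 < t" using t by auto
    have d\<phi>: "(\<phi> has_real_derivative norm (e s)) (at s within {0..T})" if "s \<in> {0..T}" for s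
      unfolding \<phi>_def using integral_has_real_derivative[OF cn that] .
    have c\<phi>: "continuous_on {0..T} \<phi>" using d\<phi> by (intro DERIV_continuous_on)
    show ?thesis
    proof (rule DERIV_nonpos_imp_decreasing_open[of 0 t])
      show "continuous_on {0..t} \<psi>" unfolding \<psi>_def
        using t by (intro continuous_intros continuous_on_subset[OF c\<phi>]) auto
      fix s assume s: "0 < s" "s < t"
      then have "(\<phi> has_real_derivative norm (e s)) (at s)"
        using d\<phi>[of s] t at_within_Icc_at[of 0 s T] by auto
      then have "(\<psi> has_real_derivative (exp (- L * s) * (L * norm (e s) - L * (k + L * \<phi> s)))) (at s)"
        unfolding \<psi>_def by (auto intro!: derivative_eq_intros simp: algebra_simps)
      moreover have "exp (- L * s) * (L * norm (e s) - L * (k + L * \<phi> s)) \<le> 0"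
        using main[of s] L s t by (intro mult_nonneg_nonpos) (auto intro: mult_left_mono)
      ultimately show "\<exists>y. (\<psi> has_real_derivative y) (at s) \<and> y \<le> 0" by blast
    qed (use t0 in auto)
  qed simp
  then have "exp (- L * t) * (k + L * \<phi> t) \<le> k" by (simp add: \<psi>_def \<phi>_def)
  then have "k + L * \<phi> t \<le> k * exp (L * t)"
    by (simp add: exp_minus field_simps)
  also have "\<dots> \<le> k * exp (L * T)" using k0 L t by (intro mult_left_mono) (auto intro: mult_left_mono)
  finally show ?thesis using main[OF t] by (simp add: k_def)
qed

section \<open>Differential equations\<close>

lemma NPC0_R_integral:
  fixes w :: "real \<Rightarrow> 'a::banach"
  assumes "0 < T" "w \<in> NPC0_R T V"
  shows "continuous_on {0..T} (\<lambda>t. integral {0..t} w)"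
    and "\<exists>S. finite S \<and> (\<forall>t\<in>{0<..<T} - S. ((\<lambda>t. integral {0..t} w) has_vector_derivative w t) (at t))"
proof -
  have int: "w integrable_on {0..T}" by (rule NPC0_R_integrable[OF assms])
  show "continuous_on {0..T} (\<lambda>t. integral {0..t} w)" by (rule indefinite_integral_continuous_1[OF int])
  obtain S where S: "finite S" "\<And>t. t \<in> {0<..<T} - S \<Longrightarrow> isCont w t"
    using NPC0_R_D[OF assms(2)] by metis
  have "((\<lambda>t. integral {0..t} w) has_vector_derivative w t) (at t)" if t: "t \<in> {0<..<T} - S" for t
  proof -
    have "((\<lambda>t. integral {0..t} w) has_vector_derivative w t) (at t within ({0..T} - {}))"
      using S(2)[OF t] t by (intro integral_has_vector_derivative_continuous_at[OF int])
        (auto intro: continuous_at_imp_continuous_at_within)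
    then show ?thesis using t by (simp add: at_within_Icc_at)
  qed
  then show "\<exists>S. finite S \<and> (\<forall>t\<in>{0<..<T} - S. ((\<lambda>t. integral {0..t} w) has_vector_derivative w t) (at t))"
    using S(1) by blast
qed

text \<open>Writing the unknown as \<open>y0 t + exp (2 * L * t) *\<^sub>R v t\<close> makes the
  Picard operator a contraction with factor 1/2 on all of [0,T] at once. The start curve
  \<open>y0\<close> need not be a solution; its defect only has to be small against the radius of
  the tube on which \<open>\<Psi>\<close> is Lipschitz.\<close>

lemma picard:
  fixes \<Psi> :: "real \<Rightarrow> 'e::banach \<Rightarrow> 'e" and y0 :: "real \<Rightarrow> 'e"
  assumes T: "0 \<le> T" and L: "0 \<le> L" and cont0: "continuous_on {0..T} y0"
    and lip: "\<And>t \<xi> \<eta>. t \<in> {0..T} \<Longrightarrow> \<xi> \<in> cball (y0 t) \<epsilon> \<Longrightarrow> \<eta> \<in> cball (y0 t) \<epsilon> \<Longrightarrow>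
        norm (\<Psi> t \<xi> - \<Psi> t \<eta>) \<le> L * norm (\<xi> - \<eta>)"
    and int: "\<And>y. continuous_on {0..T} y \<Longrightarrow> (\<And>t. t \<in> {0..T} \<Longrightarrow> y t \<in> cball (y0 t) \<epsilon>) \<Longrightarrow>
        (\<lambda>t. \<Psi> t (y t)) integrable_on {0..T}"
    and defect: "\<And>t. t \<in> {0..T} \<Longrightarrow> norm (e0 + integral {0..t} (\<lambda>s. \<Psi> s (y0 s)) - y0 t) \<le> d"
    and small: "2 * d * exp (2 * L * T) \<le> \<epsilon>"
  obtains y where "continuous_on {0..T} y" "\<And>t. t \<in> {0..T} \<Longrightarrow> y t \<in> cball (y0 t) \<epsilon>"
    "\<And>t. t \<in> {0..T} \<Longrightarrow> y t = e0 + integral {0..t} (\<lambda>s. \<Psi> s (y s))"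
proof -
  \<comment> \<open>The radius for \<open>v\<close>: times the largest weight
    \<open>exp (2 * L * T)\<close> it is \<open>\<epsilon>\<close>. The assumption
    \<open>small\<close> reads \<open>d \<le> r / 2\<close>, so the image of zero uses half the
    radius and the contraction the other half.\<close>
  define r where "r = \<epsilon> * exp (- (2 * L * T))"
  have d0: "0 \<le> d" using defect[of 0] T norm_ge_zero[of "e0 - y0 0"] by (auto dest: order_trans[OF norm_ge_zero])
  have eps0: "0 \<le> \<epsilon>" using small d0 by (smt (verit) exp_gt_zero mult_nonneg_nonneg)
  have r0: "0 \<le> r" using eps0 by (simp add: r_def)
  have dr: "d \<le> r / 2"
  proof -
    have "2 * d * exp (2 * L * T) * exp (- (2 * L * T)) \<le> r"
      unfolding r_def using small by (intro mult_right_mono) auto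
    then show ?thesis by (simp add: exp_minus field_simps)
  qed
  define Y where "Y v t = y0 t + exp (2 * L * t) *\<^sub>R apply_bcontfun v t" for v t
  \<comment> \<open>Clamps the time. Bounded continuous functions live on the whole line, so the
    operator is frozen outside [0,T].\<close>
  define c where "c t = max 0 (min T t)" for t :: real
  have c: "c t \<in> {0..T}" "t \<in> {0..T} \<Longrightarrow> c t = t" for t using T by (auto simp: c_def)
  have cc: "continuous_on UNIV c" unfolding c_def by (intro continuous_intros)
  define \<S> where "\<S> = (PiC {0..T} (\<lambda>_. cball 0 r) :: (real \<Rightarrow>\<^sub>C 'e) set)"
  have SD: "norm (apply_bcontfun v t) \<le> r" if "v \<in> \<S>" "t \<in> {0..T}" for v t
    using that by (auto simp: \<S>_def mem_PiC_iff Pi_iff)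
  have Y_cont: "continuous_on {0..T} (Y v)" for v
    unfolding Y_def by (intro continuous_intros cont0) auto
  have Y_tube: "Y v t \<in> cball (y0 t) \<epsilon>" if "v \<in> \<S>" "t \<in> {0..T}" for v t
  proof -
    have "norm (exp (2 * L * t) *\<^sub>R apply_bcontfun v t) \<le> exp (2 * L * T) * r"
      using SD[OF that] that(2) L r0 by (simp, intro mult_mono) (auto intro: mult_left_mono)
    then show ?thesis by (simp add: Y_def dist_norm r_def exp_minus field_simps)
  qed
  have \<Psi>int: "(\<lambda>s. \<Psi> s (Y v s)) integrable_on {0..T}" if "v \<in> \<S>" for v
    using int[OF Y_cont Y_tube[OF that]] .
  define h where "h v t = exp (- (2 * L * t)) *\<^sub>R (e0 + integral {0..t} (\<lambda>s. \<Psi> s (Y v s)) - y0 t)" for v t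
  have h_cont: "continuous_on {0..T} (h v)" if "v \<in> \<S>" for v
    unfolding h_def
    by (intro continuous_intros cont0 indefinite_integral_continuous_1 \<Psi>int that)
  have hb: "(\<lambda>t. h v (c t)) \<in> bcontfun" if "v \<in> \<S>" for v
  proof -
    have "continuous_on UNIV (\<lambda>t. h v (c t))"
      by (rule continuous_on_compose2[OF h_cont[OF that] cc]) (rule image_subsetI, rule c(1))
    moreover have "bounded (h v ` {0..T})"
      using h_cont[OF that] by (intro compact_imp_bounded compact_continuous_image) auto
    then have "bounded (range (\<lambda>t. h v (c t)))" by (rule bounded_subset) (use c in auto)
    ultimately show ?thesis by (simp add: bcontfun_def)
  qed
  define Op where "Op v = Bcontfun (\<lambda>t. h v (c t))" for v
  have Op: "apply_bcontfun (Op v) t = h v (c t)" if "v \<in> \<S>" for v t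
    using Bcontfun_inverse[OF hb[OF that]] by (simp add: Op_def)
  \<comment> \<open>The integral of \<open>L * exp (2 * L * s)\<close> is
    \<open>(exp (2 * L * t) - 1) / 2\<close>; after division by the weight at \<open>t\<close> less
    than one half remains.\<close>
  have key: "norm (h v t - h w t) \<le> D / 2"
    if vw: "v \<in> \<S>" "w \<in> \<S>" and D: "\<And>s. s \<in> {0..T} \<Longrightarrow> norm (apply_bcontfun v s - apply_bcontfun w s) \<le> D" and t: "t \<in> {0..T}" for v w D t
  proof -
    have D0: "0 \<le> D" using order_trans[OF norm_ge_zero D[of 0]] T by auto
    have iv: "(\<lambda>s. \<Psi> s (Y v s)) integrable_on {0..t}" if "v \<in> \<S>" for v
      by (rule integrable_subinterval_real[OF \<Psi>int[OF that]]) (use t in auto)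
    have ex: "((\<lambda>s. D * (L * exp (2 * L * s))) has_integral (D * (exp (2 * L * t) / 2 - exp (2 * L * 0) / 2))) {0..t}"
      using t by (intro has_integral_mult_right fundamental_theorem_of_calculus)
        (auto intro!: derivative_eq_intros simp: has_real_derivative_iff_has_vector_derivative[symmetric])
    have "norm (integral {0..t} (\<lambda>s. \<Psi> s (Y v s) - \<Psi> s (Y w s))) \<le> integral {0..t} (\<lambda>s. D * (L * exp (2 * L * s)))"
    proof (rule integral_norm_bound_integral)
      fix s assume s: "s \<in> {0..t}"
      then have s': "s \<in> {0..T}" using t by auto
      have "norm (\<Psi> s (Y v s) - \<Psi> s (Y w s)) \<le> L * norm (Y v s - Y w s)"
        using lip[OF s' Y_tube[OF vw(1) s'] Y_tube[OF vw(2) s']] .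
      also have "Y v s - Y w s = exp (2 * L * s) *\<^sub>R (apply_bcontfun v s - apply_bcontfun w s)"
        by (simp add: Y_def algebra_simps)
      also have "L * norm \<dots> \<le> L * (exp (2 * L * s) * D)"
        using D[OF s'] L by (intro mult_left_mono) auto
      finally show "norm (\<Psi> s (Y v s) - \<Psi> s (Y w s)) \<le> D * (L * exp (2 * L * s))" by (simp add: mult_ac)
    qed (use integrable_diff[OF iv[OF vw(1)] iv[OF vw(2)]] has_integral_integrable[OF ex] in auto)
    also have "\<dots> = D * (exp (2 * L * t) - 1) / 2" using integral_unique[OF ex] by (simp add: algebra_simps)
    finally have "norm (integral {0..t} (\<lambda>s. \<Psi> s (Y v s)) - integral {0..t} (\<lambda>s. \<Psi> s (Y w s))) \<le> D * (exp (2 * L * t) - 1) / 2"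
      using iv[OF vw(1)] iv[OF vw(2)] by (simp add: integral_diff)
    moreover have "h v t - h w t = exp (- (2 * L * t)) *\<^sub>R (integral {0..t} (\<lambda>s. \<Psi> s (Y v s)) - integral {0..t} (\<lambda>s. \<Psi> s (Y w s)))"
      by (simp add: h_def algebra_simps)
    ultimately have "norm (h v t - h w t) \<le> exp (- (2 * L * t)) * (D * (exp (2 * L * t) - 1) / 2)"
      by simp
    also have "\<dots> = D / 2 * (1 - exp (- (2 * L * t)))" by (simp add: exp_minus field_simps)
    also have "\<dots> \<le> D / 2 * 1" using D0 by (intro mult_left_mono) auto
    finally show ?thesis by simp
  qed
  have zero: "0 \<in> \<S>" using r0 by (simp add: \<S>_def mem_PiC_iff)
  have h0: "norm (h 0 t) \<le> r / 2" if "t \<in> {0..T}" for t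
  proof -
    have "Y 0 = y0" by (simp add: Y_def fun_eq_iff)
    then have "norm (h 0 t) \<le> exp (- (2 * L * t)) * d"
      using defect[OF that] by (simp add: h_def)
    also have "\<dots> \<le> 1 * d" using L that d0 by (intro mult_right_mono) auto
    finally show ?thesis using dr by simp
  qed
  have "\<exists>!v\<in>\<S>. Op v = v"
  proof (rule Banach_fix[of _ "1/2"])
    show "complete \<S>" unfolding \<S>_def by (simp add: complete_eq_closed closed_PiC)
    show "\<S> \<noteq> {}" using zero by blast
    show "Op ` \<S> \<subseteq> \<S>"
    proof (rule image_subsetI)
      fix v assume v: "v \<in> \<S>"
      have "norm (h v t) \<le> r" if t: "t \<in> {0..T}" for t
        using key[OF v zero _ t, of r] SD[OF v] h0[OF t] norm_triangle_sub[of "h v t" "h 0 t"] by fastforce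
      then show "Op v \<in> \<S>" unfolding \<S>_def mem_PiC_iff using Op[OF v] c by (auto simp: Pi_iff)
    qed
    fix v w assume vw: "v \<in> \<S>" "w \<in> \<S>"
    show "dist (Op v) (Op w) \<le> 1 / 2 * dist v w"
    proof (rule dist_bound)
      fix t
      show "dist (apply_bcontfun (Op v) t) (apply_bcontfun (Op w) t) \<le> 1 / 2 * dist v w"
        unfolding Op[OF vw(1)] Op[OF vw(2)] dist_norm
        using key[OF vw _ c(1), of "dist v w"] dist_bounded[of v _ w] by (simp add: dist_norm)
    qed
  qed auto
  then obtain v where v: "v \<in> \<S>" "Op v = v" by blast
  show thesis
  proof (rule that[of "Y v"])
    fix t assume t: "t \<in> {0..T}"
    have "apply_bcontfun v t = h v t" using Op[OF v(1), of t] v(2) c(2)[OF t] by simp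
    then show "Y v t = e0 + integral {0..t} (\<lambda>s. \<Psi> s (Y v s))"
      by (simp add: Y_def h_def exp_minus[symmetric] exp_add[symmetric])
  qed (use Y_cont Y_tube v in auto)
qed

text \<open>A general bilinear product covers left and right composition of operators alike, the
  latter through its flip.\<close>

lemma linear_ode:
  fixes b :: "'c::real_normed_vector \<Rightarrow> 'e::banach \<Rightarrow> 'e"
  assumes T: "0 < T" and b: "bounded_bilinear b" and A: "A \<in> NPC0_R T V"
  obtains y S where "continuous_on {0..T} y" "y 0 = e0" "finite S"
    "\<And>t. t \<in> {0<..<T} - S \<Longrightarrow> (y has_vector_derivative b (A t) (y t)) (at t)"
proof -
  interpret bounded_bilinear b by fact
  obtain K where K: "0 < K" "\<And>x y. norm (b x y) \<le> norm x * norm y * K" using pos_bounded by blast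
  obtain B where B: "0 < B" "\<And>t. t \<in> {0..T} \<Longrightarrow> norm (A t) \<le> B" using NPC0_R_bounded[OF T A] by blast
  define L where "L = B * K"
  have L: "0 \<le> L" using B K by (simp add: L_def)
  have bL: "norm (b (A t) \<xi>) \<le> L * norm \<xi>" if "t \<in> {0..T}" for t \<xi>
  proof -
    have "norm (A t) * norm \<xi> * K \<le> B * norm \<xi> * K"
      using B(2)[OF that] K by (intro mult_right_mono) auto
    then show ?thesis using K(2)[of "A t" \<xi>] by (simp add: L_def mult_ac)
  qed
  have reg: "(\<lambda>t. b (A t) (y t)) \<in> NPC0_R T UNIV" if "continuous_on {0..T} y" for y
    by (rule NPC0_R_compose2[OF T A NPC0_R_continuous[OF T that, of UNIV]])
      (auto simp: case_prod_beta intro!: continuous_on continuous_on_fst continuous_on_snd continuous_on_id)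
  \<comment> \<open>The Lipschitz bound is global here, so the tube may be as wide as the defect
    \<open>norm e0\<close> of the zero curve demands.\<close>
  define \<epsilon> where "\<epsilon> = 2 * norm e0 * exp (2 * L * T)"
  obtain y where y: "continuous_on {0..T} y" "\<And>t. t \<in> {0..T} \<Longrightarrow> y t \<in> cball 0 \<epsilon>"
    "\<And>t. t \<in> {0..T} \<Longrightarrow> y t = e0 + integral {0..t} (\<lambda>s. b (A s) (y s))"
  proof (rule picard[of T L "\<lambda>_. 0" \<epsilon> "\<lambda>t. b (A t)" e0 "norm e0"])
    show "norm (b (A t) \<xi> - b (A t) \<eta>) \<le> L * norm (\<xi> - \<eta>)" if "t \<in> {0..T}" for t \<xi> \<eta>
      using bL[OF that, of "\<xi> - \<eta>"] by (simp add: diff_right)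
    show "(\<lambda>t. b (A t) (y t)) integrable_on {0..T}" if "continuous_on {0..T} y" for y
      by (rule NPC0_R_integrable[OF T reg[OF that]])
  qed (use T L that in \<open>auto simp: \<epsilon>_def zero_right\<close>)
  obtain S where S: "finite S" "\<And>t. t \<in> {0<..<T} - S \<Longrightarrow>
      ((\<lambda>t. integral {0..t} (\<lambda>s. b (A s) (y s))) has_vector_derivative b (A t) (y t)) (at t)"
    using NPC0_R_integral(2)[OF T reg[OF y(1)]] by blast
  show thesis
  proof (rule that[OF y(1) _ S(1)])
    show "y 0 = e0" using y(3)[of 0] T by simp
    fix t assume t: "t \<in> {0<..<T} - S"
    have "((\<lambda>t. e0 + integral {0..t} (\<lambda>s. b (A s) (y s))) has_vector_derivative b (A t) (y t)) (at t)"
      using S(2)[OF t] by (auto intro!: derivative_eq_intros)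
    then show "(y has_vector_derivative b (A t) (y t)) (at t)"
      by (rule has_vector_derivative_transform_within_open[of _ _ _ "{0<..<T}"]) (use t y(3) in auto)
  qed
qed

text \<open>The product rule shows at once that \<open>\<Psi> o \<Phi>\<close> is constant, but in
  infinite dimension a left inverse need not be a right inverse. The order needed later is
  \<open>\<Phi> o \<Psi>\<close>; its deviation from the identity solves
  \<open>e' = A e - e A\<close> with zero initial value and vanishes by Gronwall.\<close>

lemma fundamental_solution:
  fixes A :: "real \<Rightarrow> 'e::banach \<Rightarrow>\<^sub>L 'e"
  assumes T: "0 < T" and A: "A \<in> NPC0_R T V"
  obtains \<Phi> \<Psi> :: "real \<Rightarrow> 'e \<Rightarrow>\<^sub>L 'e" and S where "continuous_on {0..T} \<Phi>" "continuous_on {0..T} \<Psi>" "finite S"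
    "\<And>t. t \<in> {0<..<T} - S \<Longrightarrow> (\<Phi> has_vector_derivative A t o\<^sub>L \<Phi> t) (at t)"
    "\<And>t. t \<in> {0<..<T} - S \<Longrightarrow> (\<Psi> has_vector_derivative - (\<Psi> t o\<^sub>L A t)) (at t)"
    "\<And>t. t \<in> {0..T} \<Longrightarrow> \<Phi> t o\<^sub>L \<Psi> t = id_blinfun"
proof -
  obtain \<Phi> :: "real \<Rightarrow> 'e \<Rightarrow>\<^sub>L 'e" and S1 where \<Phi>: "continuous_on {0..T} \<Phi>" "\<Phi> 0 = id_blinfun" "finite S1"
    "\<And>t. t \<in> {0<..<T} - S1 \<Longrightarrow> (\<Phi> has_vector_derivative A t o\<^sub>L \<Phi> t) (at t)"
    using linear_ode[OF T bounded_bilinear_blinfun_compose A] by blast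
  have A': "(\<lambda>t. - A t) \<in> NPC0_R T UNIV"
    by (rule NPC0_R_compose[OF T A]) (auto intro: continuous_intros)
  obtain \<Psi> :: "real \<Rightarrow> 'e \<Rightarrow>\<^sub>L 'e" and S2 where \<Psi>: "continuous_on {0..T} \<Psi>" "\<Psi> 0 = id_blinfun" "finite S2"
    "\<And>t. t \<in> {0<..<T} - S2 \<Longrightarrow> (\<Psi> has_vector_derivative \<Psi> t o\<^sub>L - A t) (at t)"
    using linear_ode[OF T bounded_bilinear.flip[OF bounded_bilinear_blinfun_compose] A'] by blast
  have neg: "X o\<^sub>L - Z = - (X o\<^sub>L Z)" for X :: "'e \<Rightarrow>\<^sub>L 'e" and Z :: "'e \<Rightarrow>\<^sub>L 'e"
    by (rule blinfun_eqI) (simp add: blinfun.bilinear_simps)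
  define S where "S = S1 \<union> S2"
  define e where "e t = (\<Phi> t o\<^sub>L \<Psi> t) - id_blinfun" for t
  obtain B where B: "0 < B" "\<And>t. t \<in> {0..T} \<Longrightarrow> norm (A t) \<le> B" using NPC0_R_bounded[OF T A] by blast
  have zero: "e t = 0" if t: "t \<in> {0..T}" for t
  proof -
    have "norm (e t) \<le> (norm (e 0) + integral {0..T} (\<lambda>_. 0)) * exp (2 * B * T)"
    proof (rule gronwall[of T "2 * B" e S "\<lambda>t. (A t o\<^sub>L e t) - (e t o\<^sub>L A t)" "\<lambda>_. 0"])
      show "continuous_on {0..T} e" unfolding e_def
        by (intro continuous_intros \<Phi> \<Psi> bounded_bilinear.continuous_on[OF bounded_bilinear_blinfun_compose])
      fix s assume s: "s \<in> {0<..<T} - S"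
      have X: "((\<lambda>t. \<Phi> t o\<^sub>L \<Psi> t) has_vector_derivative (\<Phi> s o\<^sub>L (\<Psi> s o\<^sub>L - A s)) + ((A s o\<^sub>L \<Phi> s) o\<^sub>L \<Psi> s)) (at s)"
        using s by (intro bounded_bilinear.has_vector_derivative[OF bounded_bilinear_blinfun_compose] \<Phi> \<Psi>) (auto simp: S_def)
      have "(e has_vector_derivative (\<Phi> s o\<^sub>L (\<Psi> s o\<^sub>L - A s)) + ((A s o\<^sub>L \<Phi> s) o\<^sub>L \<Psi> s)) (at s)"
        unfolding e_def using has_vector_derivative_diff[OF X has_vector_derivative_const[of id_blinfun]] by simp
      moreover have "(\<Phi> s o\<^sub>L (\<Psi> s o\<^sub>L - A s)) + ((A s o\<^sub>L \<Phi> s) o\<^sub>L \<Psi> s) = (A s o\<^sub>L e s) - (e s o\<^sub>L A s)"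
        by (rule blinfun_eqI) (simp add: e_def blinfun.bilinear_simps)
      ultimately show "(e has_vector_derivative (A s o\<^sub>L e s) - (e s o\<^sub>L A s)) (at s)" by simp
      have "norm (A s o\<^sub>L e s) \<le> B * norm (e s)"
        using norm_blinfun_compose[of "A s" "e s"] mult_right_mono[OF B(2)[of s] norm_ge_zero[of "e s"]] s by auto
      moreover have "norm (e s o\<^sub>L A s) \<le> norm (e s) * B"
        using norm_blinfun_compose[of "e s" "A s"] mult_left_mono[OF B(2)[of s] norm_ge_zero[of "e s"]] s by auto
      ultimately show "norm ((A s o\<^sub>L e s) - (e s o\<^sub>L A s)) \<le> 2 * B * norm (e s) + 0"
        using norm_triangle_ineq4[of "A s o\<^sub>L e s" "e s o\<^sub>L A s"] by (simp add: mult_ac)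
    qed (use T B t \<Phi> \<Psi> in \<open>auto simp: S_def\<close>)
    moreover have "e 0 = 0" by (rule blinfun_eqI) (simp add: e_def \<Phi> \<Psi> blinfun.bilinear_simps)
    ultimately show ?thesis by simp
  qed
  show thesis
    by (rule that[of \<Phi> \<Psi> S]) (use \<Phi> \<Psi> zero in \<open>auto simp: S_def e_def neg\<close>)
qed

section \<open>Needle variations\<close>

lemma has_integral_indicator_Ico:
  fixes c d :: real
  assumes "0 \<le> c" "c \<le> d" "d \<le> T"
  shows "((indicator {c..<d} :: real \<Rightarrow> real) has_integral (d - c)) {0..T}"
proof -
  have "((\<lambda>_. 1::real) has_integral (d - c)) {c..d}" using has_integral_const_real[of "1::real" c d] assms by simp
  then have "((\<lambda>t. if t \<in> {c..d} then 1 else 0 :: real) has_integral (d - c)) {0..T}"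
    using has_integral_restrict[of "{c..d}" "{0..T}" "\<lambda>_. 1::real"] assms by (auto simp: subset_iff)
  then show ?thesis
    by (rule has_integral_spike_finite[of "{d}", rotated 2]) (auto simp: indicator_def)
qed

text \<open>Differentiability is given separately at each time, without uniformity. Uniformity after
  integration holds nevertheless: curves violating it at scales tending to zero would give quotients
  that tend to zero pointwise and are bounded by the Lipschitz constant, against dominated
  convergence.\<close>

lemma integral_remainder_small:
  fixes q :: "real \<Rightarrow> 'e::real_normed_vector \<Rightarrow> real"
  assumes T: "0 \<le> T" and \<epsilon>: "0 < \<epsilon>"
    and small: "\<And>t \<eta>. t \<in> {0..T} \<Longrightarrow> 0 < \<eta> \<Longrightarrow> \<exists>\<delta>>0. \<forall>d. norm d < \<delta> \<longrightarrow> q t d \<le> \<eta> * norm d"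
    and bound: "\<And>t d. t \<in> {0..T} \<Longrightarrow> norm d \<le> \<epsilon> \<Longrightarrow> q t d \<le> K * norm d"
    and pos: "\<And>t d. 0 \<le> q t d" and \<eta>: "0 < \<eta>"
  shows "\<exists>\<delta>>0. \<forall>\<sigma> d. 0 < \<sigma> \<longrightarrow> \<sigma> \<le> \<delta> \<longrightarrow> (\<forall>t\<in>{0..T}. norm (d t) \<le> \<sigma>) \<longrightarrow>
    (\<lambda>t. q t (d t)) integrable_on {0..T} \<longrightarrow> integral {0..T} (\<lambda>t. q t (d t)) \<le> \<eta> * \<sigma>"
proof (rule ccontr)
  assume neg: "\<not> ?thesis"
  have "\<exists>\<sigma> d. 0 < \<sigma> \<and> \<sigma> \<le> min \<epsilon> (1 / Suc n) \<and> (\<forall>t\<in>{0..T}. norm (d t) \<le> \<sigma>) \<and>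
    (\<lambda>t. q t (d t)) integrable_on {0..T} \<and> \<eta> * \<sigma> < integral {0..T} (\<lambda>t. q t (d t))" for n
  proof -
    have "0 < min \<epsilon> (1 / Suc n)" using \<epsilon> by simp
    then show ?thesis using neg by (meson not_le)
  qed
  then obtain \<sigma> d where \<sigma>: "\<And>n::nat. 0 < \<sigma> n" "\<And>n. \<sigma> n \<le> min \<epsilon> (1 / Suc n)"
    and d: "\<And>n t. t \<in> {0..T} \<Longrightarrow> norm (d n t) \<le> \<sigma> n"
    and int: "\<And>n. (\<lambda>t. q t (d n t)) integrable_on {0..T}"
    and big: "\<And>n. \<eta> * \<sigma> n < integral {0..T} (\<lambda>t. q t (d n t))"
    by metis
  \<comment> \<open>Dividing by the size of the offending curve makes the violation read
    \<open>\<eta>\<close> below every integral.\<close>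
  define f where "f n t = q t (d n t) / \<sigma> n" for n t
  have fint: "f n integrable_on {0..T}" for n
    unfolding f_def using integrable_on_divide[OF int] by blast
  have K: "\<bar>f n t\<bar> \<le> \<bar>K\<bar>" if t: "t \<in> {0..T}" for n t
  proof -
    have "q t (d n t) \<le> K * norm (d n t)" using d[OF t, of n] \<sigma>(2)[of n] by (intro bound t) auto
    also have "\<dots> \<le> \<bar>K\<bar> * \<sigma> n" using d[OF t, of n] by (intro mult_mono) auto
    finally show ?thesis using \<sigma>(1)[of n] pos[of t "d n t"] by (simp add: f_def field_simps)
  qed
  have "(\<lambda>n. integral {0..T} (f n)) \<longlonglongrightarrow> integral {0..T} (\<lambda>_. 0)"
  proof (rule dominated_convergence(2)[OF fint, of "\<lambda>_. \<bar>K\<bar>"])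
    show "norm (f n t) \<le> \<bar>K\<bar>" if "t \<in> {0..T}" for n t using K[OF that] by simp
    fix t assume t: "t \<in> {0..T}"
    show "(\<lambda>n. f n t) \<longlonglongrightarrow> 0"
    proof (rule LIMSEQ_I)
      fix r :: real assume r: "0 < r"
      then obtain \<delta> where \<delta>: "\<delta> > 0" "\<And>d. norm d < \<delta> \<Longrightarrow> q t d \<le> r / 2 * norm d"
        using small[OF t, of "r / 2"] by auto
      obtain N where N: "1 / Suc N < \<delta>" using \<delta>(1) by (meson nat_approx_posE)
      show "\<exists>no. \<forall>n\<ge>no. norm (f n t - 0) < r"
      proof (intro exI[of _ N] allI impI)
        fix n assume n: "N \<le> n"
        have "1 / Suc n \<le> 1 / Suc N" using n by (simp add: frac_le)
        then have "norm (d n t) < \<delta>" using d[OF t, of n] \<sigma>(2)[of n] N by auto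
        then have "q t (d n t) \<le> r / 2 * norm (d n t)" by (rule \<delta>)
        also have "\<dots> \<le> r / 2 * \<sigma> n" using d[OF t, of n] r by (intro mult_left_mono) auto
        also have "\<dots> < r * \<sigma> n" using r \<sigma>(1)[of n] by simp
        finally show "norm (f n t - 0) < r" using \<sigma>(1)[of n] pos[of t "d n t"] by (simp add: f_def field_simps)
      qed
    qed
  qed auto
  moreover have "\<eta> \<le> integral {0..T} (f n)" for n
  proof -
    have "integral {0..T} (f n) = integral {0..T} (\<lambda>t. q t (d n t)) / \<sigma> n"
      unfolding f_def by simp
    then have "\<eta> < integral {0..T} (f n)" using big[of n] \<sigma>(1)[of n] by (simp add: pos_less_divide_eq)
    then show ?thesis by simp
  qed
  ultimately have "\<eta> \<le> 0" by (intro LIMSEQ_le_const[of "\<lambda>n. integral {0..T} (f n)"]) auto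
  then show False using \<eta> by simp
qed

text \<open>
  Needles with the same nominal time \<open>ts k\<close> are stacked side by side, in the order of their
  indices, so that they remain disjoint however small their widths \<open>a k\<close> are.
\<close>

definition needle_start :: "(nat \<Rightarrow> real) \<Rightarrow> (nat \<Rightarrow> real) \<Rightarrow> nat \<Rightarrow> real" where
  "needle_start ts a k = ts k + sum a {..<k}"

definition needle_interval :: "(nat \<Rightarrow> real) \<Rightarrow> (nat \<Rightarrow> real) \<Rightarrow> nat \<Rightarrow> real set" where
  "needle_interval ts a k = {needle_start ts a k..<needle_start ts a k + a k}"

primrec needle_control :: "(real \<Rightarrow> 'y) \<Rightarrow> (nat \<Rightarrow> real) \<Rightarrow> (nat \<Rightarrow> 'y) \<Rightarrow> (nat \<Rightarrow> real) \<Rightarrow> nat \<Rightarrow> real \<Rightarrow> 'y" where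
  "needle_control u ts vs a 0 = u"
| "needle_control u ts vs a (Suc k) =
    (\<lambda>t. if t \<in> needle_interval ts a k then vs k else needle_control u ts vs a k t)"

text \<open>Because the needles are stacked from left to right, a time in one of them lies beyond
  the end of all earlier ones; at most one indicator is nonzero. In this form the perturbed dynamics
  can be integrated and compared term by term.\<close>

lemma needle_control_eq:
  fixes G :: "'y \<Rightarrow> 'e::real_vector"
  assumes "\<And>j k. j \<le> k \<Longrightarrow> k < N \<Longrightarrow> ts j \<le> ts k" "\<And>k. k < N \<Longrightarrow> 0 \<le> a k"
  shows "G (needle_control u ts vs a N t) = G (u t) +
    (\<Sum>k<N. indicator (needle_interval ts a k) t *\<^sub>R (G (vs k) - G (u t)))"
  using assms
proof (induction N)
  case (Suc N)
  have IH: "G (needle_control u ts vs a N t) = G (u t) +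
    (\<Sum>k<N. indicator (needle_interval ts a k) t *\<^sub>R (G (vs k) - G (u t)))"
    using Suc.prems by (intro Suc.IH) auto
  show ?case
  proof (cases "t \<in> needle_interval ts a N")
    case True
    have "t \<notin> needle_interval ts a k" if k: "k < N" for k
    proof
      assume "t \<in> needle_interval ts a k"
      then have "t < ts k + sum a {..<Suc k}" by (simp add: needle_interval_def needle_start_def add_ac)
      also have "\<dots> \<le> ts N + sum a {..<N}"
        using k Suc.prems by (intro add_mono sum_mono2) auto
      finally show False using True by (simp add: needle_interval_def needle_start_def)
    qed
    then have "(\<Sum>k<N. indicator (needle_interval ts a k) t *\<^sub>R (G (vs k) - G (u t))) = 0"
      by (intro sum.neutral) auto
    then show ?thesis using True by simp
  next
    case False
    then show ?thesis using IH by simp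
  qed
qed simp

text \<open>The setting of needle variations: a state derivative is available only along the
  reference pair; elsewhere only a Lipschitz bound in a tube, uniform over each compact set of
  control values.\<close>

locale control_trajectory =
  fixes T :: real and \<Omega> :: "'e::banach set" and U :: "'y::t2_space set"
    and F :: "real \<Rightarrow> 'e \<Rightarrow> 'y \<Rightarrow> 'e" and xs :: "real \<Rightarrow> 'e" and us :: "real \<Rightarrow> 'y"
    and A :: "real \<Rightarrow> 'e \<Rightarrow>\<^sub>L 'e"
  assumes T: "0 < T" and us: "us \<in> NPC0_R T U" and xs: "continuous_on {0..T} xs"
    and traj: "\<exists>S. finite S \<and> (\<forall>t\<in>{0<..<T} - S. (xs has_vector_derivative F t (xs t) (us t)) (at t))"
    and contF: "continuous_on ({0..T} \<times> \<Omega> \<times> U) (\<lambda>(t, \<xi>, \<zeta>). F t \<xi> \<zeta>)"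
    and A: "A \<in> NPC0_R T UNIV"
    and dA: "\<And>t. t \<in> {0..T} \<Longrightarrow> ((\<lambda>\<xi>. F t \<xi> (us t)) has_derivative blinfun_apply (A t)) (at (xs t))"
    and lipschitz: "\<And>M. compact M \<Longrightarrow> M \<subseteq> U \<Longrightarrow> \<exists>\<epsilon>>0. \<exists>L\<ge>0. \<forall>t\<in>{0..T}. cball (xs t) \<epsilon> \<subseteq> \<Omega> \<and>
      (\<forall>\<zeta>\<in>M. \<forall>\<xi>\<in>cball (xs t) \<epsilon>. \<forall>\<eta>\<in>cball (xs t) \<epsilon>. norm (F t \<xi> \<zeta> - F t \<eta> \<zeta>) \<le> L * norm (\<xi> - \<eta>))"
begin

lemma F_NPC0_R:
  assumes "continuous_on {0..T} y" "\<And>t. t \<in> {0..T} \<Longrightarrow> y t \<in> \<Omega>" "w \<in> NPC0_R T U"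
  shows "(\<lambda>t. F t (y t) (w t)) \<in> NPC0_R T UNIV"
proof -
  have "(\<lambda>t. (t, y t, w t)) \<in> NPC0_R T ({0..T} \<times> \<Omega> \<times> U)"
    using assms(1,2) T
    by (intro NPC0_R_Pair[OF T _ NPC0_R_Pair[OF T _ assms(3)]] NPC0_R_continuous) (auto intro: continuous_intros)
  from NPC0_R_compose[OF T this contF, of UNIV] show ?thesis by simp
qed

end

text \<open>\<open>M\<close> contains the values of the reference control and of the needles, so one
  tube and one pair of constants serve them all. \<open>r0\<close> bounds the total width, whence
  every stacked needle ends before \<open>T\<close>.\<close>

locale needle_variation = control_trajectory T \<Omega> U F xs us A
  for T :: real and \<Omega> :: "'e::banach set" and U :: "'y::t2_space set"
    and F :: "real \<Rightarrow> 'e \<Rightarrow> 'y \<Rightarrow> 'e" and xs :: "real \<Rightarrow> 'e" and us :: "real \<Rightarrow> 'y"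
    and A :: "real \<Rightarrow> 'e \<Rightarrow>\<^sub>L 'e" +
  fixes N :: nat and ts :: "nat \<Rightarrow> real" and vs :: "nat \<Rightarrow> 'y" and M :: "'y set"
    and \<epsilon> L C r0 :: real
  assumes ts: "\<And>k. k < N \<Longrightarrow> 0 \<le> ts k" "\<And>k. k < N \<Longrightarrow> ts k + r0 < T"
    and ts_mono: "\<And>j k. j \<le> k \<Longrightarrow> k < N \<Longrightarrow> ts j \<le> ts k"
    and vs: "\<And>k. k < N \<Longrightarrow> vs k \<in> M"
    and M: "M \<subseteq> U" "\<And>t. t \<in> {0..T} \<Longrightarrow> us t \<in> M"
    and \<epsilon>: "0 < \<epsilon>" and L: "0 \<le> L" and C: "0 < C" and r0: "0 < r0"
    and tube: "\<And>t. t \<in> {0..T} \<Longrightarrow> cball (xs t) \<epsilon> \<subseteq> \<Omega>"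
    and lip: "\<And>t \<zeta> \<xi> \<eta>. t \<in> {0..T} \<Longrightarrow> \<zeta> \<in> M \<Longrightarrow> \<xi> \<in> cball (xs t) \<epsilon> \<Longrightarrow> \<eta> \<in> cball (xs t) \<epsilon> \<Longrightarrow>
      norm (F t \<xi> \<zeta> - F t \<eta> \<zeta>) \<le> L * norm (\<xi> - \<eta>)"
    and bound: "\<And>t \<zeta> \<xi>. t \<in> {0..T} \<Longrightarrow> \<zeta> \<in> M \<Longrightarrow> \<xi> \<in> cball (xs t) \<epsilon> \<Longrightarrow> norm (F t \<xi> \<zeta>) \<le> C"
begin

definition widths :: "real \<Rightarrow> (nat \<Rightarrow> real) set" where
  "widths r = {a. (\<forall>k<N. 0 \<le> a k) \<and> sum a {..<N} \<le> r}"

abbreviation ctrl :: "(nat \<Rightarrow> real) \<Rightarrow> real \<Rightarrow> 'y" where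
  "ctrl a \<equiv> needle_control us ts vs a N"

definition response :: "(nat \<Rightarrow> real) \<Rightarrow> (real \<Rightarrow> 'e) \<Rightarrow> bool" where
  "response a y \<longleftrightarrow> continuous_on {0..T} y \<and> y 0 = xs 0 \<and> (\<forall>t\<in>{0..T}. y t \<in> cball (xs t) \<epsilon>) \<and>
    (\<exists>S. finite S \<and> (\<forall>t\<in>{0<..<T} - S. (y has_vector_derivative F t (y t) (ctrl a t)) (at t)))"

lemma widths_nonneg: "a \<in> widths r \<Longrightarrow> k < N \<Longrightarrow> 0 \<le> a k"
  by (simp add: widths_def)

lemma needle_bounds:
  assumes a: "a \<in> widths r0" and k: "k < N"
  shows "ts k \<le> needle_start ts a k" "0 \<le> needle_start ts a k"
    "needle_start ts a k + a k \<le> ts k + sum a {..<N}" "needle_start ts a k + a k < T"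
proof -
  have s: "0 \<le> sum a {..<k}" using a k by (intro sum_nonneg) (auto simp: widths_def)
  have "sum a {..<Suc k} \<le> sum a {..<N}" using a k by (intro sum_mono2) (auto simp: widths_def)
  then show "needle_start ts a k + a k \<le> ts k + sum a {..<N}" by (simp add: needle_start_def)
  then show "needle_start ts a k + a k < T" using a ts(2)[OF k] by (simp add: widths_def)
  show "ts k \<le> needle_start ts a k" "0 \<le> needle_start ts a k" using s ts(1)[OF k] by (auto simp: needle_start_def)
qed

lemma ctrl_mem: "t \<in> {0..T} \<Longrightarrow> ctrl a t \<in> M"
proof -
  assume t: "t \<in> {0..T}"
  have "n \<le> N \<Longrightarrow> needle_control us ts vs a n t \<in> M" for n
    by (induction n) (use M(2)[OF t] vs in auto)
  then show ?thesis by simp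
qed

lemma ctrl_NPC0_R:
  assumes a: "a \<in> widths r0"
  shows "ctrl a \<in> NPC0_R T U"
proof -
  have "n \<le> N \<Longrightarrow> needle_control us ts vs a n \<in> NPC0_R T U" for n
  proof (induction n)
    case (Suc n)
    have "vs n \<in> U" using vs[of n] M(1) Suc.prems by auto
    then have "(\<lambda>t. if t \<in> {needle_start ts a n..<needle_start ts a n + a n} then vs n else needle_control us ts vs a n t) \<in> NPC0_R T U"
      using needle_bounds(4)[OF a, of n] Suc by (intro NPC0_R_needle T) auto
    then show ?case by (simp add: needle_interval_def)
  qed (use us in simp)
  then show ?thesis by simp
qed

lemma F_ctrl:
  assumes "a \<in> widths r0"
  shows "F t \<xi> (ctrl a t) = F t \<xi> (us t) +
    (\<Sum>k<N. indicator (needle_interval ts a k) t *\<^sub>R (F t \<xi> (vs k) - F t \<xi> (us t)))"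
  by (rule needle_control_eq[of N ts a "F t \<xi>"]) (use ts_mono assms in \<open>auto simp: widths_def\<close>)

lemma needle_interval_integral:
  assumes "a \<in> widths r0" "k < N"
  shows "((indicator (needle_interval ts a k) :: real \<Rightarrow> real) has_integral a k) {0..T}"
  using has_integral_indicator_Ico[of "needle_start ts a k" "needle_start ts a k + a k" T]
    needle_bounds[OF assms] widths_nonneg[OF assms] by (simp add: needle_interval_def)

lemma xs_integral:
  assumes "t \<in> {0..T}"
  shows "((\<lambda>s. F s (xs s) (us s)) has_integral (xs t - xs 0)) {0..t}"
  using traj has_integral_FTC_finite[of t T xs] xs assms by auto

text \<open>The reference trajectory solves the perturbed equation up to a defect of at most
  \<open>2 * C\<close> times the total width, since the dynamics change only on the needles;
  \<open>picard\<close> corrects it inside the tube.\<close>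

lemma response_exists:
  obtains r where "0 < r" "r \<le> r0" "\<And>a. a \<in> widths r \<Longrightarrow> \<exists>y. response a y"
proof -
  \<comment> \<open>Solves the smallness condition of \<open>picard\<close> for the width, with
    defect \<open>2 * C * r\<close>.\<close>
  define r where "r = min r0 (\<epsilon> / (4 * C * exp (2 * L * T)))"
  have r: "0 < r" "r \<le> r0" using r0 C \<epsilon> by (simp_all add: r_def)
  have rr: "2 * (2 * C * r) * exp (2 * L * T) \<le> \<epsilon>"
  proof -
    have "r \<le> \<epsilon> / (4 * C * exp (2 * L * T))" by (simp add: r_def)
    then show ?thesis using C by (simp add: field_simps)
  qed
  have "\<exists>y. response a y" if a: "a \<in> widths r" for a
  proof -
    have a0: "a \<in> widths r0" using a r(2) by (simp add: widths_def)
    have reg: "(\<lambda>t. F t (y t) (ctrl a t)) \<in> NPC0_R T UNIV"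
      if "continuous_on {0..T} y" "\<And>t. t \<in> {0..T} \<Longrightarrow> y t \<in> cball (xs t) \<epsilon>" for y
      by (rule F_NPC0_R[OF that(1) subsetD[OF tube that(2)] ctrl_NPC0_R[OF a0]]) auto
    obtain y where y: "continuous_on {0..T} y" "\<And>t. t \<in> {0..T} \<Longrightarrow> y t \<in> cball (xs t) \<epsilon>"
      "\<And>t. t \<in> {0..T} \<Longrightarrow> y t = xs 0 + integral {0..t} (\<lambda>s. F s (y s) (ctrl a s))"
    proof (rule picard[of T L xs \<epsilon> "\<lambda>t \<xi>. F t \<xi> (ctrl a t)" "xs 0" "2 * C * r"])
      show "norm (F t \<xi> (ctrl a t) - F t \<eta> (ctrl a t)) \<le> L * norm (\<xi> - \<eta>)"
        if "t \<in> {0..T}" "\<xi> \<in> cball (xs t) \<epsilon>" "\<eta> \<in> cball (xs t) \<epsilon>" for t \<xi> \<eta>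
        using lip[OF that(1) ctrl_mem[OF that(1)] that(2,3)] .
      show "(\<lambda>t. F t (y t) (ctrl a t)) integrable_on {0..T}"
        if "continuous_on {0..T} y" "\<And>t. t \<in> {0..T} \<Longrightarrow> y t \<in> cball (xs t) \<epsilon>" for y
        by (rule NPC0_R_integrable[OF T reg[OF that]])
      fix t assume t: "t \<in> {0..T}"
      have i1: "(\<lambda>s. F s (xs s) (ctrl a s)) integrable_on {0..t}"
        using NPC0_R_integrable[OF T reg[OF xs]] \<epsilon> t by (auto intro: integrable_subinterval_real)
      have i2: "(\<lambda>s. F s (xs s) (us s)) integrable_on {0..t}" using xs_integral[OF t] by blast
      define g where "g s = (\<Sum>k<N. 2 * C * indicator (needle_interval ts a k) s)" for s
      have g: "(g has_integral (\<Sum>k<N. 2 * C * a k)) {0..T}"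
        unfolding g_def using needle_interval_integral[OF a0] by (intro has_integral_sum has_integral_mult_right) auto
      have gt: "g integrable_on {0..t}" using g t by (auto intro: integrable_subinterval_real has_integral_integrable)
      have "norm (integral {0..t} (\<lambda>s. F s (xs s) (ctrl a s) - F s (xs s) (us s))) \<le> integral {0..t} g"
      proof (rule integral_norm_bound_integral[OF integrable_diff[OF i1 i2] gt])
        fix s assume "s \<in> {0..t}"
        then have s: "s \<in> {0..T}" using t by auto
        have xc: "xs s \<in> cball (xs s) \<epsilon>" using \<epsilon> by simp
        have "norm (F s (xs s) (ctrl a s) - F s (xs s) (us s)) \<le>
          (\<Sum>k<N. norm (indicator (needle_interval ts a k) s *\<^sub>R (F s (xs s) (vs k) - F s (xs s) (us s))))"
          unfolding F_ctrl[OF a0, of s] using norm_sum by simp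
        also have "\<dots> \<le> g s"
          unfolding g_def
        proof (rule sum_mono)
          fix k assume "k \<in> {..<N}"
          then have "norm (F s (xs s) (vs k) - F s (xs s) (us s)) \<le> 2 * C"
            using bound[OF s vs xc, of k] bound[OF s M(2)[OF s] xc] norm_triangle_ineq4[of "F s (xs s) (vs k)" "F s (xs s) (us s)"] by auto
          then show "norm (indicator (needle_interval ts a k) s *\<^sub>R (F s (xs s) (vs k) - F s (xs s) (us s))) \<le>
            2 * C * indicator (needle_interval ts a k) s"
            by (simp add: indicator_def)
        qed
        finally show "norm (F s (xs s) (ctrl a s) - F s (xs s) (us s)) \<le> g s" .
      qed
      also have "\<dots> \<le> integral {0..T} g"
        using t gt g C by (intro integral_subset_le) (auto simp: g_def intro!: sum_nonneg)
      also have "\<dots> = 2 * C * sum a {..<N}" using integral_unique[OF g] by (simp add: sum_distrib_left)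
      also have "\<dots> \<le> 2 * C * r" using a C by (simp add: widths_def)
      finally show "norm (xs 0 + integral {0..t} (\<lambda>s. F s (xs s) (ctrl a s)) - xs t) \<le> 2 * C * r"
        using integral_diff[OF i1 i2] integral_unique[OF xs_integral[OF t]] by (simp add: algebra_simps)
    qed (use T L xs rr in auto)
    obtain S where S: "finite S" "\<And>t. t \<in> {0<..<T} - S \<Longrightarrow>
        ((\<lambda>t. integral {0..t} (\<lambda>s. F s (y s) (ctrl a s))) has_vector_derivative F t (y t) (ctrl a t)) (at t)"
      using NPC0_R_integral(2)[OF T reg[OF y(1,2)]] by blast
    have "(y has_vector_derivative F t (y t) (ctrl a t)) (at t)" if t: "t \<in> {0<..<T} - S" for t
    proof -
      have "((\<lambda>t. xs 0 + integral {0..t} (\<lambda>s. F s (y s) (ctrl a s))) has_vector_derivative F t (y t) (ctrl a t)) (at t)"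
        using S(2)[OF t] by (auto intro!: derivative_eq_intros)
      then show ?thesis
        by (rule has_vector_derivative_transform_within_open[of _ _ _ "{0<..<T}"]) (use t y(3) in auto)
    qed
    moreover have "y 0 = xs 0" using y(3)[of 0] T by simp
    ultimately have "response a y" unfolding response_def using y S(1) by blast
    then show ?thesis by blast
  qed
  then show thesis using that r by blast
qed

lemma response_PC1:
  assumes a: "a \<in> widths r0" and y: "response a y"
  shows "y \<in> PC1 T \<Omega>" "t \<in> {0..T} \<Longrightarrow> ext_deriv T y t = F t (y t) (ctrl a t)"
proof -
  have y': "continuous_on {0..T} y" using y by (simp add: response_def)
  have y\<Omega>: "y t \<in> \<Omega>" if "t \<in> {0..T}" for t
    using y subsetD[OF tube[OF that], of "y t"] that by (simp add: response_def)
  obtain S where S: "finite S" "\<And>t. t \<in> {0<..<T} - S \<Longrightarrow> (y has_vector_derivative F t (y t) (ctrl a t)) (at t)"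
    using y unfolding response_def by blast
  note P = PC1_I[OF T y' y\<Omega> F_NPC0_R[OF y' y\<Omega> ctrl_NPC0_R[OF a]] S]
  show "y \<in> PC1 T \<Omega>" "t \<in> {0..T} \<Longrightarrow> ext_deriv T y t = F t (y t) (ctrl a t)" using P by auto
qed

lemma indicator_Ico_diff:
  "\<bar>indicator {c..<d} t - indicator {c'..<d'} t\<bar> \<le>
    (indicator {min c c'..<max c c'} t + indicator {min d d'..<max d d'} t :: real)"
  if "c \<le> d" "c' \<le> d'" for c d c' d' t :: real
  using that by (auto simp: indicator_def)

text \<open>Changing one width shifts every later needle. Still each end point moves by at most the
  total change of the widths, so the two controls differ only on the \<open>2 * N\<close> gaps
  between old and new end points, where the dynamics differ by at most \<open>2 * C\<close>.
  Gronwall turns this into the stated constant.\<close>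

lemma response_lipschitz:
  assumes a: "a \<in> widths r0" "response a y" and b: "b \<in> widths r0" "response b z" and t: "t \<in> {0..T}"
  shows "norm (y t - z t) \<le> 4 * C * real N * exp (L * T) * (\<Sum>k<N. \<bar>a k - b k\<bar>)"
proof -
  define I where "I a k = (indicator (needle_interval ts a k) :: real \<Rightarrow> real)" for a k
  define \<sigma> where "\<sigma> = (\<Sum>k<N. \<bar>a k - b k\<bar>)"
  define p where "p a k = needle_start ts a k" for a k
  define q where "q a k = needle_start ts a k + a k" for a k
  define J where "J k t = (indicator {min (p a k) (p b k)..<max (p a k) (p b k)} t +
      indicator {min (q a k) (q b k)..<max (q a k) (q b k)} t :: real)" for k t
  have J: "\<bar>I a k s - I b k s\<bar> \<le> J k s" if "k < N" for k s
    unfolding I_def J_def needle_interval_def p_def q_def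
    using widths_nonneg[OF a(1) that] widths_nonneg[OF b(1) that] by (intro indicator_Ico_diff) auto
  have Jint: "(J k has_integral (\<bar>p a k - p b k\<bar> + \<bar>q a k - q b k\<bar>)) {0..T}" if k: "k < N" for k
  proof -
    have "(indicator {min c c'..<max c c'} has_integral \<bar>c - c'\<bar>) {0..T}"
      if "c \<in> {0..T}" "c' \<in> {0..T}" for c c' :: real
      using has_integral_indicator_Ico[of "min c c'" "max c c'" T] that
      by (auto simp: min_def max_def abs_if split: if_splits)
    from this[of "p a k" "p b k"] this[of "q a k" "q b k"] show ?thesis
      unfolding J_def using needle_bounds[OF a(1) k] needle_bounds[OF b(1) k]
        widths_nonneg[OF a(1) k] widths_nonneg[OF b(1) k] by (intro has_integral_add) (auto simp: p_def q_def)
  qed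
  have pq: "\<bar>p a k - p b k\<bar> \<le> \<sigma>" "\<bar>q a k - q b k\<bar> \<le> \<sigma>" if k: "k < N" for k
  proof -
    have *: "\<bar>sum a {..<j} - sum b {..<j}\<bar> \<le> \<sigma>" if "j \<le> N" for j
    proof -
      have "\<bar>sum a {..<j} - sum b {..<j}\<bar> \<le> (\<Sum>k<j. \<bar>a k - b k\<bar>)"
        unfolding sum_subtractf[symmetric] by (rule sum_abs)
      also have "\<dots> \<le> \<sigma>" unfolding \<sigma>_def using that by (intro sum_mono2) auto
      finally show ?thesis .
    qed
    show "\<bar>p a k - p b k\<bar> \<le> \<sigma>" "\<bar>q a k - q b k\<bar> \<le> \<sigma>"
      using *[of k] *[of "Suc k"] k by (auto simp: p_def q_def needle_start_def)
  qed
  define R where "R s = (\<Sum>k<N. 2 * C * J k s)" for s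
  have R: "(R has_integral (\<Sum>k<N. 2 * C * (\<bar>p a k - p b k\<bar> + \<bar>q a k - q b k\<bar>))) {0..T}"
    unfolding R_def using Jint by (intro has_integral_sum has_integral_mult_right) auto
  have "(\<Sum>k<N. 2 * C * (\<bar>p a k - p b k\<bar> + \<bar>q a k - q b k\<bar>)) \<le> (\<Sum>k<N. 2 * C * (\<sigma> + \<sigma>))"
    using pq C by (intro sum_mono mult_left_mono add_mono) auto
  then have Rb: "integral {0..T} R \<le> 4 * C * real N * \<sigma>" using integral_unique[OF R] by (simp add: algebra_simps)
  have R0: "0 \<le> R s" for s unfolding R_def J_def using C by (intro sum_nonneg) auto
  obtain S where S: "finite S" "\<And>t. t \<in> {0<..<T} - S \<Longrightarrow> (y has_vector_derivative F t (y t) (ctrl a t)) (at t)"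
    using a(2) unfolding response_def by blast
  obtain S' where S': "finite S'" "\<And>t. t \<in> {0<..<T} - S' \<Longrightarrow> (z has_vector_derivative F t (z t) (ctrl b t)) (at t)"
    using b(2) unfolding response_def by blast
  have "norm (y t - z t) \<le> (norm (y 0 - z 0) + integral {0..T} R) * exp (L * T)"
  proof (rule gronwall[of T L "\<lambda>t. y t - z t" "S \<union> S'" "\<lambda>t. F t (y t) (ctrl a t) - F t (z t) (ctrl b t)" R])
    show "continuous_on {0..T} (\<lambda>t. y t - z t)"
      using a(2) b(2) by (intro continuous_intros) (auto simp: response_def)
    fix s assume s: "s \<in> {0<..<T} - (S \<union> S')"
    then show "((\<lambda>t. y t - z t) has_vector_derivative F s (y s) (ctrl a s) - F s (z s) (ctrl b s)) (at s)"
      by (intro has_vector_derivative_diff S S') auto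
    have s': "s \<in> {0..T}" using s by auto
    have yz: "y s \<in> cball (xs s) \<epsilon>" "z s \<in> cball (xs s) \<epsilon>" using a(2) b(2) s' by (auto simp: response_def)
    define D where "D k = F s (z s) (vs k) - F s (z s) (us s)" for k
    have D: "norm (D k) \<le> 2 * C" if "k < N" for k
      using bound[OF s' vs yz(2), of k] bound[OF s' M(2)[OF s'] yz(2)] that
        norm_triangle_ineq4[of "F s (z s) (vs k)" "F s (z s) (us s)"] by (auto simp: D_def)
    have "F s (z s) (ctrl a s) - F s (z s) (ctrl b s) = (\<Sum>k<N. (I a k s - I b k s) *\<^sub>R D k)"
      unfolding F_ctrl[OF a(1), of s] F_ctrl[OF b(1), of s]
      by (simp add: I_def D_def sum_subtractf scaleR_left_diff_distrib)
    also have "norm \<dots> \<le> R s"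
      unfolding R_def
    proof (rule sum_norm_le)
      fix k assume "k \<in> {..<N}"
      then have k: "k < N" by simp
      have "\<bar>I a k s - I b k s\<bar> * norm (D k) \<le> J k s * (2 * C)"
        using J[OF k, of s] D[OF k] C by (intro mult_mono) (auto simp: J_def)
      then show "norm ((I a k s - I b k s) *\<^sub>R D k) \<le> 2 * C * J k s" by (simp add: mult_ac)
    qed
    finally have 1: "norm (F s (z s) (ctrl a s) - F s (z s) (ctrl b s)) \<le> R s" .
    have 2: "norm (F s (y s) (ctrl a s) - F s (z s) (ctrl a s)) \<le> L * norm (y s - z s)"
      by (rule lip[OF s' ctrl_mem[OF s'] yz])
    show "norm (F s (y s) (ctrl a s) - F s (z s) (ctrl b s)) \<le> L * norm (y s - z s) + R s"
      using norm_triangle_ineq[of "F s (y s) (ctrl a s) - F s (z s) (ctrl a s)" "F s (z s) (ctrl a s) - F s (z s) (ctrl b s)"] 1 2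
      by simp
  qed (use T L S(1) S'(1) R R0 t in auto)
  also have "\<dots> = integral {0..T} R * exp (L * T)" using a(2) b(2) by (simp add: response_def)
  also have "\<dots> \<le> 4 * C * real N * \<sigma> * exp (L * T)" using Rb by (intro mult_right_mono) auto
  finally show ?thesis by (simp add: \<sigma>_def mult_ac)
qed

lemma response_zero: "response (\<lambda>_. 0) xs"
proof -
  have "ctrl (\<lambda>_. 0) t = us t" for t
  proof -
    have "n \<le> N \<Longrightarrow> needle_control us ts vs (\<lambda>_. 0) n t = us t" for n
      by (induction n) (auto simp: needle_interval_def)
    then show ?thesis by simp
  qed
  then show ?thesis using traj xs \<epsilon> by (simp add: response_def)
qed

end

text \<open>The premise speaks of all smaller radii as well, so that the least of finitely many
  radii still works.\<close>

lemma finite_common_radius: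
  fixes P :: "nat \<Rightarrow> real \<Rightarrow> bool"
  assumes "\<And>k. k < N \<Longrightarrow> \<exists>d>0. \<forall>d'. 0 < d' \<longrightarrow> d' \<le> d \<longrightarrow> P k d'"
  shows "\<exists>d>0. \<forall>k<N. P k d"
proof -
  have "\<exists>d>0. \<forall>k<n. \<forall>d'. 0 < d' \<longrightarrow> d' \<le> d \<longrightarrow> P k d'" if "n \<le> N" for n
    using that
  proof (induction n)
    case 0
    show ?case by (intro exI[of _ 1]) simp
  next
    case (Suc n)
    obtain d where d: "d > 0" "\<And>k d'. k < n \<Longrightarrow> 0 < d' \<Longrightarrow> d' \<le> d \<Longrightarrow> P k d'" using Suc by auto
    obtain e where e: "e > 0" "\<And>d'. 0 < d' \<Longrightarrow> d' \<le> e \<Longrightarrow> P n d'" using assms[of n] Suc.prems by auto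
    show ?case by (intro exI[of _ "min d e"]) (use d e in \<open>auto simp: less_Suc_eq\<close>)
  qed
  from this[of N] show ?thesis by force
qed

text \<open>The ramp is the length of the needle already passed at time \<open>t\<close>; it makes
  the comparison curve differentiable off the needle ends.\<close>

lemma ramp_has_derivative:
  fixes c d s :: real
  assumes "0 \<le> d" "s \<noteq> c" "s \<noteq> c + d"
  shows "((\<lambda>t. max 0 (min (t - c) d)) has_real_derivative indicator {c..<c + d} s) (at s)"
proof -
  consider "s < c" | "c < s" "s < c + d" | "c + d < s" using assms by linarith
  then show ?thesis
  proof cases
    case 1
    have "((\<lambda>t. 0) has_real_derivative 0) (at s)" by simp
    then have "((\<lambda>t. max 0 (min (t - c) d)) has_real_derivative 0) (at s)"
      by (rule has_field_derivative_transform_within_open[of _ _ _ "{..<c}"]) (use 1 assms in auto)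
    then show ?thesis using 1 by simp
  next
    case 2
    have "((\<lambda>t. t - c) has_real_derivative 1) (at s)" by (auto intro!: derivative_eq_intros)
    then have "((\<lambda>t. max 0 (min (t - c) d)) has_real_derivative 1) (at s)"
      by (rule has_field_derivative_transform_within_open[of _ _ _ "{c<..<c + d}"]) (use 2 assms in auto)
    then show ?thesis using 2 by simp
  next
    case 3
    have "((\<lambda>t. d) has_real_derivative 0) (at s)" by simp
    then have "((\<lambda>t. max 0 (min (t - c) d)) has_real_derivative 0) (at s)"
      by (rule has_field_derivative_transform_within_open[of _ _ _ "{c + d<..}"]) (use 3 assms in auto)
    then show ?thesis using 3 by simp
  qed
qed

section \<open>First-order expansion of the terminal state in the needle widths\<close>

context needle_variation
begin

text \<open>
  Compare \<open>y - xs\<close> with \<open>\<Sum>k. \<mu> k t *\<^sub>R W k t\<close>, where \<open>W k\<close> solves the variational equation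
  and \<open>\<mu> k t\<close> is the length of the part of needle \<open>k\<close> before \<open>t\<close>: the difference satisfies a
  Gronwall inequality whose forcing term is small in \<open>L\<^sup>1\<close> by dominated convergence.
\<close>

lemma response_expansion:
  fixes \<Phi> \<Psi> :: "real \<Rightarrow> 'e \<Rightarrow>\<^sub>L 'e"
  assumes \<Phi>: "continuous_on {0..T} \<Phi>" "finite S"
      "\<And>t. t \<in> {0<..<T} - S \<Longrightarrow> (\<Phi> has_vector_derivative A t o\<^sub>L \<Phi> t) (at t)"
    and inv: "\<And>t. t \<in> {0..T} \<Longrightarrow> \<Phi> t o\<^sub>L \<Psi> t = id_blinfun" and \<eta>: "0 < \<eta>"
  shows "\<exists>\<delta>>0. \<forall>a y. a \<in> widths r0 \<longrightarrow> sum a {..<N} \<le> \<delta> \<longrightarrow> response a y \<longrightarrow>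
    norm (y T - xs T - (\<Sum>k<N. a k *\<^sub>R \<Phi> T (\<Psi> (ts k) (F (ts k) (xs (ts k)) (vs k) - F (ts k) (xs (ts k)) (us (ts k))))))
      \<le> \<eta> * sum a {..<N}"
proof -
  obtain B where B: "0 < B" "\<And>t. t \<in> {0..T} \<Longrightarrow> norm (A t) \<le> B" using NPC0_R_bounded[OF T A] by blast
  \<comment> \<open>The added 1 keeps \<open>K\<close> positive when there are no needles, as it is
    divided by below.\<close>
  define K where "K = 4 * C * real N * exp (L * T) + 1"
  have K: "0 < K" using C by (simp add: K_def add_nonneg_pos)
  have zero: "(\<lambda>_. 0) \<in> widths r0" using r0 by (simp add: widths_def)
  have dist: "norm (y t - xs t) \<le> K * sum a {..<N}"
    if a: "a \<in> widths r0" "response a y" "t \<in> {0..T}" for a y t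
  proof -
    have "norm (y t - xs t) \<le> 4 * C * real N * exp (L * T) * (\<Sum>k<N. \<bar>a k - 0\<bar>)"
      by (rule response_lipschitz[OF a(1,2) zero response_zero a(3)])
    also have "(\<Sum>k<N. \<bar>a k - 0\<bar>) = sum a {..<N}" using widths_nonneg[OF a(1)] by (intro sum.cong) auto
    also have "4 * C * real N * exp (L * T) * sum a {..<N} \<le> K * sum a {..<N}"
      using widths_nonneg[OF a(1)] by (intro mult_right_mono sum_nonneg) (auto simp: K_def)
    finally show ?thesis .
  qed
  \<comment> \<open>Divides out the final Gronwall factor. Of \<open>\<eta>'\<close>, one half pays
    for the linearisation along the reference control, a quarter for freezing each needle at its
    nominal time and a quarter for replacing \<open>y\<close> by \<open>xs\<close> inside a
    needle.\<close>
  define \<eta>' where "\<eta>' = \<eta> / exp (B * T)"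
  have \<eta>': "0 < \<eta>'" using \<eta> by (simp add: \<eta>'_def)
  define W where "W k t = \<Phi> t (\<Psi> (ts k) (F (ts k) (xs (ts k)) (vs k) - F (ts k) (xs (ts k)) (us (ts k))))" for k t
  have W_cont: "continuous_on {0..T} (W k)" for k
    unfolding W_def by (intro continuous_intros \<Phi>)
  have W_deriv: "(W k has_vector_derivative A s (W k s)) (at s)" if "s \<in> {0<..<T} - S" for k s
    using bounded_linear.has_vector_derivative[OF blinfun.bounded_linear_left \<Phi>(3)[OF that]] by (simp add: W_def[abs_def])
  have W_start: "W k (ts k) = F (ts k) (xs (ts k)) (vs k) - F (ts k) (xs (ts k)) (us (ts k))" if "k < N" for k
  proof -
    have "ts k \<in> {0..T}" using ts[OF that] r0 by auto
    from inv[OF this] show ?thesis by (metis W_def blinfun_apply_id_blinfun blinfun_apply_blinfun_compose id_apply)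
  qed
  define q where "q t d = norm (F t (xs t + d) (us t) - F t (xs t) (us t) - A t d)" for t d
  \<comment> \<open>The curve fed in is \<open>y - xs\<close>, of size \<open>K\<close> times the
    total width; this is why the share \<open>\<eta>' / 2\<close> is divided by
    \<open>K\<close>.\<close>
  have "\<exists>\<delta>>0. \<forall>\<sigma> d. 0 < \<sigma> \<longrightarrow> \<sigma> \<le> \<delta> \<longrightarrow> (\<forall>t\<in>{0..T}. norm (d t) \<le> \<sigma>) \<longrightarrow>
    (\<lambda>t. q t (d t)) integrable_on {0..T} \<longrightarrow> integral {0..T} (\<lambda>t. q t (d t)) \<le> (\<eta>' / (2 * K)) * \<sigma>"
  proof (rule integral_remainder_small[of T \<epsilon> q "L + B"])
    fix t \<eta> :: real assume t: "t \<in> {0..T}" and \<eta>: "0 < \<eta>"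
    obtain \<delta> where "\<delta> > 0" "\<And>y. norm (y - xs t) < \<delta> \<Longrightarrow>
        norm (F t y (us t) - F t (xs t) (us t) - A t (y - xs t)) \<le> \<eta> * norm (y - xs t)"
      using dA[OF t] \<eta> unfolding has_derivative_at_alt by blast
    from this(1) this(2)[of "xs t + _"] show "\<exists>\<delta>>0. \<forall>d. norm d < \<delta> \<longrightarrow> q t d \<le> \<eta> * norm d"
      by (auto simp: q_def)
  next
    fix t :: real and d :: 'e assume t: "t \<in> {0..T}" and d: "norm d \<le> \<epsilon>"
    have "norm (F t (xs t + d) (us t) - F t (xs t) (us t)) \<le> L * norm d"
      using lip[OF t M(2)[OF t], of "xs t + d" "xs t"] d \<epsilon> by (simp add: dist_norm)
    moreover have "norm (A t d) \<le> B * norm d"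
      using norm_blinfun[of "A t" d] mult_right_mono[OF B(2)[OF t] norm_ge_zero[of d]] by linarith
    ultimately show "q t d \<le> (L + B) * norm d"
      using norm_triangle_ineq4[of "F t (xs t + d) (us t) - F t (xs t) (us t)" "A t d"]
      by (simp add: q_def distrib_right)
  qed (use T \<epsilon> \<eta>' K in \<open>auto simp: q_def\<close>)
  then obtain \<delta>1 where \<delta>1: "\<delta>1 > 0" "\<And>\<sigma> d. 0 < \<sigma> \<Longrightarrow> \<sigma> \<le> \<delta>1 \<Longrightarrow> (\<And>t. t\<in>{0..T} \<Longrightarrow> norm (d t) \<le> \<sigma>) \<Longrightarrow>
    (\<lambda>t. q t (d t)) integrable_on {0..T} \<Longrightarrow> integral {0..T} (\<lambda>t. q t (d t)) \<le> (\<eta>' / (2 * K)) * \<sigma>"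
    by blast
  \<comment> \<open>The error of using \<open>W k\<close> for the jump of the dynamics on needle
    \<open>k\<close>. It is zero at \<open>ts k\<close> and right continuous there; the needles lie
    to the right of their nominal times, so one side is enough.\<close>
  define G where "G k s = F s (xs s) (vs k) - F s (xs s) (us s) - W k s" for k s
  have "\<exists>\<delta>>0. \<forall>k<N. \<forall>s. ts k \<le> s \<longrightarrow> s < ts k + \<delta> \<longrightarrow> norm (G k s) \<le> \<eta>' / 4"
  proof (rule finite_common_radius)
    fix k assume k: "k < N"
    have tk: "ts k \<in> {0..<T}" using ts[OF k] r0 by auto
    have xsO: "xs t \<in> \<Omega>" if "t \<in> {0..T}" for t using subsetD[OF tube[OF that], of "xs t"] \<epsilon> by simp
    have v: "(\<lambda>_. vs k) \<in> NPC0_R T U" using vs[OF k] M(1) T by (intro NPC0_R_continuous) auto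
    have r1: "((\<lambda>s. F s (xs s) (vs k)) \<longlongrightarrow> F (ts k) (xs (ts k)) (vs k)) (at_right (ts k))"
      using F_NPC0_R[OF xs xsO v] tk by (auto simp: NPC0_R_def)
    have r2: "((\<lambda>s. F s (xs s) (us s)) \<longlongrightarrow> F (ts k) (xs (ts k)) (us (ts k))) (at_right (ts k))"
      using F_NPC0_R[OF xs xsO us] tk by (auto simp: NPC0_R_def)
    have "(G k \<longlongrightarrow> F (ts k) (xs (ts k)) (vs k) - F (ts k) (xs (ts k)) (us (ts k)) - W k (ts k)) (at_right (ts k))"
      unfolding G_def by (intro tendsto_diff r1 r2 continuous_on_Icc_left_right(2)[OF W_cont tk])
    then have "(G k \<longlongrightarrow> 0) (at_right (ts k))" using W_start[OF k] by simp
    then have "eventually (\<lambda>s. norm (G k s) < \<eta>' / 4) (at_right (ts k))"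
      using \<eta>' tendstoD[of "G k" 0 "at_right (ts k)" "\<eta>' / 4"] by (simp add: dist_norm)
    then obtain b where b: "ts k < b" "\<And>s. ts k < s \<Longrightarrow> s < b \<Longrightarrow> norm (G k s) < \<eta>' / 4"
      using tk by (auto simp: eventually_at_right[of "ts k" T])
    have "G k (ts k) = 0" using W_start[OF k] by (simp add: G_def)
    then have "norm (G k s) \<le> \<eta>' / 4" if "ts k \<le> s" "s < b" for s
      using b(2)[of s] that \<eta>' by (cases "s = ts k") auto
    then show "\<exists>d>0. \<forall>d'. 0 < d' \<longrightarrow> d' \<le> d \<longrightarrow> (\<forall>s. ts k \<le> s \<longrightarrow> s < ts k + d' \<longrightarrow> norm (G k s) \<le> \<eta>' / 4)"
      using b(1) by (intro exI[of _ "b - ts k"]) auto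
  qed
  then obtain \<delta>2 where \<delta>2: "\<delta>2 > 0" "\<And>k s. k < N \<Longrightarrow> ts k \<le> s \<Longrightarrow> s < ts k + \<delta>2 \<Longrightarrow> norm (G k s) \<le> \<eta>' / 4"
    by blast
  \<comment> \<open>The three bounds keep \<open>y - xs\<close> within \<open>\<delta>1\<close>, the
    needles within \<open>\<delta>2\<close> of their nominal times, and the Lipschitz error below
    its quarter of \<open>\<eta>'\<close>.\<close>
  define \<delta> where "\<delta> = min (min (\<delta>1 / K) \<delta>2) (\<eta>' / (8 * (L * K + 1)))"
  have LK: "0 < L * K + 1" using L K by (simp add: add_nonneg_pos)
  have \<delta>: "0 < \<delta>" "K * \<delta> \<le> \<delta>1" "\<delta> \<le> \<delta>2" "2 * (L * (K * \<delta>)) \<le> \<eta>' / 4"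
  proof -
    show "0 < \<delta>" "\<delta> \<le> \<delta>2" using \<delta>1(1) \<delta>2(1) K \<eta>' LK by (auto simp: \<delta>_def)
    have "\<delta> \<le> \<delta>1 / K" by (simp add: \<delta>_def)
    then show "K * \<delta> \<le> \<delta>1" using K by (simp add: field_simps)
    have "\<delta> \<le> \<eta>' / (8 * (L * K + 1))" by (simp add: \<delta>_def)
    then have "8 * (L * K + 1) * \<delta> \<le> \<eta>'" using LK by (simp add: field_simps)
    then have "8 * (L * (K * \<delta>)) + 8 * \<delta> \<le> \<eta>'" by (simp add: algebra_simps)
    then show "2 * (L * (K * \<delta>)) \<le> \<eta>' / 4" using \<open>0 < \<delta>\<close> by linarith
  qed
  have "norm (y T - xs T - (\<Sum>k<N. a k *\<^sub>R W k T)) \<le> \<eta> * sum a {..<N}"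
    if a: "a \<in> widths r0" "sum a {..<N} \<le> \<delta>" "response a y" for a y
  proof (cases "sum a {..<N} = 0")
    case True
    then have "a k = 0" if "k < N" for k
      using sum_nonneg_eq_0_iff[of "{..<N}" a] widths_nonneg[OF a(1)] that by auto
    moreover have "y T - xs T = 0" using dist[OF a(1,3), of T] True T by simp
    ultimately show ?thesis using True by simp
  next
    case False
    define \<sigma> where "\<sigma> = sum a {..<N}"
    have \<sigma>: "0 < \<sigma>" using False sum_nonneg[of "{..<N}" a] widths_nonneg[OF a(1)] by (simp add: \<sigma>_def less_le)
    have y: "continuous_on {0..T} y" "\<And>t. t \<in> {0..T} \<Longrightarrow> y t \<in> cball (xs t) \<epsilon>" "y 0 = xs 0"
      using a(3) by (auto simp: response_def)
    have yO: "y t \<in> \<Omega>" and xO: "xs t \<in> \<Omega>" if "t \<in> {0..T}" for t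
      using subsetD[OF tube[OF that] y(2)[OF that]] subsetD[OF tube[OF that], of "xs t"] \<epsilon> by simp_all
    obtain Sy where Sy: "finite Sy" "\<And>t. t \<in> {0<..<T} - Sy \<Longrightarrow> (y has_vector_derivative F t (y t) (ctrl a t)) (at t)"
      using a(3) unfolding response_def by blast
    obtain Sx where Sx: "finite Sx" "\<And>t. t \<in> {0<..<T} - Sx \<Longrightarrow> (xs has_vector_derivative F t (xs t) (us t)) (at t)"
      using traj by blast
    define c where "c k = needle_start ts a k" for k
    define \<mu> where "\<mu> k t = max 0 (min (t - c k) (a k))" for k t
    define I where "I k = (indicator (needle_interval ts a k) :: real \<Rightarrow> real)" for k
    define z where "z t = (\<Sum>k<N. \<mu> k t *\<^sub>R W k t)" for t
    define e where "e t = y t - xs t - z t" for t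
    define Sc where "Sc = c ` {..<N} \<union> (\<lambda>k. c k + a k) ` {..<N}"
    define Se where "Se = S \<union> Sx \<union> Sy \<union> Sc"
    define e' where "e' s = F s (y s) (ctrl a s) - F s (xs s) (us s) - (\<Sum>k<N. \<mu> k s *\<^sub>R A s (W k s) + I k s *\<^sub>R W k s)" for s
    define \<rho> where "\<rho> s = q s (y s - xs s)" for s
    define R where "R s = \<rho> s + (\<Sum>k<N. (\<eta>' / 2) * I k s)" for s
    have \<mu>_deriv: "(\<mu> k has_real_derivative I k s) (at s)" if "k < N" "s \<notin> Sc" for k s
      unfolding \<mu>_def I_def needle_interval_def c_def[symmetric]
      using that widths_nonneg[OF a(1) that(1)] by (intro ramp_has_derivative) (auto simp: Sc_def)
    have "\<rho> \<in> NPC0_R T UNIV"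
    proof -
      have cd: "continuous_on {0..T} (\<lambda>s. y s - xs s)" by (intro continuous_intros y xs)
      have 1: "(\<lambda>s. A s (y s - xs s)) \<in> NPC0_R T UNIV"
        by (rule NPC0_R_compose2[OF T A NPC0_R_continuous[OF T cd, of UNIV]])
          (auto simp: case_prod_beta intro!: continuous_intros)
      have 2: "(\<lambda>s. F s (y s) (us s) - F s (xs s) (us s)) \<in> NPC0_R T UNIV"
        by (rule NPC0_R_compose2[OF T F_NPC0_R[OF y(1) yO us] F_NPC0_R[OF xs xO us]])
          (auto simp: case_prod_beta intro!: continuous_intros)
      have "(\<lambda>s. norm (F s (y s) (us s) - F s (xs s) (us s) - A s (y s - xs s))) \<in> NPC0_R T UNIV"
        by (rule NPC0_R_compose2[OF T 2 1]) (auto simp: case_prod_beta intro!: continuous_intros)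
      then show ?thesis by (simp add: \<rho>_def[abs_def] q_def)
    qed
    then have \<rho>int: "\<rho> integrable_on {0..T}" by (rule NPC0_R_integrable[OF T])
    have dd: "norm (y t - xs t) \<le> K * \<sigma>" if "t \<in> {0..T}" for t
      using dist[OF a(1,3) that] by (simp add: \<sigma>_def)
    have K\<sigma>: "0 < K * \<sigma>" "K * \<sigma> \<le> \<delta>1" "2 * (L * (K * \<sigma>)) \<le> \<eta>' / 4"
    proof -
      have \<sigma>\<delta>: "\<sigma> \<le> \<delta>" using a(2) by (simp add: \<sigma>_def)
      then have "K * \<sigma> \<le> K * \<delta>" using K by simp
      then show "K * \<sigma> \<le> \<delta>1" using \<delta>(2) by simp
      have "L * (K * \<sigma>) \<le> L * (K * \<delta>)" using \<open>K * \<sigma> \<le> K * \<delta>\<close> L by (rule mult_left_mono)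
      then show "2 * (L * (K * \<sigma>)) \<le> \<eta>' / 4" using \<delta>(4) by simp
    qed (use K \<sigma> in simp)
    have "integral {0..T} \<rho> \<le> (\<eta>' / (2 * K)) * (K * \<sigma>)"
      unfolding \<rho>_def by (rule \<delta>1(2)[OF K\<sigma>(1,2)]) (use dd \<rho>int in \<open>auto simp: \<rho>_def[abs_def]\<close>)
    also have "\<dots> = \<eta>' / 2 * \<sigma>" using K by simp
    finally have \<rho>b: "integral {0..T} \<rho> \<le> \<eta>' / 2 * \<sigma>" .
    have Iint: "((\<lambda>s. \<Sum>k<N. (\<eta>' / 2) * I k s) has_integral (\<Sum>k<N. (\<eta>' / 2) * a k)) {0..T}"
      unfolding I_def using needle_interval_integral[OF a(1)] by (intro has_integral_sum has_integral_mult_right) auto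
    have Rint: "(R has_integral (integral {0..T} \<rho> + (\<Sum>k<N. (\<eta>' / 2) * a k))) {0..T}"
      unfolding R_def using \<rho>int Iint by (intro has_integral_add) auto
    have Rb: "integral {0..T} R \<le> \<eta>' * \<sigma>"
    proof -
      have "(\<Sum>k<N. (\<eta>' / 2) * a k) = (\<eta>' / 2) * \<sigma>" unfolding \<sigma>_def by (rule sum_distrib_left[symmetric])
      then show ?thesis unfolding integral_unique[OF Rint] using \<rho>b by simp
    qed
    have e0: "e 0 = 0"
    proof -
      have "\<mu> k 0 = 0" if "k < N" for k
        using needle_bounds(2)[OF a(1) that] widths_nonneg[OF a(1) that] by (simp add: \<mu>_def c_def)
      then show ?thesis by (simp add: e_def z_def y(3))
    qed
    have eT: "e T = y T - xs T - (\<Sum>k<N. a k *\<^sub>R W k T)"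
    proof -
      have "\<mu> k T = a k" if "k < N" for k
        using needle_bounds(4)[OF a(1) that] widths_nonneg[OF a(1) that] by (simp add: \<mu>_def c_def)
      then show ?thesis by (simp add: e_def z_def)
    qed
    have "norm (e T) \<le> (norm (e 0) + integral {0..T} R) * exp (B * T)"
    proof (rule gronwall[of T B e Se e' R])
      show "continuous_on {0..T} e" unfolding e_def z_def \<mu>_def
        by (intro continuous_intros y xs W_cont)
      show "finite Se" using \<Phi>(2) Sx(1) Sy(1) by (simp add: Se_def Sc_def)
      fix s assume s: "s \<in> {0<..<T} - Se"
      then have s': "s \<in> {0..T}" by auto
      have "(z has_vector_derivative (\<Sum>k<N. \<mu> k s *\<^sub>R A s (W k s) + I k s *\<^sub>R W k s)) (at s)"
        unfolding z_def using s
        by (intro has_vector_derivative_sum has_vector_derivative_scaleR \<mu>_deriv W_deriv) (auto simp: Se_def)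
      then show "(e has_vector_derivative e' s) (at s)"
        unfolding e_def e'_def using s
        by (intro has_vector_derivative_diff Sx Sy) (auto simp: Se_def)
      define H where "H k = F s (y s) (vs k) - F s (y s) (us s) - W k s" for k
      have Hb: "norm (I k s *\<^sub>R H k) \<le> (\<eta>' / 2) * I k s" if k: "k < N" for k
      proof (cases "s \<in> needle_interval ts a k")
        case True
        have sk: "ts k \<le> s" "s < ts k + \<delta>2"
          using True needle_bounds(1,3)[OF a(1) k] a(2) \<delta>(3) by (auto simp: needle_interval_def)
        have 1: "norm (F s (y s) (vs k) - F s (xs s) (vs k)) \<le> L * (K * \<sigma>)"
          using lip[OF s' vs[OF k] y(2)[OF s'], of "xs s"] \<epsilon> mult_left_mono[OF dd[OF s'] L] by simp
        have 2: "norm (F s (y s) (us s) - F s (xs s) (us s)) \<le> L * (K * \<sigma>)"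
          using lip[OF s' M(2)[OF s'] y(2)[OF s'], of "xs s"] \<epsilon> mult_left_mono[OF dd[OF s'] L] by simp
        have "H k = G k s + ((F s (y s) (vs k) - F s (xs s) (vs k)) - (F s (y s) (us s) - F s (xs s) (us s)))"
          by (simp add: H_def G_def)
        also have "norm \<dots> \<le> \<eta>' / 4 + (L * (K * \<sigma>) + L * (K * \<sigma>))"
          by (intro norm_triangle_mono \<delta>2(2)[OF k sk] order_trans[OF norm_triangle_ineq4 add_mono[OF 1 2]])
        also have "\<dots> \<le> \<eta>' / 2" using K\<sigma>(3) by linarith
        finally show ?thesis using True by (simp add: I_def)
      next
        case False
        then show ?thesis by (simp add: I_def)
      qed
      \<comment> \<open>Insert \<open>A s (y s - xs s)\<close>: with the drift of the curves
        \<open>W k\<close> it leaves \<open>A s (e s)\<close>. What remains is the linearisation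
        error for the reference control and, on the needles only, the errors
        \<open>H k\<close>.\<close>
      have "e' s = (F s (y s) (us s) - F s (xs s) (us s) - A s (y s - xs s)) + A s (e s) + (\<Sum>k<N. I k s *\<^sub>R H k)"
      proof -
        have "A s (z s) = (\<Sum>k<N. \<mu> k s *\<^sub>R A s (W k s))"
          by (simp add: z_def blinfun.sum_right blinfun.scaleR_right)
        then show ?thesis
          unfolding e'_def F_ctrl[OF a(1), of s] e_def I_def[symmetric] H_def
          by (simp add: blinfun.diff_right sum.distrib scaleR_diff_right sum_subtractf)
      qed
      also have "norm \<dots> \<le> \<rho> s + B * norm (e s) + (\<Sum>k<N. (\<eta>' / 2) * I k s)"
      proof (intro norm_triangle_mono)
        show "norm (A s (e s)) \<le> B * norm (e s)"
          using norm_blinfun[of "A s" "e s"] mult_right_mono[OF B(2)[OF s'] norm_ge_zero[of "e s"]] by linarith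
        show "norm (\<Sum>k<N. I k s *\<^sub>R H k) \<le> (\<Sum>k<N. (\<eta>' / 2) * I k s)"
          using Hb by (intro sum_norm_le) auto
      qed (simp add: \<rho>_def q_def)
      finally show "norm (e' s) \<le> B * norm (e s) + R s" by (simp add: R_def)
    next
      fix s
      show "0 \<le> R s" unfolding R_def \<rho>_def q_def I_def using \<eta>' by (intro add_nonneg_nonneg sum_nonneg) auto
    qed (use T B Rint in auto)
    also have "\<dots> \<le> \<eta>' * \<sigma> * exp (B * T)" using Rb e0 by simp
    also have "\<dots> = \<eta> * \<sigma>" by (simp add: \<eta>'_def)
    finally show ?thesis by (simp add: eT \<sigma>_def)
  qed
  then show ?thesis using \<delta>(1) unfolding W_def by blast
qed

end

context control_trajectory
begin

text \<open>What the multiplier rule uses: responses are trajectories of admissible controls, the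
  end point is Lipschitz in the widths (for continuity of the equality constraints), and it has a
  first-order expansion.\<close>

theorem needle_family:
  fixes \<Phi> \<Psi> :: "real \<Rightarrow> 'e \<Rightarrow>\<^sub>L 'e" and N :: nat
  assumes ts: "\<And>k. k < N \<Longrightarrow> ts k \<in> {0..<T}" "\<And>j k. j \<le> k \<Longrightarrow> k < N \<Longrightarrow> ts j \<le> ts k"
    and vs: "\<And>k. k < N \<Longrightarrow> vs k \<in> U"
    and \<Phi>: "continuous_on {0..T} \<Phi>" "finite S"
      "\<And>t. t \<in> {0<..<T} - S \<Longrightarrow> (\<Phi> has_vector_derivative A t o\<^sub>L \<Phi> t) (at t)"
    and inv: "\<And>t. t \<in> {0..T} \<Longrightarrow> \<Phi> t o\<^sub>L \<Psi> t = id_blinfun"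
  obtains r K y w where "0 < r"
    "\<forall>a. (\<forall>k<N. 0 \<le> a k) \<longrightarrow> sum a {..<N} \<le> r \<longrightarrow> w a \<in> NPC0_R T U \<and> y a \<in> PC1 T \<Omega> \<and>
       y a 0 = xs 0 \<and> (\<forall>t\<in>{0..T}. ext_deriv T (y a) t = F t (y a t) (w a t))"
    "\<forall>a b. (\<forall>k<N. 0 \<le> a k) \<longrightarrow> sum a {..<N} \<le> r \<longrightarrow> (\<forall>k<N. 0 \<le> b k) \<longrightarrow> sum b {..<N} \<le> r \<longrightarrow>
       norm (y a T - y b T) \<le> K * (\<Sum>k<N. \<bar>a k - b k\<bar>)"
    "\<forall>\<eta>>0. \<exists>\<delta>>0. \<forall>a. (\<forall>k<N. 0 \<le> a k) \<longrightarrow> sum a {..<N} \<le> r \<longrightarrow> sum a {..<N} \<le> \<delta> \<longrightarrow>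
       norm (y a T - xs T - (\<Sum>k<N. a k *\<^sub>R \<Phi> T (\<Psi> (ts k) (F (ts k) (xs (ts k)) (vs k) - F (ts k) (xs (ts k)) (us (ts k))))))
         \<le> \<eta> * sum a {..<N}"
proof -
  obtain Ku where Ku: "compact Ku" "Ku \<subseteq> U" "\<And>t. t \<in> {0..T} \<Longrightarrow> us t \<in> Ku"
    using NPC0_R_compact_range[OF T us] by metis
  define M where "M = Ku \<union> vs ` {..<N}"
  have M: "compact M" "M \<subseteq> U" using Ku vs by (auto simp: M_def intro: compact_Un finite_imp_compact)
  obtain \<epsilon> L where \<epsilon>: "0 < \<epsilon>" "0 \<le> L" "\<And>t. t \<in> {0..T} \<Longrightarrow> cball (xs t) \<epsilon> \<subseteq> \<Omega>"
    and lip: "\<And>t \<zeta> \<xi> \<eta>. t \<in> {0..T} \<Longrightarrow> \<zeta> \<in> M \<Longrightarrow> \<xi> \<in> cball (xs t) \<epsilon> \<Longrightarrow> \<eta> \<in> cball (xs t) \<epsilon> \<Longrightarrow>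
      norm (F t \<xi> \<zeta> - F t \<eta> \<zeta>) \<le> L * norm (\<xi> - \<eta>)"
    using lipschitz[OF M] by metis
  have xO: "xs t \<in> \<Omega>" if "t \<in> {0..T}" for t using subsetD[OF \<epsilon>(3)[OF that], of "xs t"] \<epsilon>(1) by simp
  have "continuous_on ({0..T} \<times> M) (\<lambda>p. (\<lambda>(t, \<xi>, \<zeta>). F t \<xi> \<zeta>) (fst p, xs (fst p), snd p))"
    by (rule continuous_on_compose2[OF contF])
      (use xO M(2) in \<open>auto intro!: continuous_intros continuous_on_compose2[OF xs]\<close>)
  then have "compact ((\<lambda>p. F (fst p) (xs (fst p)) (snd p)) ` ({0..T} \<times> M))"
    using M(1) by (intro compact_continuous_image compact_Times) auto
  from compact_imp_bounded[OF this] obtain C0 where C0: "C0 > 0"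
    and C0': "\<forall>x\<in>(\<lambda>p. F (fst p) (xs (fst p)) (snd p)) ` ({0..T} \<times> M). norm x \<le> C0"
    unfolding bounded_pos by blast
  have C0'': "norm (F t (xs t) \<zeta>) \<le> C0" if "t \<in> {0..T}" "\<zeta> \<in> M" for t \<zeta>
    using bspec[OF C0' imageI[of "(t, \<zeta>)"]] that by simp
  have "\<exists>d>0. \<forall>k<N. ts k + d < T"
    using ts(1) by (intro finite_common_radius) (metis add.commute atLeastLessThan_iff dense less_diff_eq order.strict_trans1 diff_gt_0_iff_gt)
  then obtain r0 where r0: "r0 > 0" "\<And>k. k < N \<Longrightarrow> ts k + r0 < T" by blast
  interpret needle_variation T \<Omega> U F xs us A N ts vs M \<epsilon> L "C0 + L * \<epsilon>" r0
  proof
    show "norm (F t \<xi> \<zeta>) \<le> C0 + L * \<epsilon>" if t: "t \<in> {0..T}" "\<zeta> \<in> M" "\<xi> \<in> cball (xs t) \<epsilon>" for t \<zeta> \<xi>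
    proof -
      have "norm (F t \<xi> \<zeta> - F t (xs t) \<zeta>) \<le> L * norm (\<xi> - xs t)" using lip[OF t, of "xs t"] \<epsilon>(1) by simp
      also have "\<dots> \<le> L * \<epsilon>" using t(3) \<epsilon>(2) by (intro mult_left_mono) (auto simp: dist_norm norm_minus_commute)
      finally show ?thesis using C0''[OF t(1,2)] norm_triangle_sub[of "F t \<xi> \<zeta>" "F t (xs t) \<zeta>"] by simp
    qed
  qed (use ts vs M Ku \<epsilon> lip C0 r0 in \<open>auto simp: M_def add_pos_nonneg\<close>)
  obtain r where r: "0 < r" "r \<le> r0" "\<And>a. a \<in> widths r \<Longrightarrow> \<exists>y. response a y"
    using response_exists by blast
  \<comment> \<open>By \<open>response_lipschitz\<close> with equal widths two responses agree on
    [0,T], so the choice carries no ambiguity there.\<close>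
  define y where "y a = (SOME y. response a y)" for a
  have y: "response a (y a)" if "a \<in> widths r" for a
    using r(3)[OF that] unfolding y_def by (rule someI_ex)
  have w0: "a \<in> widths r0" if "a \<in> widths r" for a using that r(2) by (simp add: widths_def)
  show thesis
  proof (rule that[OF r(1), of ctrl y]; intro allI impI)
    fix a :: "nat \<Rightarrow> real" assume "\<forall>k<N. 0 \<le> a k" "sum a {..<N} \<le> r"
    then have a: "a \<in> widths r" by (simp add: widths_def)
    show "ctrl a \<in> NPC0_R T U \<and> y a \<in> PC1 T \<Omega> \<and>
       y a 0 = xs 0 \<and> (\<forall>t\<in>{0..T}. ext_deriv T (y a) t = F t (y a t) (ctrl a t))"
      using ctrl_NPC0_R[OF w0[OF a]] response_PC1[OF w0[OF a] y[OF a]] y[OF a] by (simp add: response_def)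
  next
    fix a b :: "nat \<Rightarrow> real" assume "\<forall>k<N. 0 \<le> a k" "sum a {..<N} \<le> r" "\<forall>k<N. 0 \<le> b k" "sum b {..<N} \<le> r"
    then have a: "a \<in> widths r" and b: "b \<in> widths r" by (simp_all add: widths_def)
    show "norm (y a T - y b T) \<le> 4 * (C0 + L * \<epsilon>) * real N * exp (L * T) * (\<Sum>k<N. \<bar>a k - b k\<bar>)"
      using response_lipschitz[OF w0[OF a] y[OF a] w0[OF b] y[OF b]] T by simp
  next
    fix \<eta> :: real assume "0 < \<eta>"
    from response_expansion[OF \<Phi> inv this] obtain \<delta> where \<delta>: "\<delta> > 0" "\<And>a y. a \<in> widths r0 \<Longrightarrow> sum a {..<N} \<le> \<delta> \<Longrightarrow> response a y \<Longrightarrow>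
      norm (y T - xs T - (\<Sum>k<N. a k *\<^sub>R \<Phi> T (\<Psi> (ts k) (F (ts k) (xs (ts k)) (vs k) - F (ts k) (xs (ts k)) (us (ts k))))))
      \<le> \<eta> * sum a {..<N}"
      by blast
    show "\<exists>\<delta>>0. \<forall>a. (\<forall>k<N. 0 \<le> a k) \<longrightarrow> sum a {..<N} \<le> r \<longrightarrow> sum a {..<N} \<le> \<delta> \<longrightarrow>
       norm (y a T - xs T - (\<Sum>k<N. a k *\<^sub>R \<Phi> T (\<Psi> (ts k) (F (ts k) (xs (ts k)) (vs k) - F (ts k) (xs (ts k)) (us (ts k))))))
         \<le> \<eta> * sum a {..<N}"
    proof (intro exI[of _ \<delta>] conjI allI impI \<delta>(1))
      fix a assume "\<forall>k<N. 0 \<le> a k" "sum a {..<N} \<le> r" "sum a {..<N} \<le> \<delta>"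
      then have a: "a \<in> widths r" "sum a {..<N} \<le> \<delta>" by (simp_all add: widths_def)
      show "norm (y a T - xs T - (\<Sum>k<N. a k *\<^sub>R \<Phi> T (\<Psi> (ts k) (F (ts k) (xs (ts k)) (vs k) - F (ts k) (xs (ts k)) (us (ts k))))))
         \<le> \<eta> * sum a {..<N}"
        by (rule \<delta>(2)[OF w0[OF a(1)] a(2) y[OF a(1)]])
    qed
  qed
qed

end

section \<open>Farkas, Poincare-Miranda and the Fritz John rule\<close>

text \<open>Induction on the generators. A separator \<open>y'\<close> for the old ones either works
  for the new generator \<open>w m\<close> too or is positive on it; in the latter case everything
  is projected along \<open>w m\<close> into the kernel of \<open>y'\<close> and the induction
  hypothesis is used once more.\<close>

lemma farkas:
  fixes w :: "'k \<Rightarrow> 'i \<Rightarrow> real" and b :: "'i \<Rightarrow> real"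
  assumes "finite K" and I: "finite I"
  shows "(\<exists>c. (\<forall>k\<in>K. 0 \<le> c k) \<and> (\<forall>i\<in>I. b i = (\<Sum>k\<in>K. c k * w k i))) \<or>
    (\<exists>y. (\<forall>k\<in>K. (\<Sum>i\<in>I. y i * w k i) \<le> 0) \<and> 0 < (\<Sum>i\<in>I. y i * b i))"
  using assms(1)
proof (induction K arbitrary: w b rule: finite_induct)
  case empty
  show ?case
  proof (cases "\<forall>i\<in>I. b i = 0")
    case False
    then have "0 < (\<Sum>i\<in>I. b i * b i)"
      using I by (auto intro!: sum_pos2[of I] simp: not_sum_power2_lt_zero zero_less_mult_iff)
    then show ?thesis by (intro disjI2 exI[of _ b]) simp
  qed simp
next
  case (insert m K)
  define ip where "ip y z = (\<Sum>i\<in>I. y i * z i)" for y z :: "'i \<Rightarrow> real"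
  have ip_lin: "ip y (\<lambda>i. z i - s * z' i) = ip y z - s * ip y z'"
      "ip (\<lambda>i. y i - s * y' i) z = ip y z - s * ip y' z" for y y' z z' s
    by (simp_all add: ip_def sum_subtractf sum_distrib_left algebra_simps)
  from insert.IH[of b w] show ?case
  proof (elim disjE exE conjE)
    fix c assume c: "\<forall>k\<in>K. 0 \<le> c k" "\<forall>i\<in>I. b i = (\<Sum>k\<in>K. c k * w k i)"
    have "(\<Sum>k\<in>insert m K. (c(m := 0)) k * w k i) = (\<Sum>k\<in>K. c k * w k i)" for i
      using insert.hyps by (auto intro!: sum.cong)
    then show ?thesis using c by (intro disjI1 exI[of _ "c(m := 0)"]) auto
  next
    fix y' assume y': "\<forall>k\<in>K. (\<Sum>i\<in>I. y' i * w k i) \<le> 0" "0 < (\<Sum>i\<in>I. y' i * b i)"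
    define \<alpha> where "\<alpha> = ip y' (w m)"
    show ?thesis
    proof (cases "\<alpha> \<le> 0")
      case True
      then show ?thesis using y' by (intro disjI2 exI[of _ y']) (auto simp: \<alpha>_def ip_def)
    next
      case False
      then have \<alpha>: "0 < \<alpha>" by simp
      \<comment> \<open>Projection along \<open>w m\<close>; \<open>\<alpha> > 0\<close> makes it
        possible.\<close>
      define w' where "w' k i = w k i - ip y' (w k) / \<alpha> * w m i" for k i
      define b' where "b' i = b i - ip y' b / \<alpha> * w m i" for i
      from insert.IH[of b' w'] show ?thesis
      proof (elim disjE exE conjE)
        fix c assume c: "\<forall>k\<in>K. 0 \<le> c k" "\<forall>i\<in>I. b' i = (\<Sum>k\<in>K. c k * w' k i)"
        \<comment> \<open>The coefficient of \<open>w m\<close> left over when the projections are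
          undone. It is nonnegative because \<open>y'\<close> is positive on \<open>b\<close> and
          nonpositive on the old generators.\<close>
        define cm where "cm = ip y' b / \<alpha> - (\<Sum>k\<in>K. c k * (ip y' (w k) / \<alpha>))"
        have "(\<Sum>k\<in>K. c k * (ip y' (w k) / \<alpha>)) \<le> 0"
          using c(1) y'(1) \<alpha> by (intro sum_nonpos mult_nonneg_nonpos divide_nonpos_pos) (auto simp: ip_def)
        moreover have "0 \<le> ip y' b / \<alpha>" using y'(2) \<alpha> by (simp add: ip_def)
        ultimately have cm: "0 \<le> cm" by (simp add: cm_def)
        have "b i = (\<Sum>k\<in>insert m K. (c(m := cm)) k * w k i)" if i: "i \<in> I" for i
        proof -
          have "b' i = (\<Sum>k\<in>K. c k * w' k i)" using c(2) i by blast
          then have "b i = (\<Sum>k\<in>K. c k * w' k i) + ip y' b / \<alpha> * w m i" unfolding b'_def by linarith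
          also have "(\<Sum>k\<in>K. c k * w' k i) = (\<Sum>k\<in>K. c k * w k i) - (\<Sum>k\<in>K. c k * (ip y' (w k) / \<alpha>)) * w m i"
            by (simp add: w'_def sum_subtractf sum_distrib_right right_diff_distrib mult.assoc)
          also have "\<dots> + ip y' b / \<alpha> * w m i = cm * w m i + (\<Sum>k\<in>K. c k * w k i)"
            by (simp add: cm_def algebra_simps)
          also have "(\<Sum>k\<in>K. c k * w k i) = (\<Sum>k\<in>K. (c(m := cm)) k * w k i)"
            using insert.hyps by (intro sum.cong) auto
          finally show ?thesis using insert.hyps by simp
        qed
        then show ?thesis using c(1) cm by (intro disjI1 exI[of _ "c(m := cm)"]) auto
      next
        fix y assume y: "\<forall>k\<in>K. (\<Sum>i\<in>I. y i * w' k i) \<le> 0" "0 < (\<Sum>i\<in>I. y i * b' i)"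
        \<comment> \<open>The adjoint of the projection: \<open>y''\<close> kills \<open>w m\<close>
          and pairs with the original vectors as \<open>y\<close> does with the projected
          ones.\<close>
        define y'' where "y'' i = y i - ip y (w m) / \<alpha> * y' i" for i
        have "ip y'' (w k) = ip y (w' k)" for k
          unfolding y''_def w'_def ip_lin by simp
        moreover have "ip y'' b = ip y b'" unfolding y''_def b'_def ip_lin by simp
        moreover have "ip y'' (w m) = 0" unfolding y''_def ip_lin using \<alpha> by (simp add: \<alpha>_def)
        ultimately show ?thesis using y by (intro disjI2 exI[of _ y'']) (auto simp: ip_def)
      qed
    qed
  qed
qed

text \<open>Slack generators \<open>- e_i\<close> turn the inequality rows into equations. On the
  dual side they force the coefficients of these rows to be nonnegative, so a separator would be
  exactly the nontrivial pair that \<open>none\<close> excludes.\<close>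

lemma farkas_mixed:
  fixes w :: "'k \<Rightarrow> 'i \<Rightarrow> real" and v :: "'k \<Rightarrow> 'j \<Rightarrow> real" and b :: "'i \<Rightarrow> real" and d :: "'j \<Rightarrow> real"
  assumes K: "finite K" and I: "finite I" and J: "finite J"
    and none: "\<And>y z. (\<And>i. i \<in> I \<Longrightarrow> 0 \<le> y i) \<Longrightarrow>
      (\<And>k. k \<in> K \<Longrightarrow> (\<Sum>i\<in>I. y i * w k i) + (\<Sum>j\<in>J. z j * v k j) \<le> 0) \<Longrightarrow>
      (\<forall>i\<in>I. y i = 0) \<and> (\<forall>j\<in>J. z j = 0)"
  obtains c where "\<And>k. k \<in> K \<Longrightarrow> 0 \<le> c k" "\<And>i. i \<in> I \<Longrightarrow> b i \<le> (\<Sum>k\<in>K. c k * w k i)"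
    "\<And>j. j \<in> J \<Longrightarrow> d j = (\<Sum>k\<in>K. c k * v k j)"
proof -
  define e where "e = (case_sum (\<lambda>k. case_sum (w k) (v k)) (\<lambda>l. case_sum (\<lambda>i. if i = l then -1 else 0) (\<lambda>j. 0)) :: 'k + 'i \<Rightarrow> 'i + 'j \<Rightarrow> real)"
  have "(\<exists>c. (\<forall>k\<in>K <+> I. 0 \<le> c k) \<and> (\<forall>i\<in>I <+> J. case_sum b d i = (\<Sum>k\<in>K <+> I. c k * e k i))) \<or>
    (\<exists>y. (\<forall>k\<in>K <+> I. (\<Sum>i\<in>I <+> J. y i * e k i) \<le> 0) \<and> 0 < (\<Sum>i\<in>I <+> J. y i * case_sum b d i))"
    using K I J by (intro farkas) auto
  then show thesis
  proof (elim disjE exE conjE)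
    fix c assume c: "\<forall>k\<in>K <+> I. 0 \<le> c k" "\<forall>i\<in>I <+> J. case_sum b d i = (\<Sum>k\<in>K <+> I. c k * e k i)"
    show thesis
    proof (rule that[of "\<lambda>k. c (Inl k)"])
      show "0 \<le> c (Inl k)" if "k \<in> K" for k using c(1) that by auto
      show "b i \<le> (\<Sum>k\<in>K. c (Inl k) * w k i)" if i: "i \<in> I" for i
      proof -
        have "b i = (\<Sum>k\<in>K <+> I. c k * e k (Inl i))" using c(2) i by force
        also have "\<dots> = (\<Sum>k\<in>K. c (Inl k) * w k i) + (\<Sum>l\<in>I. if l = i then - c (Inr l) else 0)"
          unfolding sum.Plus[OF K I] by (intro arg_cong2[where f = "(+)"] sum.cong) (auto simp: e_def)
        also have "(\<Sum>l\<in>I. if l = i then - c (Inr l) else 0) = - c (Inr i)" using I i by simp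
        finally show ?thesis using c(1) i by auto
      qed
      show "d j = (\<Sum>k\<in>K. c (Inl k) * v k j)" if j: "j \<in> J" for j
      proof -
        have "d j = (\<Sum>k\<in>K <+> I. c k * e k (Inr j))" using c(2) j by force
        also have "\<dots> = (\<Sum>k\<in>K. c (Inl k) * v k j)" using K I by (simp add: sum.Plus e_def comp_def)
        finally show ?thesis .
      qed
    qed
  next
    fix y assume y: "\<forall>k\<in>K <+> I. (\<Sum>i\<in>I <+> J. y i * e k i) \<le> 0" "0 < (\<Sum>i\<in>I <+> J. y i * case_sum b d i)"
    have "(\<forall>i\<in>I. y (Inl i) = 0) \<and> (\<forall>j\<in>J. y (Inr j) = 0)"
    proof (rule none)
      fix l assume l: "l \<in> I"
      have "(\<Sum>i\<in>I <+> J. y i * e (Inr l) i) = (\<Sum>i\<in>I. if i = l then - y (Inl i) else 0) + (\<Sum>j\<in>J. 0)"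
        unfolding sum.Plus[OF I J] by (intro arg_cong2[where f = "(+)"] sum.cong) (auto simp: e_def)
      also have "\<dots> = - y (Inl l)" using I l by simp
      finally show "0 \<le> y (Inl l)" using bspec[OF y(1) InrI[OF l]] by simp
    next
      fix k assume k: "k \<in> K"
      have "(\<Sum>i\<in>I <+> J. y i * e (Inl k) i) = (\<Sum>i\<in>I. y (Inl i) * w k i) + (\<Sum>j\<in>J. y (Inr j) * v k j)"
        using I J by (simp add: sum.Plus e_def comp_def)
      then show "(\<Sum>i\<in>I. y (Inl i) * w k i) + (\<Sum>j\<in>J. y (Inr j) * v k j) \<le> 0" using y(1) k by force
    qed
    then have "(\<Sum>i\<in>I <+> J. y i * case_sum b d i) = 0" using I J by (simp add: sum.Plus comp_def)
    then show thesis using y(2) by simp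
  qed
qed

section \<open>Zeros of maps on a cube\<close>

lemma finite_coordinates_subsequence:
  fixes s :: "nat \<Rightarrow> nat \<Rightarrow> real"
  assumes "\<And>m j. j < n \<Longrightarrow> s m j \<in> {-B..B}"
  obtains z r where "strict_mono r" "\<And>j. j < n \<Longrightarrow> (\<lambda>m. s (r m) j) \<longlonglongrightarrow> z j"
proof -
  have b: "bounded ((\<lambda>x. x k) ` range s)" if "k \<in> {..<n}" for k
    using assms[of k] that by (intro bounded_subset[OF bounded_closed_interval[of "-B" B]]) auto
  have "\<forall>d\<subseteq>{..<n}. \<exists>l::nat \<Rightarrow> real. \<exists>r. strict_mono r \<and>
      (\<forall>e>0. eventually (\<lambda>m. \<forall>i\<in>d. dist (s (r m) i) (l i) < e) sequentially)"
    by (rule compact_lemma_general[where proj = "\<lambda>x k. x k" and unproj = "\<lambda>e. e"]) (use b in auto)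
  then obtain l r where r: "strict_mono r" "\<And>e. e > 0 \<Longrightarrow> eventually (\<lambda>m. \<forall>i\<in>{..<n}. dist (s (r m) i) (l i) < e) sequentially"
    by blast
  have "(\<lambda>m. s (r m) j) \<longlonglongrightarrow> l j" if j: "j < n" for j
  proof (rule tendstoI)
    fix e :: real assume "0 < e"
    from r(2)[OF this] show "eventually (\<lambda>m. dist (s (r m) j) (l j) < e) sequentially"
      by eventually_elim (use j in auto)
  qed
  then show thesis using that r(1) by blast
qed

text \<open>Label grid points by the signs of the components. Kuhn's combinatorial lemma finds in
  every grid a cell on whose corners each component shows both signs; as the mesh tends to zero
  these cells accumulate at a common zero.\<close>

lemma poincare_miranda:
  fixes F :: "(nat \<Rightarrow> real) \<Rightarrow> nat \<Rightarrow> real"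
  assumes low: "\<And>z i. (\<And>j. j < n \<Longrightarrow> z j \<in> {-1..1}) \<Longrightarrow> i < n \<Longrightarrow> z i = -1 \<Longrightarrow> F z i < 0"
    and high: "\<And>z i. (\<And>j. j < n \<Longrightarrow> z j \<in> {-1..1}) \<Longrightarrow> i < n \<Longrightarrow> z i = 1 \<Longrightarrow> 0 < F z i"
    and cont: "\<And>s z i. (\<And>m j. j < n \<Longrightarrow> s m j \<in> {-1..1}) \<Longrightarrow> (\<And>j. j < n \<Longrightarrow> (\<lambda>m. s m j) \<longlonglongrightarrow> z j) \<Longrightarrow>
      i < n \<Longrightarrow> (\<lambda>m. F (s m) i) \<longlonglongrightarrow> F z i"
  obtains z where "\<And>j. j < n \<Longrightarrow> z j \<in> {-1..1}" "\<And>i. i < n \<Longrightarrow> F z i = 0"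
proof -
  \<comment> \<open>Sends the integer grid \<open>{0..p}\<close> to the interval from -1 to 1 in
    each coordinate.\<close>
  define g where "g p x j = -1 + 2 * real (x j) / real p" for p :: nat and x :: "nat \<Rightarrow> nat" and j :: nat
  have g_cube: "g p x j \<in> {-1..1}" if "0 < p" "x j \<le> p" for p x j
    using that by (simp add: g_def field_simps)
  define good where "good m q r s \<longleftrightarrow> (\<forall>j<n. q j < Suc m) \<and> (\<forall>i<n. (\<forall>j<n. q j \<le> r i j \<and> r i j \<le> q j + 1) \<and>
      (\<forall>j<n. q j \<le> s i j \<and> s i j \<le> q j + 1) \<and> F (g (Suc m) (r i)) i \<le> 0 \<and> 0 \<le> F (g (Suc m) (s i)) i)"
    for m :: nat and q :: "nat \<Rightarrow> nat" and r s :: "nat \<Rightarrow> nat \<Rightarrow> nat"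
  have "\<exists>q r s. good m q r s" for m
  proof -
    define label where "label x i = (if F (g (Suc m) x) i < 0 then 0 else 1 :: nat)" for x i
    obtain q where q: "\<forall>i<n. q i < Suc m"
      "\<forall>i<n. \<exists>r s. (\<forall>j<n. q j \<le> r j \<and> r j \<le> q j + 1) \<and> (\<forall>j<n. q j \<le> s j \<and> s j \<le> q j + 1) \<and> label r i \<noteq> label s i"
    proof (rule kuhn_lemma[of "Suc m" n label])
      show "\<forall>x. (\<forall>i<n. x i \<le> Suc m) \<longrightarrow> (\<forall>i<n. x i = 0 \<longrightarrow> label x i = 0)"
      proof (intro allI impI)
        fix x i assume x: "\<forall>i<n. x i \<le> Suc m" "i < n" "x i = 0"
        have "g (Suc m) x j \<in> {-1..1}" if "j < n" for j using x that by (intro g_cube) auto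
        then have "F (g (Suc m) x) i < 0" using x(2,3) by (intro low) (auto simp: g_def)
        then show "label x i = 0" by (simp add: label_def)
      qed
      show "\<forall>x. (\<forall>i<n. x i \<le> Suc m) \<longrightarrow> (\<forall>i<n. x i = Suc m \<longrightarrow> label x i = 1)"
      proof (intro allI impI)
        fix x i assume x: "\<forall>i<n. x i \<le> Suc m" "i < n" "x i = Suc m"
        have "g (Suc m) x j \<in> {-1..1}" if "j < n" for j using x that by (intro g_cube) auto
        moreover have "g (Suc m) x i = 1" using x(3) by (simp add: g_def field_simps)
        ultimately have "0 < F (g (Suc m) x) i" using x(2) by (intro high) auto
        then show "label x i = 1" by (simp add: label_def)
      qed
    qed (auto simp: label_def)
    have "\<exists>r s. (\<forall>j<n. q j \<le> r j \<and> r j \<le> q j + 1) \<and>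
      (\<forall>j<n. q j \<le> s j \<and> s j \<le> q j + 1) \<and> F (g (Suc m) r) i \<le> 0 \<and> 0 \<le> F (g (Suc m) s) i" if i: "i < n" for i
    proof -
      obtain r s where rs: "\<forall>j<n. q j \<le> r j \<and> r j \<le> q j + 1" "\<forall>j<n. q j \<le> s j \<and> s j \<le> q j + 1" "label r i \<noteq> label s i"
        using q(2) i by blast
      show ?thesis
      proof (cases "F (g (Suc m) r) i < 0")
        case True
        then have "0 \<le> F (g (Suc m) s) i" using rs(3) by (simp add: label_def split: if_splits)
        then show ?thesis using rs(1,2) True by (intro exI[of _ r] exI[of _ s]) simp
      next
        case False
        then have "F (g (Suc m) s) i < 0" using rs(3) by (simp add: label_def split: if_splits)
        then show ?thesis using rs(1,2) False by (intro exI[of _ s] exI[of _ r]) simp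
      qed
    qed
    then obtain r s where "\<forall>i<n. (\<forall>j<n. q j \<le> r i j \<and> r i j \<le> q j + 1) \<and>
      (\<forall>j<n. q j \<le> s i j \<and> s i j \<le> q j + 1) \<and> F (g (Suc m) (r i)) i \<le> 0 \<and> 0 \<le> F (g (Suc m) (s i)) i"
      by metis
    then show ?thesis using q(1) unfolding good_def by blast
  qed
  then obtain q r s where "\<And>m. good m (q m) (r m) (s m)" by metis
  then have gd: "\<forall>m. good m (q m) (r m) (s m)" by blast
  have q: "\<And>m j. j < n \<Longrightarrow> q m j < Suc m"
    and r: "\<And>m i j. i < n \<Longrightarrow> j < n \<Longrightarrow> q m j \<le> r m i j \<and> r m i j \<le> q m j + 1"
    and s: "\<And>m i j. i < n \<Longrightarrow> j < n \<Longrightarrow> q m j \<le> s m i j \<and> s m i j \<le> q m j + 1"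
    and Fr: "\<And>m i. i < n \<Longrightarrow> F (g (Suc m) (r m i)) i \<le> 0" and Fs: "\<And>m i. i < n \<Longrightarrow> 0 \<le> F (g (Suc m) (s m i)) i"
  proof -
    show "q m j < Suc m" if "j < n" for m j using gd that by (simp add: good_def)
    show "q m j \<le> r m i j \<and> r m i j \<le> q m j + 1" if "i < n" "j < n" for m i j
      using spec[OF gd, of m] that unfolding good_def by blast
    show "q m j \<le> s m i j \<and> s m i j \<le> q m j + 1" if "i < n" "j < n" for m i j
      using spec[OF gd, of m] that unfolding good_def by blast
    show "F (g (Suc m) (r m i)) i \<le> 0" if "i < n" for m i
      using spec[OF gd, of m] that unfolding good_def by blast
    show "0 \<le> F (g (Suc m) (s m i)) i" if "i < n" for m i
      using spec[OF gd, of m] that unfolding good_def by blast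
  qed
  have grid: "g (Suc m) (q m) j \<in> {-1..1}" if "j < n" for m j
    using q[OF that, of m] by (intro g_cube) auto
  obtain z \<sigma> where \<sigma>: "strict_mono \<sigma>" and z: "\<And>j. j < n \<Longrightarrow> (\<lambda>m. g (Suc (\<sigma> m)) (q (\<sigma> m)) j) \<longlonglongrightarrow> z j"
    by (rule finite_coordinates_subsequence[of n "\<lambda>m. g (Suc m) (q m)" 1, OF grid]) auto
  have cube: "z j \<in> {-1..1}" if "j < n" for j
    by (rule closed_sequentially[OF closed_atLeastAtMost grid[OF that] z[OF that]])
  \<comment> \<open>All corners of a cell share its limit, since they are within one mesh width of
    the base corner.\<close>
  have near: "(\<lambda>m. g (Suc (\<sigma> m)) (x (\<sigma> m)) j) \<longlonglongrightarrow> z j"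
    if x: "\<And>m. q m j \<le> x m j \<and> x m j \<le> q m j + 1" and j: "j < n" for x j
  proof -
    have "(\<lambda>m. g (Suc (\<sigma> m)) (x (\<sigma> m)) j - g (Suc (\<sigma> m)) (q (\<sigma> m)) j) \<longlonglongrightarrow> 0"
    proof (rule tendsto_sandwich[of "\<lambda>_. 0" _ _ "\<lambda>m. 2 * inverse (real (Suc (\<sigma> m)))"])
      have "(\<lambda>m. inverse (real (Suc (\<sigma> m)))) \<longlonglongrightarrow> 0"
        using LIMSEQ_subseq_LIMSEQ[OF LIMSEQ_inverse_real_of_nat \<sigma>] by (simp add: comp_def)
      from tendsto_mult_left[OF this, of 2] show "(\<lambda>m. 2 * inverse (real (Suc (\<sigma> m)))) \<longlonglongrightarrow> 0" by simp
      have diff: "g (Suc k) (x k) j - g (Suc k) (q k) j = 2 * (real (x k j) - real (q k j)) * inverse (real (Suc k))" for k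
        by (simp only: g_def divide_inverse left_diff_distrib right_diff_distrib mult.assoc)
      have x': "0 \<le> real (x k j) - real (q k j)" "real (x k j) - real (q k j) \<le> 1" for k
        using x[of k] by linarith+
      have "0 \<le> 2 * (real (x k j) - real (q k j)) * inverse (real (Suc k))"
        "2 * (real (x k j) - real (q k j)) * inverse (real (Suc k)) \<le> 2 * inverse (real (Suc k))" for k
      proof -
        show "0 \<le> 2 * (real (x k j) - real (q k j)) * inverse (real (Suc k))"
          by (intro mult_nonneg_nonneg x'(1)) simp_all
        have "2 * (real (x k j) - real (q k j)) \<le> 2 * 1" by (rule mult_left_mono[OF x'(2)]) simp
        then have "2 * (real (x k j) - real (q k j)) \<le> 2" by (simp only: mult_1_right)
        then show "2 * (real (x k j) - real (q k j)) * inverse (real (Suc k)) \<le> 2 * inverse (real (Suc k))"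
          by (rule mult_right_mono) simp
      qed
      then show "\<forall>\<^sub>F m in sequentially. 0 \<le> g (Suc (\<sigma> m)) (x (\<sigma> m)) j - g (Suc (\<sigma> m)) (q (\<sigma> m)) j"
        "\<forall>\<^sub>F m in sequentially. g (Suc (\<sigma> m)) (x (\<sigma> m)) j - g (Suc (\<sigma> m)) (q (\<sigma> m)) j \<le> 2 * inverse (real (Suc (\<sigma> m)))"
        unfolding diff by (intro always_eventually allI; blast)+
    qed simp
    from tendsto_add[OF this z[OF j]] show ?thesis by simp
  qed
  show thesis
  proof (rule that[of z])
    fix i assume i: "i < n"
    have le: "x m j \<le> Suc m" if "\<And>m. q m j \<le> x m j \<and> x m j \<le> q m j + 1" "j < n" for x m j
      using that(1)[of m] q[OF that(2), of m] by simp
    have "(\<lambda>m. F (g (Suc (\<sigma> m)) (r (\<sigma> m) i)) i) \<longlonglongrightarrow> F z i"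
      by (rule cont[OF g_cube near[of _ "\<lambda>m. r m i"] i]) (use le[of _ "\<lambda>m. r m i"] r i in auto)
    then have 1: "F z i \<le> 0" by (rule LIMSEQ_le_const2) (use Fr i in auto)
    have "(\<lambda>m. F (g (Suc (\<sigma> m)) (s (\<sigma> m) i)) i) \<longlonglongrightarrow> F z i"
      by (rule cont[OF g_cube near[of _ "\<lambda>m. s m i"] i]) (use le[of _ "\<lambda>m. s m i"] s i in auto)
    then have 2: "0 \<le> F z i" by (rule LIMSEQ_le_const) (use Fs i in auto)
    show "F z i = 0" using 1 2 by simp
  qed (use cube in auto)
qed

text \<open>The strength of Hadamard over Gateaux differentiability: directions may vary, so the
  expansion is uniform over a compact set of directions and small perturbations of them. A failing
  sequence would have a convergent subsequence of directions.\<close>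

lemma hadamard_uniform:
  fixes \<phi> :: "'a::real_normed_vector \<Rightarrow> 'b::real_normed_vector"
  assumes \<phi>: "has_hadamard_deriv \<phi> D x" and K: "compact K" and \<eta>: "0 < \<eta>"
  shows "\<exists>\<delta>>0. \<forall>\<theta> v w. 0 < \<theta> \<longrightarrow> \<theta> < \<delta> \<longrightarrow> v \<in> K \<longrightarrow> norm (w - v) < \<delta> \<longrightarrow>
    norm (\<phi> (x + \<theta> *\<^sub>R w) - \<phi> x - \<theta> *\<^sub>R D v) \<le> \<eta> * \<theta>"
proof (rule ccontr)
  assume neg: "\<not> ?thesis"
  have "\<exists>\<theta> v w. 0 < \<theta> \<and> \<theta> < 1 / real (Suc n) \<and> v \<in> K \<and> norm (w - v) < 1 / real (Suc n) \<and>
    \<eta> * \<theta> < norm (\<phi> (x + \<theta> *\<^sub>R w) - \<phi> x - \<theta> *\<^sub>R D v)" for n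
  proof -
    have "0 < 1 / real (Suc n)" by simp
    then show ?thesis using neg by (meson not_le)
  qed
  then obtain \<theta> v w where \<theta>: "\<And>n. 0 < \<theta> n" "\<And>n. \<theta> n < 1 / real (Suc n)" and v: "\<And>n. v n \<in> K"
    and w: "\<And>n. norm (w n - v n) < 1 / real (Suc n)"
    and big: "\<And>n. \<eta> * \<theta> n < norm (\<phi> (x + \<theta> n *\<^sub>R w n) - \<phi> x - \<theta> n *\<^sub>R D (v n))"
    by metis
  obtain l r where r: "strict_mono r" "(v \<circ> r) \<longlonglongrightarrow> l"
    using K v unfolding compact_def by metis
  have inv: "(\<lambda>n. 1 / real (Suc (r n))) \<longlonglongrightarrow> 0"
    using LIMSEQ_subseq_LIMSEQ[OF LIMSEQ_inverse_real_of_nat r(1)] by (simp add: comp_def inverse_eq_divide)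
  have \<theta>0: "(\<lambda>n. \<theta> (r n)) \<longlonglongrightarrow> 0"
    by (rule tendsto_sandwich[OF _ _ _ inv, of "\<lambda>_. 0"])
      (use less_imp_le[OF \<theta>(1)] less_imp_le[OF \<theta>(2)] in auto)
  have "(\<lambda>n. w (r n) - v (r n)) \<longlonglongrightarrow> 0"
    by (rule Lim_null_comparison[OF _ inv]) (use less_imp_le[OF w] in auto)
  from tendsto_add[OF this r(2)[unfolded comp_def]] have wl: "(\<lambda>n. w (r n)) \<longlonglongrightarrow> l" by simp
  have "filterlim (\<lambda>n. (\<theta> (r n), w (r n))) (at_right 0 \<times>\<^sub>F nhds l) sequentially"
    using wl tendsto_imp_filterlim_at_right[OF \<theta>0] \<theta>(1) by (intro filterlim_Pair) auto
  then have "(\<lambda>n. (\<phi> (x + \<theta> (r n) *\<^sub>R w (r n)) - \<phi> x) /\<^sub>R \<theta> (r n)) \<longlonglongrightarrow> D l"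
    using \<phi> filterlim_compose[of "\<lambda>(\<theta>, w). (\<phi> (x + \<theta> *\<^sub>R w) - \<phi> x) /\<^sub>R \<theta>" "nhds (D l)"]
    unfolding has_hadamard_deriv_def by fastforce
  moreover have "(\<lambda>n. D (v (r n))) \<longlonglongrightarrow> D l"
    using r(2)[unfolded comp_def] by (intro blinfun.tendsto tendsto_const)
  ultimately have "(\<lambda>n. norm ((\<phi> (x + \<theta> (r n) *\<^sub>R w (r n)) - \<phi> x) /\<^sub>R \<theta> (r n) - D (v (r n)))) \<longlonglongrightarrow> norm (D l - D l)"
    by (intro tendsto_norm tendsto_diff)
  moreover have "\<eta> \<le> norm ((\<phi> (x + \<theta> n *\<^sub>R w n) - \<phi> x) /\<^sub>R \<theta> n - D (v n))" for n
  proof -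
    have "(\<phi> (x + \<theta> n *\<^sub>R w n) - \<phi> x) /\<^sub>R \<theta> n - D (v n) = (\<phi> (x + \<theta> n *\<^sub>R w n) - \<phi> x - \<theta> n *\<^sub>R D (v n)) /\<^sub>R \<theta> n"
      using \<theta>(1)[of n] by (simp add: scaleR_diff_right)
    moreover have "norm (Z /\<^sub>R \<theta> n) = norm Z / \<theta> n" for Z :: 'b
      using \<theta>(1)[of n] by (simp add: divide_inverse mult.commute)
    ultimately show ?thesis using less_imp_le[OF big[of n]] \<theta>(1)[of n] by (simp only: pos_le_divide_eq)
  qed
  ultimately have "\<eta> \<le> norm (D l - D l)" by (intro LIMSEQ_le_const) auto
  then show False using \<eta> by simp
qed

text \<open>After division by the total width the first-order displacement is a convex combination
  of the vectors \<open>w k\<close>. Hence it ranges over a compact set however the widths are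
  distributed, and the remainder of \<open>y\<close> is a small perturbation of the
  direction.\<close>

lemma hadamard_expansion:
  fixes \<phi> :: "'e::real_normed_vector \<Rightarrow> real" and y :: "(nat \<Rightarrow> real) \<Rightarrow> 'e"
  assumes \<phi>: "has_hadamard_deriv \<phi> D x" and \<eta>: "0 < \<eta>"
    and y: "\<And>\<eta>. 0 < \<eta> \<Longrightarrow> \<exists>\<delta>>0. \<forall>a. (\<forall>k<N. 0 \<le> a k) \<longrightarrow> sum a {..<N} \<le> r \<longrightarrow> sum a {..<N} \<le> \<delta> \<longrightarrow>
       norm (y a - x - (\<Sum>k<N. a k *\<^sub>R w k)) \<le> \<eta> * sum a {..<N}"
  shows "\<exists>\<delta>>0. \<forall>a. (\<forall>k<N. 0 \<le> a k) \<longrightarrow> sum a {..<N} \<le> r \<longrightarrow> sum a {..<N} \<le> \<delta> \<longrightarrow>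
       \<bar>\<phi> (y a) - \<phi> x - (\<Sum>k<N. a k * D (w k))\<bar> \<le> \<eta> * sum a {..<N}"
proof -
  define K where "K = convex hull (w ` {..<N})"
  have K: "compact K" unfolding K_def by (intro finite_imp_compact_convex_hull) simp
  obtain \<delta>1 where \<delta>1: "\<delta>1 > 0" "\<And>\<theta> v u. 0 < \<theta> \<Longrightarrow> \<theta> < \<delta>1 \<Longrightarrow> v \<in> K \<Longrightarrow> norm (u - v) < \<delta>1 \<Longrightarrow>
      norm (\<phi> (x + \<theta> *\<^sub>R u) - \<phi> x - \<theta> *\<^sub>R D v) \<le> \<eta> * \<theta>"
    using hadamard_uniform[OF \<phi> K \<eta>] by blast
  obtain \<delta>2 where \<delta>2: "\<delta>2 > 0" "\<And>a. (\<forall>k<N. 0 \<le> a k) \<Longrightarrow> sum a {..<N} \<le> r \<Longrightarrow> sum a {..<N} \<le> \<delta>2 \<Longrightarrow>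
      norm (y a - x - (\<Sum>k<N. a k *\<^sub>R w k)) \<le> \<delta>1 / 2 * sum a {..<N}"
    using y[of "\<delta>1 / 2"] \<delta>1(1) by auto
  show ?thesis
  proof (intro exI[of _ "min (\<delta>1 / 2) \<delta>2"] conjI allI impI)
    fix a assume a: "\<forall>k<N. 0 \<le> a k" "sum a {..<N} \<le> r" "sum a {..<N} \<le> min (\<delta>1 / 2) \<delta>2"
    define \<sigma> where "\<sigma> = sum a {..<N}"
    have e: "norm (y a - x - (\<Sum>k<N. a k *\<^sub>R w k)) \<le> \<delta>1 / 2 * \<sigma>" using \<delta>2(2)[OF a(1,2)] a(3) by (simp add: \<sigma>_def)
    show "\<bar>\<phi> (y a) - \<phi> x - (\<Sum>k<N. a k * D (w k))\<bar> \<le> \<eta> * sum a {..<N}"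
    proof (cases "\<sigma> = 0")
      case True
      then have "\<forall>k<N. a k = 0" using sum_nonneg_eq_0_iff[of "{..<N}" a] a(1) by (auto simp: \<sigma>_def)
      moreover from this have "y a = x" using e True by simp
      ultimately show ?thesis using True by (simp add: \<sigma>_def)
    next
      case False
      then have \<sigma>: "0 < \<sigma>" using sum_nonneg[of "{..<N}" a] a(1) by (simp add: \<sigma>_def less_le)
      define v where "v = (\<Sum>k<N. (a k / \<sigma>) *\<^sub>R w k)"
      define u where "u = (y a - x) /\<^sub>R \<sigma>"
      have v: "v \<in> K" unfolding v_def K_def
        by (rule convex_sum) (use a(1) \<sigma> in \<open>auto simp: \<sigma>_def sum_divide_distrib[symmetric] intro: hull_inc convex_convex_hull\<close>)
      have \<sigma>v: "\<sigma> *\<^sub>R v = (\<Sum>k<N. a k *\<^sub>R w k)" using \<sigma> by (simp add: v_def scaleR_sum_right)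
      have "\<sigma> *\<^sub>R (u - v) = y a - x - (\<Sum>k<N. a k *\<^sub>R w k)" using \<sigma> \<sigma>v by (simp add: u_def scaleR_diff_right)
      then have "\<sigma> * norm (u - v) \<le> \<delta>1 / 2 * \<sigma>" using e \<sigma> by (metis abs_of_pos norm_scaleR)
      then have "norm (u - v) \<le> \<delta>1 / 2" using \<sigma> by (simp add: mult.commute)
      then have "norm (\<phi> (x + \<sigma> *\<^sub>R u) - \<phi> x - \<sigma> *\<^sub>R D v) \<le> \<eta> * \<sigma>"
        using \<delta>1 a(3) \<sigma> v by (intro \<delta>1(2)) (auto simp: \<sigma>_def)
      moreover have "\<sigma> *\<^sub>R D v = (\<Sum>k<N. a k * D (w k))"
        unfolding blinfun.scaleR_right[symmetric] \<sigma>v by (simp add: blinfun.sum_right blinfun.scaleR_right)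
      moreover have "x + \<sigma> *\<^sub>R u = y a" using \<sigma> by (simp add: u_def)
      ultimately show ?thesis by (simp add: \<sigma>_def)
    qed
  qed (use \<delta>1 \<delta>2 in auto)
qed

text \<open>Balls are not compact, so bounds on compact sets must be spread to a neighbourhood.
  Points approaching \<open>K\<close> on which the bounds fail would form, together with their
  limit, a compact set violating the assumption.\<close>

lemma bounded_near_compact:
  fixes f :: "'t \<Rightarrow> 'a::metric_space \<Rightarrow> real"
  assumes K: "compact K" and O: "open W" "K \<subseteq> W"
    and bdd: "\<And>K'. compact K' \<Longrightarrow> K' \<noteq> {} \<Longrightarrow> K' \<subseteq> W \<Longrightarrow> \<exists>B. \<forall>t\<in>I. \<forall>y\<in>K'. f t y \<le> B"
  shows "\<exists>\<epsilon>>0. \<exists>B. \<forall>k\<in>K. \<forall>y. dist y k < \<epsilon> \<longrightarrow> y \<in> W \<and> (\<forall>t\<in>I. f t y \<le> B)"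
proof (rule ccontr)
  assume neg: "\<not> ?thesis"
  have "\<exists>k y. k \<in> K \<and> dist y k < 1 / real (Suc n) \<and> \<not> (y \<in> W \<and> (\<forall>t\<in>I. f t y \<le> real n))" for n
  proof -
    have "0 < 1 / real (Suc n)" by simp
    then show ?thesis using neg by (meson not_le)
  qed
  then obtain k y where k: "\<And>n. k n \<in> K" and y: "\<And>n. dist (y n) (k n) < 1 / real (Suc n)"
    and bad: "\<And>n. \<not> (y n \<in> W \<and> (\<forall>t\<in>I. f t (y n) \<le> real n))"
    by metis
  obtain l r where l: "l \<in> K" and r: "strict_mono r" "(k \<circ> r) \<longlonglongrightarrow> l"
    using K k unfolding compact_def by metis
  have inv: "(\<lambda>n. 1 / real (Suc (r n))) \<longlonglongrightarrow> 0"
    using LIMSEQ_subseq_LIMSEQ[OF LIMSEQ_inverse_real_of_nat r(1)] by (simp add: comp_def inverse_eq_divide)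
  have "(\<lambda>n. dist (k (r n)) l + 1 / real (Suc (r n))) \<longlonglongrightarrow> 0 + 0"
    using r(2) inv by (intro tendsto_add) (auto simp: tendsto_dist_iff[of _ l] comp_def)
  then have up: "(\<lambda>n. dist (k (r n)) l + 1 / real (Suc (r n))) \<longlonglongrightarrow> 0" by simp
  have "(\<lambda>n. dist (y (r n)) l) \<longlonglongrightarrow> 0"
  proof (rule tendsto_sandwich[OF _ _ tendsto_const up])
    have "dist (y (r n)) l \<le> dist (k (r n)) l + 1 / real (Suc (r n))" for n
      using dist_triangle[of "y (r n)" l "k (r n)"] y[of "r n"] by linarith
    then show "\<forall>\<^sub>F n in sequentially. dist (y (r n)) l \<le> dist (k (r n)) l + 1 / real (Suc (r n))" by simp
  qed simp
  then have yl: "(\<lambda>n. y (r n)) \<longlonglongrightarrow> l" by (simp add: tendsto_dist_iff[of _ l])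
  have "eventually (\<lambda>n. y (r n) \<in> W) sequentially" using yl O l by (intro topological_tendstoD) auto
  \<comment> \<open>Only the tail is used: early points of the sequence may lie outside
    \<open>W\<close>, where no bound is assumed.\<close>
  then obtain n0 where n0: "\<And>n. n0 \<le> n \<Longrightarrow> y (r n) \<in> W" by (auto simp: eventually_sequentially)
  define K' where "K' = insert l (range (\<lambda>n. y (r (n + n0))))"
  have "(\<lambda>n. y (r (n + n0))) \<longlonglongrightarrow> l" using LIMSEQ_ignore_initial_segment[OF yl] .
  then have "compact K'" unfolding K'_def
    using compactin_sequence_with_limit[of euclidean "\<lambda>n. y (r (n + n0))" l] by simp
  then obtain B where B: "\<And>t y. t \<in> I \<Longrightarrow> y \<in> K' \<Longrightarrow> f t y \<le> B"
  proof -
    have "K' \<subseteq> W" using n0 l O by (auto simp: K'_def)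
    then show thesis using bdd[OF \<open>compact K'\<close>] that by (auto simp: K'_def)
  qed
  obtain n where n: "B \<le> real n" using real_arch_simple by blast
  have "real n \<le> real (r (n + n0))" using seq_suble[OF r(1), of "n + n0"] by linarith
  then have "f t (y (r (n + n0))) \<le> real (r (n + n0))" if "t \<in> I" for t
    using B[OF that, of "y (r (n + n0))"] n by (auto simp: K'_def)
  then show False using bad[of "r (n + n0)"] n0[of "n + n0"] by auto
qed

text \<open>Restricted to a segment, a Gateaux differentiable map has an ordinary two-sided
  derivative, and the mean value inequality applies.\<close>

lemma gateaux_lipschitz:
  fixes \<phi> :: "'a::real_normed_vector \<Rightarrow> 'b::real_normed_vector"
  assumes C: "convex C" and d: "\<And>\<xi>. \<xi> \<in> C \<Longrightarrow> gateaux_differentiable \<phi> \<xi>"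
    and B: "\<And>\<xi>. \<xi> \<in> C \<Longrightarrow> norm (gateaux_deriv \<phi> \<xi>) \<le> B" and xy: "\<xi> \<in> C" "\<eta> \<in> C"
  shows "norm (\<phi> \<xi> - \<phi> \<eta>) \<le> B * norm (\<xi> - \<eta>)"
proof -
  define v where "v = \<xi> - \<eta>"
  define \<psi> where "\<psi> s = \<phi> (\<eta> + s *\<^sub>R v)" for s :: real
  have inC: "\<eta> + s *\<^sub>R v \<in> C" if "s \<in> {0..1}" for s
    using convexD_alt[OF C xy(2,1), of s] that by (simp add: v_def algebra_simps)
  define L where "L s = gateaux_deriv \<phi> (\<eta> + s *\<^sub>R v)" for s
  have "(\<psi> has_derivative (\<lambda>h. h *\<^sub>R L s v)) (at s within {0..1})" if s: "s \<in> {0..1}" for s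
  proof -
    have "has_gateaux_deriv \<phi> (L s) (\<eta> + s *\<^sub>R v)"
      using d[OF inC[OF s]] gateaux_deriv_eq unfolding gateaux_differentiable_def L_def by metis
    then have g: "((\<lambda>\<theta>. (\<phi> (\<eta> + s *\<^sub>R v + \<theta> *\<^sub>R c) - \<phi> (\<eta> + s *\<^sub>R v)) /\<^sub>R \<theta>) \<longlongrightarrow> L s c) (at_right 0)" for c
      by (simp add: has_gateaux_deriv_def has_right_gateaux_variation_def)
    have "((\<lambda>h. (\<psi> (s + h) - \<psi> s) /\<^sub>R h) \<longlongrightarrow> L s v) (at 0)"
      unfolding filterlim_at_split
    proof
      show "((\<lambda>h. (\<psi> (s + h) - \<psi> s) /\<^sub>R h) \<longlongrightarrow> L s v) (at_right 0)"
        using g[of v] by (simp add: \<psi>_def algebra_simps)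
      \<comment> \<open>Left quotients are the negatives of right quotients in the direction
        \<open>- v\<close>; linearity of \<open>L s\<close> makes both limits agree.\<close>
      have "((\<lambda>\<theta>. - ((\<phi> (\<eta> + s *\<^sub>R v + \<theta> *\<^sub>R (- v)) - \<phi> (\<eta> + s *\<^sub>R v)) /\<^sub>R \<theta>)) \<longlongrightarrow> - L s (- v)) (at_right 0)"
        by (intro tendsto_minus g)
      then show "((\<lambda>h. (\<psi> (s + h) - \<psi> s) /\<^sub>R h) \<longlongrightarrow> L s v) (at_left 0)"
        unfolding filterlim_at_left_to_right[of _ _ "0::real"]
        by (simp add: \<psi>_def algebra_simps blinfun.minus_right)
    qed
    then have "((\<lambda>h. norm ((\<psi> (s + h) - \<psi> s) /\<^sub>R h - L s v)) \<longlongrightarrow> norm (L s v - L s v)) (at 0)"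
      by (intro tendsto_intros)
    moreover have "eventually (\<lambda>h. norm ((\<psi> (s + h) - \<psi> s) /\<^sub>R h - L s v) = norm (\<psi> (s + h) - \<psi> s - h *\<^sub>R L s v) / norm h) (at 0)"
    proof (rule eventually_at_topological[THEN iffD2], intro exI[of _ UNIV] conjI ballI impI)
      fix h :: real assume h: "h \<noteq> 0"
      have "(\<psi> (s + h) - \<psi> s) /\<^sub>R h - L s v = (\<psi> (s + h) - \<psi> s - h *\<^sub>R L s v) /\<^sub>R h"
        using h by (simp add: scaleR_diff_right)
      then show "norm ((\<psi> (s + h) - \<psi> s) /\<^sub>R h - L s v) = norm (\<psi> (s + h) - \<psi> s - h *\<^sub>R L s v) / norm h"
        by (simp add: divide_inverse mult.commute)
    qed auto
    ultimately have "((\<lambda>h. norm (\<psi> (s + h) - \<psi> s - h *\<^sub>R L s v) / norm h) \<longlongrightarrow> 0) (at 0)"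
      by (simp add: tendsto_cong)
    then have "(\<psi> has_vector_derivative L s v) (at s)"
      by (simp add: has_vector_derivative_def has_derivative_at bounded_linear_scaleR_left)
    then show ?thesis by (simp add: has_vector_derivative_def has_derivative_at_withinI)
  qed
  then have "norm (\<psi> 1 - \<psi> 0) \<le> (B * norm v) * norm (1 - 0 :: real)"
  proof (rule differentiable_bound[of "{0..1}", rotated 1])
    fix s :: real assume s: "s \<in> {0..1}"
    have "norm (L s v) \<le> B * norm v"
      using norm_blinfun[of "L s" v] mult_right_mono[OF B[OF inC[OF s]] norm_ge_zero[of v]] by (simp add: L_def)
    then show "onorm (\<lambda>h. h *\<^sub>R L s v) \<le> B * norm v"
      by (intro onorm_le) (simp add: mult.commute mult_left_mono)
  qed auto
  then show ?thesis by (simp add: \<psi>_def v_def)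
qed

text \<open>
  If there were no multipliers, Farkas' lemma would give a direction strictly increasing the
  objective and the active constraints while fixing the equality constraints to first order,
  together with directions moving each equality constraint alone.  Poincare-Miranda, applied to a
  small simplex of such steps, then corrects the equality constraints exactly.
\<close>

lemma fritz_john:
  fixes G H :: "nat \<Rightarrow> (nat \<Rightarrow> real) \<Rightarrow> real" and dG dH :: "nat \<Rightarrow> nat \<Rightarrow> real" and \<gamma> :: "nat \<Rightarrow> real"
  assumes r: "0 < r"
    and G: "\<And>i \<eta>. i \<in> {0..m} \<Longrightarrow> 0 < \<eta> \<Longrightarrow> \<exists>\<delta>>0. \<forall>a. (\<forall>k<N. 0 \<le> a k) \<longrightarrow> sum a {..<N} \<le> r \<longrightarrow>
      sum a {..<N} \<le> \<delta> \<longrightarrow> \<bar>G i a - \<gamma> i - (\<Sum>k<N. a k * dG i k)\<bar> \<le> \<eta> * sum a {..<N}"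
    and H: "\<And>j \<eta>. j \<in> {1..q} \<Longrightarrow> 0 < \<eta> \<Longrightarrow> \<exists>\<delta>>0. \<forall>a. (\<forall>k<N. 0 \<le> a k) \<longrightarrow> sum a {..<N} \<le> r \<longrightarrow>
      sum a {..<N} \<le> \<delta> \<longrightarrow> \<bar>H j a - (\<Sum>k<N. a k * dH j k)\<bar> \<le> \<eta> * sum a {..<N}"
    and cont: "\<And>j. j \<in> {1..q} \<Longrightarrow> \<exists>\<rho>>0. \<forall>s a. (\<forall>n. (\<forall>k<N. 0 \<le> s n k) \<and> sum (s n) {..<N} \<le> \<rho>) \<longrightarrow>
      (\<forall>k<N. 0 \<le> a k) \<longrightarrow> sum a {..<N} \<le> \<rho> \<longrightarrow> (\<forall>k<N. (\<lambda>n. s n k) \<longlonglongrightarrow> a k) \<longrightarrow> (\<lambda>n::nat. H j (s n)) \<longlonglongrightarrow> H j a"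
    and feasible: "\<And>i. i \<in> {1..m} \<Longrightarrow> 0 \<le> \<gamma> i"
    and opt: "\<And>a. (\<And>k. k < N \<Longrightarrow> 0 \<le> a k) \<Longrightarrow> sum a {..<N} \<le> r \<Longrightarrow> (\<And>i. i \<in> {1..m} \<Longrightarrow> 0 \<le> G i a) \<Longrightarrow>
      (\<And>j. j \<in> {1..q} \<Longrightarrow> H j a = 0) \<Longrightarrow> G 0 a \<le> \<gamma> 0"
  shows "\<exists>lam mu. (\<forall>i\<in>{0..m}. 0 \<le> lam i) \<and> (\<forall>i\<in>{1..m}. lam i * \<gamma> i = 0) \<and>
    ((\<exists>i\<in>{0..m}. lam i \<noteq> 0) \<or> (\<exists>j\<in>{1..q}. mu j \<noteq> 0)) \<and>
    (\<forall>k<N. (\<Sum>i=0..m. lam i * dG i k) + (\<Sum>j=1..q. mu j * dH j k) \<le> 0)"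
proof (rule ccontr)
  assume neg: "\<not> ?thesis"
  \<comment> \<open>The objective, index 0, is treated as always active: it too must increase
    strictly for a contradiction.\<close>
  define Act where "Act = {i \<in> {0..m}. i = 0 \<or> \<gamma> i = 0}"
  have Act: "finite Act" "0 \<in> Act" "Act \<subseteq> {0..m}" by (auto simp: Act_def)
  have none: "(\<forall>i\<in>Act. y i = 0) \<and> (\<forall>j\<in>{1..q}. z j = 0)"
    if y: "\<And>i. i \<in> Act \<Longrightarrow> 0 \<le> y i"
      and yz: "\<And>k. k \<in> {..<N} \<Longrightarrow> (\<Sum>i\<in>Act. y i * dG i k) + (\<Sum>j\<in>{1..q}. z j * dH j k) \<le> 0" for y z :: "nat \<Rightarrow> real"
  proof -
    define lam where "lam i = (if i \<in> Act then y i else 0)" for i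
    have s: "(\<Sum>i=0..m. lam i * dG i k) = (\<Sum>i\<in>Act. y i * dG i k)" for k
      using Act by (intro sum.mono_neutral_cong_right) (auto simp: lam_def)
    have "\<not> ((\<exists>i\<in>{0..m}. lam i \<noteq> 0) \<or> (\<exists>j\<in>{1..q}. z j \<noteq> 0))"
    proof
      assume nz: "(\<exists>i\<in>{0..m}. lam i \<noteq> 0) \<or> (\<exists>j\<in>{1..q}. z j \<noteq> 0)"
      have 1: "\<forall>i\<in>{0..m}. 0 \<le> lam i" using y by (simp add: lam_def)
      have 2: "\<forall>i\<in>{1..m}. lam i * \<gamma> i = 0" by (auto simp: lam_def Act_def)
      have 3: "\<forall>k<N. (\<Sum>i=0..m. lam i * dG i k) + (\<Sum>j=1..q. z j * dH j k) \<le> 0" unfolding s using yz by auto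
      show False by (rule notE[OF neg]) (intro exI[of _ lam] exI[of _ z] conjI 1 2 3 nz)
    qed
    then have nz: "\<And>i. i \<in> {0..m} \<Longrightarrow> lam i = 0" "\<And>j. j \<in> {1..q} \<Longrightarrow> z j = 0" by auto
    have "y i = 0" if "i \<in> Act" for i using nz(1)[of i] Act(3) that by (auto simp: lam_def)
    then show ?thesis using nz(2) by blast
  qed
  have "\<exists>c. (\<forall>k<N. 0 \<le> c k) \<and> (\<forall>i\<in>Act. b i \<le> (\<Sum>k<N. c k * dG i k)) \<and> (\<forall>j\<in>{1..q}. d j = (\<Sum>k<N. c k * dH j k))"
    for b d :: "nat \<Rightarrow> real"
  proof -
    obtain c where "\<And>k. k \<in> {..<N} \<Longrightarrow> 0 \<le> c k" "\<And>i. i \<in> Act \<Longrightarrow> b i \<le> (\<Sum>k\<in>{..<N}. c k * dG i k)"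
      "\<And>j. j \<in> {1..q} \<Longrightarrow> d j = (\<Sum>k\<in>{..<N}. c k * dH j k)"
      using farkas_mixed[of "{..<N}" Act "{1..q}" "\<lambda>k i. dG i k" "\<lambda>k j. dH j k" b d, OF _ Act(1) _ none] by auto
    then show ?thesis by (intro exI[of _ c]) simp
  qed
  then obtain C where C: "\<And>b d k. k < N \<Longrightarrow> 0 \<le> C b d k"
    "\<And>b d i. i \<in> Act \<Longrightarrow> b i \<le> (\<Sum>k<N. C b d k * dG i k)"
    "\<And>b d j. j \<in> {1..q} \<Longrightarrow> (\<Sum>k<N. C b d k * dH j k) = d j"
    by metis
  \<comment> \<open>\<open>\<alpha>\<close> raises all active functions at rate at least 1 without
    moving the equalities. \<open>bp l\<close> and \<open>bm l\<close> move the equality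
    \<open>l\<close> alone, up and down, without lowering any active function. Two families are
    needed because widths must be nonnegative: \<open>A z\<close> combines them with the positive
    and negative parts of \<open>z\<close>.\<close>
  define \<alpha> where "\<alpha> = C (\<lambda>_. 1) (\<lambda>_. 0)"
  define bp where "bp l = C (\<lambda>_. 0) (\<lambda>j. if l = j then 1 else 0)" for l
  define bm where "bm l = C (\<lambda>_. 0) (\<lambda>j. if l = j then -1 else 0)" for l
  define A where "A z k = \<alpha> k + (\<Sum>l=1..q. max 0 (z l) * bp l k + max 0 (- z l) * bm l k)" for z k
  \<comment> \<open>A bound for the total width over the whole cube; the 1 makes it a safe
    divisor.\<close>
  define S where "S = sum \<alpha> {..<N} + (\<Sum>l=1..q. sum (bp l) {..<N} + sum (bm l) {..<N}) + 1"
  have nn: "0 \<le> \<alpha> k" "0 \<le> bp l k" "0 \<le> bm l k" if "k < N" for k l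
    using C(1)[OF that] by (simp_all add: \<alpha>_def bp_def bm_def)
  have A0: "0 \<le> A z k" if "k < N" for z k
    unfolding A_def using nn[OF that] by (intro add_nonneg_nonneg sum_nonneg) auto
  have S: "1 \<le> S" unfolding S_def using nn by (auto intro!: add_nonneg_nonneg sum_nonneg)
  have A_sum: "(\<Sum>k<N. A z k * d k) = (\<Sum>k<N. \<alpha> k * d k) +
      (\<Sum>l=1..q. max 0 (z l) * (\<Sum>k<N. bp l k * d k) + max 0 (- z l) * (\<Sum>k<N. bm l k * d k))" for z d
  proof -
    have "(\<Sum>k<N. A z k * d k) = (\<Sum>k<N. \<alpha> k * d k) + (\<Sum>k<N. \<Sum>l=1..q. max 0 (z l) * bp l k * d k + max 0 (- z l) * bm l k * d k)"
      by (simp add: A_def distrib_right sum.distrib sum_distrib_right)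
    also have "(\<Sum>k<N. \<Sum>l=1..q. max 0 (z l) * bp l k * d k + max 0 (- z l) * bm l k * d k) =
        (\<Sum>l=1..q. \<Sum>k<N. max 0 (z l) * bp l k * d k + max 0 (- z l) * bm l k * d k)"
      by (rule sum.swap)
    finally show ?thesis by (simp add: sum.distrib sum_distrib_left mult.assoc)
  qed
  have AS: "sum (A z) {..<N} \<le> S" if z: "\<And>l. l \<in> {1..q} \<Longrightarrow> z l \<in> {-1..1}" for z
  proof -
    have "sum (A z) {..<N} = sum \<alpha> {..<N} + (\<Sum>l=1..q. max 0 (z l) * sum (bp l) {..<N} + max 0 (- z l) * sum (bm l) {..<N})"
      using A_sum[of z "\<lambda>_. 1"] by simp
    also have "\<dots> \<le> sum \<alpha> {..<N} + (\<Sum>l=1..q. 1 * sum (bp l) {..<N} + 1 * sum (bm l) {..<N})"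
      using z nn by (intro add_left_mono sum_mono add_mono mult_right_mono sum_nonneg) force+
    finally show ?thesis by (simp add: S_def)
  qed
  have AH: "(\<Sum>k<N. A z k * dH j k) = z j" if j: "j \<in> {1..q}" for z j
  proof -
    have "(\<Sum>k<N. A z k * dH j k) = (\<Sum>l=1..q. if l = j then max 0 (z l) - max 0 (- z l) else 0)"
      unfolding A_sum \<alpha>_def bp_def bm_def C(3)[OF j] add_0 by (intro sum.cong) auto
    also have "\<dots> = max 0 (z j) - max 0 (- z j)" using j by simp
    finally show ?thesis by (simp add: max_def)
  qed
  have AG: "1 \<le> (\<Sum>k<N. A z k * dG i k)" if i: "i \<in> Act" for z i
  proof -
    have "0 \<le> (\<Sum>l=1..q. max 0 (z l) * (\<Sum>k<N. bp l k * dG i k) + max 0 (- z l) * (\<Sum>k<N. bm l k * dG i k))"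
    proof (rule sum_nonneg)
      fix l
      have "0 \<le> (\<Sum>k<N. bp l k * dG i k)" "0 \<le> (\<Sum>k<N. bm l k * dG i k)"
        using C(2)[OF i, of "\<lambda>_. 0"] by (auto simp: bp_def bm_def)
      then show "0 \<le> max 0 (z l) * (\<Sum>k<N. bp l k * dG i k) + max 0 (- z l) * (\<Sum>k<N. bm l k * dG i k)"
        by simp
    qed
    then show ?thesis unfolding A_sum using C(2)[OF i, of "\<lambda>_. 1" "\<lambda>_. 0"] by (simp add: \<alpha>_def)
  qed
  \<comment> \<open>With this choice every expansion error at scale \<open>\<theta>\<close> is at
    most \<open>\<theta> / 2\<close>, half of the rate at which the active functions grow and of the
    values of the equalities on the faces of the cube.\<close>
  define \<eta> where "\<eta> = 1 / (2 * S)"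
  have \<eta>: "0 < \<eta>" "\<eta> * S = 1 / 2" using S by (simp_all add: \<eta>_def)
  have "\<exists>\<delta>>0. \<forall>i<Suc m. \<forall>a. (\<forall>k<N. 0 \<le> a k) \<longrightarrow> sum a {..<N} \<le> r \<longrightarrow> sum a {..<N} \<le> \<delta> \<longrightarrow>
      \<bar>G i a - \<gamma> i - (\<Sum>k<N. a k * dG i k)\<bar> \<le> \<eta> * sum a {..<N}"
  proof (rule finite_common_radius)
    fix i assume "i < Suc m"
    then obtain d where "d > 0" "\<forall>a. (\<forall>k<N. 0 \<le> a k) \<longrightarrow> sum a {..<N} \<le> r \<longrightarrow>
      sum a {..<N} \<le> d \<longrightarrow> \<bar>G i a - \<gamma> i - (\<Sum>k<N. a k * dG i k)\<bar> \<le> \<eta> * sum a {..<N}"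
      using G[of i \<eta>] \<eta> by auto
    then show "\<exists>d>0. \<forall>d'. 0 < d' \<longrightarrow> d' \<le> d \<longrightarrow> (\<forall>a. (\<forall>k<N. 0 \<le> a k) \<longrightarrow> sum a {..<N} \<le> r \<longrightarrow> sum a {..<N} \<le> d' \<longrightarrow>
      \<bar>G i a - \<gamma> i - (\<Sum>k<N. a k * dG i k)\<bar> \<le> \<eta> * sum a {..<N})"
      by (intro exI[of _ d]) auto
  qed
  then obtain \<delta>1 where \<delta>1: "\<delta>1 > 0" "\<And>i a. i \<in> {0..m} \<Longrightarrow> (\<forall>k<N. 0 \<le> a k) \<Longrightarrow> sum a {..<N} \<le> r \<Longrightarrow> sum a {..<N} \<le> \<delta>1 \<Longrightarrow>
      \<bar>G i a - \<gamma> i - (\<Sum>k<N. a k * dG i k)\<bar> \<le> \<eta> * sum a {..<N}"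
    by (auto simp: less_Suc_eq_le)
  have "\<exists>\<delta>>0. \<forall>j<q. \<forall>a. (\<forall>k<N. 0 \<le> a k) \<longrightarrow> sum a {..<N} \<le> r \<longrightarrow> sum a {..<N} \<le> \<delta> \<longrightarrow>
      \<bar>H (Suc j) a - (\<Sum>k<N. a k * dH (Suc j) k)\<bar> \<le> \<eta> * sum a {..<N}"
  proof (rule finite_common_radius)
    fix j assume "j < q"
    then obtain d where "d > 0" "\<forall>a. (\<forall>k<N. 0 \<le> a k) \<longrightarrow> sum a {..<N} \<le> r \<longrightarrow>
      sum a {..<N} \<le> d \<longrightarrow> \<bar>H (Suc j) a - (\<Sum>k<N. a k * dH (Suc j) k)\<bar> \<le> \<eta> * sum a {..<N}"
      using H[of "Suc j" \<eta>] \<eta> by auto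
    then show "\<exists>d>0. \<forall>d'. 0 < d' \<longrightarrow> d' \<le> d \<longrightarrow> (\<forall>a. (\<forall>k<N. 0 \<le> a k) \<longrightarrow> sum a {..<N} \<le> r \<longrightarrow> sum a {..<N} \<le> d' \<longrightarrow>
      \<bar>H (Suc j) a - (\<Sum>k<N. a k * dH (Suc j) k)\<bar> \<le> \<eta> * sum a {..<N})"
      by (intro exI[of _ d]) auto
  qed
  then obtain \<delta>2 where \<delta>2: "\<delta>2 > 0" "\<And>j a. j < q \<Longrightarrow> (\<forall>k<N. 0 \<le> a k) \<Longrightarrow> sum a {..<N} \<le> r \<Longrightarrow> sum a {..<N} \<le> \<delta>2 \<Longrightarrow>
      \<bar>H (Suc j) a - (\<Sum>k<N. a k * dH (Suc j) k)\<bar> \<le> \<eta> * sum a {..<N}"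
    by blast
  have "\<exists>\<rho>>0. \<forall>j<q. \<forall>s a. (\<forall>n. (\<forall>k<N. 0 \<le> s n k) \<and> sum (s n) {..<N} \<le> \<rho>) \<longrightarrow>
      (\<forall>k<N. 0 \<le> a k) \<longrightarrow> sum a {..<N} \<le> \<rho> \<longrightarrow> (\<forall>k<N. (\<lambda>n. s n k) \<longlonglongrightarrow> a k) \<longrightarrow> (\<lambda>n::nat. H (Suc j) (s n)) \<longlonglongrightarrow> H (Suc j) a"
  proof (rule finite_common_radius)
    fix j assume "j < q"
    then obtain d where d: "d > 0" "\<And>s a. (\<forall>n. (\<forall>k<N. 0 \<le> s n k) \<and> sum (s n) {..<N} \<le> d) \<Longrightarrow>
      (\<forall>k<N. 0 \<le> a k) \<Longrightarrow> sum a {..<N} \<le> d \<Longrightarrow> (\<forall>k<N. (\<lambda>n. s n k) \<longlonglongrightarrow> a k) \<Longrightarrow> (\<lambda>n::nat. H (Suc j) (s n)) \<longlonglongrightarrow> H (Suc j) a"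
      using cont[of "Suc j"] by auto
    show "\<exists>d>0. \<forall>d'. 0 < d' \<longrightarrow> d' \<le> d \<longrightarrow> (\<forall>s a. (\<forall>n. (\<forall>k<N. 0 \<le> s n k) \<and> sum (s n) {..<N} \<le> d') \<longrightarrow>
      (\<forall>k<N. 0 \<le> a k) \<longrightarrow> sum a {..<N} \<le> d' \<longrightarrow> (\<forall>k<N. (\<lambda>n. s n k) \<longlonglongrightarrow> a k) \<longrightarrow> (\<lambda>n::nat. H (Suc j) (s n)) \<longlonglongrightarrow> H (Suc j) a)"
      by (intro exI[of _ d] conjI allI impI d) (auto intro: order_trans)
  qed
  then obtain \<rho> where \<rho>: "\<rho> > 0" "\<And>j s a. j < q \<Longrightarrow> (\<forall>n. (\<forall>k<N. 0 \<le> s n k) \<and> sum (s n) {..<N} \<le> \<rho>) \<Longrightarrow>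
      (\<forall>k<N. 0 \<le> a k) \<Longrightarrow> sum a {..<N} \<le> \<rho> \<Longrightarrow> (\<forall>k<N. (\<lambda>n. s n k) \<longlonglongrightarrow> a k) \<Longrightarrow> (\<lambda>n::nat. H (Suc j) (s n)) \<longlonglongrightarrow> H (Suc j) a"
    by blast
  \<comment> \<open>A crude slope bound for the inactive constraints, which merely have to stay
    positive; the 1 in \<open>S * Mx + 1\<close> absorbs the expansion error.\<close>
  define Mx where "Mx = (\<Sum>i=0..m. \<Sum>k<N. \<bar>dG i k\<bar>)"
  have Mx0: "0 \<le> Mx" by (simp add: Mx_def sum_nonneg)
  have Mx: "\<bar>dG i k\<bar> \<le> Mx" if "i \<in> {0..m}" "k < N" for i k
  proof -
    have "\<bar>dG i k\<bar> \<le> (\<Sum>k<N. \<bar>dG i k\<bar>)" using that by (intro member_le_sum) auto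
    also have "\<dots> \<le> Mx" unfolding Mx_def using that by (intro member_le_sum sum_nonneg) auto
    finally show ?thesis .
  qed
  have SM: "0 < S * Mx + 1" using S Mx0 by (simp add: add_nonneg_pos)
  have "\<exists>\<theta>>0. \<forall>i<Suc m. i \<notin> Act \<longrightarrow> \<theta> * (S * Mx + 1) < \<gamma> i"
  proof (rule finite_common_radius)
    fix i assume i: "i < Suc m"
    show "\<exists>d>0. \<forall>d'. 0 < d' \<longrightarrow> d' \<le> d \<longrightarrow> (i \<notin> Act \<longrightarrow> d' * (S * Mx + 1) < \<gamma> i)"
    proof (cases "i \<in> Act")
      case False
      then have nz: "i \<noteq> 0" "\<gamma> i \<noteq> 0" using i by (simp_all add: Act_def)
      have \<gamma>: "0 < \<gamma> i" using feasible[of i] i nz by simp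
      show ?thesis
      proof (intro exI[of _ "\<gamma> i / (2 * (S * Mx + 1))"] conjI allI impI)
        fix d' assume d': "d' \<le> \<gamma> i / (2 * (S * Mx + 1))"
        have "d' * (S * Mx + 1) \<le> \<gamma> i / (2 * (S * Mx + 1)) * (S * Mx + 1)"
          using SM by (intro mult_right_mono[OF d']) simp
        also have "\<dots> = \<gamma> i / 2" using SM by (simp add: field_simps)
        finally show "d' * (S * Mx + 1) < \<gamma> i" using \<gamma> by simp
      qed (use \<gamma> SM in simp)
    next
      case True
      then show ?thesis by (intro exI[of _ 1]) simp
    qed
  qed
  then obtain \<theta>0 where \<theta>0: "\<theta>0 > 0" "\<forall>i<Suc m. i \<notin> Act \<longrightarrow> \<theta>0 * (S * Mx + 1) < \<gamma> i"
    by (elim exE conjE)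
  define \<theta> where "\<theta> = min (min (r / S) (min (\<delta>1 / S) (\<delta>2 / S))) (min (\<rho> / S) \<theta>0)"
  have \<theta>: "0 < \<theta>" "\<theta> * S \<le> r" "\<theta> * S \<le> \<delta>1" "\<theta> * S \<le> \<delta>2" "\<theta> * S \<le> \<rho>" "\<theta> \<le> \<theta>0"
    using S r \<delta>1(1) \<delta>2(1) \<rho>(1) \<theta>0(1)
    by (auto simp: \<theta>_def pos_le_divide_eq[symmetric])
  \<comment> \<open>The shift \<open>l - 1\<close> matches cube coordinates counted from 0 with
    constraints counted from 1.\<close>
  define a where "a z k = \<theta> * A (\<lambda>l. z (l - 1)) k" for z k
  have a0: "\<forall>k<N. 0 \<le> a z k" for z using A0 \<theta>(1) by (simp add: a_def)
  have aS: "sum (a z) {..<N} \<le> \<theta> * S" if "\<And>j. j < q \<Longrightarrow> z j \<in> {-1..1}" for z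
    unfolding a_def sum_distrib_left[symmetric]
    using \<theta>(1) that by (intro mult_left_mono AS) auto
  have aH: "\<bar>H (Suc j) (a z) - \<theta> * z j\<bar> \<le> \<theta> / 2" if z: "\<And>j. j < q \<Longrightarrow> z j \<in> {-1..1}" and j: "j < q" for z j
  proof -
    have "\<bar>H (Suc j) (a z) - (\<Sum>k<N. a z k * dH (Suc j) k)\<bar> \<le> \<eta> * sum (a z) {..<N}"
      using aS[of z] z \<theta> by (intro \<delta>2(2) j a0) auto
    also have "\<dots> \<le> \<eta> * (\<theta> * S)" using aS[of z] z \<eta> by (intro mult_left_mono) auto
    also have "\<eta> * (\<theta> * S) = \<theta> * (\<eta> * S)" by (rule mult.left_commute)
    also have "\<dots> = \<theta> / 2" unfolding \<eta>(2) by simp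
    also have "(\<Sum>k<N. a z k * dH (Suc j) k) = \<theta> * z j"
      unfolding a_def mult.assoc sum_distrib_left[symmetric] using AH[of "Suc j" "\<lambda>l. z (l - 1)"] j by simp
    finally show ?thesis .
  qed
  have aG: "\<bar>G i (a z) - \<gamma> i - (\<Sum>k<N. a z k * dG i k)\<bar> \<le> \<theta> / 2" if z: "\<And>j. j < q \<Longrightarrow> z j \<in> {-1..1}" and i: "i \<in> {0..m}" for z i
  proof -
    have "\<bar>G i (a z) - \<gamma> i - (\<Sum>k<N. a z k * dG i k)\<bar> \<le> \<eta> * sum (a z) {..<N}"
      using aS[of z] z \<theta> by (intro \<delta>1(2) i a0) auto
    also have "\<dots> \<le> \<eta> * (\<theta> * S)" using aS[of z] z \<eta> by (intro mult_left_mono) auto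
    also have "\<eta> * (\<theta> * S) = \<theta> * (\<eta> * S)" by (rule mult.left_commute)
    also have "\<dots> = \<theta> / 2" unfolding \<eta>(2) by simp
    finally show ?thesis .
  qed
  \<comment> \<open>On the faces \<open>z i = -1\<close> and \<open>z i = 1\<close> the value of
    \<open>H (Suc i)\<close> is within \<open>\<theta> / 2\<close> of \<open>- \<theta>\<close> and
    \<open>\<theta>\<close>, so the signs required by \<open>poincare_miranda\<close> hold.\<close>
  obtain z where z: "\<And>j. j < q \<Longrightarrow> z j \<in> {-1..1}" and Hz: "\<And>j. j < q \<Longrightarrow> H (Suc j) (a z) = 0"
  proof (rule poincare_miranda[of q "\<lambda>z j. H (Suc j) (a z)"])
    fix z :: "nat \<Rightarrow> real" and i assume z: "\<And>j. j < q \<Longrightarrow> z j \<in> {-1..1}" and i: "i < q"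
    show "H (Suc i) (a z) < 0" if "z i = -1" using abs_le_D1[OF aH[of z, OF z i]] abs_le_D2[OF aH[of z, OF z i]] that \<theta>(1) by simp
    show "0 < H (Suc i) (a z)" if "z i = 1" using abs_le_D1[OF aH[of z, OF z i]] abs_le_D2[OF aH[of z, OF z i]] that \<theta>(1) by simp
  next
    fix s :: "nat \<Rightarrow> nat \<Rightarrow> real" and z :: "nat \<Rightarrow> real" and i
    assume s: "\<And>m j. j < q \<Longrightarrow> s m j \<in> {-1..1}" and lim: "\<And>j. j < q \<Longrightarrow> (\<lambda>m. s m j) \<longlonglongrightarrow> z j" and i: "i < q"
    have z: "z j \<in> {-1..1}" if "j < q" for j
      by (rule closed_sequentially[OF closed_atLeastAtMost s[OF that] lim[OF that]])
    show "(\<lambda>m. H (Suc i) (a (s m))) \<longlonglongrightarrow> H (Suc i) (a z)"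
    proof (rule \<rho>(2)[OF i])
      show "\<forall>n. (\<forall>k<N. 0 \<le> a (s n) k) \<and> sum (a (s n)) {..<N} \<le> \<rho>"
        using a0 aS[of "s _"] s \<theta>(5) by (meson order_trans)
      show "sum (a z) {..<N} \<le> \<rho>" using aS[of z] z \<theta>(5) by (meson order_trans)
      show "\<forall>k<N. (\<lambda>n. a (s n) k) \<longlonglongrightarrow> a z k"
        unfolding a_def A_def using lim by (auto intro!: tendsto_intros tendsto_max)
    qed (rule a0)
  qed auto
  have lin: "(\<Sum>k<N. a z k * dG i k) = \<theta> * (\<Sum>k<N. A (\<lambda>l. z (l - 1)) k * dG i k)" for i
    by (simp add: a_def sum_distrib_left mult.assoc)
  have act: "\<gamma> i < G i (a z)" if i: "i \<in> Act" for i
  proof -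
    have "i \<in> {0..m}" using Act(3) i by auto
    moreover have "\<theta> * 1 \<le> (\<Sum>k<N. a z k * dG i k)" unfolding lin using AG[OF i] \<theta>(1) by (intro mult_left_mono) auto
    ultimately show ?thesis using abs_le_D2[OF aG[of z i, OF z]] \<theta>(1) by simp
  qed
  have "G 0 (a z) \<le> \<gamma> 0"
  proof (rule opt)
    show "0 \<le> a z k" if "k < N" for k using a0 that by blast
    show "sum (a z) {..<N} \<le> r" using aS[of z] z \<theta>(2) by (meson order_trans)
    show "H j (a z) = 0" if "j \<in> {1..q}" for j using Hz[of "j - 1"] that by auto
    show "0 \<le> G i (a z)" if i: "i \<in> {1..m}" for i
    proof (cases "i \<in> Act")
      case True
      then show ?thesis using act[OF True] feasible[OF i] by simp
    next
      case False
      have i': "i \<in> {0..m}" using i by auto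
      have "\<bar>\<Sum>k<N. a z k * dG i k\<bar> \<le> (\<Sum>k<N. a z k * Mx)"
        using a0[of z] Mx[OF i'] by (intro order_trans[OF sum_abs] sum_mono) (auto simp: abs_mult intro: mult_left_mono)
      also have "\<dots> = sum (a z) {..<N} * Mx" by (simp add: sum_distrib_right)
      also have "\<dots> \<le> \<theta> * S * Mx" using aS[of z] z Mx0 by (intro mult_right_mono) auto
      finally have 1: "\<bar>\<Sum>k<N. a z k * dG i k\<bar> \<le> \<theta> * S * Mx" .
      have 2: "\<theta> * (S * Mx + 1) \<le> \<theta>0 * (S * Mx + 1)" using \<theta>(6) SM by (intro mult_right_mono) auto
      have "\<theta> * (S * Mx + 1) = \<theta> * S * Mx + \<theta>" by (simp add: algebra_simps)
      moreover have "\<theta>0 * (S * Mx + 1) < \<gamma> i" using \<theta>0(2) i' False by auto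
      ultimately show ?thesis using abs_le_D2[OF 1] 2 abs_le_D2[OF aG[of z, OF z i']] \<theta>(1) by linarith
    qed
  qed
  then show False using act[OF Act(2)] by simp
qed

text \<open>Pinning the coordinates from \<open>n\<close> on to zero reduces the product topology to
  \<open>n\<close> bounded coordinates; the norm condition survives pointwise limits because the sum
  is finite.\<close>

lemma compact_unit_multipliers:
  "compact {y :: nat \<Rightarrow> real. (\<forall>i\<ge>n. y i = 0) \<and> (\<Sum>i<n. \<bar>y i\<bar>) = 1}"
  unfolding compact_def
proof (intro allI impI)
  fix f :: "nat \<Rightarrow> nat \<Rightarrow> real"
  assume f: "\<forall>m. f m \<in> {y. (\<forall>i\<ge>n. y i = 0) \<and> (\<Sum>i<n. \<bar>y i\<bar>) = 1}"
  have "f m j \<in> {-1..1}" if "j < n" for m j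
  proof -
    have "\<bar>f m j\<bar> \<le> (\<Sum>i<n. \<bar>f m i\<bar>)" using that by (intro member_le_sum) auto
    then show ?thesis using f by auto
  qed
  from finite_coordinates_subsequence[of n f 1, OF this] obtain z r
    where r: "strict_mono r" and z: "\<And>j. j < n \<Longrightarrow> (\<lambda>m. f (r m) j) \<longlonglongrightarrow> z j" by blast
  define l where "l i = (if i < n then z i else 0)" for i
  have lim: "(\<lambda>m. f (r m) i) \<longlonglongrightarrow> l i" for i
    using z[of i] f by (cases "i < n") (auto simp: l_def)
  then have "(\<lambda>m. \<Sum>i<n. \<bar>f (r m) i\<bar>) \<longlonglongrightarrow> (\<Sum>i<n. \<bar>l i\<bar>)" by (intro tendsto_intros)
  then have "(\<Sum>i<n. \<bar>l i\<bar>) = 1" using f by (simp add: LIMSEQ_const_iff)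
  then have "l \<in> {y. (\<forall>i\<ge>n. y i = 0) \<and> (\<Sum>i<n. \<bar>y i\<bar>) = 1}" by (simp add: l_def)
  moreover have "limitin (product_topology (\<lambda>_. euclidean) UNIV) (f \<circ> r) l sequentially"
    unfolding limitin_componentwise using lim by (simp add: comp_def)
  then have "(f \<circ> r) \<longlonglongrightarrow> l" by (simp add: euclidean_product_topology)
  ultimately show "\<exists>l\<in>{y. (\<forall>i\<ge>n. y i = 0) \<and> (\<Sum>i<n. \<bar>y i\<bar>) = 1}. \<exists>r. strict_mono r \<and> (f \<circ> r) \<longlonglongrightarrow> l"
    using r by blast
qed

section \<open>The Pontryagin principle\<close>

lemma has_hadamard_deriv_hadamard_deriv:
  "hadamard_differentiable \<phi> x \<Longrightarrow> has_hadamard_deriv \<phi> (hadamard_deriv \<phi> x) x"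
  unfolding hadamard_differentiable_def using hadamard_deriv_eq by metis

lemma frechet_deriv_has_derivative:
  assumes "\<phi> differentiable (at x)"
  shows "(\<phi> has_derivative blinfun_apply (frechet_deriv \<phi> x)) (at x)"
proof -
  have d: "(\<phi> has_derivative frechet_derivative \<phi> (at x)) (at x)" using assms by (simp add: frechet_derivative_works)
  then have "blinfun_apply (frechet_deriv \<phi> x) = frechet_derivative \<phi> (at x)"
    unfolding frechet_deriv_def by (intro bounded_linear_Blinfun_apply has_derivative_bounded_linear)
  then show ?thesis using d by simp
qed

definition fst_blinfun :: "('a::real_normed_vector \<times> 'b::real_normed_vector) \<Rightarrow>\<^sub>L 'a" where
  "fst_blinfun = Blinfun fst"

definition snd_blinfun :: "('a::real_normed_vector \<times> 'b::real_normed_vector) \<Rightarrow>\<^sub>L 'b" where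
  "snd_blinfun = Blinfun snd"

definition inl_blinfun :: "'a::real_normed_vector \<Rightarrow>\<^sub>L ('a \<times> 'b::real_normed_vector)" where
  "inl_blinfun = Blinfun (\<lambda>x. (x, 0))"

definition inr_blinfun :: "'b::real_normed_vector \<Rightarrow>\<^sub>L ('a::real_normed_vector \<times> 'b)" where
  "inr_blinfun = Blinfun (\<lambda>x. (0, x))"

lemma product_blinfun_apply [simp]:
  "blinfun_apply fst_blinfun z = fst z" "blinfun_apply snd_blinfun z = snd z"
  "blinfun_apply inl_blinfun x = (x, 0)" "blinfun_apply inr_blinfun y = (0, y)"
  unfolding fst_blinfun_def snd_blinfun_def inl_blinfun_def inr_blinfun_def
  by (simp_all add: bounded_linear_Blinfun_apply bounded_linear_fst bounded_linear_snd
      bounded_linear_Pair bounded_linear_ident bounded_linear_zero)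

text \<open>For the augmented state: \<open>c = 1\<close> adds the accumulated cost to the terminal
  reward, \<open>c = 0\<close> leaves a constraint blind to it.\<close>

lemma has_hadamard_deriv_lift:
  fixes \<phi> :: "'a::real_normed_vector \<Rightarrow> real"
  assumes "has_hadamard_deriv \<phi> D \<xi>"
  shows "has_hadamard_deriv (\<lambda>z. c * snd z + \<phi> (fst z)) (c *\<^sub>R snd_blinfun + (D o\<^sub>L fst_blinfun)) (\<xi>, s)"
proof -
  have eq: "inverse \<theta> * (c * (s + \<theta> * snd w) + \<phi> (\<xi> + \<theta> *\<^sub>R fst w) - (c * s + \<phi> \<xi>)) =
      c * snd w + inverse \<theta> * (\<phi> (\<xi> + \<theta> *\<^sub>R fst w) - \<phi> \<xi>)" if "\<theta> \<noteq> 0" for \<theta> and w :: "'a \<times> real"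
    using that by (simp add: field_simps)
  have lim: "((\<lambda>(\<theta>, w). (\<phi> (\<xi> + \<theta> *\<^sub>R w) - \<phi> \<xi>) /\<^sub>R \<theta>) \<longlongrightarrow> D v) (at_right 0 \<times>\<^sub>F nhds v)" for v
    using assms by (simp add: has_hadamard_deriv_def)
  have main: "((\<lambda>(\<theta>, w). (c * snd ((\<xi>, s) + \<theta> *\<^sub>R w) + \<phi> (fst ((\<xi>, s) + \<theta> *\<^sub>R w)) - (c * snd (\<xi>, s) + \<phi> (fst (\<xi>, s)))) /\<^sub>R \<theta>)
      \<longlongrightarrow> (c *\<^sub>R snd_blinfun + (D o\<^sub>L fst_blinfun)) v) (at_right 0 \<times>\<^sub>F nhds v)" for v
  proof -
    have "filterlim (\<lambda>(\<theta>, w). (\<theta>, fst w)) (at_right 0 \<times>\<^sub>F nhds (fst v)) (at_right 0 \<times>\<^sub>F nhds v)"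
      unfolding case_prod_unfold
      by (intro filterlim_Pair filterlim_fst filterlim_compose[OF _ filterlim_snd] tendsto_fst filterlim_ident)
    from filterlim_compose[OF lim this]
    have 1: "((\<lambda>(\<theta>, w). (\<phi> (\<xi> + \<theta> *\<^sub>R fst w) - \<phi> \<xi>) /\<^sub>R \<theta>) \<longlongrightarrow> D (fst v)) (at_right 0 \<times>\<^sub>F nhds v)"
      by (simp add: case_prod_unfold)
    have 2: "((\<lambda>p. c * snd (snd p)) \<longlongrightarrow> c * snd v) (at_right (0::real) \<times>\<^sub>F nhds v)"
      by (intro tendsto_intros tendsto_snd filterlim_snd)
    have "eventually (\<lambda>p. fst p \<noteq> 0) (at_right (0::real) \<times>\<^sub>F nhds v)"
      using eventually_prod1[of "nhds v" "\<lambda>\<theta>. \<theta> \<noteq> 0" "at_right (0::real)"]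
      by (simp add: nhds_neq_bot case_prod_unfold eventually_at_filter)
    then have "eventually (\<lambda>p. c * snd (snd p) + (\<lambda>(\<theta>, w). (\<phi> (\<xi> + \<theta> *\<^sub>R fst w) - \<phi> \<xi>) /\<^sub>R \<theta>) p =
        (\<lambda>(\<theta>, w). (c * snd ((\<xi>, s) + \<theta> *\<^sub>R w) + \<phi> (fst ((\<xi>, s) + \<theta> *\<^sub>R w)) - (c * snd (\<xi>, s) + \<phi> (fst (\<xi>, s)))) /\<^sub>R \<theta>) p)
        (at_right (0::real) \<times>\<^sub>F nhds v)"
      by eventually_elim (simp add: eq case_prod_unfold)
    from filterlim_cong[OF refl refl this] tendsto_add[OF 2 1] show ?thesis
      by (simp add: blinfun.bilinear_simps)
  qed
  have "filterlim (\<lambda>\<theta>. (\<theta>, v)) (at_right 0 \<times>\<^sub>F nhds v) (at_right 0)" for v :: "'a \<times> real"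
    by (intro filterlim_Pair filterlim_ident tendsto_const)
  from filterlim_compose[OF main this] show ?thesis
    unfolding has_hadamard_deriv_def has_gateaux_deriv_def has_right_gateaux_variation_def
    using main by simp
qed

text \<open>The hypotheses at one frozen parameter. The necessary conditions are needed at all
  parameters of \<open>P\<close>, not only at the reference one.\<close>

locale bolza_maximizer =
  fixes T :: real and \<Omega> :: "'x::banach set" and U :: "'y::real_normed_vector set" and \<xi>\<^sub>0 :: 'x and m q :: nat
    and f0 :: "real \<Rightarrow> 'x \<Rightarrow> 'y \<Rightarrow> 'z \<Rightarrow> real" and f :: "real \<Rightarrow> 'x \<Rightarrow> 'y \<Rightarrow> 'z \<Rightarrow> 'x"
    and g h :: "nat \<Rightarrow> 'x \<Rightarrow> 'z \<Rightarrow> real" and \<pi> :: 'z and x :: "real \<Rightarrow> 'x" and u :: "real \<Rightarrow> 'y"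
  assumes T: "0 < T" and Omega: "open \<Omega>" and U: "open U"
    and sol: "bolza_solution T \<Omega> U \<xi>\<^sub>0 m q f0 f g h \<pi> (x, u)"
    and cont0: "continuous_on ({0..T} \<times> \<Omega> \<times> U) (\<lambda>(t, \<xi>, \<zeta>). f0 t \<xi> \<zeta> \<pi>)"
    and gat0: "\<And>t \<xi> \<zeta>. t \<in> {0..T} \<Longrightarrow> \<xi> \<in> \<Omega> \<Longrightarrow> \<zeta> \<in> U \<Longrightarrow> gateaux_differentiable (\<lambda>y. f0 t y \<zeta> \<pi>) \<xi>"
    and bdd0: "\<And>K. compact K \<Longrightarrow> K \<noteq> {} \<Longrightarrow> K \<subseteq> \<Omega> \<times> U \<Longrightarrow>
      bdd_above ((\<lambda>(t, \<xi>, \<zeta>). norm (gateaux_deriv (\<lambda>y. f0 t y \<zeta> \<pi>) \<xi>)) ` ({0..T} \<times> K))"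
    and fre0: "\<And>t \<zeta>. t \<in> {0..T} \<Longrightarrow> \<zeta> \<in> U \<Longrightarrow> (\<lambda>\<xi>. f0 t \<xi> \<zeta> \<pi>) differentiable (at (x t))"
      "continuous_on ({0..T} \<times> U) (\<lambda>(t, \<zeta>). frechet_deriv (\<lambda>\<xi>. f0 t \<xi> \<zeta> \<pi>) (x t))"
    and cont: "continuous_on ({0..T} \<times> \<Omega> \<times> U) (\<lambda>(t, \<xi>, \<zeta>). f t \<xi> \<zeta> \<pi>)"
    and gat: "\<And>t \<xi> \<zeta>. t \<in> {0..T} \<Longrightarrow> \<xi> \<in> \<Omega> \<Longrightarrow> \<zeta> \<in> U \<Longrightarrow> gateaux_differentiable (\<lambda>y. f t y \<zeta> \<pi>) \<xi>"
    and bdd: "\<And>K. compact K \<Longrightarrow> K \<noteq> {} \<Longrightarrow> K \<subseteq> \<Omega> \<times> U \<Longrightarrow>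
      bdd_above ((\<lambda>(t, \<xi>, \<zeta>). norm (gateaux_deriv (\<lambda>y. f t y \<zeta> \<pi>) \<xi>)) ` ({0..T} \<times> K))"
    and fre: "\<And>t \<zeta>. t \<in> {0..T} \<Longrightarrow> \<zeta> \<in> U \<Longrightarrow> (\<lambda>\<xi>. f t \<xi> \<zeta> \<pi>) differentiable (at (x t))"
      "continuous_on ({0..T} \<times> U) (\<lambda>(t, \<zeta>). frechet_deriv (\<lambda>\<xi>. f t \<xi> \<zeta> \<pi>) (x t))"
    and had_g: "\<And>i. i \<in> {0..m} \<Longrightarrow> hadamard_differentiable (\<lambda>\<xi>. g i \<xi> \<pi>) (x T)"
    and had_h: "\<And>j. j \<in> {1..q} \<Longrightarrow> hadamard_differentiable (\<lambda>\<xi>. h j \<xi> \<pi>) (x T)"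
    and cont_h: "\<And>j. j \<in> {1..q} \<Longrightarrow> \<exists>N. open N \<and> x T \<in> N \<and> N \<subseteq> \<Omega> \<and> continuous_on N (\<lambda>\<xi>. h j \<xi> \<pi>)"
begin

lemma x: "x \<in> PC1 T \<Omega>" "\<And>t. t \<in> {0..T} \<Longrightarrow> ext_deriv T x t = f t (x t) (u t) \<pi>" "x 0 = \<xi>\<^sub>0"
    "\<And>i. i \<in> {1..m} \<Longrightarrow> 0 \<le> g i (x T) \<pi>" "\<And>j. j \<in> {1..q} \<Longrightarrow> h j (x T) \<pi> = 0"
  and u: "u \<in> NPC0_R T U"
  using sol by (auto simp: bolza_solution_def bolza_admissible_def)

lemma x_cont: "continuous_on {0..T} x" and x_mem: "t \<in> {0..T} \<Longrightarrow> x t \<in> \<Omega>"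
  using x(1) by (auto intro: PC1_continuous PC1_mem)

lemma running_NPC0_R:
  assumes "continuous_on {0..T} y" "\<And>t. t \<in> {0..T} \<Longrightarrow> y t \<in> \<Omega>" "w \<in> NPC0_R T U"
  shows "(\<lambda>t. f0 t (y t) (w t) \<pi>) \<in> NPC0_R T UNIV"
proof -
  have "(\<lambda>t. (t, y t, w t)) \<in> NPC0_R T ({0..T} \<times> \<Omega> \<times> U)"
    using assms(1,2) T
    by (intro NPC0_R_Pair[OF T _ NPC0_R_Pair[OF T _ assms(3)]] NPC0_R_continuous) (auto intro: continuous_intros)
  from NPC0_R_compose[OF T this cont0, of UNIV] show ?thesis by simp
qed

text \<open>
  The running cost becomes an additional state, which turns the Bolza problem into a Mayer problem.
\<close>

definition F :: "real \<Rightarrow> 'x \<times> real \<Rightarrow> 'y \<Rightarrow> 'x \<times> real" where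
  "F t z \<zeta> = (f t (fst z) \<zeta> \<pi>, f0 t (fst z) \<zeta> \<pi>)"

definition xs :: "real \<Rightarrow> 'x \<times> real" where
  "xs t = (x t, integral {0..t} (\<lambda>s. f0 s (x s) (u s) \<pi>))"

definition A1 :: "real \<Rightarrow> 'x \<Rightarrow>\<^sub>L 'x" where
  "A1 t = frechet_deriv (\<lambda>\<xi>. f t \<xi> (u t) \<pi>) (x t)"

definition A0 :: "real \<Rightarrow> 'x \<Rightarrow>\<^sub>L real" where
  "A0 t = frechet_deriv (\<lambda>\<xi>. f0 t \<xi> (u t) \<pi>) (x t)"

definition A :: "real \<Rightarrow> ('x \<times> real) \<Rightarrow>\<^sub>L ('x \<times> real)" where
  "A t = (inl_blinfun o\<^sub>L (A1 t o\<^sub>L fst_blinfun)) + (inr_blinfun o\<^sub>L (A0 t o\<^sub>L fst_blinfun))"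

lemma A_apply: "A t z = (A1 t (fst z), A0 t (fst z))"
  by (simp add: A_def blinfun.bilinear_simps)

lemma tu: "(\<lambda>t. (t, u t)) \<in> NPC0_R T ({0..T} \<times> U)"
  by (rule NPC0_R_Pair[OF T NPC0_R_continuous[OF T] u]) (auto intro: continuous_intros)

lemma A1: "A1 \<in> NPC0_R T UNIV" and A0: "A0 \<in> NPC0_R T UNIV"
proof -
  show "A1 \<in> NPC0_R T UNIV"
    using NPC0_R_compose[OF T tu fre(2), of UNIV] by (simp add: A1_def[abs_def])
  show "A0 \<in> NPC0_R T UNIV"
    using NPC0_R_compose[OF T tu fre0(2), of UNIV] by (simp add: A0_def[abs_def])
qed

lemma A1_deriv: "t \<in> {0..T} \<Longrightarrow> ((\<lambda>\<xi>. f t \<xi> (u t) \<pi>) has_derivative A1 t) (at (x t))"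
  and A0_deriv: "t \<in> {0..T} \<Longrightarrow> ((\<lambda>\<xi>. f0 t \<xi> (u t) \<pi>) has_derivative A0 t) (at (x t))"
  unfolding A1_def A0_def using fre(1) fre0(1) NPC0_R_mem[OF u] frechet_deriv_has_derivative by blast+

text \<open>The derivative bounds hold on compact sets of states and controls.
  \<open>bounded_near_compact\<close> spreads them to a neighbourhood of the trajectory times
  \<open>M\<close>, where balls are convex and \<open>gateaux_lipschitz\<close> gives one constant
  for all times.\<close>

lemma lipschitz_tube:
  assumes M: "compact M" "M \<subseteq> U"
  shows "\<exists>\<epsilon>>0. \<exists>L\<ge>0. \<forall>t\<in>{0..T}. cball (x t) \<epsilon> \<subseteq> \<Omega> \<and>
      (\<forall>\<zeta>\<in>M. \<forall>\<xi>\<in>cball (x t) \<epsilon>. \<forall>\<eta>\<in>cball (x t) \<epsilon>.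
        norm (f t \<xi> \<zeta> \<pi> - f t \<eta> \<zeta> \<pi>) \<le> L * norm (\<xi> - \<eta>) \<and> norm (f0 t \<xi> \<zeta> \<pi> - f0 t \<eta> \<zeta> \<pi>) \<le> L * norm (\<xi> - \<eta>))"
proof (cases "M = {}")
  case True
  \<comment> \<open>Without controls the Lipschitz bounds are vacuous, but the tube must still lie
    in \<open>\<Omega>\<close>; an empty index set reduces \<open>bounded_near_compact\<close> to
    this.\<close>
  obtain \<epsilon> where "\<epsilon> > 0" "\<forall>k\<in>x ` {0..T}. cball k \<epsilon> \<subseteq> \<Omega>"
  proof -
    have "compact (x ` {0..T})" using x_cont by (intro compact_continuous_image) auto
    moreover have "x ` {0..T} \<subseteq> \<Omega>" using x_mem by blast
    ultimately have "\<exists>\<epsilon>>0. \<exists>B::real. \<forall>k\<in>x ` {0..T}. \<forall>y. dist y k < \<epsilon> \<longrightarrow> y \<in> \<Omega> \<and> (\<forall>t\<in>{} :: unit set. 0 \<le> B)"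
      using bounded_near_compact[of "x ` {0..T}" \<Omega> "{} :: unit set" "\<lambda>_ _. 0"] Omega by simp
    then obtain \<epsilon> where \<epsilon>: "\<epsilon> > 0" "\<And>k y. k \<in> x ` {0..T} \<Longrightarrow> dist y k < \<epsilon> \<Longrightarrow> y \<in> \<Omega>" by blast
    show thesis
    proof (rule that[of "\<epsilon> / 2"])
      show "\<forall>k\<in>x ` {0..T}. cball k (\<epsilon> / 2) \<subseteq> \<Omega>"
      proof (intro ballI subsetI)
        fix k y assume "k \<in> x ` {0..T}" "y \<in> cball k (\<epsilon> / 2)"
        then show "y \<in> \<Omega>" using \<epsilon> by (intro \<epsilon>(2)[of k]) (auto simp: dist_commute)
      qed
    qed (use \<epsilon> in simp)
  qed
  then show ?thesis using True by (intro exI[of _ \<epsilon>]) auto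
next
  case False
  define K where "K = x ` {0..T} \<times> M"
  have K: "compact K" "K \<subseteq> \<Omega> \<times> U"
    using x_cont x_mem M by (auto simp: K_def intro!: compact_Times compact_continuous_image)
  define d where "d t z = max (norm (gateaux_deriv (\<lambda>y. f t y (snd z) \<pi>) (fst z))) (norm (gateaux_deriv (\<lambda>y. f0 t y (snd z) \<pi>) (fst z)))"
    for t and z :: "'x \<times> 'y"
  have "\<exists>\<epsilon>>0. \<exists>B. \<forall>k\<in>K. \<forall>y. dist y k < \<epsilon> \<longrightarrow> y \<in> \<Omega> \<times> U \<and> (\<forall>t\<in>{0..T}. d t y \<le> B)"
  proof (rule bounded_near_compact[OF K(1) open_Times[OF Omega U] K(2)])
    fix K' assume K': "compact K'" "K' \<noteq> {}" "K' \<subseteq> \<Omega> \<times> U"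
    obtain B where B: "\<And>t \<xi> \<zeta>. t \<in> {0..T} \<Longrightarrow> (\<xi>, \<zeta>) \<in> K' \<Longrightarrow> norm (gateaux_deriv (\<lambda>y. f t y \<zeta> \<pi>) \<xi>) \<le> B"
      using bdd[OF K'] unfolding bdd_above_def by fastforce
    obtain B0 where B0: "\<And>t \<xi> \<zeta>. t \<in> {0..T} \<Longrightarrow> (\<xi>, \<zeta>) \<in> K' \<Longrightarrow> norm (gateaux_deriv (\<lambda>y. f0 t y \<zeta> \<pi>) \<xi>) \<le> B0"
      using bdd0[OF K'] unfolding bdd_above_def by fastforce
    have "d t z \<le> max B B0" if "t \<in> {0..T}" "z \<in> K'" for t z
      unfolding d_def using B[of t "fst z" "snd z"] B0[of t "fst z" "snd z"] that by (intro max.mono) auto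
    then show "\<exists>B. \<forall>t\<in>{0..T}. \<forall>y\<in>K'. d t y \<le> B" by blast
  qed
  then obtain \<epsilon> B where \<epsilon>: "\<epsilon> > 0" "\<And>k y. k \<in> K \<Longrightarrow> dist y k < \<epsilon> \<Longrightarrow> y \<in> \<Omega> \<times> U"
    "\<And>k y t. k \<in> K \<Longrightarrow> dist y k < \<epsilon> \<Longrightarrow> t \<in> {0..T} \<Longrightarrow> d t y \<le> B"
    by metis
  show ?thesis
  proof (rule exI[of _ "\<epsilon> / 2"], rule conjI[rotated], rule exI[of _ "\<bar>B\<bar>"], intro conjI ballI)
    fix t assume t: "t \<in> {0..T}"
    have near: "(\<xi>, \<zeta>) \<in> \<Omega> \<times> U \<and> d t (\<xi>, \<zeta>) \<le> B" if "\<xi> \<in> cball (x t) (\<epsilon> / 2)" "\<zeta> \<in> M" for \<xi> \<zeta>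
    proof -
      have k: "(x t, \<zeta>) \<in> K" using t that by (simp add: K_def)
      have "dist (\<xi>, \<zeta>) (x t, \<zeta>) < \<epsilon>" using that(1) \<epsilon>(1) by (simp add: dist_Pair_Pair dist_commute)
      then show ?thesis using \<epsilon>(2,3)[OF k] t by blast
    qed
    show "cball (x t) (\<epsilon> / 2) \<subseteq> \<Omega>" using near False by blast
    fix \<zeta> \<xi> \<eta> assume \<zeta>: "\<zeta> \<in> M" and \<xi>\<eta>: "\<xi> \<in> cball (x t) (\<epsilon> / 2)" "\<eta> \<in> cball (x t) (\<epsilon> / 2)"
    have "norm (f t \<xi> \<zeta> \<pi> - f t \<eta> \<zeta> \<pi>) \<le> B * norm (\<xi> - \<eta>)"
      by (rule gateaux_lipschitz[of "cball (x t) (\<epsilon> / 2)" "\<lambda>\<xi>. f t \<xi> \<zeta> \<pi>", OF convex_cball _ _ \<xi>\<eta>])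
        (use near[OF _ \<zeta>] gat[OF t] in \<open>auto simp: d_def\<close>)
    also have "\<dots> \<le> \<bar>B\<bar> * norm (\<xi> - \<eta>)" by (intro mult_right_mono) auto
    finally show "norm (f t \<xi> \<zeta> \<pi> - f t \<eta> \<zeta> \<pi>) \<le> \<bar>B\<bar> * norm (\<xi> - \<eta>)" .
    have "norm (f0 t \<xi> \<zeta> \<pi> - f0 t \<eta> \<zeta> \<pi>) \<le> B * norm (\<xi> - \<eta>)"
      by (rule gateaux_lipschitz[of "cball (x t) (\<epsilon> / 2)" "\<lambda>\<xi>. f0 t \<xi> \<zeta> \<pi>", OF convex_cball _ _ \<xi>\<eta>])
        (use near[OF _ \<zeta>] gat0[OF t] in \<open>auto simp: d_def\<close>)
    also have "\<dots> \<le> \<bar>B\<bar> * norm (\<xi> - \<eta>)" by (intro mult_right_mono) auto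
    finally show "norm (f0 t \<xi> \<zeta> \<pi> - f0 t \<eta> \<zeta> \<pi>) \<le> \<bar>B\<bar> * norm (\<xi> - \<eta>)" .
  qed (use \<epsilon>(1) in auto)
qed

lemma xs_cont: "continuous_on {0..T} xs"
  unfolding xs_def by (intro continuous_intros x_cont NPC0_R_integral(1)[OF T running_NPC0_R[OF x_cont x_mem u]])

lemma control_trajectory_F: "control_trajectory T (\<Omega> \<times> UNIV) U F xs u A"
proof
  show "\<exists>S. finite S \<and> (\<forall>t\<in>{0<..<T} - S. (xs has_vector_derivative F t (xs t) (u t)) (at t))"
  proof -
    obtain S where S: "finite S" "\<And>t. t \<in> {0<..<T} - S \<Longrightarrow> (x has_vector_derivative ext_deriv T x t) (at t)"
      using PC1_ext_deriv(2)[OF T x(1)] by blast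
    obtain S' where S': "finite S'" "\<And>t. t \<in> {0<..<T} - S' \<Longrightarrow>
        ((\<lambda>t. integral {0..t} (\<lambda>s. f0 s (x s) (u s) \<pi>)) has_vector_derivative f0 t (x t) (u t) \<pi>) (at t)"
      using NPC0_R_integral(2)[OF T running_NPC0_R[OF x_cont x_mem u]] by blast
    have "(xs has_vector_derivative F t (xs t) (u t)) (at t)" if "t \<in> {0<..<T} - (S \<union> S')" for t
      unfolding xs_def F_def fst_conv
      using S(2)[of t] S'(2)[of t] x(2)[of t] that by (intro has_vector_derivative_Pair) auto
    then show ?thesis using S(1) S'(1) by (intro exI[of _ "S \<union> S'"]) simp
  qed
  have "continuous_on ({0..T} \<times> (\<Omega> \<times> (UNIV :: real set)) \<times> U) (\<lambda>p. (fst p, fst (fst (snd p)), snd (snd p)))"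
    by (intro continuous_intros)
  moreover have "(\<lambda>p. (fst p, fst (fst (snd p)), snd (snd p))) ` ({0..T} \<times> (\<Omega> \<times> (UNIV :: real set)) \<times> U) \<subseteq> {0..T} \<times> \<Omega> \<times> U"
    by auto
  ultimately have "continuous_on ({0..T} \<times> (\<Omega> \<times> (UNIV :: real set)) \<times> U) (\<lambda>p. (\<lambda>(t, \<xi>, \<zeta>). f t \<xi> \<zeta> \<pi>) (fst p, fst (fst (snd p)), snd (snd p)))"
    "continuous_on ({0..T} \<times> (\<Omega> \<times> (UNIV :: real set)) \<times> U) (\<lambda>p. (\<lambda>(t, \<xi>, \<zeta>). f0 t \<xi> \<zeta> \<pi>) (fst p, fst (fst (snd p)), snd (snd p)))"
    using continuous_on_compose2[OF cont] continuous_on_compose2[OF cont0] by blast+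
  then show "continuous_on ({0..T} \<times> (\<Omega> \<times> UNIV) \<times> U) (\<lambda>(t, z, \<zeta>). F t z \<zeta>)"
    unfolding F_def case_prod_beta by (simp add: continuous_on_Pair)
  have c: "continuous_on UNIV (\<lambda>Y. inl_blinfun o\<^sub>L (Y o\<^sub>L fst_blinfun))" "continuous_on UNIV (\<lambda>Y. inr_blinfun o\<^sub>L (Y o\<^sub>L fst_blinfun))"
    by (intro bounded_bilinear.continuous_on[OF bounded_bilinear_blinfun_compose] continuous_intros)+
  show "A \<in> NPC0_R T UNIV"
  proof -
    have "(\<lambda>t. (inl_blinfun o\<^sub>L (A1 t o\<^sub>L fst_blinfun)) + (inr_blinfun o\<^sub>L (A0 t o\<^sub>L fst_blinfun))) \<in> NPC0_R T UNIV"
      by (rule NPC0_R_compose2[OF T NPC0_R_compose[OF T A1 c(1), of UNIV] NPC0_R_compose[OF T A0 c(2), of UNIV]])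
        (auto simp: case_prod_beta intro!: continuous_intros)
    then show ?thesis by (simp add: A_def[abs_def])
  qed
  show "((\<lambda>z. F t z (u t)) has_derivative A t) (at (xs t))" if t: "t \<in> {0..T}" for t
  proof -
    have 1: "((\<lambda>z. f t (fst z) (u t) \<pi>) has_derivative (\<lambda>z. A1 t (fst z))) (at (xs t))"
      using A1_deriv[OF t] by (intro has_derivative_compose[OF has_derivative_fst[OF has_derivative_ident]]) (simp add: xs_def)
    have 2: "((\<lambda>z. f0 t (fst z) (u t) \<pi>) has_derivative (\<lambda>z. A0 t (fst z))) (at (xs t))"
      using A0_deriv[OF t] by (intro has_derivative_compose[OF has_derivative_fst[OF has_derivative_ident]]) (simp add: xs_def)
    show ?thesis unfolding F_def A_apply[abs_def] by (rule has_derivative_Pair[OF 1 2])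
  qed
  fix M assume M: "compact M" "M \<subseteq> U"
  obtain \<epsilon> L where \<epsilon>: "\<epsilon> > 0" "L \<ge> 0" "\<And>t. t \<in> {0..T} \<Longrightarrow> cball (x t) \<epsilon> \<subseteq> \<Omega>"
    "\<And>t \<zeta> \<xi> \<eta>. t \<in> {0..T} \<Longrightarrow> \<zeta> \<in> M \<Longrightarrow> \<xi> \<in> cball (x t) \<epsilon> \<Longrightarrow> \<eta> \<in> cball (x t) \<epsilon> \<Longrightarrow>
      norm (f t \<xi> \<zeta> \<pi> - f t \<eta> \<zeta> \<pi>) \<le> L * norm (\<xi> - \<eta>) \<and> norm (f0 t \<xi> \<zeta> \<pi> - f0 t \<eta> \<zeta> \<pi>) \<le> L * norm (\<xi> - \<eta>)"
    using lipschitz_tube[OF M] by metis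
  show "\<exists>\<epsilon>>0. \<exists>L\<ge>0. \<forall>t\<in>{0..T}. cball (xs t) \<epsilon> \<subseteq> \<Omega> \<times> UNIV \<and>
      (\<forall>\<zeta>\<in>M. \<forall>\<xi>\<in>cball (xs t) \<epsilon>. \<forall>\<eta>\<in>cball (xs t) \<epsilon>. norm (F t \<xi> \<zeta> - F t \<eta> \<zeta>) \<le> L * norm (\<xi> - \<eta>))"
  proof (rule exI[of _ \<epsilon>], rule conjI[rotated], rule exI[of _ "2 * L"], intro conjI ballI)
    fix t assume t: "t \<in> {0..T}"
    have fst_in: "fst z \<in> cball (x t) \<epsilon>" if "z \<in> cball (xs t) \<epsilon>" for z
      using that dist_fst_le[of "xs t" z] by (simp add: xs_def)
    then show "cball (xs t) \<epsilon> \<subseteq> \<Omega> \<times> UNIV" using \<epsilon>(3)[OF t] by (auto simp: mem_Times_iff)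
    fix \<zeta> z z' assume \<zeta>: "\<zeta> \<in> M" and z: "z \<in> cball (xs t) \<epsilon>" "z' \<in> cball (xs t) \<epsilon>"
    have "norm (F t z \<zeta> - F t z' \<zeta>) \<le> L * norm (fst z - fst z') + L * norm (fst z - fst z')"
      using \<epsilon>(4)[OF t \<zeta> fst_in[OF z(1)] fst_in[OF z(2)]]
      by (simp add: F_def order_trans[OF norm_Pair_le] add_mono)
    also have "\<dots> \<le> 2 * L * norm (z - z')"
    proof -
      have "norm (fst (z - z')) \<le> norm (z - z')" using norm_fst_le[of "fst (z - z')" "snd (z - z')"] by (simp only: prod.collapse)
      from mult_left_mono[OF this \<epsilon>(2)] show ?thesis by simp
    qed
    finally show "norm (F t z \<zeta> - F t z' \<zeta>) \<le> 2 * L * norm (z - z')" .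
  qed (use \<epsilon> in auto)
qed (use T u xs_cont in auto)

lemma dynamics_NPC0_R:
  assumes "continuous_on {0..T} y" "\<And>t. t \<in> {0..T} \<Longrightarrow> y t \<in> \<Omega>" "w \<in> NPC0_R T U"
  shows "(\<lambda>t. f t (y t) (w t) \<pi>) \<in> NPC0_R T UNIV"
proof -
  have "(\<lambda>t. (t, y t, w t)) \<in> NPC0_R T ({0..T} \<times> \<Omega> \<times> U)"
    using assms(1,2) T
    by (intro NPC0_R_Pair[OF T _ NPC0_R_Pair[OF T _ assms(3)]] NPC0_R_continuous) (auto intro: continuous_intros)
  from NPC0_R_compose[OF T this cont, of UNIV] show ?thesis by simp
qed

section \<open>Terminal data of the Mayer problem and its multipliers\<close>

definition gE :: "nat \<Rightarrow> 'x \<times> real \<Rightarrow> real" where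
  "gE i z = (if i = 0 then 1 else 0) * snd z + g i (fst z) \<pi>"

definition hE :: "nat \<Rightarrow> 'x \<times> real \<Rightarrow> real" where
  "hE j z = h j (fst z) \<pi>"

definition DG :: "nat \<Rightarrow> ('x \<times> real) \<Rightarrow>\<^sub>L real" where
  "DG i = (if i = 0 then 1 else 0) *\<^sub>R snd_blinfun + (hadamard_deriv (\<lambda>\<xi>. g i \<xi> \<pi>) (x T) o\<^sub>L fst_blinfun)"

definition DH :: "nat \<Rightarrow> ('x \<times> real) \<Rightarrow>\<^sub>L real" where
  "DH j = hadamard_deriv (\<lambda>\<xi>. h j \<xi> \<pi>) (x T) o\<^sub>L fst_blinfun"

lemma gE_hadamard: "i \<in> {0..m} \<Longrightarrow> has_hadamard_deriv (gE i) (DG i) (xs T)"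
  and hE_hadamard: "j \<in> {1..q} \<Longrightarrow> has_hadamard_deriv (hE j) (DH j) (xs T)"
  using has_hadamard_deriv_lift[OF has_hadamard_deriv_hadamard_deriv[OF had_g[of i]], of "if i = 0 then 1 else 0"]
    has_hadamard_deriv_lift[OF has_hadamard_deriv_hadamard_deriv[OF had_h[of j]], of 0]
  unfolding gE_def[abs_def] hE_def[abs_def] DG_def DH_def xs_def by auto

text \<open>Dropping the cost coordinate of a competitor leaves an admissible pair, and that
  coordinate at \<open>T\<close> is its running cost; \<open>gE 0\<close> is therefore the Bolza
  objective.\<close>

lemma augmented_optimal:
  assumes y: "y \<in> PC1 T (\<Omega> \<times> UNIV)" and w: "w \<in> NPC0_R T U" and y0: "y 0 = xs 0"
    and dy: "\<And>t. t \<in> {0..T} \<Longrightarrow> ext_deriv T y t = F t (y t) (w t)"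
    and gy: "\<And>i. i \<in> {1..m} \<Longrightarrow> 0 \<le> gE i (y T)" and hy: "\<And>j. j \<in> {1..q} \<Longrightarrow> hE j (y T) = 0"
  shows "gE 0 (y T) \<le> gE 0 (xs T)"
proof -
  have c1: "continuous_on {0..T} (\<lambda>t. fst (y t))" and c2: "continuous_on {0..T} (\<lambda>t. snd (y t))"
    using PC1_continuous[OF y] by (auto intro: continuous_intros)
  have mem: "fst (y t) \<in> \<Omega>" if "t \<in> {0..T}" for t using PC1_mem[OF y that] by auto
  obtain S where S: "finite S" "\<And>t. t \<in> {0<..<T} - S \<Longrightarrow> (y has_vector_derivative ext_deriv T y t) (at t)"
    using PC1_ext_deriv(2)[OF T y] by blast
  have d1: "((\<lambda>t. fst (y t)) has_vector_derivative f t (fst (y t)) (w t) \<pi>) (at t)"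
    and d2: "((\<lambda>t. snd (y t)) has_vector_derivative f0 t (fst (y t)) (w t) \<pi>) (at t)" if "t \<in> {0<..<T} - S" for t
    using bounded_linear.has_vector_derivative[OF bounded_linear_fst S(2)[OF that]]
      bounded_linear.has_vector_derivative[OF bounded_linear_snd S(2)[OF that]] dy[of t] that by (auto simp: F_def)
  note P = PC1_I[OF T c1 mem dynamics_NPC0_R[OF c1 mem w] S(1) d1]
  have "((\<lambda>t. f0 t (fst (y t)) (w t) \<pi>) has_integral (snd (y T) - snd (y 0))) {0..T}"
    using has_integral_FTC_finite[OF _ _ c2 S(1) d2, of T] T by simp
  \<comment> \<open>The cost coordinate starts at zero, because \<open>snd (xs 0)\<close> is an
    integral over a single point.\<close>
  then have J: "(LINT t:{0..T}|lborel. f0 t (fst (y t)) (w t) \<pi>) = snd (y T)"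
    using set_borel_integral_eq_integral(2)[OF NPC0_R_set_integrable[OF T running_NPC0_R[OF c1 mem w]]]
    by (simp add: integral_unique y0 xs_def)
  have J': "(LINT t:{0..T}|lborel. f0 t (x t) (u t) \<pi>) = snd (xs T)"
    using set_borel_integral_eq_integral(2)[OF NPC0_R_set_integrable[OF T running_NPC0_R[OF x_cont x_mem u]]]
    by (simp add: xs_def)
  have "((\<lambda>t. fst (y t)), w) \<in> bolza_admissible T \<Omega> U \<xi>\<^sub>0 m q f g h \<pi>"
    using P w gy hy y0 by (auto simp: bolza_admissible_def gE_def hE_def xs_def x(3))
  then have "bolza_objective T f0 g \<pi> ((\<lambda>t. fst (y t)), w) \<le> bolza_objective T f0 g \<pi> (x, u)"
    using sol by (auto simp: bolza_solution_def)
  then show ?thesis by (simp add: bolza_objective_def J J' gE_def xs_def)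
qed

text \<open>\<open>fritz_john\<close> in the finitely many widths of the needles listed in
  \<open>Q\<close>; the linear functions of the widths are the terminal differentials applied to the
  transported jumps.\<close>

lemma finite_multipliers:
  fixes \<Phi> \<Psi> :: "real \<Rightarrow> ('x \<times> real) \<Rightarrow>\<^sub>L ('x \<times> real)"
  assumes \<Phi>: "continuous_on {0..T} \<Phi>" "finite S"
      "\<And>t. t \<in> {0<..<T} - S \<Longrightarrow> (\<Phi> has_vector_derivative A t o\<^sub>L \<Phi> t) (at t)"
    and inv: "\<And>t. t \<in> {0..T} \<Longrightarrow> \<Phi> t o\<^sub>L \<Psi> t = id_blinfun"
    and Q: "finite Q" "Q \<subseteq> {0..<T} \<times> U"
  shows "\<exists>lam mu. (\<forall>i\<in>{0..m}. 0 \<le> lam i) \<and> (\<forall>i\<in>{1..m}. lam i * gE i (xs T) = 0) \<and>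
    ((\<exists>i\<in>{0..m}. lam i \<noteq> 0) \<or> (\<exists>j\<in>{1..q}. mu j \<noteq> 0)) \<and>
    (\<forall>(t, v)\<in>Q. (\<Sum>i=0..m. lam i * DG i (\<Phi> T (\<Psi> t (F t (xs t) v - F t (xs t) (u t))))) +
      (\<Sum>j=1..q. mu j * DH j (\<Phi> T (\<Psi> t (F t (xs t) v - F t (xs t) (u t))))) \<le> 0)"
proof -
  interpret control_trajectory T "\<Omega> \<times> UNIV" U F xs u A by (rule control_trajectory_F)
  obtain l0 where "set l0 = Q" using finite_list[OF Q(1)] by blast
  \<comment> \<open>Stacking needs nondecreasing times. Several control values at the same time are
    allowed and simply become neighbours.\<close>
  define l where "l = sort_key fst l0"
  define N where "N = length l"
  have l: "set l = Q" "sorted (map fst l)" using \<open>set l0 = Q\<close> by (simp_all add: l_def)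
  define ts where "ts k = fst (l ! k)" for k
  define vs where "vs k = snd (l ! k)" for k
  have lk: "l ! k \<in> Q" if "k < N" for k using that l(1) nth_mem[of k l] by (simp add: N_def)
  have tk: "ts k \<in> {0..<T}" "vs k \<in> U" if "k < N" for k
    using lk[OF that] Q(2) by (auto simp: ts_def vs_def)
  have mono: "ts j \<le> ts k" if "j \<le> k" "k < N" for j k
    using sorted_nth_mono[OF l(2) that(1)] that by (simp add: N_def ts_def)
  define W where "W k = \<Phi> T (\<Psi> (ts k) (F (ts k) (xs (ts k)) (vs k) - F (ts k) (xs (ts k)) (u (ts k))))" for k
  obtain r K y w where r: "0 < r"
    and yw: "\<forall>a. (\<forall>k<N. 0 \<le> a k) \<longrightarrow> sum a {..<N} \<le> r \<longrightarrow> w a \<in> NPC0_R T U \<and> y a \<in> PC1 T (\<Omega> \<times> UNIV) \<and>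
       y a 0 = xs 0 \<and> (\<forall>t\<in>{0..T}. ext_deriv T (y a) t = F t (y a t) (w a t))"
    and lip: "\<forall>a b. (\<forall>k<N. 0 \<le> a k) \<longrightarrow> sum a {..<N} \<le> r \<longrightarrow> (\<forall>k<N. 0 \<le> b k) \<longrightarrow> sum b {..<N} \<le> r \<longrightarrow>
       norm (y a T - y b T) \<le> K * (\<Sum>k<N. \<bar>a k - b k\<bar>)"
    and exp: "\<forall>\<eta>>0. \<exists>\<delta>>0. \<forall>a. (\<forall>k<N. 0 \<le> a k) \<longrightarrow> sum a {..<N} \<le> r \<longrightarrow> sum a {..<N} \<le> \<delta> \<longrightarrow>
       norm (y a T - xs T - (\<Sum>k<N. a k *\<^sub>R W k)) \<le> \<eta> * sum a {..<N}"
  proof (rule needle_family[where N = N and ts = ts and vs = vs and \<Phi> = \<Phi> and \<Psi> = \<Psi> and S = S, folded W_def])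
    show "ts k \<in> {0..<T}" "vs k \<in> U" if "k < N" for k by (fact tk[OF that])+
    show "ts j \<le> ts k" if "j \<le> k" "k < N" for j k by (fact mono[OF that])
    show "continuous_on {0..T} \<Phi>" "finite S" by fact+
    show "(\<Phi> has_vector_derivative A t o\<^sub>L \<Phi> t) (at t)" if "t \<in> {0<..<T} - S" for t by (fact \<Phi>(3)[OF that])
    show "\<Phi> t o\<^sub>L \<Psi> t = id_blinfun" if "t \<in> {0..T}" for t by (fact inv[OF that])
  qed (rule that)
  \<comment> \<open>Nothing said so far identifies the response to zero widths with
    \<open>xs\<close> at \<open>T\<close>; the expansion at the zero vector does.\<close>
  have y0: "y (\<lambda>_. 0) T = xs T"
  proof -
    obtain \<delta> where "\<delta> > 0" "\<And>a. (\<forall>k<N. 0 \<le> a k) \<Longrightarrow> sum a {..<N} \<le> r \<Longrightarrow> sum a {..<N} \<le> \<delta> \<Longrightarrow>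
       norm (y a T - xs T - (\<Sum>k<N. a k *\<^sub>R W k)) \<le> 1 * sum a {..<N}"
      using exp[rule_format, of 1] by auto
    from this(2)[of "\<lambda>_. 0"] this(1) r show ?thesis by simp
  qed
  have "\<exists>lam mu. (\<forall>i\<in>{0..m}. 0 \<le> lam i) \<and> (\<forall>i\<in>{1..m}. lam i * gE i (xs T) = 0) \<and>
    ((\<exists>i\<in>{0..m}. lam i \<noteq> 0) \<or> (\<exists>j\<in>{1..q}. mu j \<noteq> 0)) \<and>
    (\<forall>k<N. (\<Sum>i=0..m. lam i * DG i (W k)) + (\<Sum>j=1..q. mu j * DH j (W k)) \<le> 0)"
  proof (rule fritz_john[OF r, where G = "\<lambda>i a. gE i (y a T)" and H = "\<lambda>j a. hE j (y a T)"])
    show "\<exists>\<delta>>0. \<forall>a. (\<forall>k<N. 0 \<le> a k) \<longrightarrow> sum a {..<N} \<le> r \<longrightarrow> sum a {..<N} \<le> \<delta> \<longrightarrow>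
      \<bar>gE i (y a T) - gE i (xs T) - (\<Sum>k<N. a k * DG i (W k))\<bar> \<le> \<eta> * sum a {..<N}" if "i \<in> {0..m}" "0 < \<eta>" for i \<eta>
      by (rule hadamard_expansion[OF gE_hadamard[OF that(1)] that(2) exp[rule_format]])
    show "\<exists>\<delta>>0. \<forall>a. (\<forall>k<N. 0 \<le> a k) \<longrightarrow> sum a {..<N} \<le> r \<longrightarrow> sum a {..<N} \<le> \<delta> \<longrightarrow>
      \<bar>hE j (y a T) - (\<Sum>k<N. a k * DH j (W k))\<bar> \<le> \<eta> * sum a {..<N}" if "j \<in> {1..q}" "0 < \<eta>" for j \<eta>
    proof -
      have "hE j (xs T) = 0" using x(5)[OF that(1)] by (simp add: hE_def xs_def)
      with hadamard_expansion[OF hE_hadamard[OF that(1)] that(2) exp[rule_format]] show ?thesis by simp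
    qed
    show "0 \<le> gE i (xs T)" if "i \<in> {1..m}" for i using x(4)[OF that] that by (simp add: gE_def xs_def)
    show "gE 0 (y a T) \<le> gE 0 (xs T)" if a: "\<And>k. k < N \<Longrightarrow> 0 \<le> a k" "sum a {..<N} \<le> r"
      "\<And>i. i \<in> {1..m} \<Longrightarrow> 0 \<le> gE i (y a T)" "\<And>j. j \<in> {1..q} \<Longrightarrow> hE j (y a T) = 0" for a
    proof -
      have ya: "w a \<in> NPC0_R T U \<and> y a \<in> PC1 T (\<Omega> \<times> UNIV) \<and> y a 0 = xs 0 \<and> (\<forall>t\<in>{0..T}. ext_deriv T (y a) t = F t (y a t) (w a t))"
        using yw a(1,2) by simp
      show ?thesis by (rule augmented_optimal[of "y a" "w a"]) (use ya a(3,4) in auto)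
    qed
    fix j assume j: "j \<in> {1..q}"
    obtain B where B: "open B" "x T \<in> B" "continuous_on B (\<lambda>\<xi>. h j \<xi> \<pi>)" using cont_h[OF j] by blast
    obtain e where e: "e > 0" "ball (x T) e \<subseteq> B" using B(1,2) openE by blast
    \<comment> \<open>Keeps the end point where \<open>h j\<close> is continuous. The sign of
      \<open>K\<close> is not known, hence the absolute value, and the 1 avoids division by
      zero.\<close>
    define \<rho> where "\<rho> = min r (e / (2 * (\<bar>K\<bar> + 1)))"
    have \<rho>: "\<rho> > 0" "\<rho> \<le> r" using r e(1) by (auto simp: \<rho>_def)
    have inB: "fst (y a T) \<in> B" if a: "\<forall>k<N. 0 \<le> a k" "sum a {..<N} \<le> \<rho>" for a
    proof -
      have "norm (y a T - y (\<lambda>_. 0) T) \<le> K * (\<Sum>k<N. \<bar>a k - 0\<bar>)"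
        using a \<rho>(2) r by (intro lip[rule_format]) auto
      also have "(\<Sum>k<N. \<bar>a k - 0\<bar>) = sum a {..<N}" using a(1) by (intro sum.cong) auto
      also have "K * sum a {..<N} \<le> (\<bar>K\<bar> + 1) * sum a {..<N}" using a(1) by (intro mult_right_mono sum_nonneg) auto
      also have "\<dots> \<le> (\<bar>K\<bar> + 1) * (e / (2 * (\<bar>K\<bar> + 1)))" using a(2) by (intro mult_left_mono) (auto simp: \<rho>_def)
      also have "\<dots> = e / 2"
      proof -
        have "c * (e / (2 * c)) = e / 2" if "c \<noteq> 0" for c :: real using that by simp
        from this[of "\<bar>K\<bar> + 1"] show ?thesis by linarith
      qed
      finally have "dist (y a T) (xs T) < e" using e(1) y0 by (simp add: dist_norm)
      then have "dist (fst (y a T)) (x T) < e"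
        using dist_fst_le[of "y a T" "xs T"] by (simp add: xs_def)
      then show ?thesis using e(2) by (auto simp: dist_commute)
    qed
    show "\<exists>\<rho>>0. \<forall>s a. (\<forall>n. (\<forall>k<N. 0 \<le> s n k) \<and> sum (s n) {..<N} \<le> \<rho>) \<longrightarrow>
      (\<forall>k<N. 0 \<le> a k) \<longrightarrow> sum a {..<N} \<le> \<rho> \<longrightarrow> (\<forall>k<N. (\<lambda>n. s n k) \<longlonglongrightarrow> a k) \<longrightarrow> (\<lambda>n::nat. hE j (y (s n) T)) \<longlonglongrightarrow> hE j (y a T)"
    proof (rule exI[of _ \<rho>], intro conjI allI impI \<rho>(1))
      fix s :: "nat \<Rightarrow> nat \<Rightarrow> real" and a
      assume s: "\<forall>n. (\<forall>k<N. 0 \<le> s n k) \<and> sum (s n) {..<N} \<le> \<rho>" and a: "\<forall>k<N. 0 \<le> a k" "sum a {..<N} \<le> \<rho>"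
        and lim: "\<forall>k<N. (\<lambda>n. s n k) \<longlonglongrightarrow> a k"
      have "(\<lambda>n. K * (\<Sum>k<N. \<bar>s n k - a k\<bar>)) \<longlonglongrightarrow> K * (\<Sum>k<N. \<bar>a k - a k\<bar>)"
        using lim by (intro tendsto_intros) auto
      then have "(\<lambda>n. K * (\<Sum>k<N. \<bar>s n k - a k\<bar>)) \<longlonglongrightarrow> 0" by simp
      then have "(\<lambda>n. y (s n) T - y a T) \<longlonglongrightarrow> 0"
      proof (rule Lim_null_comparison[rotated], intro always_eventually allI)
        fix n
        have s1: "\<And>k. k < N \<Longrightarrow> 0 \<le> s n k" "sum (s n) {..<N} \<le> r" using s \<rho>(2) by (auto intro: order_trans)
        show "norm (y (s n) T - y a T) \<le> K * (\<Sum>k<N. \<bar>s n k - a k\<bar>)"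
          by (rule lip[rule_format, OF s1]) (use a \<rho>(2) in auto)
      qed
      then have "(\<lambda>n. fst (y (s n) T)) \<longlonglongrightarrow> fst (y a T)" by (intro tendsto_fst) (simp add: Lim_null[symmetric])
      moreover have "isCont (\<lambda>\<xi>. h j \<xi> \<pi>) (fst (y a T))"
        using B(1,3) inB[OF a] by (simp add: continuous_on_eq_continuous_at)
      ultimately show "(\<lambda>n. hE j (y (s n) T)) \<longlonglongrightarrow> hE j (y a T)"
        unfolding hE_def using isCont_tendsto_compose[of "fst (y a T)" "\<lambda>\<xi>. h j \<xi> \<pi>"] by blast
    qed
  qed
  then obtain lam mu where LM: "(\<forall>i\<in>{0..m}. 0 \<le> lam i)" "(\<forall>i\<in>{1..m}. lam i * gE i (xs T) = 0)"
    "((\<exists>i\<in>{0..m}. lam i \<noteq> 0) \<or> (\<exists>j\<in>{1..q}. mu j \<noteq> 0))"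
    "(\<forall>k<N. (\<Sum>i=0..m. lam i * DG i (W k)) + (\<Sum>j=1..q. mu j * DH j (W k)) \<le> 0)"
    by (elim exE conjE)
  have "(\<Sum>i=0..m. lam i * DG i (\<Phi> T (\<Psi> t (F t (xs t) v - F t (xs t) (u t))))) +
      (\<Sum>j=1..q. mu j * DH j (\<Phi> T (\<Psi> t (F t (xs t) v - F t (xs t) (u t))))) \<le> 0" if "(t, v) \<in> Q" for t v
  proof -
    have "(t, v) \<in> set l" using that l(1) by simp
    then obtain k where k: "k < N" "l ! k = (t, v)" unfolding in_set_conv_nth N_def by blast
    from LM(4)[rule_format, OF k(1)] show ?thesis by (simp add: W_def ts_def vs_def k(2))
  qed
  then have all: "\<forall>(t, v)\<in>Q. (\<Sum>i=0..m. lam i * DG i (\<Phi> T (\<Psi> t (F t (xs t) v - F t (xs t) (u t))))) +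
      (\<Sum>j=1..q. mu j * DH j (\<Phi> T (\<Psi> t (F t (xs t) v - F t (xs t) (u t))))) \<le> 0" by blast
  show ?thesis by (rule exI[of _ lam], rule exI[of _ mu]) (intro conjI LM(1-3) all)
qed

text \<open>
  The multipliers of the finite families of needles have the finite intersection property in the
  compact set of normalised multipliers.
\<close>

lemma all_multipliers:
  fixes \<Phi> \<Psi> :: "real \<Rightarrow> ('x \<times> real) \<Rightarrow>\<^sub>L ('x \<times> real)"
  assumes \<Phi>: "continuous_on {0..T} \<Phi>" "finite S"
      "\<And>t. t \<in> {0<..<T} - S \<Longrightarrow> (\<Phi> has_vector_derivative A t o\<^sub>L \<Phi> t) (at t)"
    and inv: "\<And>t. t \<in> {0..T} \<Longrightarrow> \<Phi> t o\<^sub>L \<Psi> t = id_blinfun"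
  obtains lam mu where "\<And>i. i \<in> {0..m} \<Longrightarrow> 0 \<le> lam i" "\<And>i. i \<in> {1..m} \<Longrightarrow> lam i * gE i (xs T) = 0"
    "(\<exists>i\<in>{0..m}. lam i \<noteq> 0) \<or> (\<exists>j\<in>{1..q}. mu j \<noteq> (0::real))"
    "\<And>t v. t \<in> {0..<T} \<Longrightarrow> v \<in> U \<Longrightarrow> (\<Sum>i=0..m. lam i * DG i (\<Phi> T (\<Psi> t (F t (xs t) v - F t (xs t) (u t))))) +
      (\<Sum>j=1..q. mu j * DH j (\<Phi> T (\<Psi> t (F t (xs t) v - F t (xs t) (u t))))) \<le> 0"
proof -
  \<comment> \<open>One vector holds both kinds of multipliers: coordinates up to \<open>m\<close>
    are the \<open>lam i\<close>, coordinate \<open>m + j\<close> is \<open>mu j\<close>.\<close>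
  define n where "n = Suc (m + q)"
  define D where "D p = \<Phi> T (\<Psi> (fst p) (F (fst p) (xs (fst p)) (snd p) - F (fst p) (xs (fst p)) (u (fst p))))" for p
  define C where "C p = {y :: nat \<Rightarrow> real. (\<Sum>i=0..m. y i * DG i (D p)) + (\<Sum>j=1..q. y (m + j) * DH j (D p)) \<le> 0}" for p
  define B where "B = {y :: nat \<Rightarrow> real. (\<forall>i\<ge>n. y i = 0) \<and> (\<Sum>i<n. \<bar>y i\<bar>) = 1} \<inter>
    ((\<Inter>i\<in>{0..m}. {y. 0 \<le> y i}) \<inter> (\<Inter>i\<in>{1..m}. {y. y i * gE i (xs T) = 0}))"
  have cc: "continuous_on UNIV (\<lambda>y :: nat \<Rightarrow> real. y i)" for i by (rule continuous_on_product_coordinates)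
  have "compact B" unfolding B_def n_def
    by (intro compact_Int_closed compact_unit_multipliers closed_Int closed_INT ballI
        closed_Collect_le closed_Collect_eq continuous_intros cc)
  moreover have "closed (C p)" for p
    unfolding C_def by (intro closed_Collect_le continuous_intros cc)
  moreover have "B \<inter> (\<Inter>p\<in>Q. C p) \<noteq> {}" if Q: "finite Q" "Q \<subseteq> {0..<T} \<times> U" for Q
  proof -
    obtain lam mu where LM: "\<forall>i\<in>{0..m}. 0 \<le> lam i" "\<forall>i\<in>{1..m}. lam i * gE i (xs T) = 0"
      "(\<exists>i\<in>{0..m}. lam i \<noteq> 0) \<or> (\<exists>j\<in>{1..q}. mu j \<noteq> 0)"
      "\<forall>(t, v)\<in>Q. (\<Sum>i=0..m. lam i * DG i (\<Phi> T (\<Psi> t (F t (xs t) v - F t (xs t) (u t))))) +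
      (\<Sum>j=1..q. mu j * DH j (\<Phi> T (\<Psi> t (F t (xs t) v - F t (xs t) (u t))))) \<le> 0"
      using finite_multipliers[OF \<Phi> inv Q] by blast
    define y0 where "y0 i = (if i \<le> m then lam i else if i < n then mu (i - m) else 0)" for i
    define s where "s = (\<Sum>i<n. \<bar>y0 i\<bar>)"
    have "\<exists>i<n. y0 i \<noteq> 0"
      using LM(3)
    proof
      assume "\<exists>i\<in>{0..m}. lam i \<noteq> 0"
      then obtain i where "i \<le> m" "lam i \<noteq> 0" by auto
      then show ?thesis by (intro exI[of _ i]) (auto simp: y0_def n_def)
    next
      assume "\<exists>j\<in>{1..q}. mu j \<noteq> 0"
      then obtain j where "j \<in> {1..q}" "mu j \<noteq> 0" by auto
      then show ?thesis by (intro exI[of _ "m + j"]) (auto simp: y0_def n_def)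
    qed
    then obtain i0 where "i0 < n" "y0 i0 \<noteq> 0" by blast
    then have s: "0 < s" unfolding s_def by (intro sum_pos2[of _ i0]) auto
    define y where "y i = y0 i / s" for i
    have yl: "y i = lam i / s" if "i \<in> {0..m}" for i using that by (simp add: y_def y0_def)
    have ym: "y (m + j) = mu j / s" if "j \<in> {1..q}" for j using that by (simp add: y_def y0_def n_def)
    have "y \<in> B"
    proof -
      have "(\<Sum>i<n. \<bar>y i\<bar>) = 1" using s by (simp add: y_def sum_divide_distrib[symmetric] s_def[symmetric])
      moreover have "\<forall>i\<ge>n. y i = 0" by (auto simp: y_def y0_def n_def)
      moreover have "y \<in> (\<Inter>i\<in>{0..m}. {y. 0 \<le> y i})" using yl LM(1) s by simp
      moreover have "y i * gE i (xs T) = 0" if "i \<in> {1..m}" for i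
        using yl[of i] bspec[OF LM(2) that] that by auto
      then have "y \<in> (\<Inter>i\<in>{1..m}. {y. y i * gE i (xs T) = 0})" by blast
      ultimately show ?thesis by (simp add: B_def)
    qed
    moreover have "y \<in> C p" if p: "p \<in> Q" for p
    proof -
      have "(\<Sum>i=0..m. y i * DG i (D p)) + (\<Sum>j=1..q. y (m + j) * DH j (D p)) =
        ((\<Sum>i=0..m. lam i * DG i (D p)) + (\<Sum>j=1..q. mu j * DH j (D p))) / s"
        unfolding add_divide_distrib sum_divide_distrib using yl ym by (intro arg_cong2[where f = "(+)"] sum.cong) auto
      also have "\<dots> \<le> 0" using LM(4) p s by (intro divide_nonpos_pos) (auto simp: D_def)
      finally show ?thesis by (simp add: C_def)
    qed
    ultimately show ?thesis by blast
  qed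
  \<comment> \<open>Each needle imposes one closed linear inequality on the compact set
    \<open>B\<close>, and any finitely many of them have a common solution.\<close>
  ultimately have "B \<inter> (\<Inter>p\<in>{0..<T} \<times> U. C p) \<noteq> {}" by (rule compact_imp_fip_image)
  then obtain y where y: "y \<in> B" "\<And>p. p \<in> {0..<T} \<times> U \<Longrightarrow> y \<in> C p" by blast
  show thesis
  proof (rule that[of y "\<lambda>j. y (m + j)"])
    show "0 \<le> y i" if "i \<in> {0..m}" for i using y(1) that by (simp add: B_def)
    show "y i * gE i (xs T) = 0" if "i \<in> {1..m}" for i using y(1) that by (simp add: B_def)
    show "(\<exists>i\<in>{0..m}. y i \<noteq> 0) \<or> (\<exists>j\<in>{1..q}. y (m + j) \<noteq> 0)"
    proof (rule ccontr)
      assume no: "\<not> ?thesis"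
      have "y i = 0" if "i < n" for i
      proof (cases "i \<le> m")
        case False
        then have "i - m \<in> {1..q}" "m + (i - m) = i" using that by (auto simp: n_def)
        then show ?thesis using no by metis
      qed (use no in auto)
      then have "(\<Sum>i<n. \<bar>y i\<bar>) = 0" by simp
      then show False using y(1) by (simp add: B_def)
    qed
    fix t v assume "t \<in> {0..<T}" "v \<in> U"
    then show "(\<Sum>i=0..m. y i * DG i (\<Phi> T (\<Psi> t (F t (xs t) v - F t (xs t) (u t))))) +
      (\<Sum>j=1..q. y (m + j) * DH j (\<Phi> T (\<Psi> t (F t (xs t) v - F t (xs t) (u t))))) \<le> 0"
      using y(2)[of "(t, v)"] by (simp add: C_def D_def)
  qed
qed

lemma frechet_H:
  assumes t: "t \<in> {0..T}"
  shows "frechet_deriv (\<lambda>\<xi>. pontryagin_H f0 f \<pi> t \<xi> (u t) r l) (x t) = (r o\<^sub>L A1 t) + l *\<^sub>R A0 t"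
proof (rule frechet_deriv_eq)
  show "((\<lambda>\<xi>. pontryagin_H f0 f \<pi> t \<xi> (u t) r l) has_derivative ((r o\<^sub>L A1 t) + l *\<^sub>R A0 t)) (at (x t))"
    unfolding pontryagin_H_def
    by (rule has_derivative_eq_rhs[OF has_derivative_add[OF bounded_linear.has_derivative[OF blinfun.bounded_linear_right A1_deriv[OF t]]
        has_derivative_mult_right[OF A0_deriv[OF t]]]])
      (simp add: fun_eq_iff blinfun.bilinear_simps)
qed

text \<open>Reading the needle inequalities at time \<open>t\<close> as a statement about
  \<open>M o \<Phi> T o \<Psi> t\<close> gives the maximum condition directly: the terminal
  multipliers carried back along the flow are the costate, with the adjoint equation inherited from
  \<open>\<Psi>\<close>.\<close>

theorem pontryagin_principle:
  "\<exists>lam mu p. pontryagin_triple T U m q f0 f g h \<pi> (x, u) lam mu p \<and> (lam 0 = 0 \<or> lam 0 = 1)"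
proof -
  interpret control_trajectory T "\<Omega> \<times> UNIV" U F xs u A by (rule control_trajectory_F)
  obtain \<Phi> \<Psi> :: "real \<Rightarrow> ('x \<times> real) \<Rightarrow>\<^sub>L ('x \<times> real)" and S where
    \<Phi>: "continuous_on {0..T} \<Phi>" and \<Psi>: "continuous_on {0..T} \<Psi>" and S: "finite S"
    and d\<Phi>: "\<And>t. t \<in> {0<..<T} - S \<Longrightarrow> (\<Phi> has_vector_derivative A t o\<^sub>L \<Phi> t) (at t)"
    and d\<Psi>: "\<And>t. t \<in> {0<..<T} - S \<Longrightarrow> (\<Psi> has_vector_derivative - (\<Psi> t o\<^sub>L A t)) (at t)"
    and inv: "\<And>t. t \<in> {0..T} \<Longrightarrow> \<Phi> t o\<^sub>L \<Psi> t = id_blinfun"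
    using fundamental_solution[OF T A] by metis
  obtain lam' mu' where lam0': "\<And>i. i \<in> {0..m} \<Longrightarrow> 0 \<le> lam' i" and compl': "\<And>i. i \<in> {1..m} \<Longrightarrow> lam' i * gE i (xs T) = 0"
    and nz': "(\<exists>i\<in>{0..m}. lam' i \<noteq> 0) \<or> (\<exists>j\<in>{1..q}. mu' j \<noteq> (0::real))"
    and neg': "\<And>t v. t \<in> {0..<T} \<Longrightarrow> v \<in> U \<Longrightarrow> (\<Sum>i=0..m. lam' i * DG i (\<Phi> T (\<Psi> t (F t (xs t) v - F t (xs t) (u t))))) +
      (\<Sum>j=1..q. mu' j * DH j (\<Phi> T (\<Psi> t (F t (xs t) v - F t (xs t) (u t))))) \<le> 0"
    by (rule all_multipliers[OF \<Phi> S d\<Phi> inv]; (assumption | (rule that; assumption)))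
  \<comment> \<open>All conditions are homogeneous in the multipliers, so the cost multiplier can be
    scaled to 1 unless it is zero.\<close>
  define c where "c = (if lam' 0 = 0 then 1 else 1 / lam' 0)"
  have c: "0 < c" using lam0'[of 0] by (auto simp: c_def)
  define lam where "lam i = c * lam' i" for i
  define mu where "mu j = c * mu' j" for j
  have lam01: "lam 0 = 0 \<or> lam 0 = 1" by (simp add: lam_def c_def)
  have lam0: "0 \<le> lam i" if "i \<in> {0..m}" for i using lam0'[OF that] c by (simp add: lam_def)
  have compl: "lam i * gE i (xs T) = 0" if "i \<in> {1..m}" for i using compl'[OF that] by (auto simp: lam_def)
  have nz: "(\<exists>i\<in>{0..m}. lam i \<noteq> 0) \<or> (\<exists>j\<in>{1..q}. mu j \<noteq> 0)" using nz' c by (auto simp: lam_def mu_def)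
  have neg: "(\<Sum>i=0..m. lam i * DG i (\<Phi> T (\<Psi> t (F t (xs t) v - F t (xs t) (u t))))) +
      (\<Sum>j=1..q. mu j * DH j (\<Phi> T (\<Psi> t (F t (xs t) v - F t (xs t) (u t))))) \<le> 0"
    if "t \<in> {0..<T}" "v \<in> U" for t v
    using mult_nonneg_nonpos[OF less_imp_le[OF c] neg'[OF that]]
    by (simp add: lam_def mu_def distrib_left sum_distrib_left mult.assoc)
  define M where "M = (\<Sum>i=0..m. lam i *\<^sub>R DG i) + (\<Sum>j=1..q. mu j *\<^sub>R DH j)"
  \<comment> \<open>The costate of the augmented system; \<open>p\<close> below is its restriction
    to the original state.\<close>
  define R where "R t = (M o\<^sub>L \<Phi> T) o\<^sub>L \<Psi> t" for t
  define p where "p t = R t o\<^sub>L inl_blinfun" for t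
  have M_apply: "M z = (\<Sum>i=0..m. lam i * DG i z) + (\<Sum>j=1..q. mu j * DH j z)" for z
    by (simp add: M_def blinfun.add_left blinfun.sum_left blinfun.scaleR_left)
  have RT: "R T = M"
  proof (rule blinfun_eqI)
    fix z
    have "\<Phi> T (\<Psi> T z) = z" using inv[of T] T by (metis atLeastAtMost_iff blinfun_apply_blinfun_compose blinfun_apply_id_blinfun id_apply less_imp_le order_refl)
    then show "R T z = M z" by (simp add: R_def)
  qed
  have R_cont: "continuous_on {0..T} R"
    unfolding R_def by (intro bounded_bilinear.continuous_on[OF bounded_bilinear_blinfun_compose] continuous_intros \<Psi>)
  have R_deriv: "(R has_vector_derivative - (R t o\<^sub>L A t)) (at t)" if t: "t \<in> {0<..<T} - S" for t
  proof -
    have "(R has_vector_derivative ((M o\<^sub>L \<Phi> T) o\<^sub>L - (\<Psi> t o\<^sub>L A t))) (at t)"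
      unfolding R_def
      by (rule bounded_linear.has_vector_derivative[OF bounded_bilinear.bounded_linear_right[OF bounded_bilinear_blinfun_compose] d\<Psi>[OF t]])
    moreover have "(M o\<^sub>L \<Phi> T) o\<^sub>L - (\<Psi> t o\<^sub>L A t) = - (R t o\<^sub>L A t)"
      by (rule blinfun_eqI) (simp add: R_def blinfun.bilinear_simps)
    ultimately show ?thesis by simp
  qed
  \<comment> \<open>The dynamics do not depend on the accumulated cost, so this component of the
    adjoint arc is constant and equals its terminal value.\<close>
  have R0: "R t (0, s) = lam 0 * s" if t: "t \<in> {0..T}" for t s
  proof -
    have const: "R t (0, 1) = R 0 (0, 1)" if t: "t \<in> {0..T}" for t
    proof -
      have "((\<lambda>t. 0) has_integral (R t (0, 1) - R 0 (0, 1))) {0..t}"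
      proof (rule has_integral_FTC_finite[OF _ _ _ S])
        show "continuous_on {0..T} (\<lambda>t. R t (0, 1))" by (intro continuous_intros R_cont)
        show "((\<lambda>t. R t (0, 1)) has_vector_derivative 0) (at s)" if "s \<in> {0<..<T} - S" for s
          using bounded_linear.has_vector_derivative[OF blinfun.bounded_linear_left R_deriv[OF that], of "(0, 1)"]
          by (simp add: blinfun.bilinear_simps A_apply zero_prod_def[symmetric])
      qed (use t in auto)
      then show ?thesis using has_integral_unique[OF has_integral_0] by fastforce
    qed
    have "R T (0, 1) = lam 0"
    proof -
      have "(\<Sum>i=0..m. lam i * DG i (0, 1)) = (\<Sum>i=0..m. if i = 0 then lam i else 0)"
        by (intro sum.cong) (auto simp: DG_def blinfun.bilinear_simps)
      then show ?thesis by (simp add: RT M_apply DH_def)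
    qed
    then have "R t (0, 1) = lam 0" using const[OF t] const[of T] T by simp
    moreover have "(0, s) = s *\<^sub>R (0 :: 'x, 1 :: real)" by simp
    ultimately show ?thesis by (metis blinfun.scaleR_right mult.commute real_scaleR_def)
  qed
  have R_apply: "R t z = p t (fst z) + lam 0 * snd z" if t: "t \<in> {0..T}" for t z
  proof -
    have "z = (fst z, 0) + (0, snd z)" by simp
    then have "R t z = R t (fst z, 0) + R t (0, snd z)" by (metis blinfun.add_right)
    then show ?thesis by (simp add: p_def R0[OF t])
  qed
  have p_cont: "continuous_on {0..T} p"
    unfolding p_def by (intro bounded_bilinear.continuous_on[OF bounded_bilinear_blinfun_compose] continuous_intros R_cont)
  define w where "w t = - ((p t o\<^sub>L A1 t) + lam 0 *\<^sub>R A0 t)" for t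
  have w: "w \<in> NPC0_R T UNIV"
  proof -
    have 1: "(\<lambda>t. p t o\<^sub>L A1 t) \<in> NPC0_R T UNIV"
      by (rule NPC0_R_compose2[OF T NPC0_R_continuous[OF T p_cont, of UNIV] A1])
        (auto simp: case_prod_beta intro!: bounded_bilinear.continuous_on[OF bounded_bilinear_blinfun_compose] continuous_intros)
    have "(\<lambda>t. - ((p t o\<^sub>L A1 t) + lam 0 *\<^sub>R A0 t)) \<in> NPC0_R T UNIV"
      by (rule NPC0_R_compose2[OF T 1 A0]) (auto simp: case_prod_beta intro!: continuous_intros)
    then show ?thesis by (simp add: w_def[abs_def])
  qed
  have dp: "(p has_vector_derivative w t) (at t)" if t: "t \<in> {0<..<T} - S" for t
  proof -
    have t': "t \<in> {0..T}" using t by auto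
    have "(p has_vector_derivative (- (R t o\<^sub>L A t) o\<^sub>L inl_blinfun)) (at t)"
      unfolding p_def
      by (rule bounded_linear.has_vector_derivative[OF bounded_bilinear.bounded_linear_left[OF bounded_bilinear_blinfun_compose] R_deriv[OF t]])
    moreover have "- (R t o\<^sub>L A t) o\<^sub>L inl_blinfun = w t"
      by (rule blinfun_eqI) (simp add: w_def blinfun.bilinear_simps A_apply R_apply[OF t'])
    ultimately show ?thesis by simp
  qed
  note P = PC1_I[OF T p_cont _ w S dp, of UNIV]
  define k where "k t \<zeta> = pontryagin_H f0 f \<pi> t (x t) \<zeta> (p t) (lam 0)" for t \<zeta>
  have k_cont: "continuous_on ({0..T} \<times> U) (\<lambda>(t, \<zeta>). k t \<zeta>)"
  proof -
    have "continuous_on ({0..T} \<times> U) (\<lambda>z. (fst z, x (fst z), snd z))"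
      by (intro continuous_intros continuous_on_compose2[OF x_cont]) auto
    moreover have "(\<lambda>z. (fst z, x (fst z), snd z)) ` ({0..T} \<times> U) \<subseteq> {0..T} \<times> \<Omega> \<times> U" using x_mem by auto
    ultimately have "continuous_on ({0..T} \<times> U) (\<lambda>z. (\<lambda>(t, \<xi>, \<zeta>). f t \<xi> \<zeta> \<pi>) (fst z, x (fst z), snd z))"
      "continuous_on ({0..T} \<times> U) (\<lambda>z. (\<lambda>(t, \<xi>, \<zeta>). f0 t \<xi> \<zeta> \<pi>) (fst z, x (fst z), snd z))"
      using continuous_on_compose2[OF cont] continuous_on_compose2[OF cont0] by blast+
    moreover have "continuous_on ({0..T} \<times> U) (\<lambda>z. p (fst z))"
      by (intro continuous_on_compose2[OF p_cont] continuous_intros) auto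
    ultimately show ?thesis
      unfolding k_def pontryagin_H_def case_prod_unfold by (auto intro!: continuous_intros)
  qed
  have k_lim: "((\<lambda>s. k s (w' s)) \<longlongrightarrow> k t l) (at t within D)"
    if "(w' \<longlongrightarrow> l) (at t within D)" "t \<in> {0..T}" "l \<in> U" "eventually (\<lambda>s. s \<in> {0..T} \<and> w' s \<in> U) (at t within D)" for w' l t D
    using continuous_on_tendsto_compose[OF k_cont tendsto_Pair[OF tendsto_ident_at that(1)]] that(2-4)
    by (auto elim!: eventually_mono)
  have ev_left: "eventually (\<lambda>s. s \<in> {0..<T}) (at_left t)" if "t \<in> {0<..T}" for t
    unfolding eventually_at_topological using that by (intro exI[of _ "{0<..}"]) auto
  have max': "k t \<zeta> \<le> k t (u t)" if t: "t \<in> {0..<T}" and \<zeta>: "\<zeta> \<in> U" for t \<zeta>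
  proof -
    have t': "t \<in> {0..T}" using t by auto
    have "R t (F t (xs t) \<zeta> - F t (xs t) (u t)) \<le> 0" using neg[OF t \<zeta>] by (simp add: R_def M_apply)
    then show ?thesis unfolding R_apply[OF t'] 
      by (simp add: k_def pontryagin_H_def F_def xs_def blinfun.diff_right algebra_simps)
  qed
  have u_mem: "u t \<in> U" if "t \<in> {0..T}" for t using NPC0_R_mem[OF u that] .
  have Su: "\<And>t. t \<in> {0..<T} \<Longrightarrow> (u \<longlongrightarrow> u t) (at_right t)"
    "\<And>t. t \<in> {0<..T} \<Longrightarrow> \<exists>l\<in>U. (u \<longlongrightarrow> l) (at_left t)" "(u \<longlongrightarrow> u T) (at_left T)"
    by (rule NPC0_R_D[OF u]; blast)+
  \<comment> \<open>The needles only give the maximum for \<open>t < T\<close>. Passing to left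
    limits gives it at \<open>T\<close> and shows that at a jump the left limit of the control is a
    maximiser as well.\<close>
  have left_max: "k t \<zeta> \<le> k t l" if t: "t \<in> {0<..T}" and l: "l \<in> U" "(u \<longlongrightarrow> l) (at_left t)" and \<zeta>: "\<zeta> \<in> U" for t l \<zeta>
  proof (rule tendsto_le[of "at_left t" "\<lambda>s. k s (u s)" _ "\<lambda>s. k s \<zeta>"])
    show "((\<lambda>s. k s (u s)) \<longlongrightarrow> k t l) (at_left t)"
      using t ev_left[OF t] u_mem by (intro k_lim l) (auto elim!: eventually_mono)
    show "((\<lambda>s. k s \<zeta>) \<longlongrightarrow> k t \<zeta>) (at_left t)"
      using t ev_left[OF t] \<zeta> by (intro k_lim) (auto elim!: eventually_mono)
    show "\<forall>\<^sub>F s in at_left t. k s \<zeta> \<le> k s (u s)" using ev_left[OF t] by eventually_elim (rule max'[OF _ \<zeta>])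
  qed simp
  have max: "k t \<zeta> \<le> k t (u t)" if t: "t \<in> {0..T}" and \<zeta>: "\<zeta> \<in> U" for t \<zeta>
  proof (cases "t < T")
    case True
    then show ?thesis using max'[of t \<zeta>] t \<zeta> by simp
  next
    case False
    then have "t = T" using t by simp
    then show ?thesis using left_max[of T "u T" \<zeta>] Su(3) u_mem[of T] T \<zeta> by simp
  qed
  have H_right: "((\<lambda>s. k s (u s)) \<longlongrightarrow> k t (u t)) (at_right t)" if t: "t \<in> {0..<T}" for t
  proof (rule k_lim[OF Su(1)[OF t]])
    have "eventually (\<lambda>s. s \<in> {0..T}) (at_right t)"
      unfolding eventually_at_topological using t by (intro exI[of _ "{..<T}"]) auto
    then show "\<forall>\<^sub>F s in at_right t. s \<in> {0..T} \<and> u s \<in> U" by eventually_elim (use u_mem in auto)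
  qed (use t u_mem in auto)
  \<comment> \<open>The control may jump at \<open>t\<close>, but its value and its left limit both
    maximise the Hamiltonian, so the Hamiltonian does not jump.\<close>
  have H_left: "((\<lambda>s. k s (u s)) \<longlongrightarrow> k t (u t)) (at_left t)" if t: "t \<in> {0<..T}" for t
  proof -
    obtain l where l: "l \<in> U" "(u \<longlongrightarrow> l) (at_left t)" using Su(2)[OF t] by blast
    have "((\<lambda>s. k s (u s)) \<longlongrightarrow> k t l) (at_left t)"
      using t ev_left[OF t] u_mem by (intro k_lim l) (auto elim!: eventually_mono)
    moreover have "k t l = k t (u t)"
      using left_max[OF t l u_mem[of t]] max[of t l] l(1) t by auto
    ultimately show ?thesis by simp
  qed
  have H_cont: "continuous_on {0..T} (\<lambda>t. k t (u t))"
    by (rule continuous_on_IccI) (use H_left H_right T in \<open>auto simp: filterlim_at_split\<close>)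
  have adj: "ext_deriv T p t = - frechet_deriv (\<lambda>\<xi>. pontryagin_H f0 f \<pi> t \<xi> (u t) (p t) (lam 0)) (x t)" if t: "t \<in> {0..T}" for t
    unfolding frechet_H[OF t] using P(2)[OF UNIV_I _ t] by (simp add: w_def)
  have pT: "(\<Sum>i=0..m. lam i *\<^sub>R hadamard_deriv (\<lambda>\<xi>. g i \<xi> \<pi>) (x T)) + (\<Sum>j=1..q. mu j *\<^sub>R hadamard_deriv (\<lambda>\<xi>. h j \<xi> \<pi>) (x T)) = p T"
    by (rule blinfun_eqI)
      (simp add: p_def RT M_apply DG_def DH_def blinfun.bilinear_simps blinfun.sum_left)
  have "pontryagin_triple T U m q f0 f g h \<pi> (x, u) lam mu p"
    unfolding pontryagin_triple_def prod.case
  proof (intro conjI ballI)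
    show "lam i * g i (x T) \<pi> = 0" if "i \<in> {1..m}" for i using compl[OF that] that by (simp add: gE_def xs_def)
  qed (use P(1) nz lam0 pT adj max H_cont in \<open>auto simp: k_def\<close>)
  then show ?thesis using lam01 by blast
qed

end

section \<open>Sensitivity of the value\<close>

text \<open>Time reversal: costates are compared from their terminal value.\<close>

lemma gronwall_backward_zero:
  fixes e :: "real \<Rightarrow> 'a::banach"
  assumes T: "0 \<le> T" and L: "0 \<le> L" and cont: "continuous_on {0..T} e" and S: "finite S"
    and d: "\<And>s. s \<in> {0<..<T} - S \<Longrightarrow> (e has_vector_derivative e' s) (at s)"
    and b: "\<And>s. s \<in> {0<..<T} - S \<Longrightarrow> norm (e' s) \<le> L * norm (e s)"
    and eT: "e T = 0" and t: "t \<in> {0..T}"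
  shows "e t = 0"
proof -
  have "norm (e (T - (T - t))) \<le> (norm (e (T - 0)) + integral {0..T} (\<lambda>_. 0)) * exp (L * T)"
  proof (rule gronwall[of T L "\<lambda>s. e (T - s)" "(\<lambda>s. T - s) ` S" "\<lambda>s. - e' (T - s)" "\<lambda>_. 0"])
    show "continuous_on {0..T} (\<lambda>s. e (T - s))"
      by (intro continuous_on_compose2[OF cont] continuous_intros) auto
    fix s assume s: "s \<in> {0<..<T} - (\<lambda>s. T - s) ` S"
    then have s': "T - s \<in> {0<..<T} - S" by force
    have "((\<lambda>s. T - s) has_vector_derivative -1) (at s)"
      by (auto intro!: derivative_eq_intros)
    from vector_diff_chain_at[OF this d[OF s']]
    show "((\<lambda>s. e (T - s)) has_vector_derivative - e' (T - s)) (at s)" by (simp add: comp_def)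
    show "norm (- e' (T - s)) \<le> L * norm (e (T - s)) + 0" using b[OF s'] by simp
  qed (use T L S t in auto)
  then show ?thesis using eT by simp
qed

text \<open>All one-sided quotients are nonpositive, so \<open>D v\<close> and
  \<open>D (- v)\<close> are; linearity leaves only zero.\<close>

lemma gateaux_deriv_zero_at_max:
  fixes \<phi> :: "'a::real_normed_vector \<Rightarrow> real"
  assumes D: "has_gateaux_deriv \<phi> D z" and "open U" "z \<in> U" and max: "\<And>\<zeta>. \<zeta> \<in> U \<Longrightarrow> \<phi> \<zeta> \<le> \<phi> z"
  shows "D = 0"
proof (rule blinfun_eqI)
  have neg: "D v \<le> 0" for v
  proof (rule tendsto_upperbound)
    show "((\<lambda>\<theta>. (\<phi> (z + \<theta> *\<^sub>R v) - \<phi> z) /\<^sub>R \<theta>) \<longlongrightarrow> D v) (at_right 0)"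
      using D by (simp add: has_gateaux_deriv_def has_right_gateaux_variation_def)
    have "((\<lambda>\<theta>. z + \<theta> *\<^sub>R v) \<longlongrightarrow> z + 0 *\<^sub>R v) (at_right 0)" by (intro tendsto_intros)
    then have "eventually (\<lambda>\<theta>. z + \<theta> *\<^sub>R v \<in> U) (at_right 0)"
      using assms(2,3) by (auto dest: topological_tendstoD)
    moreover have "eventually (\<lambda>\<theta>::real. 0 < \<theta>) (at_right 0)" by (simp add: eventually_at_filter)
    ultimately show "\<forall>\<^sub>F \<theta> in at_right 0. (\<phi> (z + \<theta> *\<^sub>R v) - \<phi> z) /\<^sub>R \<theta> \<le> 0"
    proof eventually_elim
      case (elim \<theta>)
      then show ?case using max[of "z + \<theta> *\<^sub>R v"] by (simp add: mult_nonneg_nonpos)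
    qed
  qed simp
  fix v
  show "D v = (0 :: 'a \<Rightarrow>\<^sub>L real) v" using neg[of v] neg[of "- v"] by (simp add: blinfun.minus_right)
qed

text \<open>Serves to read partial differentials off the joint one, with \<open>\<psi>\<close>
  freezing the other arguments.\<close>

lemma has_hadamard_deriv_affine:
  fixes \<phi> :: "'a::real_normed_vector \<Rightarrow> 'b::real_normed_vector" and J :: "'c::real_normed_vector \<Rightarrow>\<^sub>L 'a"
  assumes \<phi>: "has_hadamard_deriv \<phi> D (\<psi> y)" and \<psi>: "\<And>\<theta> w. \<psi> (y + \<theta> *\<^sub>R w) = \<psi> y + \<theta> *\<^sub>R J w"
  shows "has_hadamard_deriv (\<lambda>y. \<phi> (\<psi> y)) (D o\<^sub>L J) y"
proof -
  have main: "((\<lambda>(\<theta>, w). (\<phi> (\<psi> (y + \<theta> *\<^sub>R w)) - \<phi> (\<psi> y)) /\<^sub>R \<theta>) \<longlongrightarrow> (D o\<^sub>L J) v) (at_right 0 \<times>\<^sub>F nhds v)" for v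
  proof -
    have "((\<lambda>(\<theta>, w). (\<phi> (\<psi> y + \<theta> *\<^sub>R w) - \<phi> (\<psi> y)) /\<^sub>R \<theta>) \<longlongrightarrow> D (J v)) (at_right 0 \<times>\<^sub>F nhds (J v))"
      using \<phi> by (simp add: has_hadamard_deriv_def)
    moreover have "filterlim (\<lambda>p. (fst p, J (snd p))) (at_right (0::real) \<times>\<^sub>F nhds (J v)) (at_right 0 \<times>\<^sub>F nhds v)"
      by (intro filterlim_Pair filterlim_fst blinfun.tendsto[OF tendsto_const] filterlim_snd)
    ultimately show ?thesis unfolding \<psi>
      using filterlim_compose[of "\<lambda>(\<theta>, w). (\<phi> (\<psi> y + \<theta> *\<^sub>R w) - \<phi> (\<psi> y)) /\<^sub>R \<theta>" "nhds (D (J v))"]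
      by (fastforce simp: case_prod_unfold)
  qed
  have "filterlim (\<lambda>\<theta>. (\<theta>, v)) (at_right 0 \<times>\<^sub>F nhds v) (at_right 0)" for v :: 'c
    by (intro filterlim_Pair filterlim_ident tendsto_const)
  from filterlim_compose[OF main this] show ?thesis
    unfolding has_hadamard_deriv_def has_gateaux_deriv_def has_right_gateaux_variation_def
    using main by simp
qed

lemma has_derivative_imp_has_gateaux_deriv:
  fixes \<phi> :: "'a::real_normed_vector \<Rightarrow> 'b::real_normed_vector"
  assumes "(\<phi> has_derivative blinfun_apply D) (at x)"
  shows "has_gateaux_deriv \<phi> D x"
  unfolding has_gateaux_deriv_def has_right_gateaux_variation_def
proof
  fix v
  have "((\<lambda>\<theta>. x + \<theta> *\<^sub>R v) has_vector_derivative v) (at 0)"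
    by (auto intro!: derivative_eq_intros)
  then have "((\<lambda>\<theta>. x + \<theta> *\<^sub>R v) has_derivative (\<lambda>\<theta>. \<theta> *\<^sub>R v)) (at 0)" by (simp add: has_vector_derivative_def)
  from has_derivative_compose[OF this, of \<phi> D] assms
  have "((\<lambda>\<theta>. \<phi> (x + \<theta> *\<^sub>R v)) has_derivative (\<lambda>\<theta>. \<theta> *\<^sub>R D v)) (at 0)" by (simp add: blinfun.scaleR_right)
  then have "((\<lambda>h. norm (\<phi> (x + h *\<^sub>R v) - \<phi> x - h *\<^sub>R D v) / norm h) \<longlongrightarrow> 0) (at (0::real))"
    by (simp add: has_derivative_at)
  then have "((\<lambda>h. norm (\<phi> (x + h *\<^sub>R v) - \<phi> x - h *\<^sub>R D v) / norm h) \<longlongrightarrow> 0) (at_right (0::real))"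
    by (simp add: filterlim_at_split)
  moreover have "eventually (\<lambda>h. norm (\<phi> (x + h *\<^sub>R v) - \<phi> x - h *\<^sub>R D v) / norm h = norm ((\<phi> (x + h *\<^sub>R v) - \<phi> x) /\<^sub>R h - D v)) (at_right (0::real))"
  proof -
    have "eventually (\<lambda>h::real. h \<noteq> 0) (at_right 0)" by (simp add: eventually_at_filter)
    then show ?thesis
    proof eventually_elim
      case (elim h)
      have "(\<phi> (x + h *\<^sub>R v) - \<phi> x) /\<^sub>R h - D v = (\<phi> (x + h *\<^sub>R v) - \<phi> x - h *\<^sub>R D v) /\<^sub>R h"
        using elim by (simp add: scaleR_diff_right)
      then show ?case by (simp add: divide_inverse mult.commute)
    qed
  qed
  ultimately have "((\<lambda>h. norm ((\<phi> (x + h *\<^sub>R v) - \<phi> x) /\<^sub>R h - D v)) \<longlongrightarrow> 0) (at_right (0::real))"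
    by (simp add: tendsto_cong)
  then show "((\<lambda>\<theta>. (\<phi> (x + \<theta> *\<^sub>R v) - \<phi> x) /\<^sub>R \<theta>) \<longlongrightarrow> D v) (at_right 0)"
    using Lim_null tendsto_norm_zero_iff by blast
qed

text \<open>The substitute for a chain rule along solutions: the direction
  \<open>(z' n - z) /\<^sub>R \<theta> n\<close> changes with \<open>n\<close>, which the Hadamard
  limit allows and a Gateaux limit would not.\<close>

lemma has_hadamard_deriv_along:
  assumes "has_hadamard_deriv \<phi> D z" and "\<And>n. 0 < \<theta> n" "\<theta> \<longlonglongrightarrow> 0" and "(\<lambda>n. (z' n - z) /\<^sub>R \<theta> n) \<longlonglongrightarrow> v"
  shows "(\<lambda>n. (\<phi> (z' n) - \<phi> z) /\<^sub>R \<theta> n) \<longlonglongrightarrow> D v"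
proof -
  have "filterlim (\<lambda>n. (\<theta> n, (z' n - z) /\<^sub>R \<theta> n)) (at_right 0 \<times>\<^sub>F nhds v) sequentially"
    using assms(2,4) tendsto_imp_filterlim_at_right[OF assms(3)] by (intro filterlim_Pair) auto
  moreover have "((\<lambda>(\<theta>, w). (\<phi> (z + \<theta> *\<^sub>R w) - \<phi> z) /\<^sub>R \<theta>) \<longlongrightarrow> D v) (at_right 0 \<times>\<^sub>F nhds v)"
    using assms(1) by (simp add: has_hadamard_deriv_def)
  ultimately have "(\<lambda>n. (\<lambda>(\<theta>, w). (\<phi> (z + \<theta> *\<^sub>R w) - \<phi> z) /\<^sub>R \<theta>) (\<theta> n, (z' n - z) /\<^sub>R \<theta> n)) \<longlonglongrightarrow> D v"
    by (rule filterlim_compose[rotated])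
  moreover have "z + \<theta> n *\<^sub>R ((z' n - z) /\<^sub>R \<theta> n) = z' n" for n
    using assms(2)[of n] by simp
  ultimately show ?thesis by simp
qed

text \<open>Scaled to unit sum, the nearby multipliers have a nonzero accumulation point
  \<open>z\<close> that satisfies the limit relation. Independence makes \<open>z\<close> a multiple
  of the normal multipliers by a nonzero factor \<open>z 0\<close>, and the vanishing component
  \<open>k\<close> passes to the limit.\<close>

lemma limit_multiplier_zero:
  fixes G H :: "nat \<Rightarrow> 'b::real_normed_vector" and Gs Hs :: "nat \<Rightarrow> nat \<Rightarrow> 'b" and F0 :: 'b
  assumes G: "\<And>i. i \<in> {0..m} \<Longrightarrow> (\<lambda>n. Gs n i) \<longlonglongrightarrow> G i" and H: "\<And>j. j \<in> {1..q} \<Longrightarrow> (\<lambda>n. Hs n j) \<longlonglongrightarrow> H j"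
    and F: "Fs \<longlonglongrightarrow> F0"
    and indep: "\<And>a b. (\<Sum>i=1..m. a i *\<^sub>R G i) + (\<Sum>j=1..q. b j *\<^sub>R H j) = 0 \<Longrightarrow>
      (\<forall>i\<in>{1..m}. a i = 0) \<and> (\<forall>j\<in>{1..q}. b j = (0::real))"
    and eqs: "\<And>n. ((\<exists>i\<in>{0..m}. lams n i \<noteq> 0) \<or> (\<exists>j\<in>{1..q}. mus n j \<noteq> 0)) \<and> lams n k = 0 \<and>
      (\<Sum>i=0..m. lams n i *\<^sub>R Gs n i) + (\<Sum>j=1..q. mus n j *\<^sub>R Hs n j) + lams n 0 *\<^sub>R Fs n = 0"
    and eq: "(\<Sum>i=0..m. lam i *\<^sub>R G i) + (\<Sum>j=1..q. mu j *\<^sub>R H j) + lam 0 *\<^sub>R F0 = 0" and lam0: "lam 0 = 1"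
    and k: "k \<in> {1..m}"
  shows "lam k = (0::real)"
proof -
  define s where "s n = (\<Sum>i=0..m. \<bar>lams n i\<bar>) + (\<Sum>j=1..q. \<bar>mus n j\<bar>)" for n
  have s: "0 < s n" for n
  proof -
    have "0 \<le> (\<Sum>i=0..m. \<bar>lams n i\<bar>)" "0 \<le> (\<Sum>j=1..q. \<bar>mus n j\<bar>)" by (intro sum_nonneg; simp)+
    moreover have "(\<Sum>i=0..m. \<bar>lams n i\<bar>) \<noteq> 0 \<or> (\<Sum>j=1..q. \<bar>mus n j\<bar>) \<noteq> 0"
      using eqs[of n] by (auto simp: sum_nonneg_eq_0_iff)
    ultimately show ?thesis unfolding s_def by linarith
  qed
  define y where "y n i = (if i \<le> m then lams n i / s n else mus n (i - m) / s n)" for n i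
  have yl: "y n i = lams n i / s n" if "i \<in> {0..m}" for n i using that by (simp add: y_def)
  have ym: "y n (m + j) = mus n j / s n" if "j \<in> {1..q}" for n j using that by (simp add: y_def)
  have norm1: "(\<Sum>i=0..m. \<bar>y n i\<bar>) + (\<Sum>j=1..q. \<bar>y n (m + j)\<bar>) = 1" for n
  proof -
    have "(\<Sum>i=0..m. \<bar>y n i\<bar>) = (\<Sum>i=0..m. \<bar>lams n i\<bar>) / s n"
      unfolding sum_divide_distrib using s[of n] by (intro sum.cong) (simp_all add: yl)
    moreover have "(\<Sum>j=1..q. \<bar>y n (m + j)\<bar>) = (\<Sum>j=1..q. \<bar>mus n j\<bar>) / s n"
      unfolding sum_divide_distrib using s[of n] by (intro sum.cong) (simp_all add: ym)
    ultimately show ?thesis using s[of n] by (simp add: add_divide_distrib[symmetric] s_def)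
  qed
  have "y n i \<in> {-1..1}" if i: "i < Suc (m + q)" for n i
  proof (cases "i \<le> m")
    case True
    have "\<bar>y n i\<bar> \<le> (\<Sum>i=0..m. \<bar>y n i\<bar>)" using True by (intro member_le_sum) auto
    moreover have "0 \<le> (\<Sum>j=1..q. \<bar>y n (m + j)\<bar>)" by (intro sum_nonneg) simp
    ultimately have "\<bar>y n i\<bar> \<le> 1" using norm1[of n] by linarith
    then show ?thesis by auto
  next
    case False
    then have j: "i - m \<in> {1..q}" "m + (i - m) = i" using i by auto
    have "\<bar>y n (m + (i - m))\<bar> \<le> (\<Sum>j=1..q. \<bar>y n (m + j)\<bar>)" by (rule member_le_sum[OF j(1)]) auto
    moreover have "0 \<le> (\<Sum>i=0..m. \<bar>y n i\<bar>)" by (intro sum_nonneg) simp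
    ultimately have "\<bar>y n i\<bar> \<le> 1" unfolding j(2) using norm1[of n] by linarith
    then show ?thesis by auto
  qed
  from finite_coordinates_subsequence[of "Suc (m + q)" y 1, OF this] obtain z r where
    r: "strict_mono r" and z: "\<And>i. i < Suc (m + q) \<Longrightarrow> (\<lambda>n. y (r n) i) \<longlonglongrightarrow> z i" by blast
  have zl: "(\<lambda>n. y (r n) i) \<longlonglongrightarrow> z i" if "i \<in> {0..m}" for i using that by (intro z) auto
  have zm: "(\<lambda>n. y (r n) (m + j)) \<longlonglongrightarrow> z (m + j)" if "j \<in> {1..q}" for j using that by (intro z) auto
  have sub: "(\<lambda>n. X (r n)) \<longlonglongrightarrow> l" if "X \<longlonglongrightarrow> l" for X :: "nat \<Rightarrow> 'b" and l
    using LIMSEQ_subseq_LIMSEQ[OF that r] by (simp add: comp_def)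
  have "(\<lambda>n. (\<Sum>i=0..m. \<bar>y (r n) i\<bar>) + (\<Sum>j=1..q. \<bar>y (r n) (m + j)\<bar>)) \<longlonglongrightarrow> (\<Sum>i=0..m. \<bar>z i\<bar>) + (\<Sum>j=1..q. \<bar>z (m + j)\<bar>)"
    by (intro tendsto_intros zl zm)
  then have z1: "(\<Sum>i=0..m. \<bar>z i\<bar>) + (\<Sum>j=1..q. \<bar>z (m + j)\<bar>) = 1" unfolding norm1 by (simp add: LIMSEQ_const_iff)
  have "(\<Sum>i=0..m. y n i *\<^sub>R Gs n i) + (\<Sum>j=1..q. y n (m + j) *\<^sub>R Hs n j) + y n 0 *\<^sub>R Fs n = 0" for n
  proof -
    have "(\<Sum>i=0..m. y n i *\<^sub>R Gs n i) = (1 / s n) *\<^sub>R (\<Sum>i=0..m. lams n i *\<^sub>R Gs n i)"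
      unfolding scaleR_sum_right by (intro sum.cong) (simp_all add: yl)
    moreover have "(\<Sum>j=1..q. y n (m + j) *\<^sub>R Hs n j) = (1 / s n) *\<^sub>R (\<Sum>j=1..q. mus n j *\<^sub>R Hs n j)"
      unfolding scaleR_sum_right by (intro sum.cong) (simp_all add: ym)
    moreover have "y n 0 *\<^sub>R Fs n = (1 / s n) *\<^sub>R (lams n 0 *\<^sub>R Fs n)" by (simp add: yl)
    ultimately have "(\<Sum>i=0..m. y n i *\<^sub>R Gs n i) + (\<Sum>j=1..q. y n (m + j) *\<^sub>R Hs n j) + y n 0 *\<^sub>R Fs n =
      (1 / s n) *\<^sub>R ((\<Sum>i=0..m. lams n i *\<^sub>R Gs n i) + (\<Sum>j=1..q. mus n j *\<^sub>R Hs n j) + lams n 0 *\<^sub>R Fs n)"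
      by (simp only: scaleR_add_right)
    then show ?thesis using eqs[of n] by simp
  qed
  moreover have "(\<lambda>n. (\<Sum>i=0..m. y (r n) i *\<^sub>R Gs (r n) i) + (\<Sum>j=1..q. y (r n) (m + j) *\<^sub>R Hs (r n) j) + y (r n) 0 *\<^sub>R Fs (r n))
      \<longlonglongrightarrow> (\<Sum>i=0..m. z i *\<^sub>R G i) + (\<Sum>j=1..q. z (m + j) *\<^sub>R H j) + z 0 *\<^sub>R F0"
    by (intro tendsto_intros zl zm sub[OF G] sub[OF H] sub[OF F]) auto
  ultimately have ez: "(\<Sum>i=0..m. z i *\<^sub>R G i) + (\<Sum>j=1..q. z (m + j) *\<^sub>R H j) + z 0 *\<^sub>R F0 = 0"
    by (simp add: LIMSEQ_const_iff)
  have zk: "z k = 0"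
    using zl[of k] k eqs by (auto simp: yl LIMSEQ_const_iff)
  have split: "(\<Sum>i=0..m. w i *\<^sub>R G i) = w 0 *\<^sub>R G 0 + (\<Sum>i=1..m. w i *\<^sub>R G i)" for w
    by (simp add: sum.atLeast_Suc_atMost)
  \<comment> \<open>Subtracting \<open>z 0\<close> times the normal relation removes
    \<open>G 0\<close> and \<open>F0\<close>, about which independence says nothing.\<close>
  have "(\<Sum>i=1..m. (z i - z 0 * lam i) *\<^sub>R G i) + (\<Sum>j=1..q. (z (m + j) - z 0 * mu j) *\<^sub>R H j) =
    ((\<Sum>i=0..m. z i *\<^sub>R G i) + (\<Sum>j=1..q. z (m + j) *\<^sub>R H j) + z 0 *\<^sub>R F0) -
    z 0 *\<^sub>R ((\<Sum>i=0..m. lam i *\<^sub>R G i) + (\<Sum>j=1..q. mu j *\<^sub>R H j) + lam 0 *\<^sub>R F0)"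
    unfolding split using lam0
    by (simp add: scaleR_left_diff_distrib sum_subtractf scaleR_add_right scaleR_sum_right)
  also have "\<dots> = 0" unfolding ez eq by simp
  finally have "(\<forall>i\<in>{1..m}. z i - z 0 * lam i = 0) \<and> (\<forall>j\<in>{1..q}. z (m + j) - z 0 * mu j = 0)"
    by (rule indep)
  then have zlam: "\<And>i. i \<in> {1..m} \<Longrightarrow> z i = z 0 * lam i" "\<And>j. j \<in> {1..q} \<Longrightarrow> z (m + j) = z 0 * mu j"
    unfolding right_minus_eq by blast+
  \<comment> \<open>Otherwise every component of \<open>z\<close> would vanish, against its unit
    sum.\<close>
  have "z 0 \<noteq> 0"
  proof
    assume z0: "z 0 = 0"
    have "z i = 0" if "i \<in> {0..m}" for i using zlam(1)[of i] z0 that by (cases "i = 0") auto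
    moreover have "z (m + j) = 0" if "j \<in> {1..q}" for j using zlam(2)[OF that] z0 by simp
    ultimately show False using z1 by simp
  qed
  then show ?thesis using zlam(1)[OF k] zk by simp
qed

section \<open>Limits of difference quotients in time\<close>

lemma NPC0_R_limit_measurable:
  fixes s :: "nat \<Rightarrow> real \<Rightarrow> real"
  assumes "0 < T" "\<And>n. s n \<in> NPC0_R T UNIV" "\<And>t. t \<in> {0..T} \<Longrightarrow> (\<lambda>n. s n t) \<longlonglongrightarrow> l t"
  shows "(\<lambda>t. indicator {0..T} t *\<^sub>R l t) \<in> borel_measurable lborel"
proof (rule borel_measurable_LIMSEQ_real)
  show "(\<lambda>t. indicator {0..T} t *\<^sub>R s n t) \<in> borel_measurable lborel" for n
    using NPC0_R_set_integrable[OF assms(1,2)] by (auto simp: set_integrable_def)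
  show "(\<lambda>n. indicator {0..T} t *\<^sub>R s n t) \<longlonglongrightarrow> indicator {0..T} t *\<^sub>R l t" for t
    using assms(3)[of t] by (cases "t \<in> {0..T}") (auto simp: indicator_def)
qed

text \<open>A parameter derivative has no continuity in time to rely on; it is measurable as a
  pointwise limit of piecewise continuous quotients, and the dominating function does the
  rest.\<close>

lemma NPC0_R_limit_integrable:
  fixes s :: "nat \<Rightarrow> real \<Rightarrow> real"
  assumes "0 < T" "\<And>n. s n \<in> NPC0_R T UNIV" "\<And>t. t \<in> {0..T} \<Longrightarrow> (\<lambda>n. s n t) \<longlonglongrightarrow> l t"
    and c: "set_integrable lborel {0..T} c" "\<And>t. t \<in> {0..T} \<Longrightarrow> \<bar>l t\<bar> \<le> c t"
  shows "set_integrable lborel {0..T} l"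
  unfolding set_integrable_def
proof (rule Bochner_Integration.integrable_bound[OF c(1)[unfolded set_integrable_def]])
  show "(\<lambda>t. indicator {0..T} t *\<^sub>R l t) \<in> borel_measurable lborel"
    by (rule NPC0_R_limit_measurable[OF assms(1-3)])
  show "AE t in lborel. norm (indicator {0..T} t *\<^sub>R l t) \<le> norm (indicator {0..T} t *\<^sub>R c t)"
  proof (rule AE_I2)
    fix t
    show "norm (indicator {0..T} t *\<^sub>R l t) \<le> norm (indicator {0..T} t *\<^sub>R c t)"
      using c(2)[of t] by (cases "t \<in> {0..T}") auto
  qed
qed

lemma NPC0_R_dominated_convergence:
  fixes s :: "nat \<Rightarrow> real \<Rightarrow> real"
  assumes T: "0 < T" and s: "\<And>n. s n \<in> NPC0_R T UNIV" and lim: "\<And>t. t \<in> {0..T} \<Longrightarrow> (\<lambda>n. s n t) \<longlonglongrightarrow> l t"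
    and c: "set_integrable lborel {0..T} c" "\<And>n t. t \<in> {0..T} \<Longrightarrow> \<bar>s n t\<bar> \<le> c t"
  shows "(\<lambda>n. LINT t:{0..T}|lborel. s n t) \<longlonglongrightarrow> (LINT t:{0..T}|lborel. l t)"
  unfolding set_lebesgue_integral_def
proof (rule integral_dominated_convergence[where w = "\<lambda>t. indicator {0..T} t *\<^sub>R c t"])
  show "(\<lambda>t. indicator {0..T} t *\<^sub>R l t) \<in> borel_measurable lborel"
    by (rule NPC0_R_limit_measurable[OF T s lim])
  show "(\<lambda>t. indicator {0..T} t *\<^sub>R s n t) \<in> borel_measurable lborel" for n
    using NPC0_R_set_integrable[OF T s] by (auto simp: set_integrable_def)
  show "integrable lborel (\<lambda>t. indicator {0..T} t *\<^sub>R c t)" using c(1) by (simp add: set_integrable_def)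
  show "AE t in lborel. (\<lambda>n. indicator {0..T} t *\<^sub>R s n t) \<longlonglongrightarrow> indicator {0..T} t *\<^sub>R l t"
    using lim by (intro AE_I2) (auto simp: indicator_def)
  show "AE t in lborel. norm (indicator {0..T} t *\<^sub>R s n t) \<le> indicator {0..T} t *\<^sub>R c t" for n
    using c(2) by (intro AE_I2) (auto simp: indicator_def)
qed

text \<open>\<open>sup_norm\<close> is a real supremum and bounds its function only when a bound
  exists. This is why boundedness of the quotients is checked before their norms are used.\<close>

lemma sup_norm_upper:
  assumes "\<And>t. t \<in> {0..T} \<Longrightarrow> norm (w t) \<le> B" "t \<in> {0..T}"
  shows "norm (w t) \<le> sup_norm T w" "0 \<le> sup_norm T w"
proof -
  show 1: "norm (w t) \<le> sup_norm T w"
    unfolding sup_norm_def using assms by (intro cSUP_upper) (auto intro!: bdd_aboveI[of _ B])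
  show "0 \<le> sup_norm T w" using 1 norm_ge_zero[of "w t"] by linarith
qed

lemma NPC0_R_variation_limit:
  fixes u :: "'z::real_normed_vector \<Rightarrow> real \<Rightarrow> 'a::real_normed_vector"
  assumes T: "0 < T" and d: "has_NPC0_R_variation T u d \<pi> v" and u: "\<And>n. u (\<pi> + \<theta> n *\<^sub>R v) \<in> NPC0_R T UNIV" "u \<pi> \<in> NPC0_R T UNIV"
    and \<theta>: "\<And>n. 0 < \<theta> n" "\<theta> \<longlonglongrightarrow> 0"
  obtains r where "r \<longlonglongrightarrow> (0::real)"
    "\<And>n t. t \<in> {0..T} \<Longrightarrow> norm ((u (\<pi> + \<theta> n *\<^sub>R v) t - u \<pi> t) /\<^sub>R \<theta> n - d t) \<le> r n"
proof
  let ?w = "\<lambda>n t. (u (\<pi> + \<theta> n *\<^sub>R v) t - u \<pi> t) /\<^sub>R \<theta> n - d t"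
  show "(\<lambda>n. sup_norm T (?w n)) \<longlonglongrightarrow> 0"
    using d filterlim_compose[OF _ tendsto_imp_filterlim_at_right[OF \<theta>(2)]] \<theta>(1)
    unfolding has_NPC0_R_variation_def by fastforce
  fix n t assume t: "t \<in> {0..T}"
  have dN: "d \<in> NPC0_R T UNIV" using d by (simp add: has_NPC0_R_variation_def)
  obtain B1 where B1: "\<And>t. t \<in> {0..T} \<Longrightarrow> norm (u (\<pi> + \<theta> n *\<^sub>R v) t) \<le> B1" using NPC0_R_bounded[OF T u(1)] by blast
  obtain B2 where B2: "\<And>t. t \<in> {0..T} \<Longrightarrow> norm (u \<pi> t) \<le> B2" using NPC0_R_bounded[OF T u(2)] by blast
  obtain B3 where B3: "\<And>t. t \<in> {0..T} \<Longrightarrow> norm (d t) \<le> B3" using NPC0_R_bounded[OF T dN] by blast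
  have "norm (?w n t) \<le> (B1 + B2) / \<theta> n + B3" if t: "t \<in> {0..T}" for t
  proof -
    have "norm (u (\<pi> + \<theta> n *\<^sub>R v) t - u \<pi> t) \<le> B1 + B2"
      using norm_triangle_ineq4[of "u (\<pi> + \<theta> n *\<^sub>R v) t" "u \<pi> t"] B1[OF t] B2[OF t] by linarith
    then have "norm ((u (\<pi> + \<theta> n *\<^sub>R v) t - u \<pi> t) /\<^sub>R \<theta> n) \<le> (B1 + B2) / \<theta> n"
      using \<theta>(1)[of n] by (simp add: divide_inverse mult.commute mult_right_mono)
    then show ?thesis using norm_triangle_ineq4[of "(u (\<pi> + \<theta> n *\<^sub>R v) t - u \<pi> t) /\<^sub>R \<theta> n" "d t"] B3[OF t] by linarith
  qed
  from sup_norm_upper(1)[of T "?w n", OF this t] show "norm (?w n t) \<le> sup_norm T (?w n)" by simp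
qed

text \<open>Convergence in the \<open>PC1\<close> norm also controls derivatives; this uniform rate
  is what later identifies the derivative of the variation.\<close>

lemma PC1_variation_limit:
  fixes x :: "'z::real_normed_vector \<Rightarrow> real \<Rightarrow> 'a::real_normed_vector"
  assumes T: "0 < T" and d: "has_PC1_variation T x d \<pi> v" and x: "\<And>n. x (\<pi> + \<theta> n *\<^sub>R v) \<in> PC1 T W" "x \<pi> \<in> PC1 T W"
    and \<theta>: "\<And>n. 0 < \<theta> n" "\<theta> \<longlonglongrightarrow> 0"
  obtains r where "r \<longlonglongrightarrow> (0::real)"
    "\<And>n t. t \<in> {0..T} \<Longrightarrow> norm ((x (\<pi> + \<theta> n *\<^sub>R v) t - x \<pi> t) /\<^sub>R \<theta> n - d t) \<le> r n"
    "\<And>n t. t \<in> {0..T} \<Longrightarrow> norm ((ext_deriv T (x (\<pi> + \<theta> n *\<^sub>R v)) t - ext_deriv T (x \<pi>) t) /\<^sub>R \<theta> n - ext_deriv T d t) \<le> r n"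
proof -
  let ?w = "\<lambda>n t. (x (\<pi> + \<theta> n *\<^sub>R v) t - x \<pi> t) /\<^sub>R \<theta> n - d t"
  let ?e = "\<lambda>n t. (ext_deriv T (x (\<pi> + \<theta> n *\<^sub>R v)) t - ext_deriv T (x \<pi>) t) /\<^sub>R \<theta> n - ext_deriv T d t"
  have dP: "d \<in> PC1 T UNIV" using d by (simp add: has_PC1_variation_def)
  have lim: "(\<lambda>n. PC1_norm T (?w n)) \<longlonglongrightarrow> 0"
    using d filterlim_compose[OF _ tendsto_imp_filterlim_at_right[OF \<theta>(2)]] \<theta>(1)
    unfolding has_PC1_variation_def by fastforce
  \<comment> \<open>\<open>ext_deriv\<close> is linear on \<open>PC1\<close>, since at each time it
    is a one-sided derivative from a side that depends on the time alone.\<close>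
  have ext: "ext_deriv T (?w n) t = ?e n t" if t: "t \<in> {0..T}" for n t
  proof -
    have comb: "(?w n has_vector_derivative ?e n t) F"
      if "(x (\<pi> + \<theta> n *\<^sub>R v) has_vector_derivative ext_deriv T (x (\<pi> + \<theta> n *\<^sub>R v)) t) F"
        "(x \<pi> has_vector_derivative ext_deriv T (x \<pi>) t) F" "(d has_vector_derivative ext_deriv T d t) F" for F
      using bounded_linear.has_vector_derivative[OF bounded_linear_scaleR_right has_vector_derivative_diff[OF that(1,2)]] that(3)
      by (intro has_vector_derivative_diff) auto
    show ?thesis
    proof (cases "t < T")
      case True
      then have t': "t \<in> {0..<T}" using t by simp
      show ?thesis
        by (rule ext_deriv_right[OF True comb])
          (use PC1_ext_deriv(3)[OF T x(1) t'] PC1_ext_deriv(3)[OF T x(2) t'] PC1_ext_deriv(3)[OF T dP t'] in auto)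
    next
      case False
      then have tT: "t = T" using t by simp
      show ?thesis unfolding tT
        by (rule ext_deriv_left[OF comb[unfolded tT]])
          (use PC1_ext_deriv(4)[OF T x(1)] PC1_ext_deriv(4)[OF T x(2)] PC1_ext_deriv(4)[OF T dP] in auto)
    qed
  qed
  have bnd: "\<exists>B. \<forall>t\<in>{0..T}. norm ((a t - b t) /\<^sub>R c - e t) \<le> B"
    if abe: "a \<in> NPC0_R T UNIV" "b \<in> NPC0_R T UNIV" "e \<in> NPC0_R T UNIV" for a b e :: "real \<Rightarrow> 'a" and c :: real
  proof -
    obtain B1 where B1: "\<And>t. t \<in> {0..T} \<Longrightarrow> norm (a t) \<le> B1" using NPC0_R_bounded[OF T abe(1)] by blast
    obtain B2 where B2: "\<And>t. t \<in> {0..T} \<Longrightarrow> norm (b t) \<le> B2" using NPC0_R_bounded[OF T abe(2)] by blast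
    obtain B3 where B3: "\<And>t. t \<in> {0..T} \<Longrightarrow> norm (e t) \<le> B3" using NPC0_R_bounded[OF T abe(3)] by blast
    have "norm ((a t - b t) /\<^sub>R c - e t) \<le> \<bar>inverse c\<bar> * (B1 + B2) + B3" if t: "t \<in> {0..T}" for t
    proof -
      have "norm (a t - b t) \<le> B1 + B2"
        using norm_triangle_ineq4[of "a t" "b t"] B1[OF t] B2[OF t] by linarith
      then have "norm ((a t - b t) /\<^sub>R c) \<le> \<bar>inverse c\<bar> * (B1 + B2)"
        unfolding norm_scaleR by (intro mult_left_mono) auto
      then show ?thesis using norm_triangle_ineq4[of "(a t - b t) /\<^sub>R c" "e t"] B3[OF t] by linarith
    qed
    then show ?thesis by blast
  qed
  have cN: "y \<in> NPC0_R T UNIV" if "y \<in> PC1 T V" for y :: "real \<Rightarrow> 'a" and V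
    using NPC0_R_continuous[OF T PC1_continuous[OF that], of UNIV] by simp
  show thesis
  proof (rule that[OF lim])
    fix n t assume t: "t \<in> {0..T}"
    obtain B where B: "\<And>t. t \<in> {0..T} \<Longrightarrow> norm (?w n t) \<le> B"
      using bnd[OF cN[OF x(1)] cN[OF x(2)] cN[OF dP]] by blast
    obtain B' where B': "\<And>t. t \<in> {0..T} \<Longrightarrow> norm (ext_deriv T (?w n) t) \<le> B'"
      using bnd[OF PC1_ext_deriv(1)[OF T x(1)] PC1_ext_deriv(1)[OF T x(2)] PC1_ext_deriv(1)[OF T dP]] ext by force
    note 1 = sup_norm_upper[of T "?w n", OF B t] and 2 = sup_norm_upper[of T "ext_deriv T (?w n)", OF B' t]
    show "norm (?w n t) \<le> PC1_norm T (?w n)" using 1(1) 2(2) by (simp add: PC1_norm_def)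
    show "norm (?e n t) \<le> PC1_norm T (?w n)" using 1(2) 2(1) ext[OF t, of n] by (simp add: PC1_norm_def)
  qed
qed

section \<open>Consequences of the Pontryagin conditions\<close>

context bolza_maximizer
begin

lemma triple_facts:
  assumes "pontryagin_triple T U m q f0 f g h \<pi> (x, u) lam mu p"
  shows "p \<in> PC1 T UNIV" "(\<exists>i\<in>{0..m}. lam i \<noteq> 0) \<or> (\<exists>j\<in>{1..q}. mu j \<noteq> 0)"
    "\<And>i. i \<in> {0..m} \<Longrightarrow> 0 \<le> lam i" "\<And>i. i \<in> {1..m} \<Longrightarrow> lam i * g i (x T) \<pi> = 0"
    "(\<Sum>i=0..m. lam i *\<^sub>R hadamard_deriv (\<lambda>\<xi>. g i \<xi> \<pi>) (x T)) + (\<Sum>j=1..q. mu j *\<^sub>R hadamard_deriv (\<lambda>\<xi>. h j \<xi> \<pi>) (x T)) = p T"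
    "\<And>t. t \<in> {0..T} \<Longrightarrow> ext_deriv T p t = - ((p t o\<^sub>L A1 t) + lam 0 *\<^sub>R A0 t)"
    "\<And>t \<zeta>. t \<in> {0..T} \<Longrightarrow> \<zeta> \<in> U \<Longrightarrow> p t (f t (x t) \<zeta> \<pi>) + lam 0 * f0 t (x t) \<zeta> \<pi> \<le> p t (f t (x t) (u t) \<pi>) + lam 0 * f0 t (x t) (u t) \<pi>"
  using assms unfolding pontryagin_triple_def prod.case by (simp_all add: frechet_H) (auto simp: pontryagin_H_def)

text \<open>\<open>U\<close> is open, so the maximiser in the control is interior.\<close>

lemma stationary:
  assumes tr: "pontryagin_triple T U m q f0 f g h \<pi> (x, u) lam mu p" and t: "t \<in> {0..T}"
    and D: "has_gateaux_deriv (\<lambda>\<zeta>. f t (x t) \<zeta> \<pi>) D (u t)" "has_gateaux_deriv (\<lambda>\<zeta>. f0 t (x t) \<zeta> \<pi>) D0 (u t)"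
  shows "(p t o\<^sub>L D) + lam 0 *\<^sub>R D0 = 0"
proof (rule gateaux_deriv_zero_at_max[where \<phi> = "\<lambda>\<zeta>. p t (f t (x t) \<zeta> \<pi>) + lam 0 * f0 t (x t) \<zeta> \<pi>"])
  have "((\<lambda>\<theta>. p t ((f t (x t) (u t + \<theta> *\<^sub>R v) \<pi> - f t (x t) (u t) \<pi>) /\<^sub>R \<theta>) +
      lam 0 * ((f0 t (x t) (u t + \<theta> *\<^sub>R v) \<pi> - f0 t (x t) (u t) \<pi>) /\<^sub>R \<theta>)) \<longlongrightarrow> p t (D v) + lam 0 * D0 v) (at_right 0)" for v
    using D unfolding has_gateaux_deriv_def has_right_gateaux_variation_def
    by (intro tendsto_add tendsto_mult tendsto_const blinfun.tendsto[OF tendsto_const]) auto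
  then show "has_gateaux_deriv (\<lambda>\<zeta>. p t (f t (x t) \<zeta> \<pi>) + lam 0 * f0 t (x t) \<zeta> \<pi>) ((p t o\<^sub>L D) + lam 0 *\<^sub>R D0) (u t)"
    unfolding has_gateaux_deriv_def has_right_gateaux_variation_def
    by (simp add: blinfun.bilinear_simps algebra_simps)
qed (use triple_facts(7)[OF tr t] U NPC0_R_mem[OF u t] in auto)

text \<open>With equal cost multipliers the inhomogeneous terms cancel, and the difference of the
  costates solves a homogeneous linear equation that vanishes at \<open>T\<close>.\<close>

lemma adjoint_unique:
  assumes tr: "pontryagin_triple T U m q f0 f g h \<pi> (x, u) lam mu p" "pontryagin_triple T U m q f0 f g h \<pi> (x, u) lam' mu' p'"
    and eq: "lam' 0 = lam 0" "p' T = p T" and t: "t \<in> {0..T}"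
  shows "p' t = p t"
proof -
  note P = triple_facts[OF tr(1)] and P' = triple_facts[OF tr(2)]
  obtain S where S: "finite S" "\<And>t. t \<in> {0<..<T} - S \<Longrightarrow> (p has_vector_derivative ext_deriv T p t) (at t)"
    using PC1_ext_deriv(2)[OF T P(1)] by blast
  obtain S' where S': "finite S'" "\<And>t. t \<in> {0<..<T} - S' \<Longrightarrow> (p' has_vector_derivative ext_deriv T p' t) (at t)"
    using PC1_ext_deriv(2)[OF T P'(1)] by blast
  obtain B where B: "0 < B" "\<And>t. t \<in> {0..T} \<Longrightarrow> norm (A1 t) \<le> B" using NPC0_R_bounded[OF T A1] by blast
  have "p' t - p t = 0"
  proof (rule gronwall_backward_zero[of T B "\<lambda>t. p' t - p t" "S \<union> S'" "\<lambda>t. - ((p' t - p t) o\<^sub>L A1 t)"])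
    show "continuous_on {0..T} (\<lambda>t. p' t - p t)"
      by (intro continuous_intros PC1_continuous[OF P(1)] PC1_continuous[OF P'(1)])
    fix s assume s: "s \<in> {0<..<T} - (S \<union> S')"
    then have s': "s \<in> {0..T}" by auto
    have "ext_deriv T p' s - ext_deriv T p s = - ((p' s - p s) o\<^sub>L A1 s)"
      unfolding P(6)[OF s'] P'(6)[OF s'] eq(1) by (rule blinfun_eqI) (simp add: blinfun.bilinear_simps)
    then show "((\<lambda>t. p' t - p t) has_vector_derivative - ((p' s - p s) o\<^sub>L A1 s)) (at s)"
      using has_vector_derivative_diff[OF S'(2)[of s] S(2)[of s]] s by auto
    show "norm (- ((p' s - p s) o\<^sub>L A1 s)) \<le> B * norm (p' s - p s)"
      using norm_blinfun_compose[of "p' s - p s" "A1 s"] mult_left_mono[OF B(2)[OF s'] norm_ge_zero[of "p' s - p s"]]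
      by (simp add: mult.commute)
  qed (use T B S(1) S'(1) eq t in auto)
  then show ?thesis by simp
qed

end

locale bolza_sensitivity =
  fixes T :: real
    and \<Omega> :: "'x::banach set"
    and U :: "'y::real_normed_vector set"
    and \<xi>\<^sub>0 :: 'x
    and m q :: nat
    and f0 :: "real \<Rightarrow> 'x \<Rightarrow> 'y \<Rightarrow> 'z::real_normed_vector \<Rightarrow> real"
    and f :: "real \<Rightarrow> 'x \<Rightarrow> 'y \<Rightarrow> 'z \<Rightarrow> 'x"
    and g h :: "nat \<Rightarrow> 'x \<Rightarrow> 'z \<Rightarrow> real"
    and \<pi>\<^sub>0 :: 'z
    and P :: "'z set"
    and x :: "'z \<Rightarrow> real \<Rightarrow> 'x"
    and u :: "'z \<Rightarrow> real \<Rightarrow> 'y"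
  assumes T: "0 < T"
    and Omega: "open \<Omega>" "\<Omega> \<noteq> {}"
    and U: "open U" "U \<noteq> {}"
    and xi0: "\<xi>\<^sub>0 \<in> \<Omega>"
    and mq: "1 \<le> m" "1 \<le> q"
    and SO: "open P" "\<pi>\<^sub>0 \<in> P"
      "\<forall>\<pi>\<in>P. bolza_solution T \<Omega> U \<xi>\<^sub>0 m q f0 f g h \<pi> (x \<pi>, u \<pi>)"
    and SO_bis:
      "\<forall>\<delta>. (\<exists>dx. has_PC1_variation T x dx \<pi>\<^sub>0 \<delta>) \<and> (\<exists>du. has_NPC0_R_variation T u du \<pi>\<^sub>0 \<delta>)"
    and IC1:
      "continuous_on ({0..T} \<times> \<Omega> \<times> U \<times> P) (\<lambda>(t, \<xi>, \<zeta>, \<pi>). f0 t \<xi> \<zeta> \<pi>)"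
      "\<forall>t\<in>{0..T}. \<forall>\<xi>\<in>\<Omega>. \<forall>\<zeta>\<in>U. \<forall>\<pi>\<in>P. gateaux_differentiable (\<lambda>y. f0 t y \<zeta> \<pi>) \<xi>"
      "\<forall>\<pi>\<in>P. \<forall>K. compact K \<and> K \<noteq> {} \<and> K \<subseteq> \<Omega> \<times> U \<longrightarrow>
         bdd_above ((\<lambda>(t, \<xi>, \<zeta>). norm (gateaux_deriv (\<lambda>y. f0 t y \<zeta> \<pi>) \<xi>)) ` ({0..T} \<times> K))"
    and IC2:
      "\<forall>t\<in>{0..T}. hadamard_differentiable (\<lambda>(\<xi>, \<zeta>, \<pi>). f0 t \<xi> \<zeta> \<pi>) (x \<pi>\<^sub>0 t, u \<pi>\<^sub>0 t, \<pi>\<^sub>0)"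
      "\<forall>\<pi>\<in>P. hadamard_differentiable (\<lambda>\<zeta>. f0 T (x \<pi> T) \<zeta> \<pi>) (u \<pi> T)"
      "continuous_on P (\<lambda>\<pi>. hadamard_deriv (\<lambda>\<zeta>. f0 T (x \<pi> T) \<zeta> \<pi>) (u \<pi> T))"
    and IC3:
      "\<exists>\<kappa> \<rho>. set_integrable lborel {0..T} \<kappa> \<and> (\<forall>t\<in>{0..T}. 0 \<le> \<kappa> t) \<and> \<rho> > 0 \<and>
         (\<forall>t\<in>{0..T}. \<forall>\<xi>\<^sub>1\<in>\<Omega>. \<forall>\<zeta>\<^sub>1\<in>U. \<forall>\<pi>\<^sub>1\<in>P. \<forall>\<xi>\<^sub>2\<in>\<Omega>. \<forall>\<zeta>\<^sub>2\<in>U. \<forall>\<pi>\<^sub>2\<in>P.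
            norm (\<xi>\<^sub>1 - x \<pi>\<^sub>0 t) + norm (\<zeta>\<^sub>1 - u \<pi>\<^sub>0 t) + norm (\<pi>\<^sub>1 - \<pi>\<^sub>0) < \<rho> \<and>
            norm (\<xi>\<^sub>2 - x \<pi>\<^sub>0 t) + norm (\<zeta>\<^sub>2 - u \<pi>\<^sub>0 t) + norm (\<pi>\<^sub>2 - \<pi>\<^sub>0) < \<rho> \<longrightarrow>
            \<bar>f0 t \<xi>\<^sub>1 \<zeta>\<^sub>1 \<pi>\<^sub>1 - f0 t \<xi>\<^sub>2 \<zeta>\<^sub>2 \<pi>\<^sub>2\<bar>
              \<le> \<kappa> t * (norm (\<xi>\<^sub>1 - \<xi>\<^sub>2) + norm (\<zeta>\<^sub>1 - \<zeta>\<^sub>2) + norm (\<pi>\<^sub>1 - \<pi>\<^sub>2)))"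
    and IC4:
      "\<forall>t\<in>{0..T}. \<forall>\<zeta>\<in>U. \<forall>\<pi>\<in>P. (\<lambda>\<xi>. f0 t \<xi> \<zeta> \<pi>) differentiable (at (x \<pi> t))"
      "\<forall>\<pi>\<in>P. continuous_on ({0..T} \<times> U) (\<lambda>(t, \<zeta>). frechet_deriv (\<lambda>\<xi>. f0 t \<xi> \<zeta> \<pi>) (x \<pi> t))"
    and V1:
      "\<forall>\<pi>\<in>P. continuous_on ({0..T} \<times> \<Omega> \<times> U) (\<lambda>(t, \<xi>, \<zeta>). f t \<xi> \<zeta> \<pi>)"
      "\<forall>t\<in>{0..T}. \<forall>\<xi>\<in>\<Omega>. \<forall>\<zeta>\<in>U. \<forall>\<pi>\<in>P. gateaux_differentiable (\<lambda>y. f t y \<zeta> \<pi>) \<xi>"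
      "\<forall>\<pi>\<in>P. \<forall>K. compact K \<and> K \<noteq> {} \<and> K \<subseteq> \<Omega> \<times> U \<longrightarrow>
         bdd_above ((\<lambda>(t, \<xi>, \<zeta>). norm (gateaux_deriv (\<lambda>y. f t y \<zeta> \<pi>) \<xi>)) ` ({0..T} \<times> K))"
    and V2:
      "\<forall>t\<in>{0..T}. hadamard_differentiable (\<lambda>(\<xi>, \<zeta>, \<pi>). f t \<xi> \<zeta> \<pi>) (x \<pi>\<^sub>0 t, u \<pi>\<^sub>0 t, \<pi>\<^sub>0)"
      "\<forall>\<pi>\<in>P. hadamard_differentiable (\<lambda>\<zeta>. f T (x \<pi> T) \<zeta> \<pi>) (u \<pi> T)"
    and V3:
      "\<forall>t\<in>{0..T}. \<forall>\<zeta>\<in>U. \<forall>\<pi>\<in>P. (\<lambda>\<xi>. f t \<xi> \<zeta> \<pi>) differentiable (at (x \<pi> t))"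
      "\<forall>\<pi>\<in>P. continuous_on ({0..T} \<times> U) (\<lambda>(t, \<zeta>). frechet_deriv (\<lambda>\<xi>. f t \<xi> \<zeta> \<pi>) (x \<pi> t))"
    and V4:
      "\<exists>c. set_integrable lborel {0..T} c \<and> (\<forall>t\<in>{0..T}. 0 \<le> c t) \<and>
         (\<forall>t\<in>{0..T}. norm (hadamard_deriv (\<lambda>\<pi>. f t (x \<pi>\<^sub>0 t) (u \<pi>\<^sub>0 t) \<pi>) \<pi>\<^sub>0) \<le> c t)"
    and CT1:
      "\<forall>\<phi> \<in> g ` {0..m} \<union> h ` {1..q}.
         hadamard_differentiable (\<lambda>(\<xi>, \<pi>). \<phi> \<xi> \<pi>) (x \<pi>\<^sub>0 T, \<pi>\<^sub>0) \<and>
         (\<forall>\<pi>\<in>P. hadamard_differentiable (\<lambda>\<xi>. \<phi> \<xi> \<pi>) (x \<pi> T))"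
    and CT2:
      "\<forall>\<pi>\<in>P. \<forall>j\<in>{1..q}. \<exists>N. open N \<and> x \<pi> T \<in> N \<and> N \<subseteq> \<Omega> \<and> continuous_on N (\<lambda>\<xi>. h j \<xi> \<pi>)"
    and CVT1:
      "\<forall>a b. (\<Sum>i=1..m. a i *\<^sub>R (hadamard_deriv (\<lambda>\<xi>. g i \<xi> \<pi>\<^sub>0) (x \<pi>\<^sub>0 T) o\<^sub>L
                                hadamard_deriv (\<lambda>\<zeta>. f T (x \<pi>\<^sub>0 T) \<zeta> \<pi>\<^sub>0) (u \<pi>\<^sub>0 T))) +
             (\<Sum>j=1..q. b j *\<^sub>R (hadamard_deriv (\<lambda>\<xi>. h j \<xi> \<pi>\<^sub>0) (x \<pi>\<^sub>0 T) o\<^sub>L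
                                hadamard_deriv (\<lambda>\<zeta>. f T (x \<pi>\<^sub>0 T) \<zeta> \<pi>\<^sub>0) (u \<pi>\<^sub>0 T))) = 0 \<longrightarrow>
             (\<forall>i\<in>{1..m}. a i = (0::real)) \<and> (\<forall>j\<in>{1..q}. b j = (0::real))"
    and CVT2:
      "\<forall>\<phi> \<in> g ` {0..m} \<union> h ` {1..q}.
         continuous_on P (\<lambda>\<pi>. hadamard_deriv (\<lambda>\<xi>. \<phi> \<xi> \<pi>) (x \<pi> T) o\<^sub>L
                              hadamard_deriv (\<lambda>\<zeta>. f T (x \<pi> T) \<zeta> \<pi>) (u \<pi> T))"
begin

lemma solution:
  assumes "\<pi> \<in> P"
  shows "x \<pi> \<in> PC1 T \<Omega>" "u \<pi> \<in> NPC0_R T U"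
    "\<And>t. t \<in> {0..T} \<Longrightarrow> ext_deriv T (x \<pi>) t = f t (x \<pi> t) (u \<pi> t) \<pi>" "x \<pi> 0 = \<xi>\<^sub>0"
    "\<And>i. i \<in> {1..m} \<Longrightarrow> 0 \<le> g i (x \<pi> T) \<pi>" "\<And>j. j \<in> {1..q} \<Longrightarrow> h j (x \<pi> T) \<pi> = 0"
  using SO(3) assms by (auto simp: bolza_solution_def bolza_admissible_def)

lemma T_mem: "T \<in> {0..T}" "0 \<in> {0..T}"
  using T by auto

lemma maximizer:
  assumes \<pi>: "\<pi> \<in> P"
  shows "bolza_maximizer T \<Omega> U \<xi>\<^sub>0 m q f0 f g h \<pi> (x \<pi>) (u \<pi>)"
proof
  have "continuous_on ({0..T} \<times> \<Omega> \<times> U) (\<lambda>p. (fst p, fst (snd p), snd (snd p), \<pi>))"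
    by (intro continuous_intros)
  then have "continuous_on ({0..T} \<times> \<Omega> \<times> U) (\<lambda>p. (\<lambda>(t, \<xi>, \<zeta>, \<pi>). f0 t \<xi> \<zeta> \<pi>) (fst p, fst (snd p), snd (snd p), \<pi>))"
    by (rule continuous_on_compose2[OF IC1(1)]) (use \<pi> in auto)
  then show "continuous_on ({0..T} \<times> \<Omega> \<times> U) (\<lambda>(t, \<xi>, \<zeta>). f0 t \<xi> \<zeta> \<pi>)" by (simp add: case_prod_unfold)
  show "continuous_on ({0..T} \<times> \<Omega> \<times> U) (\<lambda>(t, \<xi>, \<zeta>). f t \<xi> \<zeta> \<pi>)" using V1(1) \<pi> by blast
  show "bolza_solution T \<Omega> U \<xi>\<^sub>0 m q f0 f g h \<pi> (x \<pi>, u \<pi>)" using SO(3) \<pi> by blast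
  show "bdd_above ((\<lambda>(t, \<xi>, \<zeta>). norm (gateaux_deriv (\<lambda>y. f0 t y \<zeta> \<pi>) \<xi>)) ` ({0..T} \<times> K))"
    if "compact K" "K \<noteq> {}" "K \<subseteq> \<Omega> \<times> U" for K using mp[OF spec[OF bspec[OF IC1(3) \<pi>]], of K] that by simp
  show "bdd_above ((\<lambda>(t, \<xi>, \<zeta>). norm (gateaux_deriv (\<lambda>y. f t y \<zeta> \<pi>) \<xi>)) ` ({0..T} \<times> K))"
    if "compact K" "K \<noteq> {}" "K \<subseteq> \<Omega> \<times> U" for K using mp[OF spec[OF bspec[OF V1(3) \<pi>]], of K] that by simp
  show "continuous_on ({0..T} \<times> U) (\<lambda>(t, \<zeta>). frechet_deriv (\<lambda>\<xi>. f0 t \<xi> \<zeta> \<pi>) (x \<pi> t))" using IC4(2) \<pi> by blast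
  show "continuous_on ({0..T} \<times> U) (\<lambda>(t, \<zeta>). frechet_deriv (\<lambda>\<xi>. f t \<xi> \<zeta> \<pi>) (x \<pi> t))" using V3(2) \<pi> by blast
  show "\<exists>N. open N \<and> x \<pi> T \<in> N \<and> N \<subseteq> \<Omega> \<and> continuous_on N (\<lambda>\<xi>. h j \<xi> \<pi>)" if "j \<in> {1..q}" for j
    using CT2 \<pi> that by blast
qed (use T Omega U \<pi> IC1(2) V1(2) IC4(1) V3(1) CT1 in \<open>blast+\<close>)

text \<open>\<open>Gpart\<close>, \<open>Hpart\<close> and \<open>Fpart\<close> are the elements of
  the dual of the control space between which stationarity at \<open>T\<close> is a linear relation;
  the independence and continuity assumptions speak about them.\<close>

definition Gpart :: "nat \<Rightarrow> 'z \<Rightarrow> 'y \<Rightarrow>\<^sub>L real" where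
  "Gpart i \<pi> = hadamard_deriv (\<lambda>\<xi>. g i \<xi> \<pi>) (x \<pi> T) o\<^sub>L hadamard_deriv (\<lambda>\<zeta>. f T (x \<pi> T) \<zeta> \<pi>) (u \<pi> T)"

definition Hpart :: "nat \<Rightarrow> 'z \<Rightarrow> 'y \<Rightarrow>\<^sub>L real" where
  "Hpart j \<pi> = hadamard_deriv (\<lambda>\<xi>. h j \<xi> \<pi>) (x \<pi> T) o\<^sub>L hadamard_deriv (\<lambda>\<zeta>. f T (x \<pi> T) \<zeta> \<pi>) (u \<pi> T)"

definition Fpart :: "'z \<Rightarrow> 'y \<Rightarrow>\<^sub>L real" where
  "Fpart \<pi> = hadamard_deriv (\<lambda>\<zeta>. f0 T (x \<pi> T) \<zeta> \<pi>) (u \<pi> T)"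

text \<open>At time \<open>T\<close> the costate is a combination of terminal differentials, so
  stationarity in the control no longer contains it: a relation between multipliers alone, suited to
  passing to limits in the parameter.\<close>

lemma multiplier_equation:
  assumes \<pi>: "\<pi> \<in> P" and tr: "pontryagin_triple T U m q f0 f g h \<pi> (x \<pi>, u \<pi>) lam mu p"
  shows "(\<Sum>i=0..m. lam i *\<^sub>R Gpart i \<pi>) + (\<Sum>j=1..q. mu j *\<^sub>R Hpart j \<pi>) + lam 0 *\<^sub>R Fpart \<pi> = 0"
proof -
  interpret M: bolza_maximizer T \<Omega> U \<xi>\<^sub>0 m q f0 f g h \<pi> "x \<pi>" "u \<pi>" by (rule maximizer[OF \<pi>])
  have D: "has_gateaux_deriv (\<lambda>\<zeta>. f T (x \<pi> T) \<zeta> \<pi>) (hadamard_deriv (\<lambda>\<zeta>. f T (x \<pi> T) \<zeta> \<pi>) (u \<pi> T)) (u \<pi> T)"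
    using has_hadamard_deriv_hadamard_deriv[of "\<lambda>\<zeta>. f T (x \<pi> T) \<zeta> \<pi>"] V2(2) \<pi> by (auto simp: has_hadamard_deriv_def)
  have D0: "has_gateaux_deriv (\<lambda>\<zeta>. f0 T (x \<pi> T) \<zeta> \<pi>) (Fpart \<pi>) (u \<pi> T)"
    using has_hadamard_deriv_hadamard_deriv[of "\<lambda>\<zeta>. f0 T (x \<pi> T) \<zeta> \<pi>"] IC2(2) \<pi> by (auto simp: has_hadamard_deriv_def Fpart_def)
  have "(p T o\<^sub>L hadamard_deriv (\<lambda>\<zeta>. f T (x \<pi> T) \<zeta> \<pi>) (u \<pi> T)) + lam 0 *\<^sub>R Fpart \<pi> = 0"
    by (rule M.stationary[OF tr T_mem(1) D D0])
  moreover have "p T o\<^sub>L hadamard_deriv (\<lambda>\<zeta>. f T (x \<pi> T) \<zeta> \<pi>) (u \<pi> T) =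
      (\<Sum>i=0..m. lam i *\<^sub>R Gpart i \<pi>) + (\<Sum>j=1..q. mu j *\<^sub>R Hpart j \<pi>)"
    unfolding M.triple_facts(5)[OF tr, symmetric]
    by (rule blinfun_eqI) (simp add: blinfun.bilinear_simps blinfun.sum_left Gpart_def Hpart_def)
  ultimately show ?thesis by simp
qed

lemma independent:
  assumes "(\<Sum>i=1..m. a i *\<^sub>R Gpart i \<pi>\<^sub>0) + (\<Sum>j=1..q. b j *\<^sub>R Hpart j \<pi>\<^sub>0) = 0"
  shows "(\<forall>i\<in>{1..m}. a i = (0::real)) \<and> (\<forall>j\<in>{1..q}. b j = (0::real))"
  using CVT1 assms unfolding Gpart_def Hpart_def by blast

text \<open>The terms of index 0 and \<open>Fpart\<close> cancel in the difference of two normal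
  relations; what is left is a relation in the independent family. The costates then share their
  terminal value.\<close>

lemma multipliers_unique:
  assumes tr: "pontryagin_triple T U m q f0 f g h \<pi>\<^sub>0 (x \<pi>\<^sub>0, u \<pi>\<^sub>0) lam mu p" "lam 0 = 1"
    and tr': "pontryagin_triple T U m q f0 f g h \<pi>\<^sub>0 (x \<pi>\<^sub>0, u \<pi>\<^sub>0) lam' mu' p'" "lam' 0 = 1"
  shows "(\<forall>i\<in>{0..m}. lam' i = lam i) \<and> (\<forall>j\<in>{1..q}. mu' j = mu j) \<and> (\<forall>t\<in>{0..T}. p' t = p t)"
proof -
  interpret M: bolza_maximizer T \<Omega> U \<xi>\<^sub>0 m q f0 f g h \<pi>\<^sub>0 "x \<pi>\<^sub>0" "u \<pi>\<^sub>0" by (rule maximizer[OF SO(2)])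
  have split: "(\<Sum>i=0..m. w i *\<^sub>R Gpart i \<pi>\<^sub>0) = w 0 *\<^sub>R Gpart 0 \<pi>\<^sub>0 + (\<Sum>i=1..m. w i *\<^sub>R Gpart i \<pi>\<^sub>0)" for w
    by (simp add: sum.atLeast_Suc_atMost)
  have "(\<Sum>i=1..m. (lam' i - lam i) *\<^sub>R Gpart i \<pi>\<^sub>0) + (\<Sum>j=1..q. (mu' j - mu j) *\<^sub>R Hpart j \<pi>\<^sub>0) =
      ((\<Sum>i=0..m. lam' i *\<^sub>R Gpart i \<pi>\<^sub>0) + (\<Sum>j=1..q. mu' j *\<^sub>R Hpart j \<pi>\<^sub>0) + lam' 0 *\<^sub>R Fpart \<pi>\<^sub>0) -
      ((\<Sum>i=0..m. lam i *\<^sub>R Gpart i \<pi>\<^sub>0) + (\<Sum>j=1..q. mu j *\<^sub>R Hpart j \<pi>\<^sub>0) + lam 0 *\<^sub>R Fpart \<pi>\<^sub>0)"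
    unfolding split tr(2) tr'(2) by (simp add: scaleR_left_diff_distrib sum_subtractf)
  also have "\<dots> = 0"
    unfolding multiplier_equation[OF SO(2) tr(1)] multiplier_equation[OF SO(2) tr'(1)] by simp
  finally have d: "(\<forall>i\<in>{1..m}. lam' i - lam i = 0) \<and> (\<forall>j\<in>{1..q}. mu' j - mu j = 0)" by (rule independent)
  have lam: "lam' i = lam i" if "i \<in> {0..m}" for i
    using conjunct1[OF d] tr(2) tr'(2) that by (cases "i = 0") auto
  have mu: "mu' j = mu j" if "j \<in> {1..q}" for j using bspec[OF conjunct2[OF d] that] by simp
  have "p' T = p T"
    unfolding M.triple_facts(5)[OF tr(1), symmetric] M.triple_facts(5)[OF tr'(1), symmetric]
    by (intro arg_cong2[where f = "(+)"] sum.cong refl) (simp_all add: lam mu)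
  then have "p' t = p t" if "t \<in> {0..T}" for t
    using M.adjoint_unique[OF tr(1) tr'(1) _ _ that] tr(2) tr'(2) by simp
  then show ?thesis using lam mu by blast
qed

text \<open>A triple with \<open>lam 0 = 0\<close> would be a nontrivial relation in the independent
  family.\<close>

lemma normal_triple:
  obtains lam mu p where "pontryagin_triple T U m q f0 f g h \<pi>\<^sub>0 (x \<pi>\<^sub>0, u \<pi>\<^sub>0) lam mu p" "lam 0 = 1"
proof -
  interpret M: bolza_maximizer T \<Omega> U \<xi>\<^sub>0 m q f0 f g h \<pi>\<^sub>0 "x \<pi>\<^sub>0" "u \<pi>\<^sub>0" by (rule maximizer[OF SO(2)])
  obtain lam mu p where tr: "pontryagin_triple T U m q f0 f g h \<pi>\<^sub>0 (x \<pi>\<^sub>0, u \<pi>\<^sub>0) lam mu p"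
    and lam: "lam 0 = 0 \<or> lam 0 = 1"
    using M.pontryagin_principle by blast
  have "lam 0 \<noteq> 0"
  proof
    assume 0: "lam 0 = 0"
    have "(\<Sum>i=1..m. lam i *\<^sub>R Gpart i \<pi>\<^sub>0) + (\<Sum>j=1..q. mu j *\<^sub>R Hpart j \<pi>\<^sub>0) = 0"
      using multiplier_equation[OF SO(2) tr] 0 by (simp add: sum.atLeast_Suc_atMost)
    from independent[OF this] have "lam i = 0" if "i \<in> {0..m}" for i
      using 0 that by (cases "i = 0") auto
    moreover have "mu j = 0" if "j \<in> {1..q}" for j
      using independent[OF \<open>(\<Sum>i=1..m. lam i *\<^sub>R Gpart i \<pi>\<^sub>0) + (\<Sum>j=1..q. mu j *\<^sub>R Hpart j \<pi>\<^sub>0) = 0\<close>] that by blast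
    ultimately show False using M.triple_facts(2)[OF tr] by blast
  qed
  then show thesis using that[OF tr] lam by blast
qed

text \<open>
  An active constraint with positive multiplier stays active along the solutions: otherwise the
  normalised multipliers at the perturbed parameters, with vanishing component, would accumulate
  at the unique multiplier of the unperturbed problem.
\<close>

lemma active_stays_active:
  assumes tr: "pontryagin_triple T U m q f0 f g h \<pi>\<^sub>0 (x \<pi>\<^sub>0, u \<pi>\<^sub>0) lam mu p" "lam 0 = 1"
    and \<pi>s: "\<And>n. \<pi>s n \<in> P" "\<pi>s \<longlonglongrightarrow> \<pi>\<^sub>0" and k: "k \<in> {1..m}" "lam k \<noteq> 0"
  shows "eventually (\<lambda>n. g k (x (\<pi>s n) T) (\<pi>s n) = 0) sequentially"
proof (rule ccontr)
  assume "\<not> ?thesis"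
  then obtain r :: "nat \<Rightarrow> nat" where r: "strict_mono r" "\<And>n. g k (x (\<pi>s (r n)) T) (\<pi>s (r n)) \<noteq> 0"
    using not_eventually_sequentiallyD by blast
  define \<pi>r where "\<pi>r n = \<pi>s (r n)" for n
  have \<pi>r: "\<pi>r n \<in> P" for n using \<pi>s(1) by (simp add: \<pi>r_def)
  have lim: "\<pi>r \<longlonglongrightarrow> \<pi>\<^sub>0" using LIMSEQ_subseq_LIMSEQ[OF \<pi>s(2) r(1)] by (simp add: \<pi>r_def[abs_def] comp_def)
  \<comment> \<open>Only the algebraic relation is kept and the costate is dropped.
    \<open>lam k = 0\<close> comes from complementary slackness, as the constraint is inactive along
    this subsequence.\<close>
  define good where "good n lam mu \<longleftrightarrow> ((\<exists>i\<in>{0..m}. lam i \<noteq> 0) \<or> (\<exists>j\<in>{1..q}. mu j \<noteq> 0)) \<and> lam k = 0 \<and>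
      (\<Sum>i=0..m. lam i *\<^sub>R Gpart i (\<pi>r n)) + (\<Sum>j=1..q. mu j *\<^sub>R Hpart j (\<pi>r n)) + lam 0 *\<^sub>R Fpart (\<pi>r n) = 0"
    for n and lam mu :: "nat \<Rightarrow> real"
  have "\<exists>lam mu. good n lam mu" for n
  proof -
    interpret M: bolza_maximizer T \<Omega> U \<xi>\<^sub>0 m q f0 f g h "\<pi>r n" "x (\<pi>r n)" "u (\<pi>r n)" by (rule maximizer[OF \<pi>r])
    obtain lam mu p where tr: "pontryagin_triple T U m q f0 f g h (\<pi>r n) (x (\<pi>r n), u (\<pi>r n)) lam mu p"
      using M.pontryagin_principle by blast
    have "lam k = 0" using M.triple_facts(4)[OF tr k(1)] r(2)[of n] by (simp add: \<pi>r_def)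
    then have "good n lam mu" using M.triple_facts(2)[OF tr] multiplier_equation[OF \<pi>r tr] unfolding good_def by blast
    then show ?thesis by blast
  qed
  then obtain lams mus where "\<And>n. good n (lams n) (mus n)" by metis
  note eqs = this[unfolded good_def]
  have c: "(\<lambda>n. \<Theta> (\<pi>r n)) \<longlonglongrightarrow> \<Theta> \<pi>\<^sub>0" if "continuous_on P \<Theta>" for \<Theta> :: "'z \<Rightarrow> 'y \<Rightarrow>\<^sub>L real"
    using continuous_on_tendsto_compose[OF that lim SO(2)] \<pi>r by simp
  have G: "(\<lambda>n. Gpart i (\<pi>r n)) \<longlonglongrightarrow> Gpart i \<pi>\<^sub>0" if "i \<in> {0..m}" for i
    by (rule c) (use CVT2 that in \<open>auto simp: Gpart_def\<close>)
  have H: "(\<lambda>n. Hpart j (\<pi>r n)) \<longlonglongrightarrow> Hpart j \<pi>\<^sub>0" if "j \<in> {1..q}" for j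
    by (rule c) (use CVT2 that in \<open>auto simp: Hpart_def\<close>)
  have F: "(\<lambda>n. Fpart (\<pi>r n)) \<longlonglongrightarrow> Fpart \<pi>\<^sub>0"
    by (rule c) (use IC2(3) in \<open>simp add: Fpart_def\<close>)
  have "lam k = 0"
    by (rule limit_multiplier_zero[where Gs = "\<lambda>n i. Gpart i (\<pi>r n)" and Hs = "\<lambda>n j. Hpart j (\<pi>r n)",
        OF G H F independent eqs multiplier_equation[OF SO(2) tr(1)] tr(2) k(1)])
  then show False using k(2) by simp
qed

section \<open>Partial differentials at the reference solution\<close>

definition Df :: "real \<Rightarrow> ('x \<times> 'y \<times> 'z) \<Rightarrow>\<^sub>L 'x" where
  "Df t = hadamard_deriv (\<lambda>(\<xi>, \<zeta>, \<pi>). f t \<xi> \<zeta> \<pi>) (x \<pi>\<^sub>0 t, u \<pi>\<^sub>0 t, \<pi>\<^sub>0)"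

definition Df0 :: "real \<Rightarrow> ('x \<times> 'y \<times> 'z) \<Rightarrow>\<^sub>L real" where
  "Df0 t = hadamard_deriv (\<lambda>(\<xi>, \<zeta>, \<pi>). f0 t \<xi> \<zeta> \<pi>) (x \<pi>\<^sub>0 t, u \<pi>\<^sub>0 t, \<pi>\<^sub>0)"

lemma Df: "t \<in> {0..T} \<Longrightarrow> has_hadamard_deriv (\<lambda>(\<xi>, \<zeta>, \<pi>). f t \<xi> \<zeta> \<pi>) (Df t) (x \<pi>\<^sub>0 t, u \<pi>\<^sub>0 t, \<pi>\<^sub>0)"
  and Df0: "t \<in> {0..T} \<Longrightarrow> has_hadamard_deriv (\<lambda>(\<xi>, \<zeta>, \<pi>). f0 t \<xi> \<zeta> \<pi>) (Df0 t) (x \<pi>\<^sub>0 t, u \<pi>\<^sub>0 t, \<pi>\<^sub>0)"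
  unfolding Df_def Df0_def using V2(1) IC2(1) by (blast intro: has_hadamard_deriv_hadamard_deriv)+

lemma hadamard_partials:
  fixes \<phi> :: "'x \<Rightarrow> 'y \<Rightarrow> 'z \<Rightarrow> 'w::real_normed_vector"
  assumes "has_hadamard_deriv (\<lambda>(\<xi>, \<zeta>, \<pi>). \<phi> \<xi> \<zeta> \<pi>) D (a, b, c)"
  shows "has_hadamard_deriv (\<lambda>\<xi>. \<phi> \<xi> b c) (D o\<^sub>L inl_blinfun) a"
    "has_hadamard_deriv (\<lambda>\<zeta>. \<phi> a \<zeta> c) (D o\<^sub>L (inr_blinfun o\<^sub>L inl_blinfun)) b"
    "has_hadamard_deriv (\<lambda>\<pi>. \<phi> a b \<pi>) (D o\<^sub>L (inr_blinfun o\<^sub>L inr_blinfun)) c"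
  using has_hadamard_deriv_affine[of "\<lambda>(\<xi>, \<zeta>, \<pi>). \<phi> \<xi> \<zeta> \<pi>" D "\<lambda>\<xi>. (\<xi>, b, c)" a inl_blinfun]
    has_hadamard_deriv_affine[of "\<lambda>(\<xi>, \<zeta>, \<pi>). \<phi> \<xi> \<zeta> \<pi>" D "\<lambda>\<zeta>. (a, \<zeta>, c)" b "inr_blinfun o\<^sub>L inl_blinfun"]
    has_hadamard_deriv_affine[of "\<lambda>(\<xi>, \<zeta>, \<pi>). \<phi> \<xi> \<zeta> \<pi>" D "\<lambda>\<pi>. (a, b, \<pi>)" c "inr_blinfun o\<^sub>L inr_blinfun"]
    assms by simp_all

lemma hadamard_partials2:
  fixes \<phi> :: "'x \<Rightarrow> 'z \<Rightarrow> 'w::real_normed_vector"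
  assumes "has_hadamard_deriv (\<lambda>(\<xi>, \<pi>). \<phi> \<xi> \<pi>) D (a, c)"
  shows "has_hadamard_deriv (\<lambda>\<xi>. \<phi> \<xi> c) (D o\<^sub>L inl_blinfun) a"
    "has_hadamard_deriv (\<lambda>\<pi>. \<phi> a \<pi>) (D o\<^sub>L inr_blinfun) c"
  using has_hadamard_deriv_affine[of "\<lambda>(\<xi>, \<pi>). \<phi> \<xi> \<pi>" D "\<lambda>\<xi>. (\<xi>, c)" a inl_blinfun]
    has_hadamard_deriv_affine[of "\<lambda>(\<xi>, \<pi>). \<phi> \<xi> \<pi>" D "\<lambda>\<pi>. (a, \<pi>)" c inr_blinfun]
    assms by simp_all

abbreviation D4f :: "real \<Rightarrow> 'z \<Rightarrow>\<^sub>L 'x" where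
  "D4f t \<equiv> hadamard_deriv (\<lambda>\<pi>. f t (x \<pi>\<^sub>0 t) (u \<pi>\<^sub>0 t) \<pi>) \<pi>\<^sub>0"

abbreviation D4f0 :: "real \<Rightarrow> 'z \<Rightarrow>\<^sub>L real" where
  "D4f0 t \<equiv> hadamard_deriv (\<lambda>\<pi>. f0 t (x \<pi>\<^sub>0 t) (u \<pi>\<^sub>0 t) \<pi>) \<pi>\<^sub>0"

lemma D4f: "t \<in> {0..T} \<Longrightarrow> D4f t = Df t o\<^sub>L (inr_blinfun o\<^sub>L inr_blinfun)"
  and D4f0: "t \<in> {0..T} \<Longrightarrow> D4f0 t = Df0 t o\<^sub>L (inr_blinfun o\<^sub>L inr_blinfun)"
  using hadamard_deriv_eq hadamard_partials(3) Df Df0 by blast+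

lemma D4f_hadamard: "t \<in> {0..T} \<Longrightarrow> has_hadamard_deriv (\<lambda>\<pi>. f t (x \<pi>\<^sub>0 t) (u \<pi>\<^sub>0 t) \<pi>) (D4f t) \<pi>\<^sub>0"
  and D4f0_hadamard: "t \<in> {0..T} \<Longrightarrow> has_hadamard_deriv (\<lambda>\<pi>. f0 t (x \<pi>\<^sub>0 t) (u \<pi>\<^sub>0 t) \<pi>) (D4f0 t) \<pi>\<^sub>0"
  unfolding D4f D4f0 using hadamard_partials(3)[OF Df] hadamard_partials(3)[OF Df0] by blast+

lemma small_steps:
  assumes "0 < \<rho>"
  obtains \<theta> where "\<And>n. 0 < \<theta> n" "\<theta> \<longlonglongrightarrow> 0" "\<And>n. \<pi>\<^sub>0 + \<theta> n *\<^sub>R \<delta> \<in> P" "\<And>n. norm (\<theta> n *\<^sub>R \<delta>) < (\<rho> :: real)"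
proof -
  have lim: "(\<lambda>n. inverse (real (Suc n)) *\<^sub>R \<delta>) \<longlonglongrightarrow> 0 *\<^sub>R \<delta>" by (intro tendsto_intros LIMSEQ_inverse_real_of_nat)
  then have "(\<lambda>n. \<pi>\<^sub>0 + inverse (real (Suc n)) *\<^sub>R \<delta>) \<longlonglongrightarrow> \<pi>\<^sub>0 + 0 *\<^sub>R \<delta>" by (intro tendsto_add tendsto_const)
  then have "eventually (\<lambda>n. \<pi>\<^sub>0 + inverse (real (Suc n)) *\<^sub>R \<delta> \<in> P) sequentially"
    using SO(1,2) by (auto dest: topological_tendstoD)
  moreover have "eventually (\<lambda>n. norm (inverse (real (Suc n)) *\<^sub>R \<delta>) < \<rho>) sequentially"
    using tendsto_norm[OF lim] assms by (auto dest: order_tendstoD)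
  ultimately have "eventually (\<lambda>n. \<pi>\<^sub>0 + inverse (real (Suc n)) *\<^sub>R \<delta> \<in> P \<and> norm (inverse (real (Suc n)) *\<^sub>R \<delta>) < \<rho>) sequentially"
    by (rule eventually_conj)
  then obtain N where N: "\<And>n. N \<le> n \<Longrightarrow> \<pi>\<^sub>0 + inverse (real (Suc n)) *\<^sub>R \<delta> \<in> P \<and> norm (inverse (real (Suc n)) *\<^sub>R \<delta>) < \<rho>"
    by (auto simp: eventually_sequentially)
  show thesis
  proof (rule that[of "\<lambda>n. inverse (real (Suc (n + N)))"])
    show "(\<lambda>n. inverse (real (Suc (n + N)))) \<longlonglongrightarrow> 0"
      by (rule LIMSEQ_ignore_initial_segment[OF LIMSEQ_inverse_real_of_nat])
    show "\<pi>\<^sub>0 + inverse (real (Suc (n + N))) *\<^sub>R \<delta> \<in> P" "norm (inverse (real (Suc (n + N))) *\<^sub>R \<delta>) < \<rho>" for n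
      using N[of "n + N"] le_add2[of N n] by blast+
  qed simp
qed

lemma quotient_NPC0_R:
  fixes a b :: "real \<Rightarrow> 'w::real_normed_vector"
  assumes "a \<in> NPC0_R T UNIV" "b \<in> NPC0_R T UNIV"
  shows "(\<lambda>t. (a t - b t) /\<^sub>R c) \<in> NPC0_R T UNIV"
  by (rule NPC0_R_compose2[OF T assms]) (auto simp: case_prod_unfold intro!: continuous_intros)

text \<open>The local Lipschitz bound on \<open>f0\<close> and the bound on the parameter derivative
  of \<open>f\<close> give integrable majorants. They also yield a common bound that is linear in
  the norm of the direction, from which continuity of the derivative of the value follows.\<close>

lemma parameter_integrable:
  fixes \<delta> :: 'z
  assumes p: "p \<in> PC1 T (UNIV :: ('x \<Rightarrow>\<^sub>L real) set)"
  shows "set_integrable lborel {0..T} (\<lambda>t. D4f0 t \<delta>)" "set_integrable lborel {0..T} (\<lambda>t. p t (D4f t \<delta>))"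
    and "\<exists>\<kappa>. set_integrable lborel {0..T} \<kappa> \<and> (\<forall>t\<in>{0..T}. 0 \<le> \<kappa> t) \<and> (\<forall>t\<in>{0..T}. \<forall>\<delta>::'z. \<bar>D4f0 t \<delta>\<bar> \<le> \<kappa> t * norm \<delta> \<and> \<bar>p t (D4f t \<delta>)\<bar> \<le> \<kappa> t * norm \<delta>)"
proof -
  obtain \<kappa> \<rho> where \<kappa>: "set_integrable lborel {0..T} \<kappa>" "\<forall>t\<in>{0..T}. 0 \<le> \<kappa> t" and \<rho>: "\<rho> > 0"
    and lip: "\<And>t \<xi>\<^sub>1 \<zeta>\<^sub>1 \<pi>\<^sub>1 \<xi>\<^sub>2 \<zeta>\<^sub>2 \<pi>\<^sub>2. t \<in> {0..T} \<Longrightarrow> \<xi>\<^sub>1 \<in> \<Omega> \<Longrightarrow> \<zeta>\<^sub>1 \<in> U \<Longrightarrow> \<pi>\<^sub>1 \<in> P \<Longrightarrow> \<xi>\<^sub>2 \<in> \<Omega> \<Longrightarrow> \<zeta>\<^sub>2 \<in> U \<Longrightarrow> \<pi>\<^sub>2 \<in> P \<Longrightarrow>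
            norm (\<xi>\<^sub>1 - x \<pi>\<^sub>0 t) + norm (\<zeta>\<^sub>1 - u \<pi>\<^sub>0 t) + norm (\<pi>\<^sub>1 - \<pi>\<^sub>0) < \<rho> \<Longrightarrow>
            norm (\<xi>\<^sub>2 - x \<pi>\<^sub>0 t) + norm (\<zeta>\<^sub>2 - u \<pi>\<^sub>0 t) + norm (\<pi>\<^sub>2 - \<pi>\<^sub>0) < \<rho> \<Longrightarrow>
            \<bar>f0 t \<xi>\<^sub>1 \<zeta>\<^sub>1 \<pi>\<^sub>1 - f0 t \<xi>\<^sub>2 \<zeta>\<^sub>2 \<pi>\<^sub>2\<bar>
              \<le> \<kappa> t * (norm (\<xi>\<^sub>1 - \<xi>\<^sub>2) + norm (\<zeta>\<^sub>1 - \<zeta>\<^sub>2) + norm (\<pi>\<^sub>1 - \<pi>\<^sub>2))"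
    using IC3 by metis
  obtain c where c: "set_integrable lborel {0..T} c" "\<forall>t\<in>{0..T}. 0 \<le> c t" "\<And>t. t \<in> {0..T} \<Longrightarrow> norm (D4f t) \<le> c t"
    using V4 by blast
  have pN: "p \<in> NPC0_R T UNIV" using NPC0_R_continuous[OF T PC1_continuous[OF p], of UNIV] by simp
  obtain B where B: "0 < B" "\<And>t. t \<in> {0..T} \<Longrightarrow> norm (p t) \<le> B" using NPC0_R_bounded[OF T pN] by blast
  interpret M: bolza_maximizer T \<Omega> U \<xi>\<^sub>0 m q f0 f g h \<pi>\<^sub>0 "x \<pi>\<^sub>0" "u \<pi>\<^sub>0" by (rule maximizer[OF SO(2)])
  \<comment> \<open>State and control are frozen, so only the parameter increment enters the
    Lipschitz bound.\<close>
  have D4b: "\<bar>D4f0 t \<delta>\<bar> \<le> \<kappa> t * norm \<delta>" if t: "t \<in> {0..T}" for t and \<delta> :: 'z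
  proof -
    obtain \<theta> where \<theta>: "\<And>n. 0 < \<theta> n" "\<theta> \<longlonglongrightarrow> 0" "\<And>n. \<pi>\<^sub>0 + \<theta> n *\<^sub>R \<delta> \<in> P" "\<And>n. norm (\<theta> n *\<^sub>R \<delta>) < \<rho>"
      using small_steps[OF \<rho>] by metis
    have "(\<lambda>n. (f0 t (x \<pi>\<^sub>0 t) (u \<pi>\<^sub>0 t) (\<pi>\<^sub>0 + \<theta> n *\<^sub>R \<delta>) - f0 t (x \<pi>\<^sub>0 t) (u \<pi>\<^sub>0 t) \<pi>\<^sub>0) /\<^sub>R \<theta> n) \<longlonglongrightarrow> D4f0 t \<delta>"
      by (rule has_hadamard_deriv_along[OF D4f0_hadamard[OF t] \<theta>(1,2)]) (use \<theta>(1) in \<open>simp add: less_imp_neq[symmetric]\<close>)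
    then have "(\<lambda>n. \<bar>(f0 t (x \<pi>\<^sub>0 t) (u \<pi>\<^sub>0 t) (\<pi>\<^sub>0 + \<theta> n *\<^sub>R \<delta>) - f0 t (x \<pi>\<^sub>0 t) (u \<pi>\<^sub>0 t) \<pi>\<^sub>0) /\<^sub>R \<theta> n\<bar>) \<longlonglongrightarrow> \<bar>D4f0 t \<delta>\<bar>"
      by (rule tendsto_rabs)
    then show ?thesis
    proof (rule LIMSEQ_le_const2, intro exI[of _ 0] allI impI)
      fix n
      have "\<bar>f0 t (x \<pi>\<^sub>0 t) (u \<pi>\<^sub>0 t) (\<pi>\<^sub>0 + \<theta> n *\<^sub>R \<delta>) - f0 t (x \<pi>\<^sub>0 t) (u \<pi>\<^sub>0 t) \<pi>\<^sub>0\<bar> \<le>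
          \<kappa> t * (norm (x \<pi>\<^sub>0 t - x \<pi>\<^sub>0 t) + norm (u \<pi>\<^sub>0 t - u \<pi>\<^sub>0 t) + norm (\<pi>\<^sub>0 + \<theta> n *\<^sub>R \<delta> - \<pi>\<^sub>0))"
        using \<theta>(3,4)[of n] SO(2) M.x_mem[OF t] NPC0_R_mem[OF M.u t] \<rho> by (intro lip t) auto
      also have "\<dots> = \<theta> n * (\<kappa> t * norm \<delta>)" using \<theta>(1)[of n] by simp
      finally show "\<bar>(f0 t (x \<pi>\<^sub>0 t) (u \<pi>\<^sub>0 t) (\<pi>\<^sub>0 + \<theta> n *\<^sub>R \<delta>) - f0 t (x \<pi>\<^sub>0 t) (u \<pi>\<^sub>0 t) \<pi>\<^sub>0) /\<^sub>R \<theta> n\<bar> \<le> \<kappa> t * norm \<delta>"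
        using \<theta>(1)[of n] by (simp add: abs_mult field_simps)
    qed
  qed
  have Dpb: "\<bar>p t (D4f t \<delta>)\<bar> \<le> B * c t * norm \<delta>" if t: "t \<in> {0..T}" for t and \<delta> :: 'z
  proof -
    have "\<bar>p t (D4f t \<delta>)\<bar> \<le> norm (p t) * norm (D4f t \<delta>)" using norm_blinfun[of "p t" "D4f t \<delta>"] by simp
    also have "\<dots> \<le> B * (c t * norm \<delta>)"
      using B(1) B(2)[OF t] order_trans[OF norm_blinfun mult_right_mono[OF c(3)[OF t] norm_ge_zero], of \<delta>]
      by (intro mult_mono) auto
    finally show ?thesis by (simp add: mult.assoc)
  qed
  show "\<exists>\<kappa>. set_integrable lborel {0..T} \<kappa> \<and> (\<forall>t\<in>{0..T}. 0 \<le> \<kappa> t) \<and> (\<forall>t\<in>{0..T}. \<forall>\<delta>::'z. \<bar>D4f0 t \<delta>\<bar> \<le> \<kappa> t * norm \<delta> \<and> \<bar>p t (D4f t \<delta>)\<bar> \<le> \<kappa> t * norm \<delta>)"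
  proof (intro exI[of _ "\<lambda>t. \<kappa> t + B * c t"] conjI ballI allI)
    show "set_integrable lborel {0..T} (\<lambda>t. \<kappa> t + B * c t)"
      by (intro set_integral_add(1) \<kappa>(1) set_integrable_mult_right c(1))
    fix t assume t: "t \<in> {0..T}"
    have nn: "0 \<le> \<kappa> t" "0 \<le> B * c t" using \<kappa>(2) c(2) B(1) t by auto
    then show "0 \<le> \<kappa> t + B * c t" by simp
    fix \<delta> :: 'z
    have "\<kappa> t * norm \<delta> \<le> (\<kappa> t + B * c t) * norm \<delta>" "B * c t * norm \<delta> \<le> (\<kappa> t + B * c t) * norm \<delta>"
      using nn by (intro mult_right_mono; simp)+
    then show "\<bar>D4f0 t \<delta>\<bar> \<le> (\<kappa> t + B * c t) * norm \<delta>" "\<bar>p t (D4f t \<delta>)\<bar> \<le> (\<kappa> t + B * c t) * norm \<delta>"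
      using D4b[OF t, of \<delta>] Dpb[OF t, of \<delta>] by linarith+
  qed
  obtain \<theta> where \<theta>: "\<And>n. 0 < \<theta> n" "\<theta> \<longlonglongrightarrow> 0" "\<And>n. \<pi>\<^sub>0 + \<theta> n *\<^sub>R \<delta> \<in> P" "\<And>n. norm (\<theta> n *\<^sub>R \<delta>) < \<rho>"
    using small_steps[OF \<rho>] by metis
  have r0: "(\<lambda>t. f0 t (x \<pi>\<^sub>0 t) (u \<pi>\<^sub>0 t) \<pi>) \<in> NPC0_R T UNIV" and r1: "(\<lambda>t. f t (x \<pi>\<^sub>0 t) (u \<pi>\<^sub>0 t) \<pi>) \<in> NPC0_R T UNIV" if "\<pi> \<in> P" for \<pi>
    using bolza_maximizer.running_NPC0_R[OF maximizer[OF that] M.x_cont M.x_mem M.u]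
      bolza_maximizer.dynamics_NPC0_R[OF maximizer[OF that] M.x_cont M.x_mem M.u] by auto
  show "set_integrable lborel {0..T} (\<lambda>t. D4f0 t \<delta>)"
  proof (rule NPC0_R_limit_integrable[OF T, of "\<lambda>n t. (f0 t (x \<pi>\<^sub>0 t) (u \<pi>\<^sub>0 t) (\<pi>\<^sub>0 + \<theta> n *\<^sub>R \<delta>) - f0 t (x \<pi>\<^sub>0 t) (u \<pi>\<^sub>0 t) \<pi>\<^sub>0) /\<^sub>R \<theta> n"])
    show "(\<lambda>n. (f0 t (x \<pi>\<^sub>0 t) (u \<pi>\<^sub>0 t) (\<pi>\<^sub>0 + \<theta> n *\<^sub>R \<delta>) - f0 t (x \<pi>\<^sub>0 t) (u \<pi>\<^sub>0 t) \<pi>\<^sub>0) /\<^sub>R \<theta> n) \<longlonglongrightarrow> D4f0 t \<delta>" if t: "t \<in> {0..T}" for t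
      by (rule has_hadamard_deriv_along[OF D4f0_hadamard[OF t] \<theta>(1,2)]) (use \<theta>(1) in \<open>simp add: less_imp_neq[symmetric]\<close>)
    show "set_integrable lborel {0..T} (\<lambda>t. \<kappa> t * norm \<delta>)" by (intro set_integrable_mult_left \<kappa>(1))
  qed (use D4b quotient_NPC0_R[OF r0[OF \<theta>(3)] r0[OF SO(2)]] in auto)
  show "set_integrable lborel {0..T} (\<lambda>t. p t (D4f t \<delta>))"
  proof (rule NPC0_R_limit_integrable[OF T, of "\<lambda>n t. p t ((f t (x \<pi>\<^sub>0 t) (u \<pi>\<^sub>0 t) (\<pi>\<^sub>0 + \<theta> n *\<^sub>R \<delta>) - f t (x \<pi>\<^sub>0 t) (u \<pi>\<^sub>0 t) \<pi>\<^sub>0) /\<^sub>R \<theta> n)"])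
    show "(\<lambda>n. p t ((f t (x \<pi>\<^sub>0 t) (u \<pi>\<^sub>0 t) (\<pi>\<^sub>0 + \<theta> n *\<^sub>R \<delta>) - f t (x \<pi>\<^sub>0 t) (u \<pi>\<^sub>0 t) \<pi>\<^sub>0) /\<^sub>R \<theta> n)) \<longlonglongrightarrow> p t (D4f t \<delta>)" if t: "t \<in> {0..T}" for t
      by (intro blinfun.tendsto[OF tendsto_const] has_hadamard_deriv_along[OF D4f_hadamard[OF t] \<theta>(1,2)])
        (use \<theta>(1) in \<open>simp add: less_imp_neq[symmetric]\<close>)
    show "(\<lambda>t. p t ((f t (x \<pi>\<^sub>0 t) (u \<pi>\<^sub>0 t) (\<pi>\<^sub>0 + \<theta> n *\<^sub>R \<delta>) - f t (x \<pi>\<^sub>0 t) (u \<pi>\<^sub>0 t) \<pi>\<^sub>0) /\<^sub>R \<theta> n)) \<in> NPC0_R T UNIV" for n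
      by (rule NPC0_R_compose2[OF T pN quotient_NPC0_R[OF r1[OF \<theta>(3)] r1[OF SO(2)]]])
        (auto simp: case_prod_unfold intro!: continuous_intros)
    show "set_integrable lborel {0..T} (\<lambda>t. B * c t * norm \<delta>)" by (intro set_integrable_mult_left set_integrable_mult_right c(1))
  qed (use Dpb in auto)
qed

section \<open>Differentiation of the value along a sequence of parameters\<close>

abbreviation (input) V :: "'z \<Rightarrow> real" where
  "V \<equiv> bolza_value T \<Omega> U \<xi>\<^sub>0 m q f0 f g h"

lemma value_eq:
  "\<pi> \<in> P \<Longrightarrow> V \<pi> = (LINT t:{0..T}|lborel. f0 t (x \<pi> t) (u \<pi> t) \<pi>) + g 0 (x \<pi> T) \<pi>"
  using bolza_value_eq[OF bspec[OF SO(3)]] by (simp add: bolza_objective_def)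

lemma running_cost_NPC0_R: "\<pi> \<in> P \<Longrightarrow> (\<lambda>t. f0 t (x \<pi> t) (u \<pi> t) \<pi>) \<in> NPC0_R T UNIV"
  using bolza_maximizer.running_NPC0_R[OF maximizer] bolza_maximizer.x_cont[OF maximizer]
    bolza_maximizer.x_mem[OF maximizer] bolza_maximizer.u[OF maximizer] by blast

text \<open>The joint quotient of state, control and parameter converges at every time, its
  parameter part being constantly \<open>\<delta>\<close>. Differentiating \<open>f\<close> along it
  identifies the derivative of \<open>dx\<close>; for \<open>f0\<close> the Lipschitz assumption
  supplies the majorant. \<open>dx 0 = 0\<close> because the initial state does not depend on the
  parameter.\<close>

lemma variation_sequence:
  assumes \<theta>: "\<And>n. 0 < \<theta> n" "\<theta> \<longlonglongrightarrow> 0" and inP: "\<And>n. \<pi>\<^sub>0 + \<theta> n *\<^sub>R \<delta> \<in> P"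
  obtains dx du where "dx \<in> PC1 T UNIV" "du \<in> NPC0_R T UNIV" "dx 0 = 0"
    "\<And>t. t \<in> {0..T} \<Longrightarrow> (\<lambda>n. (x (\<pi>\<^sub>0 + \<theta> n *\<^sub>R \<delta>) t - x \<pi>\<^sub>0 t) /\<^sub>R \<theta> n) \<longlonglongrightarrow> dx t"
    "\<And>t. t \<in> {0..T} \<Longrightarrow> ext_deriv T dx t = Df t (dx t, du t, \<delta>)"
    "(\<lambda>n. LINT t:{0..T}|lborel. (f0 t (x (\<pi>\<^sub>0 + \<theta> n *\<^sub>R \<delta>) t) (u (\<pi>\<^sub>0 + \<theta> n *\<^sub>R \<delta>) t) (\<pi>\<^sub>0 + \<theta> n *\<^sub>R \<delta>) - f0 t (x \<pi>\<^sub>0 t) (u \<pi>\<^sub>0 t) \<pi>\<^sub>0) /\<^sub>R \<theta> n)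
      \<longlonglongrightarrow> (LINT t:{0..T}|lborel. Df0 t (dx t, du t, \<delta>))"
proof -
  define \<pi>s where "\<pi>s n = \<pi>\<^sub>0 + \<theta> n *\<^sub>R \<delta>" for n
  have \<pi>s: "\<pi>s n \<in> P" for n using inP by (simp add: \<pi>s_def)
  have \<pi>q: "(\<pi>s n - \<pi>\<^sub>0) /\<^sub>R \<theta> n = \<delta>" for n using \<theta>(1)[of n] by (simp add: \<pi>s_def)
  obtain dx du where dx: "has_PC1_variation T x dx \<pi>\<^sub>0 \<delta>" and du: "has_NPC0_R_variation T u du \<pi>\<^sub>0 \<delta>"
    using SO_bis by blast
  have dxP: "dx \<in> PC1 T UNIV" using dx by (simp add: has_PC1_variation_def)
  have duN: "du \<in> NPC0_R T UNIV" using du by (simp add: has_NPC0_R_variation_def)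
  obtain r where r: "r \<longlonglongrightarrow> 0"
    "\<And>n t. t \<in> {0..T} \<Longrightarrow> norm ((x (\<pi>s n) t - x \<pi>\<^sub>0 t) /\<^sub>R \<theta> n - dx t) \<le> r n"
    "\<And>n t. t \<in> {0..T} \<Longrightarrow> norm ((ext_deriv T (x (\<pi>s n)) t - ext_deriv T (x \<pi>\<^sub>0) t) /\<^sub>R \<theta> n - ext_deriv T dx t) \<le> r n"
    unfolding \<pi>s_def using PC1_variation_limit[OF T dx solution(1)[OF inP] solution(1)[OF SO(2)] \<theta>] by blast
  have uU: "u \<pi> \<in> NPC0_R T UNIV" if "\<pi> \<in> P" for \<pi> using NPC0_R_mono[OF solution(2)[OF that]] by simp
  obtain s where s: "s \<longlonglongrightarrow> 0"
    "\<And>n t. t \<in> {0..T} \<Longrightarrow> norm ((u (\<pi>s n) t - u \<pi>\<^sub>0 t) /\<^sub>R \<theta> n - du t) \<le> s n"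
    unfolding \<pi>s_def using NPC0_R_variation_limit[OF T du uU[OF inP] uU[OF SO(2)] \<theta>] by blast
  have sandwich: "a \<longlonglongrightarrow> l" if "b \<longlonglongrightarrow> 0" "\<And>n. norm (a n - l) \<le> b n"
    for a :: "nat \<Rightarrow> 'w::real_normed_vector" and l b
    using Lim_null_comparison[of "\<lambda>n. a n - l" b sequentially] that by (simp add: LIM_zero_iff)
  have xl: "(\<lambda>n. (x (\<pi>s n) t - x \<pi>\<^sub>0 t) /\<^sub>R \<theta> n) \<longlonglongrightarrow> dx t"
    and el: "(\<lambda>n. (ext_deriv T (x (\<pi>s n)) t - ext_deriv T (x \<pi>\<^sub>0) t) /\<^sub>R \<theta> n) \<longlonglongrightarrow> ext_deriv T dx t"
    and ul: "(\<lambda>n. (u (\<pi>s n) t - u \<pi>\<^sub>0 t) /\<^sub>R \<theta> n) \<longlonglongrightarrow> du t" if t: "t \<in> {0..T}" for t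
    using sandwich[OF r(1) r(2)[OF t]] sandwich[OF r(1) r(3)[OF t]] sandwich[OF s(1) s(2)[OF t]] by blast+
  have joint: "(\<lambda>n. ((x (\<pi>s n) t, u (\<pi>s n) t, \<pi>s n) - (x \<pi>\<^sub>0 t, u \<pi>\<^sub>0 t, \<pi>\<^sub>0)) /\<^sub>R \<theta> n) \<longlonglongrightarrow> (dx t, du t, \<delta>)"
    if t: "t \<in> {0..T}" for t
    unfolding diff_Pair scaleR_Pair \<pi>q by (intro tendsto_Pair xl ul t tendsto_const)
  have dx0: "dx 0 = 0"
    using xl[OF T_mem(2)] unfolding solution(4)[OF \<pi>s] solution(4)[OF SO(2)] by (simp add: LIMSEQ_const_iff)
  have ext: "ext_deriv T dx t = Df t (dx t, du t, \<delta>)" if t: "t \<in> {0..T}" for t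
  proof (rule LIMSEQ_unique[OF el[OF t]])
    show "(\<lambda>n. (ext_deriv T (x (\<pi>s n)) t - ext_deriv T (x \<pi>\<^sub>0) t) /\<^sub>R \<theta> n) \<longlonglongrightarrow> Df t (dx t, du t, \<delta>)"
      using has_hadamard_deriv_along[OF Df[OF t] \<theta> joint[OF t]]
      unfolding solution(3)[OF \<pi>s t] solution(3)[OF SO(2) t] by simp
  qed
  let ?Q = "\<lambda>n t. (f0 t (x (\<pi>s n) t) (u (\<pi>s n) t) (\<pi>s n) - f0 t (x \<pi>\<^sub>0 t) (u \<pi>\<^sub>0 t) \<pi>\<^sub>0) /\<^sub>R \<theta> n"
  have Ql: "(\<lambda>n. ?Q n t) \<longlonglongrightarrow> Df0 t (dx t, du t, \<delta>)" if t: "t \<in> {0..T}" for t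
    using has_hadamard_deriv_along[OF Df0[OF t] \<theta> joint[OF t]] by simp
  have QN: "?Q n \<in> NPC0_R T UNIV" for n
    by (rule quotient_NPC0_R[OF running_cost_NPC0_R[OF \<pi>s] running_cost_NPC0_R[OF SO(2)]])
  obtain \<kappa> \<rho> where \<kappa>: "set_integrable lborel {0..T} \<kappa>" "\<forall>t\<in>{0..T}. 0 \<le> \<kappa> t" and \<rho>: "\<rho> > 0"
    and lip: "\<And>t \<xi>\<^sub>1 \<zeta>\<^sub>1 \<pi>\<^sub>1 \<xi>\<^sub>2 \<zeta>\<^sub>2 \<pi>\<^sub>2. t \<in> {0..T} \<Longrightarrow> \<xi>\<^sub>1 \<in> \<Omega> \<Longrightarrow> \<zeta>\<^sub>1 \<in> U \<Longrightarrow> \<pi>\<^sub>1 \<in> P \<Longrightarrow> \<xi>\<^sub>2 \<in> \<Omega> \<Longrightarrow> \<zeta>\<^sub>2 \<in> U \<Longrightarrow> \<pi>\<^sub>2 \<in> P \<Longrightarrow>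
            norm (\<xi>\<^sub>1 - x \<pi>\<^sub>0 t) + norm (\<zeta>\<^sub>1 - u \<pi>\<^sub>0 t) + norm (\<pi>\<^sub>1 - \<pi>\<^sub>0) < \<rho> \<Longrightarrow>
            norm (\<xi>\<^sub>2 - x \<pi>\<^sub>0 t) + norm (\<zeta>\<^sub>2 - u \<pi>\<^sub>0 t) + norm (\<pi>\<^sub>2 - \<pi>\<^sub>0) < \<rho> \<Longrightarrow>
            \<bar>f0 t \<xi>\<^sub>1 \<zeta>\<^sub>1 \<pi>\<^sub>1 - f0 t \<xi>\<^sub>2 \<zeta>\<^sub>2 \<pi>\<^sub>2\<bar>
              \<le> \<kappa> t * (norm (\<xi>\<^sub>1 - \<xi>\<^sub>2) + norm (\<zeta>\<^sub>1 - \<zeta>\<^sub>2) + norm (\<pi>\<^sub>1 - \<pi>\<^sub>2))"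
    using IC3 by metis
  obtain Bx where Bx: "\<And>t. t \<in> {0..T} \<Longrightarrow> norm (dx t) \<le> Bx"
    using NPC0_R_bounded[OF T NPC0_R_continuous[OF T PC1_continuous[OF dxP], of UNIV]] by blast
  obtain Bu where Bu: "\<And>t. t \<in> {0..T} \<Longrightarrow> norm (du t) \<le> Bu" using NPC0_R_bounded[OF T duN] by blast
  \<comment> \<open>Eventually the quotients of state and control exceed their limits by less than
    1, so the joint increment is at most \<open>\<theta> n * C\<close>. The same constant puts the
    perturbed points inside the Lipschitz ball and bounds the quotients of
    \<open>f0\<close>.\<close>
  define C where "C = (Bx + 1) + (Bu + 1) + norm \<delta>"
  have "eventually (\<lambda>n. r n < 1) sequentially" "eventually (\<lambda>n. s n < 1) sequentially"
    using order_tendstoD(2)[OF r(1), of 1] order_tendstoD(2)[OF s(1), of 1] by simp_all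
  moreover have "eventually (\<lambda>n. \<theta> n * C < \<rho>) sequentially"
    by (rule order_tendstoD(2)[OF tendsto_mult_left_zero[OF \<theta>(2)] \<rho>])
  ultimately have "eventually (\<lambda>n. r n < 1 \<and> s n < 1 \<and> \<theta> n * C < \<rho>) sequentially"
    by (simp add: eventually_conj_iff)
  then obtain N where N: "\<And>n. N \<le> n \<Longrightarrow> r n < 1 \<and> s n < 1 \<and> \<theta> n * C < \<rho>"
    unfolding eventually_sequentially by blast
  have scale: "norm a \<le> \<theta> n * (B + 1)" if "norm (a /\<^sub>R \<theta> n - d) \<le> b" "b < 1" "norm d \<le> B"
    for a d :: "'w::real_normed_vector" and n b B
  proof -
    have "norm (a /\<^sub>R \<theta> n) \<le> B + 1"
      using norm_triangle_ineq2[of "a /\<^sub>R \<theta> n" d] that by linarith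
    then show ?thesis using \<theta>(1)[of n] by (simp add: field_simps)
  qed
  have Qb: "\<bar>?Q n t\<bar> \<le> \<kappa> t * C" if n: "N \<le> n" and t: "t \<in> {0..T}" for n t
  proof -
    have x': "norm (x (\<pi>s n) t - x \<pi>\<^sub>0 t) \<le> \<theta> n * (Bx + 1)" using scale[OF r(2)[OF t]] N[OF n] Bx[OF t] by blast
    have u': "norm (u (\<pi>s n) t - u \<pi>\<^sub>0 t) \<le> \<theta> n * (Bu + 1)" using scale[OF s(2)[OF t]] N[OF n] Bu[OF t] by blast
    have p': "norm (\<pi>s n - \<pi>\<^sub>0) = \<theta> n * norm \<delta>" using \<theta>(1)[of n] by (simp add: \<pi>s_def)
    have sum: "norm (x (\<pi>s n) t - x \<pi>\<^sub>0 t) + norm (u (\<pi>s n) t - u \<pi>\<^sub>0 t) + norm (\<pi>s n - \<pi>\<^sub>0) \<le> \<theta> n * C"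
      unfolding C_def distrib_left[of "\<theta> n" "Bx + 1 + (Bu + 1)"] distrib_left[of "\<theta> n" "Bx + 1" "Bu + 1"]
      using x' u' p' by linarith
    have "\<bar>f0 t (x (\<pi>s n) t) (u (\<pi>s n) t) (\<pi>s n) - f0 t (x \<pi>\<^sub>0 t) (u \<pi>\<^sub>0 t) \<pi>\<^sub>0\<bar> \<le>
        \<kappa> t * (norm (x (\<pi>s n) t - x \<pi>\<^sub>0 t) + norm (u (\<pi>s n) t - u \<pi>\<^sub>0 t) + norm (\<pi>s n - \<pi>\<^sub>0))"
    proof (rule lip[OF t])
      show "x (\<pi>s n) t \<in> \<Omega>" "u (\<pi>s n) t \<in> U" "x \<pi>\<^sub>0 t \<in> \<Omega>" "u \<pi>\<^sub>0 t \<in> U" "\<pi>s n \<in> P" "\<pi>\<^sub>0 \<in> P"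
        using PC1_mem[OF solution(1) t] NPC0_R_mem[OF solution(2) t] \<pi>s SO(2) by blast+
      show "norm (x (\<pi>s n) t - x \<pi>\<^sub>0 t) + norm (u (\<pi>s n) t - u \<pi>\<^sub>0 t) + norm (\<pi>s n - \<pi>\<^sub>0) < \<rho>"
        using sum N[OF n] by linarith
    qed (use \<rho> in simp)
    also have "\<dots> \<le> \<kappa> t * (\<theta> n * C)" using sum \<kappa>(2) t by (intro mult_left_mono) auto
    finally show ?thesis using \<theta>(1)[of n] by (simp add: abs_mult field_simps)
  qed
  have "(\<lambda>n. LINT t:{0..T}|lborel. ?Q (n + N) t) \<longlonglongrightarrow> (LINT t:{0..T}|lborel. Df0 t (dx t, du t, \<delta>))"
  proof (rule NPC0_R_dominated_convergence[OF T QN])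
    show "(\<lambda>n. ?Q (n + N) t) \<longlonglongrightarrow> Df0 t (dx t, du t, \<delta>)" if "t \<in> {0..T}" for t
      using LIMSEQ_ignore_initial_segment[OF Ql[OF that], of N] .
    show "set_integrable lborel {0..T} (\<lambda>t. \<kappa> t * C)" by (intro set_integrable_mult_left \<kappa>(1))
    show "\<bar>?Q (n + N) t\<bar> \<le> \<kappa> t * C" if "t \<in> {0..T}" for n t by (rule Qb[OF le_add2 that])
  qed
  then have "(\<lambda>n. LINT t:{0..T}|lborel. ?Q n t) \<longlonglongrightarrow> (LINT t:{0..T}|lborel. Df0 t (dx t, du t, \<delta>))"
    by (rule LIMSEQ_offset)
  then show thesis
    by (intro that[OF dxP duN dx0 _ ext]) (use xl in \<open>simp_all add: \<pi>s_def\<close>)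
qed

lemma terminal_quotient:
  assumes \<phi>: "\<phi> \<in> g ` {0..m} \<union> h ` {1..q}"
    and \<theta>: "\<And>n. 0 < \<theta> n" "\<theta> \<longlonglongrightarrow> 0"
    and xl: "(\<lambda>n. (x (\<pi>\<^sub>0 + \<theta> n *\<^sub>R \<delta>) T - x \<pi>\<^sub>0 T) /\<^sub>R \<theta> n) \<longlonglongrightarrow> d"
  shows "(\<lambda>n. (\<phi> (x (\<pi>\<^sub>0 + \<theta> n *\<^sub>R \<delta>) T) (\<pi>\<^sub>0 + \<theta> n *\<^sub>R \<delta>) - \<phi> (x \<pi>\<^sub>0 T) \<pi>\<^sub>0) /\<^sub>R \<theta> n) \<longlonglongrightarrow>
    hadamard_deriv (\<lambda>\<xi>. \<phi> \<xi> \<pi>\<^sub>0) (x \<pi>\<^sub>0 T) d + hadamard_deriv (\<lambda>\<pi>. \<phi> (x \<pi>\<^sub>0 T) \<pi>) \<pi>\<^sub>0 \<delta>"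
proof -
  obtain D where D: "has_hadamard_deriv (\<lambda>(\<xi>, \<pi>). \<phi> \<xi> \<pi>) D (x \<pi>\<^sub>0 T, \<pi>\<^sub>0)"
    using CT1 \<phi> unfolding hadamard_differentiable_def by blast
  have "(\<pi>\<^sub>0 + \<theta> n *\<^sub>R \<delta> - \<pi>\<^sub>0) /\<^sub>R \<theta> n = \<delta>" for n using \<theta>(1)[of n] by simp
  then have "(\<lambda>n. ((x (\<pi>\<^sub>0 + \<theta> n *\<^sub>R \<delta>) T, \<pi>\<^sub>0 + \<theta> n *\<^sub>R \<delta>) - (x \<pi>\<^sub>0 T, \<pi>\<^sub>0)) /\<^sub>R \<theta> n) \<longlonglongrightarrow> (d, \<delta>)"
    unfolding diff_Pair scaleR_Pair by (simp only: tendsto_Pair[OF xl tendsto_const])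
  from has_hadamard_deriv_along[OF D \<theta> this]
  have "(\<lambda>n. (\<phi> (x (\<pi>\<^sub>0 + \<theta> n *\<^sub>R \<delta>) T) (\<pi>\<^sub>0 + \<theta> n *\<^sub>R \<delta>) - \<phi> (x \<pi>\<^sub>0 T) \<pi>\<^sub>0) /\<^sub>R \<theta> n) \<longlonglongrightarrow> D (d, \<delta>)" by simp
  moreover have "D (d, \<delta>) = D (d, 0) + D (0, \<delta>)" by (simp add: blinfun.add_right[symmetric])
  ultimately show ?thesis
    unfolding hadamard_deriv_eq[OF hadamard_partials2(1)[OF D]] hadamard_deriv_eq[OF hadamard_partials2(2)[OF D]]
    by simp
qed

definition sensitivity :: "(nat \<Rightarrow> real) \<Rightarrow> (nat \<Rightarrow> real) \<Rightarrow> (real \<Rightarrow> 'x \<Rightarrow>\<^sub>L real) \<Rightarrow> 'z \<Rightarrow> real" where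
  "sensitivity lam mu p \<delta> = hadamard_deriv (\<lambda>\<pi>. g 0 (x \<pi>\<^sub>0 T) \<pi>) \<pi>\<^sub>0 \<delta> +
     (\<Sum>i=1..m. lam i * hadamard_deriv (\<lambda>\<pi>. g i (x \<pi>\<^sub>0 T) \<pi>) \<pi>\<^sub>0 \<delta>) +
     (\<Sum>j=1..q. mu j * hadamard_deriv (\<lambda>\<pi>. h j (x \<pi>\<^sub>0 T) \<pi>) \<pi>\<^sub>0 \<delta>) +
     (LINT t:{0..T}|lborel. D4f0 t \<delta>) + (LINT t:{0..T}|lborel. p t (D4f t \<delta>))"

text \<open>The adjoint equation accounts for the state direction \<open>a\<close> and stationarity
  removes the control direction \<open>b\<close>. Along \<open>dx\<close> the subtracted bracket is
  the derivative of \<open>p t (dx t)\<close>.\<close>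

lemma costate_pairing:
  assumes tr: "pontryagin_triple T U m q f0 f g h \<pi>\<^sub>0 (x \<pi>\<^sub>0, u \<pi>\<^sub>0) lam mu p" "lam 0 = 1" and t: "t \<in> {0..T}"
  shows "Df0 t (a, b, \<delta>) = D4f0 t \<delta> + p t (D4f t \<delta>) - (ext_deriv T p t a + p t (Df t (a, b, \<delta>)))"
proof -
  interpret M: bolza_maximizer T \<Omega> U \<xi>\<^sub>0 m q f0 f g h \<pi>\<^sub>0 "x \<pi>\<^sub>0" "u \<pi>\<^sub>0" by (rule maximizer[OF SO(2)])
  \<comment> \<open>The Frechet differential in the state and the first part of the joint Hadamard
    differential are both Gateaux differentials, hence equal.\<close>
  have A: "M.A1 t = Df t o\<^sub>L inl_blinfun" "M.A0 t = Df0 t o\<^sub>L inl_blinfun"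
    using has_gateaux_deriv_unique[OF has_derivative_imp_has_gateaux_deriv[OF M.A1_deriv[OF t]]]
      has_gateaux_deriv_unique[OF has_derivative_imp_has_gateaux_deriv[OF M.A0_deriv[OF t]]]
      hadamard_partials(1)[OF Df[OF t]] hadamard_partials(1)[OF Df0[OF t]]
    unfolding has_hadamard_deriv_def by blast+
  have "(p t o\<^sub>L (Df t o\<^sub>L (inr_blinfun o\<^sub>L inl_blinfun))) + lam 0 *\<^sub>R (Df0 t o\<^sub>L (inr_blinfun o\<^sub>L inl_blinfun)) = 0"
    using M.stationary[OF tr(1) t] hadamard_partials(2)[OF Df[OF t]] hadamard_partials(2)[OF Df0[OF t]]
    unfolding has_hadamard_deriv_def by blast
  from arg_cong[where f = "\<lambda>L. blinfun_apply L b", OF this]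
  have st: "p t (Df t (0, b, 0)) + Df0 t (0, b, 0) = 0" using tr(2) by (simp add: blinfun.bilinear_simps)
  have split: "L (a, b, \<delta>) = L (a, 0, 0) + L (0, b, 0) + L (0, 0, \<delta>)" for L :: "('x \<times> 'y \<times> 'z) \<Rightarrow>\<^sub>L 'w::real_normed_vector"
    by (simp add: blinfun.add_right[symmetric])
  have ext: "ext_deriv T p t a = - p t (Df t (a, 0, 0)) - Df0 t (a, 0, 0)"
    unfolding M.triple_facts(6)[OF tr(1) t] A tr(2) by (simp add: blinfun.bilinear_simps zero_prod_def)
  show ?thesis
    unfolding D4f[OF t] D4f0[OF t] ext split[of "Df0 t"] split[of "Df t"]
    using st by (simp add: blinfun.add_right)
qed

lemma value_quotient_limit:
  assumes tr: "pontryagin_triple T U m q f0 f g h \<pi>\<^sub>0 (x \<pi>\<^sub>0, u \<pi>\<^sub>0) lam mu p" "lam 0 = 1"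
    and \<theta>: "\<And>n. 0 < \<theta> n" "\<theta> \<longlonglongrightarrow> 0" and inP: "\<And>n. \<pi>\<^sub>0 + \<theta> n *\<^sub>R \<delta> \<in> P"
  shows "(\<lambda>n. (V (\<pi>\<^sub>0 + \<theta> n *\<^sub>R \<delta>) - V \<pi>\<^sub>0) /\<^sub>R \<theta> n) \<longlonglongrightarrow> sensitivity lam mu p \<delta>"
proof -
  interpret M: bolza_maximizer T \<Omega> U \<xi>\<^sub>0 m q f0 f g h \<pi>\<^sub>0 "x \<pi>\<^sub>0" "u \<pi>\<^sub>0" by (rule maximizer[OF SO(2)])
  note pP = M.triple_facts(1)[OF tr(1)]
  obtain dx du where dx: "dx \<in> PC1 T UNIV" "du \<in> NPC0_R T UNIV" "dx 0 = 0"
    and xl: "\<And>t. t \<in> {0..T} \<Longrightarrow> (\<lambda>n. (x (\<pi>\<^sub>0 + \<theta> n *\<^sub>R \<delta>) t - x \<pi>\<^sub>0 t) /\<^sub>R \<theta> n) \<longlonglongrightarrow> dx t"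
    and ext: "\<And>t. t \<in> {0..T} \<Longrightarrow> ext_deriv T dx t = Df t (dx t, du t, \<delta>)"
    and il: "(\<lambda>n. LINT t:{0..T}|lborel. (f0 t (x (\<pi>\<^sub>0 + \<theta> n *\<^sub>R \<delta>) t) (u (\<pi>\<^sub>0 + \<theta> n *\<^sub>R \<delta>) t) (\<pi>\<^sub>0 + \<theta> n *\<^sub>R \<delta>) - f0 t (x \<pi>\<^sub>0 t) (u \<pi>\<^sub>0 t) \<pi>\<^sub>0) /\<^sub>R \<theta> n)
      \<longlonglongrightarrow> (LINT t:{0..T}|lborel. Df0 t (dx t, du t, \<delta>))"
    by (rule variation_sequence[OF \<theta> inP]) (rule that; assumption)
  note tq = terminal_quotient[OF _ \<theta> xl[OF T_mem(1)]]
  let ?e = "\<lambda>t. ext_deriv T p t (dx t) + p t (ext_deriv T dx t)"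
  have e1: "(\<lambda>t. ext_deriv T p t (dx t)) \<in> NPC0_R T UNIV"
    by (rule NPC0_R_compose2[OF T PC1_ext_deriv(1)[OF T pP] NPC0_R_continuous[OF T PC1_continuous[OF dx(1)], of UNIV]])
      (auto simp: case_prod_unfold intro!: continuous_intros)
  have e2: "(\<lambda>t. p t (ext_deriv T dx t)) \<in> NPC0_R T UNIV"
    by (rule NPC0_R_compose2[OF T NPC0_R_continuous[OF T PC1_continuous[OF pP], of UNIV] PC1_ext_deriv(1)[OF T dx(1)]])
      (auto simp: case_prod_unfold intro!: continuous_intros)
  have eN: "?e \<in> NPC0_R T UNIV"
    by (rule NPC0_R_compose2[OF T e1 e2]) (auto simp: case_prod_unfold intro!: continuous_intros)
  have e_int: "set_integrable lborel {0..T} ?e" by (rule NPC0_R_set_integrable[OF T eN])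
  obtain S where S: "finite S" "\<And>t. t \<in> {0<..<T} - S \<Longrightarrow> (p has_vector_derivative ext_deriv T p t) (at t)"
    using PC1_ext_deriv(2)[OF T pP] by blast
  obtain S' where S': "finite S'" "\<And>t. t \<in> {0<..<T} - S' \<Longrightarrow> (dx has_vector_derivative ext_deriv T dx t) (at t)"
    using PC1_ext_deriv(2)[OF T dx(1)] by blast
  \<comment> \<open>Integration by parts: the boundary term at 0 vanishes with \<open>dx 0\<close>,
    the one at \<open>T\<close> remains.\<close>
  have "(?e has_integral (p T (dx T) - p 0 (dx 0))) {0..T}"
  proof (rule has_integral_FTC_finite[of T T "\<lambda>t. p t (dx t)" "S \<union> S'"])
    show "continuous_on {0..T} (\<lambda>t. p t (dx t))"
      by (intro continuous_intros PC1_continuous[OF pP] PC1_continuous[OF dx(1)])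
    fix s assume "s \<in> {0<..<T} - (S \<union> S')"
    then show "((\<lambda>t. p t (dx t)) has_vector_derivative ?e s) (at s)"
      using bounded_bilinear.has_vector_derivative[OF bounded_bilinear_blinfun_apply S(2)[of s] S'(2)[of s]]
      by (simp add: add.commute)
  qed (use T S(1) S'(1) in auto)
  then have e: "(LINT t:{0..T}|lborel. ?e t) = p T (dx T)"
    using set_borel_integral_eq_integral(2)[OF e_int] dx(3) by (simp add: integral_unique)
  have "(LINT t:{0..T}|lborel. Df0 t (dx t, du t, \<delta>)) = (LINT t:{0..T}|lborel. D4f0 t \<delta> + p t (D4f t \<delta>) - ?e t)"
    by (intro set_lebesgue_integral_cong) (auto simp: ext costate_pairing[OF tr])
  also have "\<dots> = (LINT t:{0..T}|lborel. D4f0 t \<delta>) + (LINT t:{0..T}|lborel. p t (D4f t \<delta>)) - p T (dx T)"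
    using parameter_integrable(1,2)[OF pP, of \<delta>] e_int e by (simp add: set_integral_add set_integral_diff)
  finally have int: "(LINT t:{0..T}|lborel. Df0 t (dx t, du t, \<delta>)) =
    (LINT t:{0..T}|lborel. D4f0 t \<delta>) + (LINT t:{0..T}|lborel. p t (D4f t \<delta>)) - p T (dx T)" .
  \<comment> \<open>For a nonzero multiplier the constraint is eventually zero along the solutions,
    so its total derivative vanishes and the state part is minus the parameter part. For a zero
    multiplier both sides vanish.\<close>
  have G: "lam i * hadamard_deriv (\<lambda>\<xi>. g i \<xi> \<pi>\<^sub>0) (x \<pi>\<^sub>0 T) (dx T) = - (lam i * hadamard_deriv (\<lambda>\<pi>. g i (x \<pi>\<^sub>0 T) \<pi>) \<pi>\<^sub>0 \<delta>)"
    if i: "i \<in> {1..m}" for i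
  proof (cases "lam i = 0")
    case False
    have "(\<lambda>n. \<pi>\<^sub>0 + \<theta> n *\<^sub>R \<delta>) \<longlonglongrightarrow> \<pi>\<^sub>0 + 0 *\<^sub>R \<delta>" by (intro tendsto_intros \<theta>(2))
    then have "eventually (\<lambda>n. g i (x (\<pi>\<^sub>0 + \<theta> n *\<^sub>R \<delta>) T) (\<pi>\<^sub>0 + \<theta> n *\<^sub>R \<delta>) = 0) sequentially"
      using active_stays_active[OF tr inP _ i False] by simp
    moreover have "g i (x \<pi>\<^sub>0 T) \<pi>\<^sub>0 = 0" using M.triple_facts(4)[OF tr(1) i] False by simp
    ultimately have "eventually (\<lambda>n. (g i (x (\<pi>\<^sub>0 + \<theta> n *\<^sub>R \<delta>) T) (\<pi>\<^sub>0 + \<theta> n *\<^sub>R \<delta>) - g i (x \<pi>\<^sub>0 T) \<pi>\<^sub>0) /\<^sub>R \<theta> n = 0) sequentially"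
      by (auto elim: eventually_mono)
    then have "(\<lambda>n. (g i (x (\<pi>\<^sub>0 + \<theta> n *\<^sub>R \<delta>) T) (\<pi>\<^sub>0 + \<theta> n *\<^sub>R \<delta>) - g i (x \<pi>\<^sub>0 T) \<pi>\<^sub>0) /\<^sub>R \<theta> n) \<longlonglongrightarrow> 0"
      by (rule tendsto_eventually)
    from LIMSEQ_unique[OF tq[of "g i"] this] i
    have "hadamard_deriv (\<lambda>\<xi>. g i \<xi> \<pi>\<^sub>0) (x \<pi>\<^sub>0 T) (dx T) = - hadamard_deriv (\<lambda>\<pi>. g i (x \<pi>\<^sub>0 T) \<pi>) \<pi>\<^sub>0 \<delta>" by simp
    then show ?thesis by simp
  qed simp
  \<comment> \<open>Feasibility of all perturbed solutions makes the quotient identically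
    zero.\<close>
  have H: "hadamard_deriv (\<lambda>\<xi>. h j \<xi> \<pi>\<^sub>0) (x \<pi>\<^sub>0 T) (dx T) = - hadamard_deriv (\<lambda>\<pi>. h j (x \<pi>\<^sub>0 T) \<pi>) \<pi>\<^sub>0 \<delta>"
    if j: "j \<in> {1..q}" for j
  proof -
    have "(\<lambda>n. (h j (x (\<pi>\<^sub>0 + \<theta> n *\<^sub>R \<delta>) T) (\<pi>\<^sub>0 + \<theta> n *\<^sub>R \<delta>) - h j (x \<pi>\<^sub>0 T) \<pi>\<^sub>0) /\<^sub>R \<theta> n) \<longlonglongrightarrow> 0"
      using solution(6)[OF inP j] solution(6)[OF SO(2) j] by simp
    from LIMSEQ_unique[OF tq[of "h j"] this] j show ?thesis by simp
  qed
  \<comment> \<open>Transversality. The term of index 0 is left as it stands; it cancels against the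
    state part in the variation of \<open>g 0\<close>, so no trace of \<open>dx\<close>
    survives.\<close>
  have "p T (dx T) = (\<Sum>i=0..m. lam i * hadamard_deriv (\<lambda>\<xi>. g i \<xi> \<pi>\<^sub>0) (x \<pi>\<^sub>0 T) (dx T)) +
      (\<Sum>j=1..q. mu j * hadamard_deriv (\<lambda>\<xi>. h j \<xi> \<pi>\<^sub>0) (x \<pi>\<^sub>0 T) (dx T))"
    unfolding M.triple_facts(5)[OF tr(1), symmetric] by (simp add: blinfun.bilinear_simps blinfun.sum_left)
  also have "\<dots> = hadamard_deriv (\<lambda>\<xi>. g 0 \<xi> \<pi>\<^sub>0) (x \<pi>\<^sub>0 T) (dx T) +
      (\<Sum>i=1..m. - (lam i * hadamard_deriv (\<lambda>\<pi>. g i (x \<pi>\<^sub>0 T) \<pi>) \<pi>\<^sub>0 \<delta>)) +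
      (\<Sum>j=1..q. - (mu j * hadamard_deriv (\<lambda>\<pi>. h j (x \<pi>\<^sub>0 T) \<pi>) \<pi>\<^sub>0 \<delta>))"
    using tr(2) by (simp add: sum.atLeast_Suc_atMost G H)
  finally have pT: "p T (dx T) = hadamard_deriv (\<lambda>\<xi>. g 0 \<xi> \<pi>\<^sub>0) (x \<pi>\<^sub>0 T) (dx T) -
      (\<Sum>i=1..m. lam i * hadamard_deriv (\<lambda>\<pi>. g i (x \<pi>\<^sub>0 T) \<pi>) \<pi>\<^sub>0 \<delta>) -
      (\<Sum>j=1..q. mu j * hadamard_deriv (\<lambda>\<pi>. h j (x \<pi>\<^sub>0 T) \<pi>) \<pi>\<^sub>0 \<delta>)"
    by (simp add: sum_negf)
  have "(V (\<pi>\<^sub>0 + \<theta> n *\<^sub>R \<delta>) - V \<pi>\<^sub>0) /\<^sub>R \<theta> n =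
      (LINT t:{0..T}|lborel. (f0 t (x (\<pi>\<^sub>0 + \<theta> n *\<^sub>R \<delta>) t) (u (\<pi>\<^sub>0 + \<theta> n *\<^sub>R \<delta>) t) (\<pi>\<^sub>0 + \<theta> n *\<^sub>R \<delta>) - f0 t (x \<pi>\<^sub>0 t) (u \<pi>\<^sub>0 t) \<pi>\<^sub>0) /\<^sub>R \<theta> n) +
      (g 0 (x (\<pi>\<^sub>0 + \<theta> n *\<^sub>R \<delta>) T) (\<pi>\<^sub>0 + \<theta> n *\<^sub>R \<delta>) - g 0 (x \<pi>\<^sub>0 T) \<pi>\<^sub>0) /\<^sub>R \<theta> n" for n
  proof -
    note i1 = NPC0_R_set_integrable[OF T running_cost_NPC0_R[OF inP[of n]]] and i2 = NPC0_R_set_integrable[OF T running_cost_NPC0_R[OF SO(2)]]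
    show ?thesis
      unfolding value_eq[OF inP[of n]] value_eq[OF SO(2)] set_integral_scaleR_right set_integral_diff(2)[OF i1 i2]
      by (simp add: algebra_simps)
  qed
  moreover have "(\<lambda>n. (LINT t:{0..T}|lborel. (f0 t (x (\<pi>\<^sub>0 + \<theta> n *\<^sub>R \<delta>) t) (u (\<pi>\<^sub>0 + \<theta> n *\<^sub>R \<delta>) t) (\<pi>\<^sub>0 + \<theta> n *\<^sub>R \<delta>) - f0 t (x \<pi>\<^sub>0 t) (u \<pi>\<^sub>0 t) \<pi>\<^sub>0) /\<^sub>R \<theta> n) +
      (g 0 (x (\<pi>\<^sub>0 + \<theta> n *\<^sub>R \<delta>) T) (\<pi>\<^sub>0 + \<theta> n *\<^sub>R \<delta>) - g 0 (x \<pi>\<^sub>0 T) \<pi>\<^sub>0) /\<^sub>R \<theta> n) \<longlonglongrightarrow> sensitivity lam mu p \<delta>"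
    using tendsto_add[OF il tq[of "g 0"]] unfolding int pT sensitivity_def by (simp add: ac_simps)
  ultimately show ?thesis by simp
qed

end

text \<open>Integrability in every single direction makes the integral linear; the common majorant
  makes it bounded.\<close>

lemma bounded_linear_set_integral:
  fixes D :: "real \<Rightarrow> 'a::real_normed_vector \<Rightarrow>\<^sub>L real"
  assumes D: "\<And>v. set_integrable lborel A (\<lambda>t. D t v)" and \<kappa>: "set_integrable lborel A \<kappa>"
    and b: "\<And>t v. t \<in> A \<Longrightarrow> \<bar>D t v\<bar> \<le> \<kappa> t * norm v"
  shows "bounded_linear (\<lambda>v. LINT t:A|lborel. D t v)"
proof (rule bounded_linear_intro)
  fix v w :: 'a and r :: real
  show "(LINT t:A|lborel. D t (v + w)) = (LINT t:A|lborel. D t v) + (LINT t:A|lborel. D t w)"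
    by (simp add: blinfun.add_right set_integral_add D)
  show "(LINT t:A|lborel. D t (r *\<^sub>R v)) = r *\<^sub>R (LINT t:A|lborel. D t v)"
    by (simp add: blinfun.scaleR_right)
  have "norm (LINT t:A|lborel. D t v) \<le> (LINT t:A|lborel. norm (D t v))"
    by (rule set_integral_norm_bound[OF D])
  also have "\<dots> \<le> (LINT t:A|lborel. \<kappa> t * norm v)"
    using b by (intro set_integral_mono set_integrable_norm D set_integrable_mult_left \<kappa>) auto
  finally show "norm (LINT t:A|lborel. D t v) \<le> norm v * (LINT t:A|lborel. \<kappa> t)" by (simp add: mult.commute)
qed

section \<open>Gateaux differentiability of the value\<close>

context bolza_sensitivity
begin

lemma bounded_linear_sensitivity:
  assumes p: "p \<in> PC1 T UNIV"
  shows "bounded_linear (sensitivity lam mu p)"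
proof -
  obtain \<kappa> where \<kappa>: "set_integrable lborel {0..T} \<kappa>" "\<forall>t\<in>{0..T}. 0 \<le> \<kappa> t"
    "\<forall>t\<in>{0..T}. \<forall>\<delta>::'z. \<bar>D4f0 t \<delta>\<bar> \<le> \<kappa> t * norm \<delta> \<and> \<bar>p t (D4f t \<delta>)\<bar> \<le> \<kappa> t * norm \<delta>"
    using parameter_integrable(3)[OF p] by blast
  have 1: "bounded_linear (\<lambda>\<delta>. LINT t:{0..T}|lborel. D4f0 t \<delta>)"
    using parameter_integrable(1)[OF p] \<kappa> by (intro bounded_linear_set_integral) auto
  have "bounded_linear (\<lambda>\<delta>. LINT t:{0..T}|lborel. (p t o\<^sub>L D4f t) \<delta>)"
    using parameter_integrable(2)[OF p] \<kappa> by (intro bounded_linear_set_integral) auto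
  then have 2: "bounded_linear (\<lambda>\<delta>. LINT t:{0..T}|lborel. p t (D4f t \<delta>))" by simp
  show ?thesis
    unfolding sensitivity_def[abs_def]
    by (intro bounded_linear_add bounded_linear_sum bounded_linear_const_mult blinfun.bounded_linear_right 1 2)
qed

lemma value_gateaux:
  assumes tr: "pontryagin_triple T U m q f0 f g h \<pi>\<^sub>0 (x \<pi>\<^sub>0, u \<pi>\<^sub>0) lam mu p" "lam 0 = 1"
  shows "has_gateaux_deriv V (Blinfun (sensitivity lam mu p)) \<pi>\<^sub>0"
  unfolding has_gateaux_deriv_def has_right_gateaux_variation_def
proof
  fix \<delta>
  have p: "p \<in> PC1 T UNIV" using tr(1) by (simp add: pontryagin_triple_def)
  show "((\<lambda>\<theta>. (V (\<pi>\<^sub>0 + \<theta> *\<^sub>R \<delta>) - V \<pi>\<^sub>0) /\<^sub>R \<theta>) \<longlongrightarrow> Blinfun (sensitivity lam mu p) \<delta>) (at_right 0)"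
    unfolding bounded_linear_Blinfun_apply[OF bounded_linear_sensitivity[OF p]] tendsto_at_iff_sequentially
  \<comment> \<open>The one-sided limit is tested on sequences, the form in which dominated
    convergence and the compactness of multipliers were used; a tail of each sequence keeps the
    parameters in \<open>P\<close>.\<close>
  proof (intro allI impI)
    fix \<theta> :: "nat \<Rightarrow> real"
    assume pos: "\<forall>n. \<theta> n \<in> {0<..} - {0}" and lim: "\<theta> \<longlonglongrightarrow> 0"
    have "(\<lambda>n. \<pi>\<^sub>0 + \<theta> n *\<^sub>R \<delta>) \<longlonglongrightarrow> \<pi>\<^sub>0 + 0 *\<^sub>R \<delta>" by (intro tendsto_intros lim)
    then have "eventually (\<lambda>n. \<pi>\<^sub>0 + \<theta> n *\<^sub>R \<delta> \<in> P) sequentially"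
      using SO(1,2) by (auto dest: topological_tendstoD)
    then obtain N where N: "\<And>n. N \<le> n \<Longrightarrow> \<pi>\<^sub>0 + \<theta> n *\<^sub>R \<delta> \<in> P" unfolding eventually_sequentially by blast
    have "(\<lambda>n. (V (\<pi>\<^sub>0 + \<theta> (n + N) *\<^sub>R \<delta>) - V \<pi>\<^sub>0) /\<^sub>R \<theta> (n + N)) \<longlonglongrightarrow> sensitivity lam mu p \<delta>"
      using pos by (intro value_quotient_limit[OF tr] LIMSEQ_ignore_initial_segment[OF lim] N) auto
    from LIMSEQ_offset[OF this]
    show "((\<lambda>\<theta>. (V (\<pi>\<^sub>0 + \<theta> *\<^sub>R \<delta>) - V \<pi>\<^sub>0) /\<^sub>R \<theta>) \<circ> \<theta>) \<longlonglongrightarrow> sensitivity lam mu p \<delta>" by (simp add: comp_def)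
  qed
qed

end

theorem corollary3p2:
  fixes T :: real
    and \<Omega> :: "'x::banach set"
    and U :: "'y::real_normed_vector set"
    and \<xi>\<^sub>0 :: 'x
    and m q :: nat
    and f0 :: "real \<Rightarrow> 'x \<Rightarrow> 'y \<Rightarrow> 'z::real_normed_vector \<Rightarrow> real"
    and f :: "real \<Rightarrow> 'x \<Rightarrow> 'y \<Rightarrow> 'z \<Rightarrow> 'x"
    and g h :: "nat \<Rightarrow> 'x \<Rightarrow> 'z \<Rightarrow> real"
    and \<pi>\<^sub>0 :: 'z
    and P :: "'z set"
    and x :: "'z \<Rightarrow> real \<Rightarrow> 'x"
    and u :: "'z \<Rightarrow> real \<Rightarrow> 'y"
  assumes T: "0 < T"
    and Omega: "open \<Omega>" "\<Omega> \<noteq> {}"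
    and U: "open U" "U \<noteq> {}"
    and xi0: "\<xi>\<^sub>0 \<in> \<Omega>"
    and mq: "1 \<le> m" "1 \<le> q"
    and SO: "open P" "\<pi>\<^sub>0 \<in> P"
      "\<forall>\<pi>\<in>P. bolza_solution T \<Omega> U \<xi>\<^sub>0 m q f0 f g h \<pi> (x \<pi>, u \<pi>)"
    and SO_bis:
      "\<forall>\<delta>. (\<exists>dx. has_PC1_variation T x dx \<pi>\<^sub>0 \<delta>) \<and> (\<exists>du. has_NPC0_R_variation T u du \<pi>\<^sub>0 \<delta>)"
    and IC1:
      "continuous_on ({0..T} \<times> \<Omega> \<times> U \<times> P) (\<lambda>(t, \<xi>, \<zeta>, \<pi>). f0 t \<xi> \<zeta> \<pi>)"
      "\<forall>t\<in>{0..T}. \<forall>\<xi>\<in>\<Omega>. \<forall>\<zeta>\<in>U. \<forall>\<pi>\<in>P. gateaux_differentiable (\<lambda>y. f0 t y \<zeta> \<pi>) \<xi>"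
      "\<forall>\<pi>\<in>P. \<forall>K. compact K \<and> K \<noteq> {} \<and> K \<subseteq> \<Omega> \<times> U \<longrightarrow>
         bdd_above ((\<lambda>(t, \<xi>, \<zeta>). norm (gateaux_deriv (\<lambda>y. f0 t y \<zeta> \<pi>) \<xi>)) ` ({0..T} \<times> K))"
    and IC2:
      "\<forall>t\<in>{0..T}. hadamard_differentiable (\<lambda>(\<xi>, \<zeta>, \<pi>). f0 t \<xi> \<zeta> \<pi>) (x \<pi>\<^sub>0 t, u \<pi>\<^sub>0 t, \<pi>\<^sub>0)"
      "\<forall>\<pi>\<in>P. hadamard_differentiable (\<lambda>\<zeta>. f0 T (x \<pi> T) \<zeta> \<pi>) (u \<pi> T)"
      "continuous_on P (\<lambda>\<pi>. hadamard_deriv (\<lambda>\<zeta>. f0 T (x \<pi> T) \<zeta> \<pi>) (u \<pi> T))"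
    and IC3:
      "\<exists>\<kappa> \<rho>. set_integrable lborel {0..T} \<kappa> \<and> (\<forall>t\<in>{0..T}. 0 \<le> \<kappa> t) \<and> \<rho> > 0 \<and>
         (\<forall>t\<in>{0..T}. \<forall>\<xi>\<^sub>1\<in>\<Omega>. \<forall>\<zeta>\<^sub>1\<in>U. \<forall>\<pi>\<^sub>1\<in>P. \<forall>\<xi>\<^sub>2\<in>\<Omega>. \<forall>\<zeta>\<^sub>2\<in>U. \<forall>\<pi>\<^sub>2\<in>P.
            norm (\<xi>\<^sub>1 - x \<pi>\<^sub>0 t) + norm (\<zeta>\<^sub>1 - u \<pi>\<^sub>0 t) + norm (\<pi>\<^sub>1 - \<pi>\<^sub>0) < \<rho> \<and>
            norm (\<xi>\<^sub>2 - x \<pi>\<^sub>0 t) + norm (\<zeta>\<^sub>2 - u \<pi>\<^sub>0 t) + norm (\<pi>\<^sub>2 - \<pi>\<^sub>0) < \<rho> \<longrightarrow>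
            \<bar>f0 t \<xi>\<^sub>1 \<zeta>\<^sub>1 \<pi>\<^sub>1 - f0 t \<xi>\<^sub>2 \<zeta>\<^sub>2 \<pi>\<^sub>2\<bar>
              \<le> \<kappa> t * (norm (\<xi>\<^sub>1 - \<xi>\<^sub>2) + norm (\<zeta>\<^sub>1 - \<zeta>\<^sub>2) + norm (\<pi>\<^sub>1 - \<pi>\<^sub>2)))"
    and IC4:
      "\<forall>t\<in>{0..T}. \<forall>\<zeta>\<in>U. \<forall>\<pi>\<in>P. (\<lambda>\<xi>. f0 t \<xi> \<zeta> \<pi>) differentiable (at (x \<pi> t))"
      "\<forall>\<pi>\<in>P. continuous_on ({0..T} \<times> U) (\<lambda>(t, \<zeta>). frechet_deriv (\<lambda>\<xi>. f0 t \<xi> \<zeta> \<pi>) (x \<pi> t))"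
    and V1:
      "\<forall>\<pi>\<in>P. continuous_on ({0..T} \<times> \<Omega> \<times> U) (\<lambda>(t, \<xi>, \<zeta>). f t \<xi> \<zeta> \<pi>)"
      "\<forall>t\<in>{0..T}. \<forall>\<xi>\<in>\<Omega>. \<forall>\<zeta>\<in>U. \<forall>\<pi>\<in>P. gateaux_differentiable (\<lambda>y. f t y \<zeta> \<pi>) \<xi>"
      "\<forall>\<pi>\<in>P. \<forall>K. compact K \<and> K \<noteq> {} \<and> K \<subseteq> \<Omega> \<times> U \<longrightarrow>
         bdd_above ((\<lambda>(t, \<xi>, \<zeta>). norm (gateaux_deriv (\<lambda>y. f t y \<zeta> \<pi>) \<xi>)) ` ({0..T} \<times> K))"
    and V2:
      "\<forall>t\<in>{0..T}. hadamard_differentiable (\<lambda>(\<xi>, \<zeta>, \<pi>). f t \<xi> \<zeta> \<pi>) (x \<pi>\<^sub>0 t, u \<pi>\<^sub>0 t, \<pi>\<^sub>0)"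
      "\<forall>\<pi>\<in>P. hadamard_differentiable (\<lambda>\<zeta>. f T (x \<pi> T) \<zeta> \<pi>) (u \<pi> T)"
    and V3:
      "\<forall>t\<in>{0..T}. \<forall>\<zeta>\<in>U. \<forall>\<pi>\<in>P. (\<lambda>\<xi>. f t \<xi> \<zeta> \<pi>) differentiable (at (x \<pi> t))"
      "\<forall>\<pi>\<in>P. continuous_on ({0..T} \<times> U) (\<lambda>(t, \<zeta>). frechet_deriv (\<lambda>\<xi>. f t \<xi> \<zeta> \<pi>) (x \<pi> t))"
    and V4:
      "\<exists>c. set_integrable lborel {0..T} c \<and> (\<forall>t\<in>{0..T}. 0 \<le> c t) \<and>
         (\<forall>t\<in>{0..T}. norm (hadamard_deriv (\<lambda>\<pi>. f t (x \<pi>\<^sub>0 t) (u \<pi>\<^sub>0 t) \<pi>) \<pi>\<^sub>0) \<le> c t)"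
    and CT1:
      "\<forall>\<phi> \<in> g ` {0..m} \<union> h ` {1..q}.
         hadamard_differentiable (\<lambda>(\<xi>, \<pi>). \<phi> \<xi> \<pi>) (x \<pi>\<^sub>0 T, \<pi>\<^sub>0) \<and>
         (\<forall>\<pi>\<in>P. hadamard_differentiable (\<lambda>\<xi>. \<phi> \<xi> \<pi>) (x \<pi> T))"
    and CT2:
      "\<forall>\<pi>\<in>P. \<forall>j\<in>{1..q}. \<exists>N. open N \<and> x \<pi> T \<in> N \<and> N \<subseteq> \<Omega> \<and> continuous_on N (\<lambda>\<xi>. h j \<xi> \<pi>)"
    and CVT1:
      "\<forall>a b. (\<Sum>i=1..m. a i *\<^sub>R (hadamard_deriv (\<lambda>\<xi>. g i \<xi> \<pi>\<^sub>0) (x \<pi>\<^sub>0 T) o\<^sub>L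
                                hadamard_deriv (\<lambda>\<zeta>. f T (x \<pi>\<^sub>0 T) \<zeta> \<pi>\<^sub>0) (u \<pi>\<^sub>0 T))) +
             (\<Sum>j=1..q. b j *\<^sub>R (hadamard_deriv (\<lambda>\<xi>. h j \<xi> \<pi>\<^sub>0) (x \<pi>\<^sub>0 T) o\<^sub>L
                                hadamard_deriv (\<lambda>\<zeta>. f T (x \<pi>\<^sub>0 T) \<zeta> \<pi>\<^sub>0) (u \<pi>\<^sub>0 T))) = 0 \<longrightarrow>
             (\<forall>i\<in>{1..m}. a i = (0::real)) \<and> (\<forall>j\<in>{1..q}. b j = (0::real))"
    and CVT2:
      "\<forall>\<phi> \<in> g ` {0..m} \<union> h ` {1..q}.
         continuous_on P (\<lambda>\<pi>. hadamard_deriv (\<lambda>\<xi>. \<phi> \<xi> \<pi>) (x \<pi> T) o\<^sub>L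
                              hadamard_deriv (\<lambda>\<zeta>. f T (x \<pi> T) \<zeta> \<pi>) (u \<pi> T))"
    and ESP:
      "\<exists>ip :: ('y \<Rightarrow>\<^sub>L real) \<Rightarrow> ('y \<Rightarrow>\<^sub>L real) \<Rightarrow> real.
         is_inner_product ip \<and> continuous_on UNIV (\<lambda>(a, b). ip a b)"
  shows "\<exists>lam mu p.
      pontryagin_triple T U m q f0 f g h \<pi>\<^sub>0 (x \<pi>\<^sub>0, u \<pi>\<^sub>0) lam mu p \<and> lam 0 = 1 \<and>
      (\<forall>lam' mu' p'.
         pontryagin_triple T U m q f0 f g h \<pi>\<^sub>0 (x \<pi>\<^sub>0, u \<pi>\<^sub>0) lam' mu' p' \<and> lam' 0 = 1 \<longrightarrow>
         (\<forall>i\<in>{0..m}. lam' i = lam i) \<and> (\<forall>j\<in>{1..q}. mu' j = mu j) \<and> (\<forall>t\<in>{0..T}. p' t = p t)) \<and>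
      gateaux_differentiable (bolza_value T \<Omega> U \<xi>\<^sub>0 m q f0 f g h) \<pi>\<^sub>0 \<and>
      (\<forall>\<delta>.
         set_integrable lborel {0..T}
           (\<lambda>t. hadamard_deriv (\<lambda>\<pi>. f0 t (x \<pi>\<^sub>0 t) (u \<pi>\<^sub>0 t) \<pi>) \<pi>\<^sub>0 \<delta>) \<and>
         set_integrable lborel {0..T}
           (\<lambda>t. p t (hadamard_deriv (\<lambda>\<pi>. f t (x \<pi>\<^sub>0 t) (u \<pi>\<^sub>0 t) \<pi>) \<pi>\<^sub>0 \<delta>)) \<and>
         gateaux_deriv (bolza_value T \<Omega> U \<xi>\<^sub>0 m q f0 f g h) \<pi>\<^sub>0 \<delta> =
           hadamard_deriv (\<lambda>\<pi>. g 0 (x \<pi>\<^sub>0 T) \<pi>) \<pi>\<^sub>0 \<delta> +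
           (\<Sum>i=1..m. lam i * hadamard_deriv (\<lambda>\<pi>. g i (x \<pi>\<^sub>0 T) \<pi>) \<pi>\<^sub>0 \<delta>) +
           (\<Sum>j=1..q. mu j * hadamard_deriv (\<lambda>\<pi>. h j (x \<pi>\<^sub>0 T) \<pi>) \<pi>\<^sub>0 \<delta>) +
           (LINT t:{0..T}|lborel. hadamard_deriv (\<lambda>\<pi>. f0 t (x \<pi>\<^sub>0 t) (u \<pi>\<^sub>0 t) \<pi>) \<pi>\<^sub>0 \<delta>) +
           (LINT t:{0..T}|lborel. p t (hadamard_deriv (\<lambda>\<pi>. f t (x \<pi>\<^sub>0 t) (u \<pi>\<^sub>0 t) \<pi>) \<pi>\<^sub>0 \<delta>)))"
proof -
  interpret bolza_sensitivity T \<Omega> U \<xi>\<^sub>0 m q f0 f g h \<pi>\<^sub>0 P x u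
    by (rule bolza_sensitivity.intro)
      (fact T Omega U xi0 mq SO SO_bis IC1 IC2 IC3 IC4 V1 V2 V3 V4 CT1 CT2 CVT1 CVT2)+
  obtain lam mu p where tr: "pontryagin_triple T U m q f0 f g h \<pi>\<^sub>0 (x \<pi>\<^sub>0, u \<pi>\<^sub>0) lam mu p" "lam 0 = 1"
    by (rule normal_triple)
  have p: "p \<in> PC1 T UNIV" using tr(1) by (simp add: pontryagin_triple_def)
  note D = value_gateaux[OF tr]
  show ?thesis
  proof (rule exI[of _ lam], rule exI[of _ mu], rule exI[of _ p], intro conjI allI impI)
    fix lam' mu' p'
    assume "pontryagin_triple T U m q f0 f g h \<pi>\<^sub>0 (x \<pi>\<^sub>0, u \<pi>\<^sub>0) lam' mu' p' \<and> lam' 0 = 1"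
    from multipliers_unique[OF tr conjunct1[OF this] conjunct2[OF this]]
    show "\<forall>i\<in>{0..m}. lam' i = lam i" "\<forall>j\<in>{1..q}. mu' j = mu j" "\<forall>t\<in>{0..T}. p' t = p t" by blast+
  next
    show "gateaux_differentiable (bolza_value T \<Omega> U \<xi>\<^sub>0 m q f0 f g h) \<pi>\<^sub>0"
      using D unfolding gateaux_differentiable_def by blast
  qed (simp_all only: tr parameter_integrable(1,2)[OF p] gateaux_deriv_eq[OF D]
      bounded_linear_Blinfun_apply[OF bounded_linear_sensitivity[OF p]] sensitivity_def)
qed

end
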